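(* Let $m\ge1$ be an integer and consider the regression model, the penalized spline estimator $\hat f^{[m]}$ of degree $p=m$ with $m$th-order difference penalty, the quantities $\alpha,\beta$ and the kernel $K(t,s)$ described in the context. Suppose that the true regression function $f$ is $2m$th order continuously differentiable with bounded $2m$th derivative. For $t\in(0,1)$ let $\sigma_K^2(t)$ be the limit given by $\frac1\beta\int_0^1K^2(t,s)\,ds\to\sigma_K^2(t)$ as $n\to\infty$. (1) If $\alpha n^{2m/(4m+1)}\to0$ and $\alpha^{-(2m-1)/(2m)}\log K_n/K_n\to0$ (with $K_n\to\infty$), then for $t\in(0,1)$, $$\sqrt{\tfrac n\beta}\,\big[\hat f^{[m]}(t)-f(t)\big]\to N\big(0,\sigma_K^2(t)\big)\quad\text{in distribution}.$$ (2) If instead $\alpha=c^{2m}n^{-2m/(4m+1)}$ for $c>0$ and $K_n\sim n^\gamma$ with $\gamma>(2m-1)/(4m+1)$, then for $t\in(0,1)$, $$n^{2m/(4m+1)}\big[\hat f^{[m]}(t)-f(t)\big]\to N\Big((-1)^{m-1}c^{2m}f^{(2m)}(t),\ \frac{\sigma_K^2(t)}{c}\Big)\quad\text{in distribution}.$$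
   Context: Model: $y_i=f(t_i)+\epsilon_i$, $i=1,\dots,n$, with $f:[0,1]\to\mathbb R$, $t_i=i/n$, and $\epsilon_i$ i.i.d. normal with mean $0$ and variance $\sigma^2$. Limits are as $n\to\infty$. Splines: $K_n$ is a positive integer such that $n/K_n$ is an integer; the knots are $\kappa_j=j/K_n$ (used for $j=0,\dots,K_n$ and extended by the same formula outside $[0,1]$). For a degree $p\ge 0$, $B_k^{[p]}$, $k=1,\dots,K_n+p$, denotes the $p$th degree B-spline basis: $B_k^{[0]}$ is the indicator of $(\kappa_{k-1},\kappa_k]$ and $B_j^{[p]}(t)=\frac{K_n}{p}(t-\kappa_{j-p-1})B_{j-1}^{[p-1]}(t)+\frac{K_n}{p}(\kappa_j-t)B_j^{[p-1]}(t)$. Estimator: $\Delta b_k=b_k-b_{k-1}$ and $\Delta^m=\Delta\Delta^{m-1}$. For $\lambda^*>0$ the coefficients $\hat b=(\hat b_1,\dots,\hat b_{K_n+p})$ minimize $$\sum_{i=1}^n\Big[y_i-\sum_{k=1}^{K_n+p}b_kB_k^{[p]}(t_i)\Big]^2+\lambda^*\sum_{k=m+1}^{K_n+p}[\Delta^m b_k]^2,$$ and $\hat f^{[p]}(x)=\sum_{k=1}^{K_n+p}\hat b_kB_k^{[p]}(x)$. Here $p=m$. Put $\alpha=\lambda^*/(nK_n^{2m-1})$ and $\beta=\alpha^{-1/(2m)}$ (both depend on $n$). Kernel $K(t,s)$, for $t,s\in[0,1]$. With $A_k=\begin{pmatrix}-\mu_k&\omega_k\\-\omega_k&-\mu_k\end{pmatrix}$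 and $A_k^j(i,\ell)$ the $(i,\ell)$ entry of the $j$th power of $A_k$: If $m$ is even, $K(t,s)=L(|t-s|)$ with $L(u)=\sum_{k=0}^{m/2-1}\beta e^{-\beta\mu_ku}[c_k\cos(\omega_k\beta u)+d_k\sin(\omega_k\beta u)]$, $\mu_k=\cos\frac{(1+2k)\pi}{2m}$, $\omega_k=\sin\frac{(1+2k)\pi}{2m}$, where $(c_k,d_k)_{0\le k\le m/2-1}$ is the unique solution of the linear system $\sum_{k=0}^{m/2-1}[A_k^{2r-1}(1,1)c_k+A_k^{2r-1}(1,2)d_k]=0$ for $r=1,\dots,m-1$ and $=\frac12$ for $r=m$. If $m$ is odd, $K(t,s)=P(|t-s|)$ with $P(u)=c_0\beta e^{-\beta u}+\sum_{k=1}^{(m-1)/2}\beta e^{-\beta\mu_ku}[c_k\cos(\omega_k\beta u)+d_k\sin(\omega_k\beta u)]$, $\mu_k=\cos\frac{k\pi}{m}$, $\omega_k=\sin\frac{k\pi}{m}$, where $c_0,(c_k,d_k)_{1\le k\le (m-1)/2}$ is the unique solution of $-c_0+\sum_{k=1}^{(m-1)/2}[A_k^{2r-1}(1,1)c_k+A_k^{2r-1}(1,2)d_k]=0$ for $r=1,\dots,m-1$ and $=-\frac12$ for $r=m$.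
   Formalization: The limit variances are σ²σ_K²(t) and σ²σ_K²(t)/c, with σ² the noise variance (σ > 0), instead of σ_K²(t) and σ_K²(t)/c; as printed the claim fails unless σ = 1, because K does not depend on σ. *)

theory Defs
  imports "HOL-Probability.Probability" "HOL-Library.Landau_Symbols"
begin

text \<open>Derivatives are taken within \<open>S\<close>, so they are one-sided at the end points of an interval.\<close>

primrec iter_deriv_on :: "real set \<Rightarrow> nat \<Rightarrow> (real \<Rightarrow> real) \<Rightarrow> real \<Rightarrow> real" where
  "iter_deriv_on S 0 f = f"
| "iter_deriv_on S (Suc k) f = (\<lambda>x. vector_derivative (iter_deriv_on S k f) (at x within S))"

definition cont_diff_on :: "nat \<Rightarrow> (real \<Rightarrow> real) \<Rightarrow> real set \<Rightarrow> bool" where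
  "cont_diff_on k f S \<longleftrightarrow>
     (\<forall>i<k. \<forall>x\<in>S. iter_deriv_on S i f differentiable (at x within S)) \<and>
     continuous_on S (iter_deriv_on S k f)"

text \<open>B-splines on the knots \<open>j / K\<close>. Knots and B-splines are indexed by integers, because the
  recursion refers to knots to the left of 0.\<close>

definition knot :: "nat \<Rightarrow> int \<Rightarrow> real" where
  "knot K j = real_of_int j / real K"

fun bspline :: "nat \<Rightarrow> nat \<Rightarrow> int \<Rightarrow> real \<Rightarrow> real" where
  "bspline K 0 j t = indicator {knot K (j - 1)<..knot K j} t"
| "bspline K (Suc p) j t =
     real K / real (Suc p) * (t - knot K (j - int (Suc p) - 1)) * bspline K p (j - 1) t
     + real K / real (Suc p) * (knot K j - t) * bspline K p j t"

text \<open>Coefficient vectors are functions on \<open>nat\<close>, of which only the values at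
  \<open>1, \<dots>, K + p\<close> matter.\<close>

definition spline :: "nat \<Rightarrow> nat \<Rightarrow> (nat \<Rightarrow> real) \<Rightarrow> real \<Rightarrow> real" where
  "spline K p b t = (\<Sum>k=1..K+p. b k * bspline K p (int k) t)"

text \<open>The truncated subtraction in \<open>backward_diff\<close> is harmless: the penalty uses
  \<open>(backward_diff ^^ m) b k\<close> only for \<open>k \<ge> m + 1\<close>.\<close>

definition backward_diff :: "(nat \<Rightarrow> real) \<Rightarrow> nat \<Rightarrow> real" where
  "backward_diff b k = b k - b (k - 1)"

definition pspline_objective ::
    "nat \<Rightarrow> nat \<Rightarrow> nat \<Rightarrow> nat \<Rightarrow> real \<Rightarrow> (nat \<Rightarrow> real) \<Rightarrow> (nat \<Rightarrow> real) \<Rightarrow> real" where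
  "pspline_objective n K p m lam y b =
     (\<Sum>i=1..n. (y i - spline K p b (real i / real n))\<^sup>2)
     + lam * (\<Sum>k=m+1..K+p. ((backward_diff ^^ m) b k)\<^sup>2)"

definition is_pspline_coeff ::
    "nat \<Rightarrow> nat \<Rightarrow> nat \<Rightarrow> nat \<Rightarrow> real \<Rightarrow> (nat \<Rightarrow> real) \<Rightarrow> (nat \<Rightarrow> real) \<Rightarrow> bool" where
  "is_pspline_coeff n K p m lam y b \<longleftrightarrow>
     (\<forall>b'. pspline_objective n K p m lam y b \<le> pspline_objective n K p m lam y b')"

definition kernel_mu :: "nat \<Rightarrow> nat \<Rightarrow> real" where
  "kernel_mu m k = (if even m then cos ((1 + 2 * real k) * pi / (2 * real m))
                    else cos (real k * pi / real m))"

definition kernel_omega :: "nat \<Rightarrow> nat \<Rightarrow> real" where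
  "kernel_omega m k = (if even m then sin ((1 + 2 * real k) * pi / (2 * real m))
                       else sin (real k * pi / real m))"

definition kernel_matrix :: "nat \<Rightarrow> nat \<Rightarrow> real^2^2" where
  "kernel_matrix m k = vector [vector [- kernel_mu m k, kernel_omega m k],
                               vector [- kernel_omega m k, - kernel_mu m k]]"

text \<open>Matrix powers; the overloaded power operator on \<open>real^2^2\<close> acts componentwise.\<close>

definition matrix_power :: "real^2^2 \<Rightarrow> nat \<Rightarrow> real^2^2" where
  "matrix_power A j = (((**) A) ^^ j) (mat 1)"

text \<open>The indices \<open>k\<close> of the coefficient pairs \<open>(c k, d k)\<close>; for odd \<open>m\<close> there is in addition the
  single coefficient \<open>c 0\<close>.\<close>

definition kernel_indices :: "nat \<Rightarrow> nat set" where
  "kernel_indices m = (if even m then {0..<m div 2} else {1..(m - 1) div 2})"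

definition kernel_system_lhs :: "nat \<Rightarrow> (nat \<Rightarrow> real) \<Rightarrow> (nat \<Rightarrow> real) \<Rightarrow> nat \<Rightarrow> real" where
  "kernel_system_lhs m c d r =
     (if even m then 0 else - c 0) +
     (\<Sum>k\<in>kernel_indices m. matrix_power (kernel_matrix m k) (2 * r - 1) $ 1 $ 1 * c k
                           + matrix_power (kernel_matrix m k) (2 * r - 1) $ 1 $ 2 * d k)"

definition kernel_system :: "nat \<Rightarrow> (nat \<Rightarrow> real) \<Rightarrow> (nat \<Rightarrow> real) \<Rightarrow> bool" where
  "kernel_system m c d \<longleftrightarrow>
     (\<forall>r\<in>{1..m-1}. kernel_system_lhs m c d r = 0) \<and>
     kernel_system_lhs m c d m = (if even m then 1/2 else - 1/2)"

definition kernel ::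
    "nat \<Rightarrow> (nat \<Rightarrow> real) \<Rightarrow> (nat \<Rightarrow> real) \<Rightarrow> real \<Rightarrow> real \<Rightarrow> real \<Rightarrow> real" where
  "kernel m c d \<beta> t s =
     (let u = \<bar>t - s\<bar> in
      (if even m then 0 else c 0 * \<beta> * exp (- \<beta> * u)) +
      (\<Sum>k\<in>kernel_indices m. \<beta> * exp (- \<beta> * kernel_mu m k * u) *
         (c k * cos (kernel_omega m k * \<beta> * u) + d k * sin (kernel_omega m k * \<beta> * u))))"

text \<open>The normalised squared norm of the kernel, whose limit as the sample size grows is
  \<open>\<sigma>\<^sub>K\<^sup>2(t)\<close>. It does not involve the noise: with noise variance \<open>\<sigma>\<^sup>2\<close> the asymptotic variance
  of the estimator is \<open>\<sigma>\<^sup>2 \<sigma>\<^sub>K\<^sup>2(t)\<close>, and it is \<open>\<sigma>\<^sub>K\<^sup>2(t)\<close> under the normalisation \<open>\<sigma> = 1\<close>.\<close>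

definition kernel_variance ::
    "nat \<Rightarrow> (nat \<Rightarrow> real) \<Rightarrow> (nat \<Rightarrow> real) \<Rightarrow> real \<Rightarrow> real \<Rightarrow> real" where
  "kernel_variance m c d \<beta> t = 1 / \<beta> * integral {0..1} (\<lambda>s. (kernel m c d \<beta> t s)\<^sup>2)"

definition sigma_K2 ::
    "nat \<Rightarrow> (nat \<Rightarrow> real) \<Rightarrow> (nat \<Rightarrow> real) \<Rightarrow> (nat \<Rightarrow> real) \<Rightarrow> real \<Rightarrow> real" where
  "sigma_K2 m c d \<beta> t = lim (\<lambda>j. kernel_variance m c d (\<beta> j) t)"

text \<open>The second argument is the variance, whereas \<open>normal_density\<close> takes the standard
  deviation.\<close>

definition normal_law :: "real \<Rightarrow> real \<Rightarrow> real measure" where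
  "normal_law \<mu> v = density lborel (\<lambda>x. ennreal (normal_density \<mu> (sqrt v) x))"

end

theory Submission
  imports Defs "HOL-Real_Asymp.Real_Asymp"
begin

text \<open>The minimiser solves the normal equations, so \<open>f\<^sub>n(t)\<close> is linear in the data: \<open>f\<^sub>n(t) = \<Sum> w\<^sub>i y\<^sub>i\<close>.
  With Gaussian noise its law is exactly normal, and only the limits of its mean and of \<open>\<Sum> w\<^sub>i\<^sup>2\<close> are needed.

  Let \<open>V\<close> be the equivalent kernel at \<open>t\<close>. It is the Green function of \<open>(-1)\<^sup>m \<alpha> D\<^sup>2\<^sup>m + 1\<close> on the line, hence it
  reproduces \<open>h(t)\<close> in the form \<open>\<integral> g h + \<alpha> \<integral> g\<^sup>(\<^sup>m\<^sup>) h\<^sup>(\<^sup>m\<^sup>)\<close> up to boundary terms that are exponentially small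
  in \<open>\<beta>\<close>. Testing the normal equations with the spline \<open>Q\<close> whose \<open>m\<close>-th derivative consists of the cell averages
  of \<open>V\<^sup>(\<^sup>m\<^sup>)\<close> gives \<open>f\<^sub>n(t) = (1/n) \<Sum> y\<^sub>i Q(t\<^sub>i)\<close> up to \<open>o(\<surd>\<beta>)\<close> times the empirical norm of the data. So
  \<open>(n/\<beta>) \<Sum> w\<^sub>i\<^sup>2\<close> has the same limit as \<open>(1/\<beta>) \<integral> V\<^sup>2\<close>.

  For \<open>m \<ge> 2\<close> the bias is \<open>- (-1)\<^sup>m \<alpha> \<integral> V f\<^sup>(\<^sup>2\<^sup>m\<^sup>)\<close> up to \<open>\<beta>\<^sup>2/K\<^sup>2\<close> and exponentially small terms: second order
  quadrature applies, and the derivatives of the error are bounded by a discrete Sobolev inequality. For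
  \<open>m = 1\<close> that remainder is not \<open>o(\<alpha>)\<close>, and a discrete maximum principle with exponential barriers replaces
  the argument.\<close>

section \<open>B-splines\<close>

text \<open>Cell averages are the right choice because the \<open>m\<close>-th derivative of a
  spline \<open>g\<close> is constant on each knot cell: paired with the averages of
  \<open>V^(m)\<close> it gives \<open>\<integral> V^(m) g^(m)\<close> with no error at all. What
  remains is quadrature on the design grid, the distance between \<open>V\<close> and
  \<open>Q\<close>, and boundary terms. All rates are powers of \<beta>, because \<alpha> =
  \<beta>^(-2m) and both regimes imply \<beta>^(2m-1) / K -> 0. Scaled by sqrt n, the weights have
  norm of order sqrt \<beta>, and their relative error \<beta>^m / K vanishes for every m >= 1. The
  bias is of order \<alpha>; dividing \<beta>^2 / K^2 by \<alpha> gives (\<beta>^(m+1) / K)^2, which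
  vanishes because m + 1 <= 2m - 1 once m >= 2. For m = 1 it would be \<beta>^4 / K^2, over which
  the hypotheses give no control. The maximum principle compares the estimator at the knots with f +
  \<alpha> \<psi>, where \<psi> is a smooth approximation of f'', and pays only B / K^2 = \<alpha> B
  (\<beta> / K)^2.\<close>

definition forward_diff :: "(nat \<Rightarrow> real) \<Rightarrow> nat \<Rightarrow> real" where
  "forward_diff b k = b (Suc k) - b k"

text \<open>Forward differences never meet the truncated subtraction at index 0, and they are what
  differentiating a spline does to its coefficients.\<close>

lemma backward_diff_funpow_shift: "(backward_diff ^^ i) b (k + i) = (forward_diff ^^ i) b k"
proof (induction i arbitrary: k)
  case (Suc i)
  have "(backward_diff ^^ Suc i) b (k + Suc i)
      = (backward_diff ^^ i) b (Suc k + i) - (backward_diff ^^ i) b (k + i)"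
    by (simp add: backward_diff_def)
  also have "\<dots> = (forward_diff ^^ Suc i) b k"
    unfolding Suc.IH by (simp add: forward_diff_def)
  finally show ?case .
qed simp

lemma forward_diff_funpow_add:
  "(forward_diff ^^ i) (\<lambda>k. b k + c k) = (\<lambda>k. (forward_diff ^^ i) b k + (forward_diff ^^ i) c k)"
  by (induction i) (auto simp: forward_diff_def fun_eq_iff)

lemma forward_diff_funpow_scale:
  "(forward_diff ^^ i) (\<lambda>k. a * b k) = (\<lambda>k. a * (forward_diff ^^ i) b k)"
  by (induction i) (auto simp: forward_diff_def fun_eq_iff algebra_simps)

lemma spline_add: "spline K p (\<lambda>k. b k + c k) x = spline K p b x + spline K p c x"
  by (simp add: spline_def algebra_simps sum.distrib)

lemma spline_scale: "spline K p (\<lambda>k. a * b k) x = a * spline K p b x"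
  by (simp add: spline_def sum_distrib_left algebra_simps)

lemma bspline_eq_0:
  assumes "K > 0" "t \<le> knot K (j - int p - 1) \<or> t > knot K j"
  shows "bspline K p j t = 0"
  using assms(2)
proof (induction p arbitrary: j)
  case 0
  then show ?case by (auto simp: indicator_def)
next
  case (Suc p)
  have mono: "knot K i \<le> knot K l" if "i \<le> l" for i l
    using that assms(1) by (simp add: knot_def divide_right_mono)
  have "bspline K p (j - 1) t = 0"
    using Suc.prems mono[of "j - 1" j] by (intro Suc.IH) (auto simp: algebra_simps)
  moreover have "bspline K p j t = 0"
    using Suc.prems mono[of "j - int (Suc p) - 1" "j - int p - 1"]
    by (intro Suc.IH) auto
  ultimately show ?case by simp
qed

text \<open>The hat function is computed by hand as the base of the continuity proof: degree zero is
  discontinuous, and from degree one on the recursion preserves continuity.\<close>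

lemma bspline_1:
  assumes "K > 0"
  shows "bspline K 1 j t = max 0 (min (real K * t - of_int j + 2) (of_int j - real K * t))"
proof -
  have *: "bspline K 1 j t = (real K * t - of_int j + 2) * indicator {knot K (j - 2)<..knot K (j - 1)} t
     + (of_int j - real K * t) * indicator {knot K (j - 1)<..knot K j} t"
    using assms by (simp add: knot_def field_simps)
  have k: "knot K i < t \<longleftrightarrow> of_int i < real K * t" "t \<le> knot K i \<longleftrightarrow> real K * t \<le> of_int i" for i
    using assms by (auto simp: knot_def field_simps)
  define y where "y = real K * t"
  show ?thesis
    unfolding * indicator_def greaterThanAtMost_iff k y_def[symmetric]
    by (auto simp: max_def min_def)
qed

text \<open>Knots are excluded because the degree zero functions jump there; the fundamental theorem
  of calculus tolerates finitely many such points. In positive degree the recursion is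
  differentiated, with the induction hypothesis applied to both of its terms.\<close>

lemma bspline_deriv:
  assumes "K > 0" "real K * t \<notin> \<int>"
  shows "(bspline K 0 j has_real_derivative 0) (at t)"
    and "(bspline K (Suc p) j has_real_derivative
           real K * (bspline K p (j - 1) t - bspline K p j t)) (at t)"
proof -
  show *: "(bspline K 0 j has_real_derivative 0) (at t)" for j
  proof -
    \<comment> \<open>The open cell around \<open>t\<close>, on which every degree zero function is
      constant.\<close>
    let ?S = "{knot K (of_int \<lfloor>real K * t\<rfloor>)<..<knot K (of_int \<lfloor>real K * t\<rfloor> + 1)}"
    have "real_of_int \<lfloor>real K * t\<rfloor> \<noteq> real K * t"
      using assms(2) by (metis Ints_of_int)
    then have t: "real_of_int \<lfloor>real K * t\<rfloor> < real K * t" "real K * t < of_int \<lfloor>real K * t\<rfloor> + 1"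
      by linarith+
    then have tS: "t \<in> ?S" using assms(1) by (auto simp: knot_def field_simps)
    have c: "bspline K 0 j s = bspline K 0 j t" if "s \<in> ?S" for s
    proof -
      have fl: "\<lfloor>real K * u\<rfloor> = \<lfloor>real K * t\<rfloor> \<and> real_of_int \<lfloor>real K * t\<rfloor> < real K * u" if "u \<in> ?S" for u
        using that assms(1) by (auto simp: knot_def field_simps intro!: floor_unique)
      have "knot K i < u \<longleftrightarrow> i \<le> \<lfloor>real K * t\<rfloor>" if "u \<in> ?S" for u i
      proof -
        have "knot K i < u \<longleftrightarrow> of_int i < real K * u"
          using assms(1) by (auto simp: knot_def field_simps)
        also have "\<dots> \<longleftrightarrow> i \<le> \<lfloor>real K * t\<rfloor>"
          using fl[OF that] by (smt (verit, best) le_floor_iff of_int_le_iff)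
        finally show ?thesis .
      qed
      then show ?thesis using tS that
        by (auto simp: indicator_def not_less[symmetric])
    qed
    show ?thesis
      by (rule has_field_derivative_transform_within_open[OF DERIV_const open_greaterThanLessThan tS
            c[symmetric]])
  qed
  show "(bspline K (Suc p) j has_real_derivative
           real K * (bspline K p (j - 1) t - bspline K p j t)) (at t)"
  proof (induction p arbitrary: j)
    case 0
    have "bspline K (Suc 0) j = (\<lambda>t. real K * (t - knot K (j - 2)) * bspline K 0 (j - 1) t
     + real K * (knot K j - t) * bspline K 0 j t)" by (auto simp: fun_eq_iff)
    moreover have "((\<lambda>t. real K * (t - knot K (j - 2)) * bspline K 0 (j - 1) t
     + real K * (knot K j - t) * bspline K 0 j t) has_real_derivative
           real K * (bspline K 0 (j - 1) t - bspline K 0 j t)) (at t)"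
      by (rule derivative_eq_intros * refl)+ (simp add: algebra_simps)
    ultimately show ?case by simp
  next
    case (Suc p)
    let ?q = "real (Suc (Suc p))"
    have e: "bspline K (Suc (Suc p)) j = (\<lambda>t. real K / ?q * (t - knot K (j - int (Suc (Suc p)) - 1)) * bspline K (Suc p) (j - 1) t
     + real K / ?q * (knot K j - t) * bspline K (Suc p) j t)" by (auto simp: fun_eq_iff)
    have k: "knot K (j - int i) = knot K j - real i / real K" "knot K (j - int i - 1) = knot K j - (real i + 1) / real K"
       "knot K (j - 1 - int i - 1) = knot K j - (real i + 2) / real K" "knot K (j - 1) = knot K j - 1 / real K" for i
      using assms(1) by (auto simp: knot_def field_simps)
    define X where "X = bspline K p (j - 2) t"
    define Y where "Y = bspline K p (j - 1) t"
    define Z where "Z = bspline K p j t"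
    have s: "j - 1 - 1 = j - 2" by simp
    have k3: "knot K (j - 1 - int (Suc p) - 1) = knot K j - (real p + 3) / real K"
      using k(3)[of "Suc p"] by (simp add: algebra_simps)
    have k2: "knot K (j - int (Suc p) - 1) = knot K j - (real p + 2) / real K"
      using k(2)[of "Suc p"] by (simp add: algebra_simps)
    have b1: "bspline K (Suc p) (j - 1) t = real K / real (Suc p) * (t - (knot K j - (real p + 3) / real K)) * X
        + real K / real (Suc p) * (knot K j - 1 / real K - t) * Y"
      by (simp only: bspline.simps k3 k(4) X_def Y_def s)
    have b2: "bspline K (Suc p) j t = real K / real (Suc p) * (t - (knot K j - (real p + 2) / real K)) * Y
        + real K / real (Suc p) * (knot K j - t) * Z"
      by (simp only: bspline.simps k2 Y_def Z_def)
    \<comment> \<open>Both sides are expanded in the degree \<open>p\<close> functions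
      \<open>X\<close>, \<open>Y\<close>, \<open>Z\<close> at the indices \<open>j - 2\<close>,
      \<open>j - 1\<close>, \<open>j\<close>; the coefficients then agree.\<close>
    have eq: "real K / ?q * (1 * bspline K (Suc p) (j - 1) t + (t - knot K (j - int (Suc (Suc p)) - 1)) * (real K * (X - Y)))
       + real K / ?q * ((0 - 1) * bspline K (Suc p) j t + (knot K j - t) * (real K * (Y - Z)))
       = real K * (bspline K (Suc p) (j - 1) t - bspline K (Suc p) j t)"
      unfolding b1 b2 k using assms(1) by (simp add: divide_simps) (simp add: algebra_simps)
    have D1: "((\<lambda>t. real K / ?q * (t - knot K (j - int (Suc (Suc p)) - 1)) * bspline K (Suc p) (j - 1) t)
        has_real_derivative real K / ?q * (1 * bspline K (Suc p) (j - 1) t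
          + (t - knot K (j - int (Suc (Suc p)) - 1)) * (real K * (X - Y)))) (at t)"
      unfolding X_def Y_def
      by (rule derivative_eq_intros Suc.IH refl)+
        (simp add: algebra_simps add_divide_distrib diff_divide_distrib s del: bspline.simps)
    have D2: "((\<lambda>t. real K / ?q * (knot K j - t) * bspline K (Suc p) j t)
        has_real_derivative real K / ?q * ((0 - 1) * bspline K (Suc p) j t
          + (knot K j - t) * (real K * (Y - Z)))) (at t)"
      unfolding Y_def Z_def
      by (rule derivative_eq_intros Suc.IH refl)+
        (simp add: algebra_simps add_divide_distrib diff_divide_distrib s del: bspline.simps)
    from DERIV_add[OF D1 D2] show ?case unfolding e eq .
  qed
qed

lemma bspline_continuous:
  assumes "K > 0"
  shows "continuous_on S (bspline K (Suc p) j)"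
proof (induction p arbitrary: j)
  case 0
  have "bspline K (Suc 0) j = (\<lambda>t. max 0 (min (real K * t - of_int j + 2) (of_int j - real K * t)))"
    using bspline_1[OF assms] by (auto simp: fun_eq_iff)
  then show ?case by (auto intro!: continuous_intros)
next
  case (Suc p)
  have e: "bspline K (Suc (Suc p)) j = (\<lambda>t. real K / real (Suc (Suc p)) * (t - knot K (j - int (Suc (Suc p)) - 1)) * bspline K (Suc p) (j - 1) t
     + real K / real (Suc (Suc p)) * (knot K j - t) * bspline K (Suc p) j t)" by (auto simp: fun_eq_iff)
  show ?case unfolding e by (intro continuous_intros Suc.IH)
qed

lemma spline_continuous: "K > 0 \<Longrightarrow> p > 0 \<Longrightarrow> continuous_on S (spline K p b)"
  unfolding spline_def using bspline_continuous[of K S "p - 1"] by (auto intro!: continuous_intros)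

text \<open>Abel summation. The end terms drop out because the degree \<open>p\<close> functions
  with indices \<open>0\<close> and \<open>K + Suc p\<close> vanish on the open unit
  interval.\<close>

lemma spline_deriv:
  assumes "K > 0" "real K * x \<notin> \<int>" "0 < x" "x < 1"
  shows "(spline K (Suc p) b has_real_derivative real K * spline K p (forward_diff b) x) (at x)"
proof -
  define B where "B k = bspline K p (int k) x" for k
  have z: "B 0 = 0" "B (K + Suc p) = 0"
    unfolding B_def using assms by (auto intro!: bspline_eq_0 simp: knot_def field_simps)
  have "(\<Sum>k=1..K + Suc p. b k * (real K * (B (k - 1) - B k)))
      = real K * ((\<Sum>k=1..K + Suc p. b k * B (k - 1)) - (\<Sum>k=1..K + Suc p. b k * B k))"
    by (simp add: sum_distrib_left sum_subtractf algebra_simps)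
  also have "(\<Sum>k=1..K + Suc p. b k * B (k - 1)) = (\<Sum>k=0..K + p. b (Suc k) * B k)"
    by (simp add: sum.shift_bounds_cl_Suc_ivl del: sum.cl_ivl_Suc)
  also have "\<dots> = (\<Sum>k=1..K + p. b (Suc k) * B k)"
    using z(1) by (simp add: sum.atLeast_Suc_atMost)
  also have "(\<Sum>k=1..K + Suc p. b k * B k) = (\<Sum>k=1..K + p. b k * B k)"
    using z(2) by simp
  finally have *: "(\<Sum>k=1..K + Suc p. b k * (real K * (B (k - 1) - B k))) = real K * spline K p (forward_diff b) x"
    by (simp add: spline_def B_def forward_diff_def left_diff_distrib sum_subtractf)
  have "(spline K (Suc p) b has_real_derivative (\<Sum>k=1..K + Suc p. b k * (real K * (B (k - 1) - B k)))) (at x)"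
    unfolding spline_def
  proof (rule DERIV_sum)
    fix k assume "k \<in> {1..K + Suc p}"
    then have i: "int (k - 1) = int k - 1" by auto
    show "((\<lambda>x. b k * bspline K (Suc p) (int k) x) has_real_derivative b k * (real K * (B (k - 1) - B k))) (at x)"
      unfolding B_def i by (intro DERIV_cmult bspline_deriv assms)
  qed
  then show ?thesis by (simp only: *)
qed

section \<open>Partition of unity and splines with prescribed derivatives\<close>

lemma spline_0:
  assumes "k \<in> {1..K}" "knot K (int k - 1) < x" "x \<le> knot K (int k)"
  shows "spline K 0 b x = b k"
proof -
  have K: "K > 0" using assms by auto
  have B: "bspline K 0 (int l) x = (if l = k then 1 else 0)" for l
  proof (cases "l = k")
    case True then show ?thesis using assms by auto
  next
    case False
    have m: "knot K i \<le> knot K j" if "i \<le> j" for i j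
      using that K by (simp add: knot_def divide_right_mono)
    have "l \<le> k - 1 \<or> k \<le> l - 1 \<and> l \<ge> 1" using False by auto
    then show ?thesis
      using False assms m[of "int l" "int k - 1"] m[of "int k" "int l - 1"]
      by (simp add: indicator_def) linarith
  qed
  show ?thesis unfolding spline_def B using assms by (simp add: if_distrib cong: if_cong)
qed

text \<open>Each function of degree \<open>p\<close> enters the recursions of two consecutive
  functions of the next degree, and its two coefficients add up to one.\<close>

lemma sum_bspline:
  assumes "K > 0" "0 < x" "x \<le> 1"
  shows "(\<Sum>k=1..K+p. bspline K p (int k) x) = 1"
proof (induction p)
  case 0
  define k where "k = nat \<lceil>real K * x\<rceil>"
  have ce: "0 < \<lceil>real K * x\<rceil>" using assms by simp
  have "real K * x \<le> real K" using assms by (simp add: mult_left_le)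
  then have "\<lceil>real K * x\<rceil> \<le> int K" by (simp add: ceiling_le_iff)
  then have k: "k \<in> {1..K}" "int k = \<lceil>real K * x\<rceil>"
    unfolding k_def using ce by (simp_all add: nat_le_iff Suc_le_eq)
  then have "knot K (int k - 1) < x" "x \<le> knot K (int k)"
    using assms unfolding knot_def k by (simp_all add: field_simps) linarith+
  from spline_0[OF k(1) this, of "\<lambda>_. 1"] show ?case by (simp add: spline_def)
next
  case (Suc p)
  define B where "B k = bspline K p (int k) x" for k
  have z: "B 0 = 0" "B (K + Suc p) = 0"
    unfolding B_def using assms by (auto intro!: bspline_eq_0 simp: knot_def field_simps)
  define c where "c = real K / real (Suc p)"
  have "(\<Sum>k=1..K+Suc p. bspline K (Suc p) (int k) x)
     = (\<Sum>k=1..K+Suc p. c * (x - knot K (int k - int (Suc p) - 1)) * B (k - 1) + c * (knot K (int k) - x) * B k)"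
  proof (rule sum.cong)
    fix k assume "k \<in> {1..K + Suc p}"
    then have i: "int (k - 1) = int k - 1" by auto
    show "bspline K (Suc p) (int k) x = c * (x - knot K (int k - int (Suc p) - 1)) * B (k - 1) + c * (knot K (int k) - x) * B k"
      by (simp add: c_def B_def i[simplified])
  qed simp
  also have "\<dots> = (\<Sum>k=1..K + Suc p. c * (x - knot K (int k - int (Suc p) - 1)) * B (k - 1)) + (\<Sum>k=1..K + Suc p. c * (knot K (int k) - x) * B k)"
    by (rule sum.distrib)
  also have "(\<Sum>k=1..K + Suc p. c * (x - knot K (int k - int (Suc p) - 1)) * B (k - 1)) = (\<Sum>k=0..K + p. c * (x - knot K (int k - int (Suc p))) * B k)"
    by (simp add: sum.shift_bounds_cl_Suc_ivl algebra_simps del: sum.cl_ivl_Suc)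
  also have "\<dots> = (\<Sum>k=1..K + p. c * (x - knot K (int k - int (Suc p))) * B k)"
    using z(1) by (simp add: sum.atLeast_Suc_atMost)
  also have "(\<Sum>k=1..K + Suc p. c * (knot K (int k) - x) * B k) = (\<Sum>k=1..K + p. c * (knot K (int k) - x) * B k)"
    using z(2) by simp
  also have "(\<Sum>k=1..K + p. c * (x - knot K (int k - int (Suc p))) * B k) + (\<Sum>k=1..K + p. c * (knot K (int k) - x) * B k) = (\<Sum>k=1..K + p. B k)"
    unfolding sum.distrib[symmetric]
  proof (rule sum.cong)
    fix k
    have "c * (knot K (int k) - knot K (int k - int (Suc p))) = 1"
      using assms by (simp add: c_def knot_def diff_divide_distrib[symmetric] del: of_nat_Suc)
    then have "c * (x - knot K (int k - int (Suc p))) + c * (knot K (int k) - x) = 1"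
      by (simp add: algebra_simps)
    then show "c * (x - knot K (int k - int (Suc p))) * B k + c * (knot K (int k) - x) * B k = B k"
      by (metis distrib_right mult_1)
  qed simp
  finally show ?case using Suc.IH by (simp add: B_def)
qed

text \<open>The cells of degree zero are open on the left and miss the point 0, so the value there
  is obtained from continuity as a limit from the right.\<close>

lemma sum_bspline_left_end:
  assumes "K > 0" "p > 0"
  shows "(\<Sum>k=1..K+p. bspline K p (int k) 0) = 1"
proof -
  let ?f = "\<lambda>x. \<Sum>k=1..K+p. bspline K p (int k) x"
  have "continuous_on UNIV ?f"
    using bspline_continuous[OF assms(1), of UNIV "p - 1"] assms(2) by (auto intro!: continuous_intros)
  then have "isCont ?f 0" by (simp add: continuous_on_eq_continuous_at)
  then have "(?f \<longlongrightarrow> ?f 0) (at_right 0)"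
    by (auto simp: isCont_def intro: tendsto_mono[rotated] at_le)
  moreover have "eventually (\<lambda>x. ?f x = 1) (at_right 0)"
    using eventually_at_right_real[of 0 1] sum_bspline[OF assms(1)] by (auto elim!: eventually_mono)
  then have "(?f \<longlongrightarrow> 1) (at_right 0)" by (rule tendsto_eventually)
  ultimately show ?thesis using tendsto_unique trivial_limit_at_right_real by blast
qed

text \<open>By \<open>spline_deriv\<close> this is the \<open>i\<close>-th derivative away from the
  knots. The case \<open>i = m\<close> is the step function of the top differences, which carries
  the penalty.\<close>

definition spline_deriv_chain :: "nat \<Rightarrow> nat \<Rightarrow> (nat \<Rightarrow> real) \<Rightarrow> nat \<Rightarrow> real \<Rightarrow> real" where
  "spline_deriv_chain K m b i x = real K ^ i * spline K (m - i) ((forward_diff ^^ i) b) x"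

text \<open>Integrating \<open>q\<close> repeatedly: summing coefficients inverts
  \<open>forward_diff\<close>, and the constant of summation adjusts the value at 0, because by the
  partition of unity a constant added to all coefficients is added to the spline.\<close>

lemma ex_spline_coeff:
  assumes "K > 0"
  shows "\<exists>b. (\<forall>i<m. spline_deriv_chain K m b i 0 = a i) \<and>
             (\<forall>k. real K ^ m * (forward_diff ^^ m) b k = q k)"
proof (induction m arbitrary: a q)
  case 0
  then show ?case by (intro exI[of _ q]) auto
next
  case (Suc m)
  obtain b where b: "\<forall>i<m. spline_deriv_chain K m b i 0 = a (Suc i) / real K"
      "\<forall>k. real K ^ m * (forward_diff ^^ m) b k = q k / real K"
    using Suc[of "\<lambda>i. a (Suc i) / real K" "\<lambda>k. q k / real K"] by blast
  define u where "u = (\<lambda>k. \<Sum>l<k. b l)"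
  define c where "c = a 0 - spline K (Suc m) u 0"
  define b' where "b' = (\<lambda>k. c + u k)"
  have fd: "forward_diff b' = b" by (auto simp: fun_eq_iff forward_diff_def b'_def u_def)
  have "spline K (Suc m) b' 0 = c * (\<Sum>k=1..K + Suc m. bspline K (Suc m) (int k) 0) + spline K (Suc m) u 0"
    unfolding b'_def spline_def distrib_right sum.distrib sum_distrib_left ..
  then have "spline K (Suc m) b' 0 = a 0"
    unfolding sum_bspline_left_end[OF assms zero_less_Suc] c_def by simp
  have "spline_deriv_chain K (Suc m) b' i 0 = a i" if "i < Suc m" for i
  proof (cases i)
    case 0 then show ?thesis using \<open>spline K (Suc m) b' 0 = a 0\<close> by (simp add: spline_deriv_chain_def)
  next
    case (Suc i')
    then have "spline_deriv_chain K (Suc m) b' i 0 = real K * spline_deriv_chain K m b i' 0"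
      by (simp add: spline_deriv_chain_def funpow_Suc_right fd del: funpow.simps)
    then show ?thesis using b(1) that Suc assms by simp
  qed
  moreover have "real K ^ Suc m * (forward_diff ^^ Suc m) b' k = q k" for k
    using b(2)[rule_format, of k] assms
    by (simp add: funpow_Suc_right fd field_simps del: funpow.simps)
  ultimately show ?case by blast
qed

section \<open>The equivalent kernel\<close>

text \<open>\<open>\<kappa> i\<close> is the \<open>i\<close>-th derivative of the half-line profile
  whose even reflection is the Green function. The reflection fails to be smooth at the first odd
  order not vanishing at 0. That order is \<open>2m - 1\<close>; its jump is twice the one-sided
  value and produces the unit point mass, whence the \<open>1/2\<close>.\<close>

locale green_kernel =
  fixes m :: nat and \<kappa> :: "nat \<Rightarrow> real \<Rightarrow> real" and C c :: real
  assumes m_pos: "m \<ge> 1" and c_pos: "c > 0"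
    and kappa_deriv: "\<And>i u. (\<kappa> i has_real_derivative \<kappa> (Suc i) u) (at u)"
    and kappa_bound: "\<And>i u. u \<ge> 0 \<Longrightarrow> \<bar>\<kappa> i u\<bar> \<le> C * exp (- c * u)"
    and kappa_ode: "\<And>u. (-1) ^ m * \<kappa> (2 * m) u + \<kappa> 0 u = 0"
    and kappa_odd: "\<And>i. odd i \<Longrightarrow> i < 2 * m - 1 \<Longrightarrow> \<kappa> i 0 = 0"
    and kappa_top: "\<kappa> (2 * m - 1) 0 = (-1) ^ m / 2"

text \<open>The roots of \<open>(-1)\<^sup>m z\<^sup>2\<^sup>m + 1\<close> in the left half plane are \<open>- exp (\<plusminus> i \<theta>\<^sub>k)\<close>.\<close>

definition kernel_theta :: "nat \<Rightarrow> nat \<Rightarrow> real" where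
  "kernel_theta m k = (if even m then (1 + 2 * real k) * pi / (2 * real m) else real k * pi / real m)"

text \<open>The characteristic roots have modulus one, so a derivative flips the sign and shifts the
  phase by \<theta>; this gives all orders in one formula. For odd \<open>m\<close> the root -1 is
  real and contributes the term with \<open>c 0\<close>.\<close>

definition kernel_deriv :: "nat \<Rightarrow> (nat \<Rightarrow> real) \<Rightarrow> (nat \<Rightarrow> real) \<Rightarrow> nat \<Rightarrow> real \<Rightarrow> real" where
  "kernel_deriv m c d i u = (-1) ^ i * ((if even m then 0 else c 0 * exp (- u)) +
     (\<Sum>k\<in>kernel_indices m. exp (- kernel_mu m k * u) *
        (c k * cos (kernel_omega m k * u - real i * kernel_theta m k)
         + d k * sin (kernel_omega m k * u - real i * kernel_theta m k))))"

lemma kernel_eq_kernel_deriv: "kernel m c d \<beta> t s = \<beta> * kernel_deriv m c d 0 (\<beta> * \<bar>t - s\<bar>)"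
  by (simp add: kernel_def kernel_deriv_def Let_def algebra_simps sum_distrib_left)

lemma kernel_mu_eq: "kernel_mu m k = cos (kernel_theta m k)"
  and kernel_omega_eq: "kernel_omega m k = sin (kernel_theta m k)"
  by (simp_all add: kernel_mu_def kernel_omega_def kernel_theta_def)

text \<open>\<open>kernel_indices\<close> picks one angle below \<open>\<pi> / 2\<close> from each
  conjugate pair, hence only decaying solutions.\<close>

lemma kernel_mu_pos:
  assumes "k \<in> kernel_indices m"
  shows "kernel_mu m k > 0"
proof -
  have m: "m > 0" using assms by (auto simp: kernel_indices_def split: if_splits)
  have "0 \<le> kernel_theta m k" by (auto simp: kernel_theta_def)
  moreover have "kernel_theta m k < pi / 2"
  proof (cases "even m")
    case True
    then have "1 + 2 * k < m" using assms by (auto simp: kernel_indices_def)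
    then have "1 + 2 * real k < real m" by linarith
    then have "pi * (1 + 2 * real k) < pi * real m" by simp
    then show ?thesis using True m by (simp add: kernel_theta_def field_simps)
  next
    case False
    then have "2 * k < m" using assms m by (auto simp: kernel_indices_def)
    then have "2 * real k < real m" by linarith
    then show ?thesis using False m by (simp add: kernel_theta_def field_simps)
  qed
  ultimately show ?thesis unfolding kernel_mu_eq by (intro cos_gt_zero_pi) (use pi_gt_zero in linarith)+
qed

text \<open>\<open>kernel_matrix m k\<close> is minus the rotation by the angle
  \<open>kernel_theta m k\<close>, so its powers multiply the angle.\<close>

lemma kernel_matrix_power:
  "matrix_power (kernel_matrix m k) j $ 1 $ 1 = (-1) ^ j * cos (real j * kernel_theta m k)"
  "matrix_power (kernel_matrix m k) j $ 1 $ 2 = - ((-1) ^ j * sin (real j * kernel_theta m k))"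
proof -
  let ?A = "kernel_matrix m k" and ?t = "kernel_theta m k"
  have A: "?A $ 1 $ 1 = - cos ?t" "?A $ 1 $ 2 = sin ?t" "?A $ 2 $ 1 = - sin ?t" "?A $ 2 $ 2 = - cos ?t"
    by (simp_all add: kernel_matrix_def kernel_mu_eq kernel_omega_eq)
  have "matrix_power ?A j $ 1 $ 1 = (-1) ^ j * cos (real j * ?t) \<and>
        matrix_power ?A j $ 1 $ 2 = - ((-1) ^ j * sin (real j * ?t)) \<and>
        matrix_power ?A j $ 2 $ 1 = (-1) ^ j * sin (real j * ?t) \<and>
        matrix_power ?A j $ 2 $ 2 = (-1) ^ j * cos (real j * ?t)"
  proof (induction j)
    case 0
    then show ?case by (simp add: matrix_power_def mat_def)
  next
    case (Suc j)
    have "matrix_power ?A (Suc j) $ a $ b = ?A $ a $ 1 * matrix_power ?A j $ 1 $ b + ?A $ a $ 2 * matrix_power ?A j $ 2 $ b" for a b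
      by (simp add: matrix_power_def matrix_matrix_mult_def sum_2)
    moreover have "real (Suc j) * ?t = ?t + real j * ?t" by (simp add: algebra_simps)
    ultimately show ?case using Suc.IH by (simp add: A cos_add sin_add algebra_simps)
  qed
  then show "matrix_power ?A j $ 1 $ 1 = (-1) ^ j * cos (real j * ?t)"
    "matrix_power ?A j $ 1 $ 2 = - ((-1) ^ j * sin (real j * ?t))" by auto
qed

text \<open>The first rows of the odd matrix powers are the phases picked up by
  \<open>2r - 1\<close> differentiations at 0. The linear system for the coefficients thus
  prescribes the jumps of the reflected profile.\<close>

lemma kernel_system_lhs_eq:
  assumes "r \<ge> 1"
  shows "kernel_system_lhs m c d r = kernel_deriv m c d (2 * r - 1) 0"
proof -
  have o: "(- 1 :: real) ^ (2 * r - 1) = - 1" using assms by (auto simp: Suc_double_not_eq_double)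
  show ?thesis
    unfolding kernel_system_lhs_def kernel_deriv_def kernel_matrix_power o
    by (simp add: sum_negf[symmetric] algebra_simps)
qed

lemma exp_trig_deriv:
  "((\<lambda>u. exp (- cos \<theta> * u) * (a * cos (sin \<theta> * u - x) + b * sin (sin \<theta> * u - x))) has_real_derivative
    - (exp (- cos \<theta> * u) * (a * cos (sin \<theta> * u - (x + \<theta>)) + b * sin (sin \<theta> * u - (x + \<theta>))))) (at u)"
proof -
  have "cos (sin \<theta> * u - (x + \<theta>)) = cos (sin \<theta> * u - x) * cos \<theta> + sin (sin \<theta> * u - x) * sin \<theta>"
    "sin (sin \<theta> * u - (x + \<theta>)) = sin (sin \<theta> * u - x) * cos \<theta> - cos (sin \<theta> * u - x) * sin \<theta>"
    using cos_diff[of "sin \<theta> * u - x" \<theta>] sin_diff[of "sin \<theta> * u - x" \<theta>] by (simp_all add: algebra_simps)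
  note e = this
  show ?thesis unfolding e
    by (rule derivative_eq_intros refl)+ (simp add: algebra_simps)
qed

lemma kernel_deriv_has_derivative:
  "(kernel_deriv m c d i has_real_derivative kernel_deriv m c d (Suc i) u) (at u)"
proof -
  have "((\<lambda>u. (-1) ^ i * ((if even m then 0 else c 0 * exp (- u)) +
     (\<Sum>k\<in>kernel_indices m. exp (- cos (kernel_theta m k) * u) *
        (c k * cos (sin (kernel_theta m k) * u - real i * kernel_theta m k)
         + d k * sin (sin (kernel_theta m k) * u - real i * kernel_theta m k))))) has_real_derivative
      (-1) ^ i * ((if even m then 0 else - (c 0 * exp (- u))) +
     (\<Sum>k\<in>kernel_indices m. - (exp (- cos (kernel_theta m k) * u) *
        (c k * cos (sin (kernel_theta m k) * u - (real i * kernel_theta m k + kernel_theta m k))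
         + d k * sin (sin (kernel_theta m k) * u - (real i * kernel_theta m k + kernel_theta m k))))))) (at u)"
    by (intro DERIV_cmult DERIV_add DERIV_sum exp_trig_deriv) (auto intro!: derivative_eq_intros)
  moreover have i: "real (Suc i) * x = real i * x + x" for x by (simp add: algebra_simps)
  ultimately show ?thesis
    unfolding kernel_deriv_def kernel_mu_eq kernel_omega_eq i sum_negf power_Suc
    by (cases "even m") (simp_all add: ring_distribs sum_negf)
qed

text \<open>After \<open>2m\<close> differentiations the phase has moved by an odd multiple of \<pi>
  for even \<open>m\<close> and by a multiple of \<open>2\<pi>\<close> for odd \<open>m\<close>,
  which is the sign needed in each case.\<close>

lemma kernel_deriv_ode:
  assumes "m \<ge> 1"
  shows "(-1) ^ m * kernel_deriv m c d (2 * m) u + kernel_deriv m c d 0 u = 0"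
proof -
  have *: "cos (x - real (2 * m) * kernel_theta m k) = (if even m then - cos x else cos x)"
    "sin (x - real (2 * m) * kernel_theta m k) = (if even m then - sin x else sin x)" for x k
  proof -
    have "real (2 * m) * kernel_theta m k = (if even m then of_int (2 * int k) * pi + pi else of_int (2 * int k) * pi)"
      using assms by (simp add: kernel_theta_def field_simps)
    moreover have "cos (y - of_int (2 * int k) * pi) = cos y" "sin (y - of_int (2 * int k) * pi) = sin y" for y
      using cos_int_2pin[of "int k"] sin_int_2pin[of "int k"]
      by (simp_all add: cos_diff sin_diff algebra_simps)
    ultimately show "cos (x - real (2 * m) * kernel_theta m k) = (if even m then - cos x else cos x)"
       "sin (x - real (2 * m) * kernel_theta m k) = (if even m then - sin x else sin x)"
      by (simp_all add: diff_diff_eq[symmetric] del: of_int_mult of_int_numeral)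
  qed
  show ?thesis
    unfolding kernel_deriv_def * by (auto simp: sum_negf[symmetric] algebra_simps sum.distrib[symmetric])
qed

lemma kernel_deriv_bound:
  "\<exists>C c'. c' > 0 \<and> (\<forall>i u. u \<ge> 0 \<longrightarrow> \<bar>kernel_deriv m c d i u\<bar> \<le> C * exp (- c' * u))"
proof -
  \<comment> \<open>The slowest decay rate. The entry \<open>1\<close> is the rate of the real root
    for odd \<open>m\<close>, and it keeps the minimum meaningful when the index set is empty, as
    for \<open>m = 1\<close>.\<close>
  define c' where "c' = Min (insert 1 (kernel_mu m ` kernel_indices m))"
  have fin: "finite (kernel_indices m)" by (simp add: kernel_indices_def)
  have c': "c' > 0" "c' \<le> 1" "\<And>k. k \<in> kernel_indices m \<Longrightarrow> c' \<le> kernel_mu m k"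
    unfolding c'_def using fin kernel_mu_pos by (auto simp: Min_gr_iff)
  define C where "C = \<bar>c 0\<bar> + (\<Sum>k\<in>kernel_indices m. \<bar>c k\<bar> + \<bar>d k\<bar>)"
  have "\<bar>kernel_deriv m c d i u\<bar> \<le> C * exp (- c' * u)" if u: "u \<ge> 0" for i u
  proof -
    have 1: "\<bar>if even m then 0 else c 0 * exp (- u)\<bar> \<le> \<bar>c 0\<bar> * exp (- c' * u)"
      using c'(1,2) u by (auto simp: abs_mult intro!: mult_left_mono mult_right_le_one_le mult_left_le_one_le)
    have 2: "\<bar>exp (- kernel_mu m k * u) * (c k * cos x + d k * sin x)\<bar> \<le> (\<bar>c k\<bar> + \<bar>d k\<bar>) * exp (- c' * u)"
      if k: "k \<in> kernel_indices m" for k x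
    proof -
      have "\<bar>c k * cos x + d k * sin x\<bar> \<le> \<bar>c k * cos x\<bar> + \<bar>d k * sin x\<bar>" by (rule abs_triangle_ineq)
      also have "\<dots> \<le> \<bar>c k\<bar> * 1 + \<bar>d k\<bar> * 1"
        unfolding abs_mult by (intro add_mono mult_left_mono) auto
      finally have "\<bar>c k * cos x + d k * sin x\<bar> \<le> \<bar>c k\<bar> + \<bar>d k\<bar>" by simp
      moreover have "exp (- kernel_mu m k * u) \<le> exp (- c' * u)"
        using c'(3)[OF k] u by (simp add: mult_right_mono)
      ultimately show ?thesis unfolding abs_mult by (subst mult.commute) (intro mult_mono, auto)
    qed
    have "\<bar>kernel_deriv m c d i u\<bar> \<le> \<bar>if even m then 0 else c 0 * exp (- u)\<bar> +
      (\<Sum>k\<in>kernel_indices m. \<bar>exp (- kernel_mu m k * u) * (c k * cos (kernel_omega m k * u - real i * kernel_theta m k)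
         + d k * sin (kernel_omega m k * u - real i * kernel_theta m k))\<bar>)"
      unfolding kernel_deriv_def abs_mult[of "(-1)^i"] power_abs
      by (simp only: abs_minus_cancel abs_one power_one mult_1) (rule order_trans[OF abs_triangle_ineq add_left_mono[OF sum_abs]])
    also have "\<dots> \<le> \<bar>c 0\<bar> * exp (- c' * u) + (\<Sum>k\<in>kernel_indices m. (\<bar>c k\<bar> + \<bar>d k\<bar>) * exp (- c' * u))"
      by (intro add_mono 1 sum_mono 2)
    also have "\<dots> = C * exp (- c' * u)" by (simp add: C_def sum_distrib_right distrib_right)
    finally show ?thesis .
  qed
  then show ?thesis using c'(1) by blast
qed

lemma green_kernel_kernel_deriv:
  assumes "m \<ge> 1" "kernel_system m c d"
  shows "\<exists>C c'. green_kernel m (kernel_deriv m c d) C c'"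
proof -
  obtain C c' where C: "c' > 0" "\<And>i u. u \<ge> 0 \<Longrightarrow> \<bar>kernel_deriv m c d i u\<bar> \<le> C * exp (- c' * u)"
    using kernel_deriv_bound by blast
  have odd: "kernel_deriv m c d i 0 = 0" if o: "odd i" "i < 2 * m - 1" for i
  proof -
    obtain r where r: "i = 2 * r + 1" using o(1) by (metis oddE)
    then have "kernel_system_lhs m c d (Suc r) = 0" using o assms(2) by (auto simp: kernel_system_def)
    then show ?thesis using kernel_system_lhs_eq[of "Suc r" m c d] r by simp
  qed
  have top: "kernel_deriv m c d (2 * m - 1) 0 = (-1) ^ m / 2"
    using assms kernel_system_lhs_eq[of m m c d] by (auto simp: kernel_system_def)
  show ?thesis
    by (intro exI[of _ C] exI[of _ c'], unfold_locales)
      (use assms C odd top in \<open>auto intro: kernel_deriv_has_derivative kernel_deriv_ode\<close>)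
qed

section \<open>Chains of derivatives\<close>

text \<open>A common frame for smooth functions, splines and kinked kernels. The orders below
  \<open>m\<close> are continuous; the derivative relation may fail on the finite set
  \<open>S\<close>, so the top order \<open>F m\<close> may be a step function and is only read
  under integrals.\<close>

definition deriv_chain :: "nat \<Rightarrow> real set \<Rightarrow> (nat \<Rightarrow> real \<Rightarrow> real) \<Rightarrow> bool" where
  "deriv_chain m S F \<longleftrightarrow> finite S \<and> (\<forall>i<m. continuous_on {0..1} (F i) \<and>
     (\<forall>x\<in>{0<..<1} - S. (F i has_real_derivative F (Suc i) x) (at x)))"

lemma deriv_chain_diff:
  "deriv_chain m S F \<Longrightarrow> deriv_chain m T G \<Longrightarrow> deriv_chain m (S \<union> T) (\<lambda>i x. F i x - G i x)"
  unfolding deriv_chain_def by (auto intro!: continuous_intros derivative_intros)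

lemma deriv_chain_mono: "deriv_chain m S F \<Longrightarrow> k \<le> m \<Longrightarrow> deriv_chain k S F"
  unfolding deriv_chain_def by auto

lemma deriv_chain_shift: "deriv_chain (m + k) S F \<Longrightarrow> deriv_chain m S (\<lambda>i. F (i + k))"
  unfolding deriv_chain_def by auto

lemma deriv_chain_continuous:
  "deriv_chain m S F \<Longrightarrow> i < m \<Longrightarrow> T \<subseteq> {0..1} \<Longrightarrow> continuous_on T (F i)"
  unfolding deriv_chain_def by (meson continuous_on_subset)

lemma deriv_chain_has_integral:
  assumes "deriv_chain m S F" "i < m" "0 \<le> a" "a \<le> b" "b \<le> 1"
  shows "(F (Suc i) has_integral F i b - F i a) {a..b}"
  using assms
  by (intro fundamental_theorem_of_calculus_interior_strong[of S])
    (auto simp: deriv_chain_def has_real_derivative_iff_has_vector_derivative[symmetric]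
      intro: continuous_on_subset)

text \<open>Below the top order the exceptional points disappear, since \<open>F i\<close> is an
  antiderivative of the continuous \<open>F (Suc i)\<close>.\<close>

lemma deriv_chain_has_derivative:
  assumes "deriv_chain m S F" "Suc i < m" "0 < x" "x < 1"
  shows "(F i has_real_derivative F (Suc i) x) (at x)"
proof -
  have c: "continuous_on {0..1} (F (Suc i))" using assms by (auto simp: deriv_chain_def)
  have e: "F i y = F i 0 + integral {0..y} (F (Suc i))" if "y \<in> {0<..<1}" for y
    using integral_unique[OF deriv_chain_has_integral[OF assms(1) _ order_refl, of i y]] that assms by auto
  have "((\<lambda>y. F i 0 + integral {0..y} (F (Suc i))) has_real_derivative 0 + F (Suc i) x) (at x within {0..1})"
    using c assms by (intro derivative_intros integral_has_real_derivative) auto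
  then have "((\<lambda>y. F i 0 + integral {0..y} (F (Suc i))) has_real_derivative F (Suc i) x) (at x)"
    using assms by (simp add: at_within_Icc_at)
  then show ?thesis
    by (rule has_field_derivative_transform_within_open[of _ _ _ "{0<..<1}"]) (use e assms in auto)
qed

section \<open>Mean value arguments and a discrete Sobolev inequality on the grid\<close>

lemma deriv_chain_mvt:
  assumes "deriv_chain m S F" "Suc i < m" "0 \<le> a" "a < b" "b \<le> 1"
  shows "\<exists>z. a < z \<and> z < b \<and> F i b - F i a = (b - a) * F (Suc i) z"
proof -
  have "continuous_on {a..b} (F i)"
    using assms by (intro deriv_chain_continuous[OF assms(1)]) auto
  moreover have "(F i has_derivative (*) (F (Suc i) z)) (at z)" if "a < z" "z < b" for z
    using deriv_chain_has_derivative[OF assms(1,2), of z] that assms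
    by (simp add: has_field_derivative_def)
  ultimately obtain z where "a < z" "z < b" "F i b - F i a = F (Suc i) z * (b - a)"
    using mvt[of a b "F i" "\<lambda>z. (*) (F (Suc i) z)"] assms(4) by auto
  then show ?thesis by (auto simp: mult.commute)
qed

text \<open>Repeated mean values: neighbours \<open>2l\<close> and \<open>2l + 1\<close> are paired,
  the difference quotient of a pair is at most \<open>2 / \<delta> * A\<close>, and half as many
  points remain for the next order. Points from different pairs stay apart by \<delta> because the
  gap between the pairs lies between them.\<close>

lemma deriv_chain_small_point:
  assumes "deriv_chain m S F" "i < m" "\<delta> > 0"
    and "\<And>l. l < 2 ^ i \<Longrightarrow> 0 \<le> x l \<and> x l \<le> 1 \<and> \<bar>F 0 (x l)\<bar> \<le> A"
    and "\<And>l. Suc l < 2 ^ i \<Longrightarrow> x l + \<delta> \<le> x (Suc l)"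
  shows "\<exists>\<xi>\<in>{0..1}. \<bar>F i \<xi>\<bar> \<le> (2 / \<delta>) ^ i * A"
  using assms
proof (induction i arbitrary: m F A x)
  case 0
  then show ?case by force
next
  case (Suc i)
  have "\<exists>z. x (2 * l) < z \<and> z < x (Suc (2 * l)) \<and> \<bar>F (Suc 0) z\<bar> \<le> 2 / \<delta> * A" if "l < 2 ^ i" for l
  proof -
    have l: "Suc (2 * l) < 2 ^ Suc i" using that by simp
    have d: "x (2 * l) + \<delta> \<le> x (Suc (2 * l))" using Suc.prems(5) l by simp
    obtain z where z: "x (2 * l) < z" "z < x (Suc (2 * l))"
      "F 0 (x (Suc (2 * l))) - F 0 (x (2 * l)) = (x (Suc (2 * l)) - x (2 * l)) * F (Suc 0) z"
      using deriv_chain_mvt[OF Suc.prems(1), of 0 "x (2 * l)" "x (Suc (2 * l))"] Suc.prems l d by fastforce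
    have "\<delta> * \<bar>F (Suc 0) z\<bar> \<le> \<bar>(x (Suc (2 * l)) - x (2 * l)) * F (Suc 0) z\<bar>"
      unfolding abs_mult using d Suc.prems(3) by (intro mult_right_mono) auto
    also have "\<dots> \<le> 2 * A"
      unfolding z(3)[symmetric] using Suc.prems(4)[of "2 * l"] Suc.prems(4)[of "Suc (2 * l)"] l by auto
    finally show ?thesis using z Suc.prems(3) by (auto simp: field_simps)
  qed
  then obtain y where y: "\<And>l. l < 2 ^ i \<Longrightarrow> x (2 * l) < y l \<and> y l < x (Suc (2 * l)) \<and> \<bar>F (Suc 0) (y l)\<bar> \<le> 2 / \<delta> * A"
    by metis
  have "\<exists>\<xi>\<in>{0..1}. \<bar>(\<lambda>i. F (i + 1)) i \<xi>\<bar> \<le> (2 / \<delta>) ^ i * (2 / \<delta> * A)"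
  proof (rule Suc.IH[of "m - 1" _ y])
    show "deriv_chain (m - 1) S (\<lambda>i. F (i + 1))"
      using Suc.prems by (intro deriv_chain_shift) auto
    show "0 \<le> y l \<and> y l \<le> 1 \<and> \<bar>F (0 + 1) (y l)\<bar> \<le> 2 / \<delta> * A" if "l < 2 ^ i" for l
    proof -
      have "2 * l < 2 ^ Suc i" "Suc (2 * l) < 2 ^ Suc i"
        using that by simp_all
      then show ?thesis using y[OF that] Suc.prems(4)[of "2 * l"] Suc.prems(4)[of "Suc (2 * l)"] by auto
    qed
    show "y l + \<delta> \<le> y (Suc l)" if "Suc l < 2 ^ i" for l
      using y[OF that] y[of l] that Suc.prems(5)[of "Suc (2 * l)"] by auto
  qed (use Suc.prems in auto)
  then show ?case by (simp add: algebra_simps)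
qed

text \<open>Pigeonhole on every other of \<open>2R\<close> consecutive blocks of \<open>q\<close>
  grid points: if \<open>g\<close> exceeded \<open>2 * R * A\<close> throughout one block, that
  block alone would break the bound on the sum of squares. The skipped blocks provide the
  separation.\<close>

lemma grid_separated_points:
  fixes g :: "real \<Rightarrow> real"
  assumes R: "R > 0" "2 * R \<le> n" and A: "A \<ge> 0" "(\<Sum>i=1..n. (g (real i / real n))\<^sup>2) \<le> real n * A\<^sup>2"
  shows "\<exists>x. (\<forall>l<R. 0 \<le> x l \<and> x l \<le> 1 \<and> \<bar>g (x l)\<bar> \<le> 2 * real R * A) \<and>
             (\<forall>l. Suc l < R \<longrightarrow> x l + 1 / (2 * real R) \<le> x (Suc l))"
proof -
  define q where "q = n div (2 * R)"
  have q1: "q \<ge> 1" unfolding q_def using R by (simp add: Suc_le_eq div_greater_zero_iff)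
  have nq: "n < 2 * R * (q + 1)" unfolding q_def using R
    by (metis Suc_eq_plus1 dividend_less_times_div mult_Suc_right add.commute mult_pos_pos pos2)
  have qn: "2 * R * q \<le> n" unfolding q_def by simp
  have n4: "n \<le> 4 * R * q"
  proof -
    have "R \<le> R * q" using q1 by simp
    moreover have "2 * R * (q + 1) = 2 * (R * q) + 2 * R" "4 * R * q = 4 * (R * q)"
      by (simp_all add: algebra_simps)
    ultimately show ?thesis using nq by linarith
  qed
  have "\<exists>i. i \<in> {2*l*q+1..2*l*q+q} \<and> \<bar>g (real i / real n)\<bar> \<le> 2 * real R * A" if l: "l < R" for l
  proof (rule ccontr)
    assume "\<not> ?thesis"
    then have big: "\<bar>g (real i / real n)\<bar> > 2 * real R * A" if "i \<in> {2*l*q+1..2*l*q+q}" for i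
      using that by (meson not_le)
    have sub: "{2*l*q+1..2*l*q+q} \<subseteq> {1..n}"
    proof -
      have "(2 * l + 1) * q \<le> 2 * R * q" using l by (intro mult_right_mono) auto
      then show ?thesis using qn by auto
    qed
    have "real n * A\<^sup>2 \<le> real (4 * R * q) * A\<^sup>2" using n4 by (intro mult_right_mono) (auto simp only: of_nat_le_iff zero_le_power2)
    also have "\<dots> \<le> (\<Sum>i\<in>{2*l*q+1..2*l*q+q}. (2 * real R * A)\<^sup>2)"
    proof -
      have "4 * real R \<le> 4 * (real R * real R)" using R by simp
      then have "(4 * real R) * (real q * A\<^sup>2) \<le> (4 * (real R * real R)) * (real q * A\<^sup>2)"
        by (intro mult_right_mono) auto
      then show ?thesis by (simp add: power2_eq_square algebra_simps)
    qed
    also have "\<dots> < (\<Sum>i\<in>{2*l*q+1..2*l*q+q}. (g (real i / real n))\<^sup>2)"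
    proof (rule sum_strict_mono)
      fix i assume "i \<in> {2*l*q+1..2*l*q+q}"
      from big[OF this] show "(2 * real R * A)\<^sup>2 < (g (real i / real n))\<^sup>2"
        using A by (metis abs_le_square_iff abs_of_nonneg linorder_not_le mult_nonneg_nonneg of_nat_0_le_iff zero_le_numeral)
    qed (use q1 in auto)
    also have "\<dots> \<le> (\<Sum>i=1..n. (g (real i / real n))\<^sup>2)"
      by (rule sum_mono2) (use sub in auto)
    finally show False using A(2) by simp
  qed
  then obtain i where i: "\<And>l. l < R \<Longrightarrow> i l \<in> {2*l*q+1..2*l*q+q} \<and> \<bar>g (real (i l) / real n)\<bar> \<le> 2 * real R * A"
    by metis
  have n0: "n > 0" using R by auto
  show ?thesis
  proof (intro exI[of _ "\<lambda>l. real (i l) / real n"] conjI allI impI)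
    fix l assume l: "l < R"
    have "(2 * l + 1) * q \<le> 2 * R * q" using l by (intro mult_right_mono) auto
    then have "i l \<le> n" using i[OF l] qn by auto
    then show "real (i l) / real n \<le> 1" using n0 by simp
    show "\<bar>g (real (i l) / real n)\<bar> \<le> 2 * real R * A" using i[OF l] by simp
  next
    fix l assume l: "Suc l < R"
    have "i l + (q + 1) \<le> i (Suc l)" using i[of l] i[of "Suc l"] l by auto
    then have "real (i l) + (real q + 1) \<le> real (i (Suc l))" by (metis of_nat_1 of_nat_add of_nat_le_iff)
    moreover have "real n / (2 * real R) \<le> real q + 1"
    proof -
      have "real n \<le> real (2 * R * (q + 1))" using nq by (simp only: of_nat_le_iff)
      then show ?thesis using R by (simp add: field_simps)
    qed
    ultimately have "real (i l) + real n / (2 * real R) \<le> real (i (Suc l))" by linarith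
    then have "(real (i l) + real n / (2 * real R)) / real n \<le> real (i (Suc l)) / real n"
      by (rule divide_right_mono) auto
    then show "real (i l) / real n + 1 / (2 * real R) \<le> real (i (Suc l)) / real n"
      using n0 by (simp add: add_divide_distrib)
  qed auto
qed

text \<open>Mean squares on the grid yield, for each order below \<open>m\<close>, one point where
  that derivative is small. The oscillation bound spreads this over the interval at order
  \<open>m - 1\<close>, and mean values carry it down to lower orders.\<close>

lemma grid_sobolev:
  "\<exists>D n0. D \<ge> 1 \<and> (\<forall>n\<ge>n0. \<forall>F S A I. deriv_chain m S F \<longrightarrow> A \<ge> 0 \<longrightarrow> I \<ge> 0 \<longrightarrow>
     (\<Sum>i=1..n. (F 0 (real i / real n))\<^sup>2) \<le> real n * A\<^sup>2 \<longrightarrow>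
     (\<forall>x\<in>{0..1}. \<forall>y\<in>{0..1}. \<bar>F (m - 1) x - F (m - 1) y\<bar> \<le> I) \<longrightarrow>
     (\<forall>i<m. \<forall>x\<in>{0..1}. \<bar>F i x\<bar> \<le> D * (A + I)))"
proof -
  define R :: nat where "R = 2 ^ m"
  \<comment> \<open>\<open>4 * R\<close> is the factor \<open>2 / \<delta>\<close> of one mean value
    step at spacing \<open>1 / (2 * R)\<close>; \<open>2 * R\<close> is the loss in the pigeonhole
    step.\<close>
  define D0 where "D0 = (4 * real R) ^ m * (2 * real R)"
  have R1: "R \<ge> 1" by (simp add: R_def)
  have D0: "D0 \<ge> 1" unfolding D0_def using R1
    by (intro mult_ge1_I one_le_power) auto
  have main: "\<bar>F i x\<bar> \<le> real m * D0 * A + I"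
    if n: "n \<ge> 2 * R" and F: "deriv_chain m S F" and A: "A \<ge> 0" and I: "I \<ge> 0"
      and g: "(\<Sum>i=1..n. (F 0 (real i / real n))\<^sup>2) \<le> real n * A\<^sup>2"
      and osc: "\<forall>x\<in>{0..1}. \<forall>y\<in>{0..1}. \<bar>F (m - 1) x - F (m - 1) y\<bar> \<le> I"
      and i: "i < m" and x: "x \<in> {0..1}" for n F S A I i x
  proof -
    obtain p where p: "\<forall>l<R. 0 \<le> p l \<and> p l \<le> 1 \<and> \<bar>F 0 (p l)\<bar> \<le> 2 * real R * A"
      "\<forall>l. Suc l < R \<longrightarrow> p l + 1 / (2 * real R) \<le> p (Suc l)"
      using grid_separated_points[of R n A "F 0"] R1 n A g by auto
    have small: "\<exists>\<xi>\<in>{0..1}. \<bar>F j \<xi>\<bar> \<le> D0 * A" if j: "j < m" for j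
    proof -
      have le: "2 ^ j \<le> R" unfolding R_def using j by (intro power_increasing) auto
      obtain \<xi> where \<xi>: "\<xi> \<in> {0..1}" "\<bar>F j \<xi>\<bar> \<le> (2 / (1 / (2 * real R))) ^ j * (2 * real R * A)"
        using deriv_chain_small_point[OF F j, of "1 / (2 * real R)" p "2 * real R * A"] p le R1 by fastforce
      note \<xi>(2)
      also have "(2 / (1 / (2 * real R))) ^ j * (2 * real R * A) \<le> (4 * real R) ^ m * (2 * real R * A)"
      proof (rule mult_right_mono)
        have "(2 / (1 / (2 * real R))) ^ j = (4 * real R) ^ j" by simp
        also have "\<dots> \<le> (4 * real R) ^ m" using R1 j by (intro power_increasing) auto
        finally show "(2 / (1 / (2 * real R))) ^ j \<le> (4 * real R) ^ m" .
      qed (use A in auto)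
      finally show ?thesis using \<xi>(1) by (auto simp: D0_def mult.assoc)
    qed
    \<comment> \<open>Downward induction on the order: the previous bound controls the oscillation,
      and the small point of the current order costs one more \<open>D0 * A\<close>.\<close>
    have "\<forall>x\<in>{0..1}. \<bar>F (m - Suc j) x\<bar> \<le> real (Suc j) * D0 * A + I" if "j < m" for j
      using that
    proof (induction j)
      case 0
      obtain \<xi> where \<xi>: "\<xi> \<in> {0..1}" "\<bar>F (m - 1) \<xi>\<bar> \<le> D0 * A" using small[of "m - 1"] 0 by auto
      have "\<bar>F (m - 1) x\<bar> \<le> D0 * A + I" if "x \<in> {0..1}" for x
      proof -
        have "\<bar>F (m - 1) x - F (m - 1) \<xi>\<bar> \<le> I" using osc that \<xi>(1) by auto
        then show ?thesis using \<xi>(2) by linarith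
      qed
      then show ?case by simp
    next
      case (Suc j)
      have s: "Suc (m - Suc (Suc j)) = m - Suc j" using Suc.prems by auto
      obtain \<xi> where \<xi>: "\<xi> \<in> {0..1}" "\<bar>F (m - Suc (Suc j)) \<xi>\<bar> \<le> D0 * A" using small[of "m - Suc (Suc j)"] Suc by auto
      have *: "\<bar>F (m - Suc (Suc j)) x - F (m - Suc (Suc j)) y\<bar> \<le> real (Suc j) * D0 * A + I"
        if xy: "x \<in> {0..1}" "y \<in> {0..1}" "x < y" for x y
      proof -
        obtain z where z: "x < z" "z < y" "F (m - Suc (Suc j)) y - F (m - Suc (Suc j)) x = (y - x) * F (m - Suc j) z"
          using deriv_chain_mvt[OF F, of "m - Suc (Suc j)" x y] xy Suc.prems unfolding s by auto
        have "\<bar>(y - x) * F (m - Suc j) z\<bar> \<le> 1 * \<bar>F (m - Suc j) z\<bar>"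
          unfolding abs_mult using xy by (intro mult_right_mono) auto
        moreover have "\<bar>F (m - Suc j) z\<bar> \<le> real (Suc j) * D0 * A + I"
          using Suc z xy by auto
        ultimately show ?thesis using z(3) by linarith
      qed
      have nn: "0 \<le> real (Suc j) * D0 * A + I" using D0 A I by auto
      show ?case
      proof
        fix x :: real assume x: "x \<in> {0..1}"
        have "\<bar>F (m - Suc (Suc j)) x - F (m - Suc (Suc j)) \<xi>\<bar> \<le> real (Suc j) * D0 * A + I"
          using *[OF x \<xi>(1)] *[OF \<xi>(1) x] nn by (cases x \<xi> rule: linorder_cases) auto
        then have "\<bar>F (m - Suc (Suc j)) x\<bar> \<le> real (Suc j) * D0 * A + I + D0 * A" using \<xi>(2) by linarith
        then show "\<bar>F (m - Suc (Suc j)) x\<bar> \<le> real (Suc (Suc j)) * D0 * A + I" by (simp add: algebra_simps)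
      qed
    qed
    from this[of "m - Suc i"] x i have "\<bar>F i x\<bar> \<le> real (Suc (m - Suc i)) * D0 * A + I" by auto
    also have "\<dots> \<le> real m * D0 * A + I"
      using D0 A i by (intro add_right_mono mult_right_mono) auto
    finally show ?thesis .
  qed
  show ?thesis
  proof (intro exI[of _ "real m * D0 + 1"] exI[of _ "2 * R"] conjI allI impI ballI)
    fix n F S A I i x
    assume "2 * R \<le> n" "deriv_chain m S F" "0 \<le> A" "0 \<le> I"
      "(\<Sum>i = 1..n. (F 0 (real i / real n))\<^sup>2) \<le> real n * A\<^sup>2"
      "\<forall>x\<in>{0..1}. \<forall>y\<in>{0..1}. \<bar>F (m - 1) x - F (m - 1) y\<bar> \<le> I" "i < m" "x \<in> {0..1::real}"
    then have "\<bar>F i x\<bar> \<le> real m * D0 * A + I" by (rule main)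
    also have "\<dots> \<le> (real m * D0 + 1) * (A + I)"
    proof -
      have "0 \<le> real m * D0 * I" "0 \<le> A" using D0 \<open>0 \<le> I\<close> \<open>0 \<le> A\<close> by auto
      then show ?thesis by (simp add: algebra_simps)
    qed
    finally show "\<bar>F i x\<bar> \<le> (real m * D0 + 1) * (A + I)" .
  qed (use D0 in auto)
qed

section \<open>Repeated integration by parts and integration over cells\<close>

lemma alternating_sum_deriv:
  fixes F G :: "nat \<Rightarrow> real \<Rightarrow> real"
  assumes "\<And>j. j < m \<Longrightarrow> (F j has_real_derivative F (Suc j) x) (at x)"
    and "\<And>j. j < m \<Longrightarrow> (G j has_real_derivative G (Suc j) x) (at x)"
  shows "((\<lambda>x. \<Sum>j<m. (-1) ^ j * (F j x * G (m - 1 - j) x)) has_real_derivative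
          F 0 x * G m x - (-1) ^ m * (F m x * G 0 x)) (at x)"
proof -
  define T where "T j = (-1) ^ j * (F j x * G (m - j) x)" for j
  have "((\<lambda>x. \<Sum>j<m. (-1) ^ j * (F j x * G (m - 1 - j) x)) has_real_derivative
      (\<Sum>j<m. T j - T (Suc j))) (at x)"
  proof (rule DERIV_sum)
    fix j assume "j \<in> {..<m}"
    then have j: "j < m" by simp
    have s: "Suc (m - 1 - j) = m - j" "m - Suc j = m - 1 - j" using j by auto
    have "(G (m - 1 - j) has_real_derivative G (m - j) x) (at x)"
      using assms(2)[of "m - 1 - j"] j unfolding s by auto
    from DERIV_cmult[OF DERIV_mult'[OF assms(1)[OF j] this], of "(-1) ^ j"]
    show "((\<lambda>x. (-1) ^ j * (F j x * G (m - 1 - j) x)) has_real_derivative T j - T (Suc j)) (at x)"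
      by (simp add: T_def algebra_simps)
  qed
  also have "(\<Sum>j<m. T j - T (Suc j)) = T 0 - T m" by (rule sum_lessThan_telescope')
  finally show ?thesis by (simp add: T_def)
qed

text \<open>The alternating signs make the mixed terms telescope, so all \<open>m\<close>
  integrations by parts are a single use of the fundamental theorem of calculus.\<close>

lemma repeated_ibp:
  fixes F G :: "nat \<Rightarrow> real \<Rightarrow> real"
  assumes "a \<le> b" "finite S"
    and "\<And>j. j < m \<Longrightarrow> continuous_on {a..b} (F j)"
    and "\<And>j. j < m \<Longrightarrow> continuous_on {a..b} (G j)"
    and "\<And>j x. j < m \<Longrightarrow> x \<in> {a<..<b} - S \<Longrightarrow> (F j has_real_derivative F (Suc j) x) (at x)"
    and "\<And>j x. j < m \<Longrightarrow> x \<in> {a<..<b} - S \<Longrightarrow> (G j has_real_derivative G (Suc j) x) (at x)"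
  shows "((\<lambda>x. F 0 x * G m x - (-1) ^ m * (F m x * G 0 x)) has_integral
     (\<Sum>j<m. (-1) ^ j * (F j b * G (m - 1 - j) b)) - (\<Sum>j<m. (-1) ^ j * (F j a * G (m - 1 - j) a))) {a..b}"
proof (rule fundamental_theorem_of_calculus_interior_strong[of S, OF assms(2) assms(1)])
  show "((\<lambda>x. \<Sum>j<m. (-1) ^ j * (F j x * G (m - 1 - j) x)) has_vector_derivative
        F 0 x * G m x - (-1) ^ m * (F m x * G 0 x)) (at x)" if "x \<in> {a<..<b} - S" for x
    unfolding has_real_derivative_iff_has_vector_derivative[symmetric]
    by (intro alternating_sum_deriv assms that)
  show "continuous_on {a..b} (\<lambda>x. \<Sum>j<m. (-1) ^ j * (F j x * G (m - 1 - j) x))"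
    by (intro continuous_intros assms) auto
qed

lemma has_integral_cells:
  fixes f :: "real \<Rightarrow> real"
  assumes "n > 0" "\<And>k. k < n \<Longrightarrow> (f has_integral I k) {real k / real n..real (Suc k) / real n}"
  shows "(f has_integral (\<Sum>k<n. I k)) {0..1}"
proof -
  have "(f has_integral (\<Sum>k<j. I k)) {0..real j / real n}" if "j \<le> n" for j
    using that
  proof (induction j)
    case 0
    then show ?case using has_integral_refl(2)[of f 0] by simp
  next
    case (Suc j)
    show ?case unfolding sum.lessThan_Suc
      using Suc assms(1) by (intro has_integral_combine[of 0 "real j / real n"] assms(2)) (auto simp: divide_right_mono)
  qed
  from this[of n] assms(1) show ?thesis by simp
qed

lemma integral_cells:
  fixes f :: "real \<Rightarrow> real"
  assumes "n > 0" "f integrable_on {0..1}"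
  shows "(\<Sum>k<n. integral {real k / real n..real (Suc k) / real n} f) = integral {0..1} f"
proof -
  have "f integrable_on {real k / real n..real (Suc k) / real n}" if "k < n" for k
    using that assms(1) by (intro integrable_subinterval_real[OF assms(2)]) auto
  then have "(f has_integral (\<Sum>k<n. integral {real k / real n..real (Suc k) / real n} f)) {0..1}"
    by (intro has_integral_cells assms(1)) (auto intro: integrable_integral)
  then show ?thesis by (simp add: integral_unique)
qed

section \<open>Normal equations\<close>

text \<open>The value of the \<open>m\<close>-th derivative on cell \<open>k\<close>. Cells are
  counted from 0 and coefficients from 1, whence the \<open>Suc k\<close>.\<close>

definition top_deriv :: "nat \<Rightarrow> nat \<Rightarrow> (nat \<Rightarrow> real) \<Rightarrow> nat \<Rightarrow> real" where
  "top_deriv K m b k = real K ^ m * (forward_diff ^^ m) b (Suc k)"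

definition cell :: "nat \<Rightarrow> nat \<Rightarrow> real set" where
  "cell n k = {real k / real n..real (Suc k) / real n}"

lemma cell_subset: "k < n \<Longrightarrow> cell n k \<subseteq> {0..1}"
  by (auto simp: cell_def field_simps)

lemma ex_cell:
  assumes "n > 0" "x \<in> {0..1}"
  shows "\<exists>k<n. x \<in> cell n k"
proof (cases "x = 1")
  case True
  then show ?thesis using assms by (intro exI[of _ "n - 1"]) (auto simp: cell_def of_nat_diff)
next
  case False
  define k where "k = nat \<lfloor>real n * x\<rfloor>"
  have less: "real n * x < real n" using mult_strict_left_mono[of x 1 "real n"] False assms by simp
  have k: "real k \<le> real n * x" "real n * x < real k + 1"
  proof -
    have "0 \<le> real n * x" using assms by simp
    then show "real k \<le> real n * x" "real n * x < real k + 1" unfolding k_def by linarith+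
  qed
  then have "k < n" using less by linarith
  then show ?thesis using assms k
    by (intro exI[of _ k]) (simp add: cell_def field_simps)
qed

lemma top_deriv_add: "top_deriv K m (\<lambda>k. b k + c k) l = top_deriv K m b l + top_deriv K m c l"
  by (simp add: top_deriv_def forward_diff_funpow_add algebra_simps)

lemma top_deriv_scale: "top_deriv K m (\<lambda>k. a * b k) l = a * top_deriv K m b l"
  by (simp add: top_deriv_def forward_diff_funpow_scale algebra_simps)

lemma spline_deriv_chain_0: "spline_deriv_chain K m b 0 = spline K m b"
  by (simp add: spline_deriv_chain_def fun_eq_iff)

lemma deriv_chain_spline:
  assumes "K > 0"
  shows "deriv_chain m ((\<lambda>j. real j / real K) ` {..K}) (spline_deriv_chain K m b)"
  unfolding deriv_chain_def
proof (intro conjI allI impI ballI)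
  fix i assume i: "i < m"
  show "continuous_on {0..1} (spline_deriv_chain K m b i)"
    unfolding spline_deriv_chain_def using i assms by (intro continuous_intros spline_continuous) auto
  fix x :: real assume x: "x \<in> {0<..<1} - (\<lambda>j. real j / real K) ` {..K}"
  have nz: "real K * x \<notin> \<int>"
  proof
    assume "real K * x \<in> \<int>"
    then obtain z where z: "real K * x = of_int z" by (auto elim: Ints_cases)
    have "0 \<le> real K * x" "real K * x \<le> real K" using x assms by (auto simp: mult_left_le)
    then have "0 \<le> z" "z \<le> int K" unfolding z by linarith+
    then have "x = real (nat z) / real K" "nat z \<le> K" using z assms by (auto simp: field_simps)
    then show False using x by auto
  qed
  obtain p where p: "m - i = Suc p" using i by (cases "m - i") auto
  then have p': "m - Suc i = p" by auto
  have "((\<lambda>x. real K ^ i * spline K (Suc p) ((forward_diff ^^ i) b) x) has_real_derivative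
      real K ^ i * (real K * spline K p (forward_diff ((forward_diff ^^ i) b)) x)) (at x)"
    using x nz assms by (intro DERIV_cmult spline_deriv) auto
  then show "(spline_deriv_chain K m b i has_real_derivative spline_deriv_chain K m b (Suc i) x) (at x)"
    unfolding spline_deriv_chain_def p p' by (simp add: mult_ac)
qed auto

lemma spline_deriv_chain_top:
  assumes "K > 0" "k < K" "x \<in> {real k / real K<..real (Suc k) / real K}"
  shows "spline_deriv_chain K m b m x = top_deriv K m b k"
proof -
  have "spline K 0 ((forward_diff ^^ m) b) x = (forward_diff ^^ m) b (Suc k)"
    using assms by (intro spline_0) (auto simp: knot_def)
  then show ?thesis by (simp add: spline_deriv_chain_def top_deriv_def)
qed

lemma has_integral_times_top_deriv:
  assumes "K > 0" "k < K" "real k / real K \<le> a" "a \<le> b" "b \<le> real (Suc k) / real K" "(f has_integral I) {a..b}"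
  shows "((\<lambda>x. f x * spline_deriv_chain K m c m x) has_integral I * top_deriv K m c k) {a..b}"
proof (rule has_integral_spike_finite[of "{a}" _ _ "\<lambda>x. f x * top_deriv K m c k"])
  show "((\<lambda>x. f x * top_deriv K m c k) has_integral I * top_deriv K m c k) {a..b}"
    by (rule has_integral_mult_left) fact
  fix x assume "x \<in> {a..b} - {a}"
  then show "f x * spline_deriv_chain K m c m x = f x * top_deriv K m c k"
    using assms by (subst spline_deriv_chain_top[of K k]) auto
qed simp

text \<open>The spline factor is constant on each cell, so integrating \<open>F m\<close> there
  leaves increments of \<open>F (m - 1)\<close>; the identity is exact.\<close>

lemma has_integral_chain_times_top:
  assumes "K > 0" "m \<ge> 1" "deriv_chain m S F"
  shows "((\<lambda>x. F m x * spline_deriv_chain K m c m x) has_integral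
     (\<Sum>k<K. (F (m - 1) (real (Suc k) / real K) - F (m - 1) (real k / real K)) * top_deriv K m c k)) {0..1}"
proof (rule has_integral_cells[OF assms(1)])
  fix k assume k: "k < K"
  have "real (Suc k) / real K \<le> 1" using k by auto
  moreover have "real k / real K \<le> real (Suc k) / real K" by (simp add: divide_right_mono)
  ultimately show "((\<lambda>x. F m x * spline_deriv_chain K m c m x) has_integral
    (F (m - 1) (real (Suc k) / real K) - F (m - 1) (real k / real K)) * top_deriv K m c k)
     {real k / real K..real (Suc k) / real K}"
    using deriv_chain_has_integral[OF assms(3), of "m - 1" "real k / real K" "real (Suc k) / real K"] assms k
    by (intro has_integral_times_top_deriv) auto
qed

lemma spline_deriv_chain_linear:
  assumes "K > 0" "m \<ge> 1" "k < K" "x \<in> cell K k"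
  shows "spline_deriv_chain K m b (m - 1) x
       = spline_deriv_chain K m b (m - 1) (real k / real K) + (x - real k / real K) * top_deriv K m b k"
proof -
  have x: "real k / real K \<le> x" "x \<le> real (Suc k) / real K" using assms by (auto simp: cell_def)
  have x1: "x \<le> 1" using cell_subset[OF assms(3)] assms(4) by auto
  have "(spline_deriv_chain K m b (Suc (m - 1)) has_integral
      spline_deriv_chain K m b (m - 1) x - spline_deriv_chain K m b (m - 1) (real k / real K)) {real k / real K..x}"
    using assms x x1 by (intro deriv_chain_has_integral[OF deriv_chain_spline]) auto
  moreover have "((\<lambda>x. 1 * spline_deriv_chain K m b m x) has_integral (x - real k / real K) * top_deriv K m b k) {real k / real K..x}"
    using assms x has_integral_const_real[of "1::real" "real k / real K" x]
    by (intro has_integral_times_top_deriv) auto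
  moreover have "Suc (m - 1) = m" using assms(2) by simp
  ultimately have "spline_deriv_chain K m b (m - 1) x - spline_deriv_chain K m b (m - 1) (real k / real K)
      = (x - real k / real K) * top_deriv K m b k"
    by (simp add: has_integral_unique)
  then show ?thesis by simp
qed

text \<open>The spline copies the derivatives of \<open>F\<close> at 0 and takes the cell averages
  of \<open>F m\<close> as its top derivative. Hence its order \<open>m - 1\<close> interpolates
  \<open>F (m - 1)\<close> linearly at the knots, and lower orders follow by integrating the error
  from 0. The bounds \<open>\<rho> k\<close> are kept cell by cell so that the decay of a kernel
  survives the summation over cells.\<close>

lemma spline_projection:
  assumes K: "K > 0" and m: "m \<ge> 1" and F: "deriv_chain m S F"
  obtains b where
    "\<And>k. k < K \<Longrightarrow> top_deriv K m b k = real K * (F (m - 1) (real (Suc k) / real K) - F (m - 1) (real k / real K))"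
    "\<And>\<rho> k x. \<lbrakk>\<forall>k<K. \<forall>x\<in>cell K k. \<forall>y\<in>cell K k. \<bar>F (m - 1) x - F (m - 1) y\<bar> \<le> \<rho> k;
       k < K; x \<in> cell K k\<rbrakk> \<Longrightarrow> \<bar>F (m - 1) x - spline_deriv_chain K m b (m - 1) x\<bar> \<le> \<rho> k"
    "\<And>k. k \<le> K \<Longrightarrow> spline_deriv_chain K m b (m - 1) (real k / real K) = F (m - 1) (real k / real K)"
    "\<And>\<rho> x. \<lbrakk>\<forall>k<K. \<forall>x\<in>cell K k. \<bar>F (m - 1) x - spline_deriv_chain K m b (m - 1) x\<bar> \<le> \<rho> k;
       m \<ge> 2; x \<in> {0..1}\<rbrakk> \<Longrightarrow> \<bar>F 0 x - spline K m b x\<bar> \<le> (\<Sum>k<K. \<rho> k) / real K"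
proof -
  \<comment> \<open>The truncated \<open>k - 1\<close> is harmless: \<open>top_deriv\<close> reads
    the differences from index 1 on.\<close>
  obtain b where b: "\<forall>i<m. spline_deriv_chain K m b i 0 = F i 0"
     "\<forall>k. real K ^ m * (forward_diff ^^ m) b k
        = real K * (F (m - 1) (real k / real K) - F (m - 1) (real (k - 1) / real K))"
    using ex_spline_coeff[OF K, of m "\<lambda>i. F i 0" "\<lambda>k. real K * (F (m - 1) (real k / real K) - F (m - 1) (real (k - 1) / real K))"]
    by blast
  define Q where "Q = spline_deriv_chain K m b"
  have top: "top_deriv K m b k = real K * (F (m - 1) (real (Suc k) / real K) - F (m - 1) (real k / real K))" for k
    using b(2) by (simp add: top_deriv_def)
  have Qc: "deriv_chain m ((\<lambda>j. real j / real K) ` {..K}) Q"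
    unfolding Q_def by (rule deriv_chain_spline[OF K])
  have knot: "Q (m - 1) (real k / real K) = F (m - 1) (real k / real K)" if "k \<le> K" for k
    using that
  proof (induction k)
    case 0
    then show ?case using b(1) m by (simp add: Q_def)
  next
    case (Suc k)
    have "real (Suc k) / real K \<in> cell K k" by (simp add: cell_def divide_right_mono)
    from spline_deriv_chain_linear[OF K m _ this, of b] Suc
    have "Q (m - 1) (real (Suc k) / real K) = Q (m - 1) (real k / real K) + (1 / real K) * top_deriv K m b k"
      by (simp add: Q_def diff_divide_distrib[symmetric])
    then show ?case using Suc K by (simp add: top)
  qed
  have osc: "\<bar>F (m - 1) x - Q (m - 1) x\<bar> \<le> \<rho> k"
    if \<rho>: "\<forall>k<K. \<forall>x\<in>cell K k. \<forall>y\<in>cell K k. \<bar>F (m - 1) x - F (m - 1) y\<bar> \<le> \<rho> k"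
      and k: "k < K" and x: "x \<in> cell K k" for \<rho> k x
  proof -
    define s where "s = (x - real k / real K) * real K"
    have "real k \<le> x * real K" "x * real K \<le> real k + 1" using x K by (auto simp: cell_def field_simps)
    moreover have "s = x * real K - real k" using K by (simp add: s_def left_diff_distrib)
    ultimately have s: "0 \<le> s" "s \<le> 1" by auto
    define p where "p = F (m - 1) x - F (m - 1) (real k / real K)"
    define q where "q = F (m - 1) x - F (m - 1) (real (Suc k) / real K)"
    have "Q (m - 1) x = F (m - 1) (real k / real K)
       + s * (F (m - 1) (real (Suc k) / real K) - F (m - 1) (real k / real K))"
      using spline_deriv_chain_linear[OF K m k x, of b] knot[of k] k by (simp add: Q_def s_def top)
    \<comment> \<open>Linear interpolation makes the error a convex combination of the differences
      to the two end values of the cell.\<close>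
    then have e: "F (m - 1) x - Q (m - 1) x = (1 - s) * p + s * q"
      by (simp add: p_def q_def algebra_simps)
    have "\<bar>p\<bar> \<le> \<rho> k" "\<bar>q\<bar> \<le> \<rho> k"
      unfolding p_def q_def by (intro \<rho>[rule_format, OF k x]; simp add: cell_def divide_right_mono)+
    then have "\<bar>(1 - s) * p + s * q\<bar> \<le> (1 - s) * \<rho> k + s * \<rho> k"
      using s by (intro order_trans[OF abs_triangle_ineq] add_mono) (simp_all add: abs_mult mult_left_mono)
    then show ?thesis unfolding e by (simp add: algebra_simps)
  qed
  have sup: "\<bar>F 0 x - Q 0 x\<bar> \<le> (\<Sum>k<K. \<rho> k) / real K"
    if \<rho>: "\<forall>k<K. \<forall>x\<in>cell K k. \<bar>F (m - 1) x - Q (m - 1) x\<bar> \<le> \<rho> k"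
      and m2: "m \<ge> 2" and x: "x \<in> {0..1}" for \<rho> x
  proof -
    define R where "R = (\<lambda>i x. F i x - Q i x)"
    have R: "deriv_chain m (S \<union> (\<lambda>j. real j / real K) ` {..K}) R"
      unfolding R_def by (rule deriv_chain_diff[OF F Qc])
    have R0: "R i 0 = 0" if "i < m" for i using b(1) that by (simp add: R_def Q_def)
    let ?B = "(\<Sum>k<K. \<rho> k) / real K"
    have c: "continuous_on {0..1} (R (m - 1))" using R m2 by (auto simp: deriv_chain_def)
    have ai: "(\<lambda>x. \<bar>R (m - 1) x\<bar>) integrable_on {0..1}"
      using c by (intro integrable_continuous_real continuous_intros)
    have "integral {0..1} (\<lambda>x. \<bar>R (m - 1) x\<bar>) = (\<Sum>k<K. integral (cell K k) (\<lambda>x. \<bar>R (m - 1) x\<bar>))"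
      unfolding cell_def using integral_cells[OF K ai] by simp
    also have "\<dots> \<le> (\<Sum>k<K. \<rho> k / real K)"
    proof (rule sum_mono)
      fix k assume k: "k \<in> {..<K}"
      have "(\<lambda>x. \<bar>R (m - 1) x\<bar>) integrable_on cell K k"
        unfolding cell_def using k cell_subset[of k K] by (intro integrable_subinterval_real[OF ai]) (auto simp: cell_def)
      then have "integral (cell K k) (\<lambda>x. \<bar>R (m - 1) x\<bar>) \<le> integral (cell K k) (\<lambda>x. \<rho> k)"
        using \<rho> k by (intro integral_le) (auto simp: R_def cell_def)
      also have "\<dots> = \<rho> k / real K" by (simp add: cell_def diff_divide_distrib[symmetric] divide_right_mono)
      finally show "integral (cell K k) (\<lambda>x. \<bar>R (m - 1) x\<bar>) \<le> \<rho> k / real K" .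
    qed
    finally have I: "integral {0..1} (\<lambda>x. \<bar>R (m - 1) x\<bar>) \<le> ?B" by (simp add: sum_divide_distrib)
    have B0: "?B \<ge> 0" by (rule order_trans[OF integral_nonneg[OF ai] I]) auto
    \<comment> \<open>The first integration turns the mean absolute error into a supremum bound; the
      further ones, over intervals of length at most one, preserve it.\<close>
    have "\<forall>x\<in>{0..1}. \<bar>R (m - 2 - j) x\<bar> \<le> ?B" if "j \<le> m - 2" for j
      using that
    proof (induction j)
      case 0
      show ?case
      proof
        fix x :: real assume x: "x \<in> {0..1}"
        have "(R (Suc (m - 2)) has_integral R (m - 2) x - R (m - 2) 0) {0..x}"
          using x m2 by (intro deriv_chain_has_integral[OF R]) auto
        moreover have "Suc (m - 2) = m - 1" using m2 by auto
        ultimately have i: "(R (m - 1) has_integral R (m - 2) x) {0..x}" using R0[of "m - 2"] m2 by simp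
        have ax: "(\<lambda>x. \<bar>R (m - 1) x\<bar>) integrable_on {0..x}"
          using x by (intro integrable_subinterval_real[OF ai]) auto
        have "\<bar>integral {0..x} (R (m - 1))\<bar> \<le> integral {0..x} (\<lambda>x. \<bar>R (m - 1) x\<bar>)"
          using integral_norm_bound_integral[OF has_integral_integrable[OF i] ax] by simp
        also have "\<dots> \<le> integral {0..1} (\<lambda>x. \<bar>R (m - 1) x\<bar>)"
          using x by (intro integral_subset_le ax ai) auto
        finally have "\<bar>R (m - 2) x\<bar> \<le> ?B" using I integral_unique[OF i] by simp
        then show "\<bar>R (m - 2 - 0) x\<bar> \<le> ?B" by simp
      qed
    next
      case (Suc j)
      show ?case
      proof
        fix x :: real assume x: "x \<in> {0..1}"
        have s: "Suc (m - 2 - Suc j) = m - 2 - j" using Suc.prems by auto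
        have i: "(R (m - 2 - j) has_integral R (m - 2 - Suc j) x - R (m - 2 - Suc j) 0) {0..x}"
          unfolding s[symmetric] using x m2 Suc.prems by (intro deriv_chain_has_integral[OF R]) auto
        have "\<bar>R (m - 2 - Suc j) x - R (m - 2 - Suc j) 0\<bar> \<le> ?B * (x - 0)"
          using has_integral_bound_real[OF B0 finite.emptyI i] Suc x by auto
        also have "\<dots> \<le> ?B * 1" by (rule mult_left_mono) (use x B0 in auto)
        finally show "\<bar>R (m - 2 - Suc j) x\<bar> \<le> ?B" using R0[of "m - 2 - Suc j"] m2 by simp
      qed
    qed
    from this[of "m - 2"] x show ?thesis by (simp add: R_def)
  qed
  show ?thesis
  proof (rule that[of b])
    fix \<rho> k x
    assume h: "\<forall>k<K. \<forall>x\<in>cell K k. \<forall>y\<in>cell K k. \<bar>F (m - 1) x - F (m - 1) y\<bar> \<le> \<rho> k"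
    show "\<bar>F (m - 1) x - spline_deriv_chain K m b (m - 1) x\<bar> \<le> \<rho> k" if "k < K" "x \<in> cell K k"
      using osc[OF h that] unfolding Q_def .
  next
    fix \<rho> x
    assume h: "\<forall>k<K. \<forall>x\<in>cell K k. \<bar>F (m - 1) x - spline_deriv_chain K m b (m - 1) x\<bar> \<le> \<rho> k"
    show "\<bar>F 0 x - spline K m b x\<bar> \<le> (\<Sum>k<K. \<rho> k) / real K" if "m \<ge> 2" "x \<in> {0..1}"
      using sup[OF h[folded Q_def] that] unfolding Q_def spline_deriv_chain_0 .
  qed (use top knot in \<open>simp_all add: Q_def\<close>)
qed

text \<open>The weak form of stationarity. In this normalisation the penalty is
  \<open>n * \<alpha>\<close> times the integral of the product of the two \<open>m\<close>-th
  derivatives.\<close>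

definition normal_eq :: "nat \<Rightarrow> nat \<Rightarrow> nat \<Rightarrow> real \<Rightarrow> (nat \<Rightarrow> real) \<Rightarrow> (nat \<Rightarrow> real) \<Rightarrow> bool" where
  "normal_eq n K m \<alpha> y b \<longleftrightarrow> (\<forall>b'.
     (\<Sum>i=1..n. (y i - spline K m b (real i / real n)) * spline K m b' (real i / real n))
     = real n * \<alpha> / real K * (\<Sum>k<K. top_deriv K m b k * top_deriv K m b' k))"

lemma penalty_eq:
  assumes "K > 0"
  shows "real K ^ (2 * m) * (\<Sum>k=m+1..K+m. (backward_diff ^^ m) b k * (backward_diff ^^ m) b' k)
       = (\<Sum>k<K. top_deriv K m b k * top_deriv K m b' k)"
proof -
  have "(\<Sum>k=m+1..K+m. (backward_diff ^^ m) b k * (backward_diff ^^ m) b' k)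
      = (\<Sum>k<K. (backward_diff ^^ m) b (Suc k + m) * (backward_diff ^^ m) b' (Suc k + m))"
    by (rule sum.reindex_bij_witness[of _ "\<lambda>k. Suc k + m" "\<lambda>k. k - m - 1"]) auto
  then show ?thesis
    unfolding backward_diff_funpow_shift
    by (simp add: top_deriv_def sum_distrib_left power_mult power2_eq_square algebra_simps power_mult_distrib)
qed

lemma linear_coeff_zero:
  fixes p q :: real
  assumes "\<And>\<tau>. 0 \<le> \<tau>\<^sup>2 * q - 2 * \<tau> * p" "q \<ge> 0"
  shows "p = 0"
proof (rule ccontr)
  assume "p \<noteq> 0"
  \<comment> \<open>The minimiser of the quadratic would be \<open>p / q\<close>; the
    \<open>+ 1\<close> covers \<open>q = 0\<close>.\<close>
  define w where "w = p / (q + 1)"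
  have p: "p = w * (q + 1)" using assms(2) by (simp add: w_def)
  have "0 \<le> w\<^sup>2 * q - 2 * w * p" by (rule assms)
  also have "\<dots> = w\<^sup>2 * (q - 2 * (q + 1))" unfolding p by (simp add: algebra_simps power2_eq_square)
  also have "\<dots> < 0" using \<open>p \<noteq> 0\<close> p assms(2) by (intro mult_pos_neg) auto
  finally show False by simp
qed

text \<open>Along a direction \<open>b'\<close> the objective is a quadratic polynomial in the step
  length, and at a minimum its linear coefficient vanishes.\<close>

lemma pspline_coeff_normal_eq:
  assumes K: "K > 0" and n: "n > 0" and lam: "lam > 0" and m: "m \<ge> 1"
    and b: "is_pspline_coeff n K m m lam y b"
    and \<alpha>: "\<alpha> = lam / (real n * real K ^ (2 * m - 1))"
  shows "normal_eq n K m \<alpha> y b"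
  unfolding normal_eq_def
proof
  fix b'
  define g where "g i = spline K m b (real i / real n)" for i
  define h where "h i = spline K m b' (real i / real n)" for i
  define D where "D = (\<lambda>b. (backward_diff ^^ m) b)"
  have lin: "D (\<lambda>k. b k + \<tau> * b' k) k = D b k + \<tau> * D b' k" if "k \<in> {m+1..K+m}" for \<tau> k
  proof -
    have "D c k = (forward_diff ^^ m) c (k - m)" for c
      using backward_diff_funpow_shift[of m c "k - m"] that by (simp add: D_def)
    then show ?thesis by (simp add: forward_diff_funpow_add forward_diff_funpow_scale)
  qed
  let ?J = "{m+1..K+m}"
  define p where "p = (\<Sum>i=1..n. (y i - g i) * h i) - lam * (\<Sum>k\<in>?J. D b k * D b' k)"
  define q where "q = (\<Sum>i=1..n. (h i)\<^sup>2) + lam * (\<Sum>k\<in>?J. (D b' k)\<^sup>2)"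
  have "pspline_objective n K m m lam y (\<lambda>k. b k + \<tau> * b' k) = pspline_objective n K m m lam y b + (\<tau>\<^sup>2 * q - 2 * \<tau> * p)" for \<tau>
  proof -
    have 1: "(\<Sum>i=1..n. (y i - (g i + \<tau> * h i))\<^sup>2)
        = (\<Sum>i=1..n. (y i - g i)\<^sup>2) + \<tau>\<^sup>2 * (\<Sum>i=1..n. (h i)\<^sup>2) - 2 * \<tau> * (\<Sum>i=1..n. (y i - g i) * h i)"
      unfolding sum_distrib_left sum.distrib[symmetric] sum_subtractf[symmetric]
      by (rule sum.cong) (auto simp: power2_eq_square algebra_simps)
    have 2: "(\<Sum>k\<in>?J. (D (\<lambda>k. b k + \<tau> * b' k) k)\<^sup>2)
        = (\<Sum>k\<in>?J. (D b k)\<^sup>2) + \<tau>\<^sup>2 * (\<Sum>k\<in>?J. (D b' k)\<^sup>2) + 2 * \<tau> * (\<Sum>k\<in>?J. D b k * D b' k)"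
      unfolding sum_distrib_left sum.distrib[symmetric]
      by (rule sum.cong) (auto simp: lin power2_eq_square algebra_simps)
    show ?thesis
      unfolding pspline_objective_def spline_add spline_scale g_def[symmetric] h_def[symmetric] D_def[symmetric] 1 2 p_def q_def
      by (simp add: algebra_simps)
  qed
  then have "0 \<le> \<tau>\<^sup>2 * q - 2 * \<tau> * p" for \<tau>
    using b unfolding is_pspline_coeff_def by (metis le_add_same_cancel1)
  moreover have "q \<ge> 0" unfolding q_def using lam by (intro add_nonneg_nonneg mult_nonneg_nonneg sum_nonneg) auto
  ultimately have "p = 0" by (rule linear_coeff_zero)
  then have "(\<Sum>i=1..n. (y i - g i) * h i) = lam * (\<Sum>k\<in>?J. D b k * D b' k)" by (simp add: p_def)
  moreover have "lam = real n * \<alpha> / real K * real K ^ (2 * m)"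
    using K n m unfolding \<alpha> by (cases "2 * m") (auto simp: field_simps)
  ultimately show "(\<Sum>i=1..n. (y i - spline K m b (real i / real n)) * spline K m b' (real i / real n))
     = real n * \<alpha> / real K * (\<Sum>k<K. top_deriv K m b k * top_deriv K m b' k)"
    unfolding penalty_eq[OF K, symmetric] g_def h_def D_def by (simp add: mult.assoc)
qed

text \<open>The equations are tested with the solution itself, and the mixed sum is split by
  \<open>2 y g \<le> y^2 + g^2\<close>.\<close>

lemma normal_eq_energy:
  assumes "normal_eq n K m \<alpha> y b" "\<alpha> > 0"
  shows "(\<Sum>i=1..n. (spline K m b (real i / real n))\<^sup>2) \<le> (\<Sum>i=1..n. (y i)\<^sup>2)"
    and "real n * \<alpha> / real K * (\<Sum>k<K. (top_deriv K m b k)\<^sup>2) \<le> (\<Sum>i=1..n. (y i)\<^sup>2)"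
proof -
  define g where "g i = spline K m b (real i / real n)" for i
  define E where "E = real n * \<alpha> / real K * (\<Sum>k<K. (top_deriv K m b k)\<^sup>2)"
  have E: "E \<ge> 0" unfolding E_def using assms(2) by (intro mult_nonneg_nonneg sum_nonneg) auto
  have "(\<Sum>i=1..n. (y i - g i) * g i) = E"
    using assms(1) unfolding normal_eq_def by (simp add: g_def E_def power2_eq_square)
  then have "(\<Sum>i=1..n. y i * g i) - (\<Sum>i=1..n. (g i)\<^sup>2) = E"
    by (simp add: sum_subtractf[symmetric] power2_eq_square algebra_simps)
  moreover have "2 * (\<Sum>i=1..n. y i * g i) \<le> (\<Sum>i=1..n. (y i)\<^sup>2) + (\<Sum>i=1..n. (g i)\<^sup>2)"
    unfolding sum_distrib_left sum.distrib[symmetric]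
    by (rule sum_mono) (use sum_squares_bound in \<open>auto simp: mult.assoc\<close>)
  moreover have "(\<Sum>i=1..n. (g i)\<^sup>2) \<ge> 0" by (intro sum_nonneg) auto
  ultimately show "(\<Sum>i=1..n. (spline K m b (real i / real n))\<^sup>2) \<le> (\<Sum>i=1..n. (y i)\<^sup>2)"
     "real n * \<alpha> / real K * (\<Sum>k<K. (top_deriv K m b k)\<^sup>2) \<le> (\<Sum>i=1..n. (y i)\<^sup>2)"
    using E unfolding g_def[symmetric] E_def[symmetric] by linarith+
qed

text \<open>Gram-Schmidt by induction on \<open>J\<close>. The residual \<open>r\<close> of the data
  and the residual \<open>u\<close> of the new vector are orthogonal to the old vectors; subtracting
  from \<open>r\<close> its component along \<open>u\<close> keeps this and adds the new
  orthogonality. If \<open>u\<close> vanishes, division by zero gives \<open>\<tau> = 0\<close>,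
  which is still correct.\<close>

lemma least_squares_exists:
  fixes v :: "'j \<Rightarrow> 'i \<Rightarrow> real"
  assumes "finite J" "finite I"
  shows "\<exists>a. \<forall>j\<in>J. (\<Sum>i\<in>I. (y i - (\<Sum>l\<in>J. a l * v l i)) * v j i) = 0"
  using assms(1)
proof (induction J arbitrary: y rule: finite_induct)
  case empty
  then show ?case by simp
next
  case (insert j J)
  obtain a where a: "\<forall>l\<in>J. (\<Sum>i\<in>I. (y i - (\<Sum>l\<in>J. a l * v l i)) * v l i) = 0" using insert.IH by blast
  obtain c where c: "\<forall>l\<in>J. (\<Sum>i\<in>I. (v j i - (\<Sum>l\<in>J. c l * v l i)) * v l i) = 0" using insert.IH by blast
  define r where "r i = y i - (\<Sum>l\<in>J. a l * v l i)" for i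
  define u where "u i = v j i - (\<Sum>l\<in>J. c l * v l i)" for i
  define U where "U = (\<Sum>i\<in>I. u i * u i)"
  define \<tau> where "\<tau> = (\<Sum>i\<in>I. r i * u i) / U"
  have orth: "(\<Sum>i\<in>I. w i * v j i) = (\<Sum>i\<in>I. w i * u i)" if "\<forall>l\<in>J. (\<Sum>i\<in>I. w i * v l i) = 0" for w
  proof -
    have "(\<Sum>i\<in>I. w i * v j i) = (\<Sum>i\<in>I. w i * u i) + (\<Sum>i\<in>I. \<Sum>l\<in>J. c l * (w i * v l i))"
      by (simp add: u_def sum.distrib[symmetric] algebra_simps sum_distrib_left)
    also have "(\<Sum>i\<in>I. \<Sum>l\<in>J. c l * (w i * v l i)) = (\<Sum>l\<in>J. c l * (\<Sum>i\<in>I. w i * v l i))"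
      by (subst sum.swap) (simp add: sum_distrib_left)
    finally show ?thesis using that by simp
  qed
  have rl: "\<forall>l\<in>J. (\<Sum>i\<in>I. r i * v l i) = 0" using a by (simp add: r_def)
  have ul: "\<forall>l\<in>J. (\<Sum>i\<in>I. u i * v l i) = 0" using c by (simp add: u_def)
  define a' where "a' l = (if l = j then \<tau> else a l - \<tau> * c l)" for l
  have res: "y i - (\<Sum>l\<in>insert j J. a' l * v l i) = r i - \<tau> * u i" for i
  proof -
    have "(\<Sum>l\<in>J. a' l * v l i) = (\<Sum>l\<in>J. a l * v l i) - \<tau> * (\<Sum>l\<in>J. c l * v l i)"
      unfolding sum_distrib_left sum_subtractf[symmetric]
      using insert.hyps by (intro sum.cong) (auto simp: a'_def algebra_simps)
    then show ?thesis using insert.hyps by (simp add: a'_def r_def u_def algebra_simps)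
  qed
  have lin: "(\<Sum>i\<in>I. (r i - \<tau> * u i) * w i) = (\<Sum>i\<in>I. r i * w i) - \<tau> * (\<Sum>i\<in>I. u i * w i)" for w
    by (simp add: sum_distrib_left sum_subtractf[symmetric] algebra_simps)
  have "(\<Sum>i\<in>I. (r i - \<tau> * u i) * v l i) = 0" if "l \<in> insert j J" for l
  proof (cases "l = j")
    case False
    then show ?thesis using that rl ul by (simp add: lin)
  next
    case True
    have "(\<Sum>i\<in>I. r i * u i) = \<tau> * U"
    proof (cases "U = 0")
      case True
      then have "\<forall>i\<in>I. u i = 0"
        using assms(2) unfolding U_def by (subst (asm) sum_nonneg_eq_0_iff) auto
      then show ?thesis using True by simp
    qed (simp add: \<tau>_def)
    then show ?thesis unfolding lin True orth[OF rl] orth[OF ul] U_def by simp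
  qed
  then show ?case by (intro exI[of _ a']) (simp only: res, blast)
qed

lemma forward_diff_funpow_cong:
  "(\<And>j. k \<le> j \<Longrightarrow> j \<le> k + i \<Longrightarrow> b j = c j) \<Longrightarrow> (forward_diff ^^ i) b k = (forward_diff ^^ i) c k"
proof (induction i arbitrary: k)
  case (Suc i)
  have "(forward_diff ^^ i) b (Suc k) = (forward_diff ^^ i) c (Suc k)" by (rule Suc.IH) (auto intro: Suc.prems)
  moreover have "(forward_diff ^^ i) b k = (forward_diff ^^ i) c k" by (rule Suc.IH) (auto intro: Suc.prems)
  ultimately show ?case
    by (simp only: funpow.simps comp_def forward_diff_def[of "(forward_diff ^^ i) b"]
        forward_diff_def[of "(forward_diff ^^ i) c"])
qed auto

lemma top_deriv_basis:
  assumes "k < K"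
  shows "top_deriv K m b k = (\<Sum>l=1..K+m. b l * top_deriv K m (\<lambda>j. if j = l then 1 else 0) k)"
proof -
  have sum: "top_deriv K m (\<lambda>j. \<Sum>l\<in>L. c l j) k = (\<Sum>l\<in>L. top_deriv K m (c l) k)" if "finite L" for L c
    using that
  proof (induction rule: finite_induct)
    case empty
    have "top_deriv K m (\<lambda>j. 0 * 0) k = 0" by (subst top_deriv_scale) simp
    then show ?case by simp
  qed (simp add: top_deriv_add)
  have "top_deriv K m b k = top_deriv K m (\<lambda>j. \<Sum>l=1..K+m. b l * (if j = l then 1 else 0)) k"
    unfolding top_deriv_def using assms
    by (intro arg_cong[of _ _ "\<lambda>x. _ * x"] forward_diff_funpow_cong) (simp add: if_distrib cong: if_cong)
  then show ?thesis by (simp only: sum finite_atLeastAtMost top_deriv_scale)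
qed

lemma spline_basis:
  "spline K m b x = (\<Sum>l=1..K+m. b l * spline K m (\<lambda>j. if j = l then 1 else 0) x)"
proof -
  have "spline K m (\<lambda>j. if j = l then 1 else 0) x = bspline K m (int l) x" if "l \<in> {1..K+m}" for l
  proof -
    have "spline K m (\<lambda>j. if j = l then 1 else 0) x = (\<Sum>k\<in>{1..K+m}. if k = l then bspline K m (int k) x else 0)"
      unfolding spline_def by (rule sum.cong) simp_all
    then show ?thesis using that by (simp only: sum.delta finite_atLeastAtMost if_True)
  qed
  then show ?thesis unfolding spline_def[of K m b] by (intro sum.cong) simp_all
qed

text \<open>Penalized least squares is ordinary least squares with \<open>K\<close> additional
  observations equal to zero, whose regressors are the top derivatives scaled by
  \<open>w\<close>.\<close>

lemma normal_eq_solvable: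
  assumes "\<alpha> > 0"
  shows "\<exists>b. normal_eq n K m \<alpha> y b"
proof -
  define e where "e l = (\<lambda>j::nat. if j = l then 1 else 0 :: real)" for l
  define w where "w = sqrt (real n * \<alpha> / real K)"
  have w2: "w * w = real n * \<alpha> / real K" unfolding w_def using assms by (simp add: real_sqrt_mult_self)
  define v where "v l z = (case z of Inl i \<Rightarrow> spline K m (e l) (real i / real n) | Inr k \<Rightarrow> w * top_deriv K m (e l) k)" for l z
  define Y where "Y z = (case z of Inl i \<Rightarrow> y i | Inr (k::nat) \<Rightarrow> 0)" for z
  define I where "I = {1..n} <+> {..<K}"
  obtain a where a: "\<forall>j\<in>{1..K+m}. (\<Sum>z\<in>I. (Y z - (\<Sum>l\<in>{1..K+m}. a l * v l z)) * v j z) = 0"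
    using least_squares_exists[of "{1..K+m}" I Y v] by (auto simp: I_def)
  have vl: "(\<Sum>l=1..K+m. c l * v l (Inl i)) = spline K m c (real i / real n)" for c i
    unfolding spline_basis[of K m c] by (simp add: v_def e_def)
  have vr: "(\<Sum>l=1..K+m. c l * v l (Inr k)) = w * top_deriv K m c k" if "k < K" for c k
    unfolding top_deriv_basis[OF that, of m c] by (simp add: v_def e_def sum_distrib_left algebra_simps)
  have "normal_eq n K m \<alpha> y a"
    unfolding normal_eq_def
  proof
    fix b'
    have "0 = (\<Sum>j=1..K+m. b' j * (\<Sum>z\<in>I. (Y z - (\<Sum>l\<in>{1..K+m}. a l * v l z)) * v j z))"
      using a by simp
    also have "\<dots> = (\<Sum>z\<in>I. (Y z - (\<Sum>l\<in>{1..K+m}. a l * v l z)) * (\<Sum>j=1..K+m. b' j * v j z))"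
      unfolding sum_distrib_left by (subst sum.swap) (simp add: algebra_simps)
    also have "\<dots> = (\<Sum>i=1..n. (y i - spline K m a (real i / real n)) * spline K m b' (real i / real n))
        + (\<Sum>k<K. (0 - w * top_deriv K m a k) * (w * top_deriv K m b' k))"
      unfolding I_def by (simp add: sum.Plus Y_def vl[unfolded One_nat_def] vr[unfolded One_nat_def])
    also have "(\<Sum>k<K. (0 - w * top_deriv K m a k) * (w * top_deriv K m b' k))
       = - (real n * \<alpha> / real K * (\<Sum>k<K. top_deriv K m a k * top_deriv K m b' k))"
      unfolding w2[symmetric] sum_distrib_left sum_negf[symmetric] by (rule sum.cong) (auto simp: algebra_simps)
    finally show "(\<Sum>i=1..n. (y i - spline K m a (real i / real n)) * spline K m b' (real i / real n))
       = real n * \<alpha> / real K * (\<Sum>k<K. top_deriv K m a k * top_deriv K m b' k)" by simp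
  qed
  then show ?thesis by blast
qed

section \<open>The reproducing property\<close>

context green_kernel
begin

text \<open>The \<open>i\<close>-th derivative in \<open>s\<close> of the equivalent kernel \<open>\<beta> \<kappa> 0 (\<beta> \<bar>t - s\<bar>)\<close>.\<close>

definition V :: "real \<Rightarrow> real \<Rightarrow> nat \<Rightarrow> real \<Rightarrow> real" where
  "V \<beta> t i s = \<beta> ^ Suc i * (if s \<le> t then (-1) ^ i * \<kappa> i (\<beta> * (t - s)) else \<kappa> i (\<beta> * (s - t)))"

text \<open>The envelope records where the kernel is concentrated. Its mean over the interval is of
  order \<open>1 / \<beta>\<close>, which recovers a factor lost in pointwise bounds.\<close>

definition env :: "real \<Rightarrow> real \<Rightarrow> real \<Rightarrow> real" where
  "env \<beta> t s = exp (- c * \<beta> * \<bar>s - t\<bar>)"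

lemma C_nonneg: "C \<ge> 0"
  using kappa_bound[of 0 0] by (auto intro: order_trans[OF abs_ge_zero])

lemma env_nonneg: "env \<beta> t s \<ge> 0" by (simp add: env_def)

lemma env_le_1: "\<beta> > 0 \<Longrightarrow> env \<beta> t s \<le> 1"
  using c_pos by (simp add: env_def)

lemma V_bound: "\<beta> > 0 \<Longrightarrow> \<bar>V \<beta> t i s\<bar> \<le> C * \<beta> ^ Suc i * env \<beta> t s"
proof -
  assume \<beta>: "\<beta> > 0"
  have "\<bar>V \<beta> t i s\<bar> = \<beta> ^ Suc i * \<bar>\<kappa> i (\<beta> * \<bar>s - t\<bar>)\<bar>"
    using \<beta> by (auto simp: V_def abs_mult power_abs)
  also have "\<dots> \<le> \<beta> ^ Suc i * (C * exp (- c * (\<beta> * \<bar>s - t\<bar>)))"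
    using \<beta> by (intro mult_left_mono kappa_bound) auto
  finally show ?thesis by (simp add: env_def mult_ac)
qed

text \<open>The branches \<open>VL\<close> and \<open>VR\<close> are smooth on the whole line, so
  integration by parts can be done up to \<open>t\<close> from either side with all one-sided values
  available.\<close>

definition VL :: "real \<Rightarrow> real \<Rightarrow> nat \<Rightarrow> real \<Rightarrow> real" where
  "VL \<beta> t i s = \<beta> ^ Suc i * ((-1) ^ i * \<kappa> i (\<beta> * (t - s)))"

definition VR :: "real \<Rightarrow> real \<Rightarrow> nat \<Rightarrow> real \<Rightarrow> real" where
  "VR \<beta> t i s = \<beta> ^ Suc i * \<kappa> i (\<beta> * (s - t))"

lemma V_eq: "V \<beta> t i s = (if s \<le> t then VL \<beta> t i s else VR \<beta> t i s)"
  by (simp add: V_def VL_def VR_def)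

lemma VL_deriv: "(VL \<beta> t i has_real_derivative VL \<beta> t (Suc i) x) (at x)"
  unfolding VL_def by (rule derivative_eq_intros kappa_deriv[THEN DERIV_chain2] refl)+ (simp add: algebra_simps)

lemma VR_deriv: "(VR \<beta> t i has_real_derivative VR \<beta> t (Suc i) x) (at x)"
  unfolding VR_def by (rule derivative_eq_intros kappa_deriv[THEN DERIV_chain2] refl)+ (simp add: algebra_simps)

lemma VL_continuous: "continuous_on T (VL \<beta> t i)"
  by (meson DERIV_isCont VL_deriv continuous_at_imp_continuous_on)

lemma VR_continuous: "continuous_on T (VR \<beta> t i)"
  by (meson DERIV_isCont VR_deriv continuous_at_imp_continuous_on)

lemma V_deriv:
  assumes "x \<noteq> t"
  shows "(V \<beta> t i has_real_derivative V \<beta> t (Suc i) x) (at x)"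
proof (cases "x < t")
  case True
  have "(V \<beta> t i has_real_derivative VL \<beta> t (Suc i) x) (at x)"
    by (rule has_field_derivative_transform_within_open[OF VL_deriv, of "{..<t}"]) (use True in \<open>auto simp: V_eq\<close>)
  then show ?thesis using True by (simp add: V_eq)
next
  case False
  have "(V \<beta> t i has_real_derivative VR \<beta> t (Suc i) x) (at x)"
    by (rule has_field_derivative_transform_within_open[OF VR_deriv, of "{t<..}"]) (use False assms in \<open>auto simp: V_eq\<close>)
  then show ?thesis using False assms by (simp add: V_eq)
qed

text \<open>At \<open>t\<close> the two branches agree in even orders by symmetry, and in odd orders
  below \<open>2m - 1\<close> because \<kappa> vanishes there at 0. Order \<open>2m - 1\<close>
  jumps.\<close>

lemma V_chain: "deriv_chain (2 * m - 1) {t} (V \<beta> t)"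
  unfolding deriv_chain_def
proof (intro conjI allI impI ballI)
  fix i assume i: "i < 2 * m - 1"
  have "VL \<beta> t i t = VR \<beta> t i t"
    using kappa_odd[of i] i by (cases "even i") (auto simp: VL_def VR_def)
  then show "continuous_on {0..1} (V \<beta> t i)"
    unfolding V_eq[abs_def]
    by (intro continuous_on_cases_le VL_continuous VR_continuous continuous_intros) auto
qed (auto intro: V_deriv)

lemma V_chain_m: "deriv_chain m {t} (V \<beta> t)"
  by (rule deriv_chain_mono[OF V_chain]) (use m_pos in auto)

section \<open>Integrals, sums and oscillation bounds with the exponential envelope\<close>

lemma env_continuous: "continuous_on T (env \<beta> t)"
  unfolding env_def by (intro continuous_intros)

lemma env_integrable: "env \<beta> t integrable_on {a..b}"
  by (intro integrable_continuous_real env_continuous)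

lemma env_integral:
  assumes "\<beta> > 0" "0 \<le> t" "t \<le> 1"
  shows "integral {0..1} (env \<beta> t) \<le> 2 / (c * \<beta>)"
proof -
  let ?r = "c * \<beta>"
  have r: "?r > 0" using c_pos assms by simp
  have "((\<lambda>s. exp (- ?r * (t - s))) has_integral exp (- ?r * (t - t)) / ?r - exp (- ?r * (t - 0)) / ?r) {0..t}"
    using r assms
    by (intro fundamental_theorem_of_calculus) (auto intro!: derivative_eq_intros
        simp: has_real_derivative_iff_has_vector_derivative[symmetric])
  from has_integral_eq[OF _ this, of "env \<beta> t"]
  have L: "(env \<beta> t has_integral 1 / ?r - exp (- ?r * t) / ?r) {0..t}"
    by (simp add: env_def mult.assoc)
  have "((\<lambda>s. exp (- ?r * (s - t))) has_integral (- exp (- ?r * (1 - t)) / ?r) - (- exp (- ?r * (t - t)) / ?r)) {t..1}"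
    using r assms
    by (intro fundamental_theorem_of_calculus) (auto intro!: derivative_eq_intros
        simp: has_real_derivative_iff_has_vector_derivative[symmetric])
  from has_integral_eq[OF _ this, of "env \<beta> t"]
  have R: "(env \<beta> t has_integral 1 / ?r - exp (- ?r * (1 - t)) / ?r) {t..1}"
    by (simp add: env_def mult.assoc)
  have "integral {0..1} (env \<beta> t) = (1 / ?r - exp (- ?r * t) / ?r) + (1 / ?r - exp (- ?r * (1 - t)) / ?r)"
    using integral_unique[OF has_integral_combine[OF assms(2,3) L R]] .
  also have "\<dots> \<le> 1 / ?r + 1 / ?r"
    using r by (intro add_mono) auto
  finally show ?thesis by (simp add: mult.commute)
qed

text \<open>A cell has length at most \<open>1 / \<beta>\<close>, so the exponent changes by at most
  \<open>c\<close> within it.\<close>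

lemma env_compare:
  assumes "\<beta> > 0" "\<beta> \<le> real n" "x \<in> cell n k" "y \<in> cell n k"
  shows "env \<beta> t x \<le> exp c * env \<beta> t y"
proof -
  have n: "real n > 0" using assms by linarith
  have "\<bar>x - y\<bar> \<le> real (Suc k) / real n - real k / real n"
    using assms(3,4) by (auto simp: cell_def)
  also have "\<dots> = 1 / real n" by (simp add: diff_divide_distrib[symmetric])
  finally have "\<beta> * \<bar>x - y\<bar> \<le> real n * (1 / real n)" using assms by (intro mult_mono) auto
  then have "\<beta> * \<bar>x - y\<bar> \<le> 1" using n by simp
  moreover have "\<beta> * \<bar>y - t\<bar> \<le> \<beta> * (\<bar>x - y\<bar> + \<bar>x - t\<bar>)" using assms(1) by (intro mult_left_mono) auto
  ultimately have "c * (\<beta> * \<bar>y - t\<bar>) \<le> c * (1 + \<beta> * \<bar>x - t\<bar>)"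
    using c_pos by (intro mult_left_mono) (auto simp: algebra_simps)
  then show ?thesis unfolding env_def exp_add[symmetric] by (simp add: algebra_simps)
qed

lemma env_sum:
  assumes "\<beta> > 0" "\<beta> \<le> real n" "0 \<le> t" "t \<le> 1"
  shows "(\<Sum>i<n. env \<beta> t (real (Suc i) / real n)) / real n \<le> 2 * exp c / (c * \<beta>)"
proof -
  have n: "n > 0" using assms by (cases n) auto
  have "(\<Sum>i<n. env \<beta> t (real (Suc i) / real n)) / real n \<le> (\<Sum>i<n. exp c * integral (cell n i) (env \<beta> t))"
    unfolding sum_divide_distrib
  proof (rule sum_mono)
    fix i
    have r: "real (Suc i) / real n \<in> cell n i" by (simp add: cell_def divide_right_mono)
    have "integral (cell n i) (\<lambda>_. env \<beta> t (real (Suc i) / real n)) \<le> integral (cell n i) (\<lambda>s. exp c * env \<beta> t s)"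
      using env_compare[OF assms(1,2) r] env_integrable
      by (intro integral_le integrable_on_cmult_left) (auto simp: cell_def)
    moreover have "integral (cell n i) (\<lambda>_. env \<beta> t (real (Suc i) / real n)) = env \<beta> t (real (Suc i) / real n) / real n"
      by (simp add: cell_def diff_divide_distrib[symmetric] divide_right_mono)
    ultimately show "env \<beta> t (real (Suc i) / real n) / real n \<le> exp c * integral (cell n i) (env \<beta> t)" by simp
  qed
  also have "\<dots> = exp c * integral {0..1} (env \<beta> t)"
    using integral_cells[OF n env_integrable] by (simp add: cell_def sum_distrib_left[symmetric])
  also have "\<dots> \<le> exp c * (2 / (c * \<beta>))" by (intro mult_left_mono env_integral assms) auto
  finally show ?thesis by (simp add: mult.commute)
qed

text \<open>The point \<open>z\<close> is left free so that the envelope can be evaluated wherever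
  the following sum needs it.\<close>

lemma V_osc:
  assumes "i < 2 * m - 1" "\<beta> > 0" "\<beta> \<le> real n" "k < n" "x \<in> cell n k" "y \<in> cell n k" "z \<in> cell n k"
  shows "\<bar>V \<beta> t i x - V \<beta> t i y\<bar> \<le> C * exp c * \<beta> ^ (i + 2) / real n * env \<beta> t z"
proof -
  let ?B = "C * \<beta> ^ (i + 2) * (exp c * env \<beta> t z)"
  have B: "?B \<ge> 0" using C_nonneg assms env_nonneg by auto
  have *: "\<bar>V \<beta> t i y - V \<beta> t i x\<bar> \<le> ?B * (1 / real n)"
    if xy: "x \<in> cell n k" "y \<in> cell n k" "x \<le> y" for x y
  proof -
    have i: "(V \<beta> t (Suc i) has_integral V \<beta> t i y - V \<beta> t i x) {x..y}"
      using xy cell_subset[OF assms(4)] by (intro deriv_chain_has_integral[OF V_chain assms(1)]) auto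
    have "\<bar>V \<beta> t i y - V \<beta> t i x\<bar> \<le> ?B * (y - x)"
    proof (rule has_integral_bound_real[OF B finite.emptyI i, unfolded real_norm_def, simplified, THEN order_trans])
      fix s assume "x \<le> s \<and> s \<le> y"
      then have s: "s \<in> cell n k" using xy by (auto simp: cell_def)
      have "\<bar>V \<beta> t (Suc i) s\<bar> \<le> C * \<beta> ^ Suc (Suc i) * env \<beta> t s" by (rule V_bound[OF assms(2)])
      also have "\<dots> \<le> C * \<beta> ^ Suc (Suc i) * (exp c * env \<beta> t z)"
        using C_nonneg assms s by (intro mult_left_mono env_compare[OF assms(2,3)]) auto
      finally show "\<bar>V \<beta> t (Suc i) s\<bar> \<le> C * (\<beta> * (\<beta> * \<beta> ^ i)) * (exp c * env \<beta> t z)" by simp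
    qed (use xy in \<open>simp_all\<close>)
    also have "\<dots> \<le> ?B * (1 / real n)"
    proof (rule mult_left_mono[OF _ B])
      have "y - x \<le> real (Suc k) / real n - real k / real n" using xy by (auto simp: cell_def)
      then show "y - x \<le> 1 / real n" by (simp add: diff_divide_distrib[symmetric])
    qed
    finally show ?thesis .
  qed
  have "\<bar>V \<beta> t i x - V \<beta> t i y\<bar> \<le> ?B * (1 / real n)"
    using *[of x y] *[of y x] assms(5,6) by (cases "x \<le> y") auto
  then show ?thesis by (simp add: mult_ac)
qed

lemma boundary_sum_bound:
  assumes "\<beta> \<ge> 1" "H \<ge> 0" "\<And>j. j < m \<Longrightarrow> \<bar>W (m + j)\<bar> \<le> C * \<beta> ^ Suc (m + j) * E" "\<And>i. i < m \<Longrightarrow> \<bar>h i\<bar> \<le> H" "E \<ge> 0"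
  shows "\<bar>\<Sum>j<m. (-1) ^ j * (W (m + j) * h (m - 1 - j))\<bar> \<le> real m * (C * \<beta> ^ (2 * m) * E * H)"
proof -
  have "\<bar>\<Sum>j<m. (-1) ^ j * (W (m + j) * h (m - 1 - j))\<bar> \<le> (\<Sum>j<m. C * \<beta> ^ (2 * m) * E * H)"
  proof (rule order_trans[OF sum_abs], rule sum_mono)
    fix j assume "j \<in> {..<m}"
    then have j: "j < m" by simp
    have "\<bar>W (m + j)\<bar> \<le> C * \<beta> ^ (2 * m) * E"
    proof (rule order_trans[OF assms(3)[OF j]])
      have "\<beta> ^ Suc (m + j) \<le> \<beta> ^ (2 * m)" using j assms(1) by (intro power_increasing) auto
      then show "C * \<beta> ^ Suc (m + j) * E \<le> C * \<beta> ^ (2 * m) * E"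
        using C_nonneg assms(5) by (intro mult_right_mono mult_left_mono)
    qed
    then have "\<bar>W (m + j)\<bar> * \<bar>h (m - 1 - j)\<bar> \<le> C * \<beta> ^ (2 * m) * E * H"
      using assms j C_nonneg by (intro mult_mono assms) auto
    then show "\<bar>(-1) ^ j * (W (m + j) * h (m - 1 - j))\<bar> \<le> C * \<beta> ^ (2 * m) * E * H"
      by (simp add: abs_mult power_abs)
  qed
  then show ?thesis by simp
qed

text \<open>Up to exponentially small boundary terms, the kernel is the reproducing kernel of the form
  \<open>\<integral> g h + \<alpha> \<integral> g\<^sup>(\<^sup>m\<^sup>) h\<^sup>(\<^sup>m\<^sup>)\<close>.\<close>

lemma representation:
  assumes h: "deriv_chain m S h" and t: "0 < t" "t < 1" and \<beta>: "\<beta> \<ge> 1" and \<alpha>: "\<alpha> * \<beta> ^ (2 * m) = 1"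
    and H: "\<And>i. i < m \<Longrightarrow> \<bar>h i 0\<bar> \<le> H" "\<And>i. i < m \<Longrightarrow> \<bar>h i 1\<bar> \<le> H"
    and \<delta>: "\<delta> \<le> t" "\<delta> \<le> 1 - t"
  shows "\<exists>e. ((\<lambda>s. V \<beta> t 0 s * h 0 s + \<alpha> * (V \<beta> t m s * h m s)) has_integral h 0 t + e) {0..1}
            \<and> \<bar>e\<bar> \<le> 2 * real m * C * H * exp (- c * \<beta> * \<delta>)"
proof -
  define \<Phi> where "\<Phi> W s = (\<Sum>j<m. (-1) ^ j * (W (m + j) s * h (m - 1 - j) s))" for W :: "nat \<Rightarrow> real \<Rightarrow> real" and s
  have b0: "\<beta> > 0" using \<beta> by simp
  have ode: "(-1) ^ m * (\<alpha> * (\<beta> ^ Suc (2 * m) * \<kappa> (2 * m) u)) = - (\<beta> * \<kappa> 0 u)" for u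
  proof -
    have "(-1) ^ m * (\<alpha> * (\<beta> ^ Suc (2 * m) * \<kappa> (2 * m) u)) = (\<alpha> * \<beta> ^ (2 * m)) * (\<beta> * ((-1) ^ m * \<kappa> (2 * m) u))"
      by (simp add: algebra_simps)
    also have "(-1) ^ m * \<kappa> (2 * m) u = - \<kappa> 0 u" using kappa_ode[of u] by linarith
    finally show ?thesis using \<alpha> by simp
  qed
  have fin: "finite S" using h by (simp add: deriv_chain_def)
  \<comment> \<open>The \<open>m\<close> derivatives of \<open>h\<close> are traded for the orders
    \<open>m\<close> to \<open>2m\<close> of the kernel; the differential equation then turns order
    \<open>2m\<close> back into order 0.\<close>
  have "((\<lambda>x. VL \<beta> t (m + 0) x * h m x - (-1) ^ m * (VL \<beta> t (m + m) x * h 0 x)) has_integral \<Phi> (VL \<beta> t) t - \<Phi> (VL \<beta> t) 0) {0..t}"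
    unfolding \<Phi>_def using h t
    by (intro repeated_ibp[of _ _ S m "\<lambda>j. VL \<beta> t (m + j)" h])
      (auto intro!: VL_continuous VL_deriv deriv_chain_continuous[OF h] simp: deriv_chain_def VL_deriv)
  from has_integral_mult_right[OF this, of \<alpha>]
  have L: "((\<lambda>s. V \<beta> t 0 s * h 0 s + \<alpha> * (V \<beta> t m s * h m s)) has_integral \<alpha> * (\<Phi> (VL \<beta> t) t - \<Phi> (VL \<beta> t) 0)) {0..t}"
  proof (rule has_integral_eq[rotated])
    fix x assume "x \<in> {0..t}"
    then have v: "V \<beta> t i x = VL \<beta> t i x" for i by (simp add: V_eq)
    have o: "(-1) ^ m * (\<alpha> * VL \<beta> t (m + m) x) = - VL \<beta> t 0 x"
      using ode[of "\<beta> * (t - x)"] by (simp add: VL_def mult_2)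
    have "\<alpha> * (VL \<beta> t (m + 0) x * h m x - (-1) ^ m * (VL \<beta> t (m + m) x * h 0 x))
        = \<alpha> * (VL \<beta> t m x * h m x) - ((-1) ^ m * (\<alpha> * VL \<beta> t (m + m) x)) * h 0 x"
      by (simp add: algebra_simps)
    then show "\<alpha> * (VL \<beta> t (m + 0) x * h m x - (-1) ^ m * (VL \<beta> t (m + m) x * h 0 x)) = V \<beta> t 0 x * h 0 x + \<alpha> * (V \<beta> t m x * h m x)"
      unfolding v o by simp
  qed
  have "((\<lambda>x. VR \<beta> t (m + 0) x * h m x - (-1) ^ m * (VR \<beta> t (m + m) x * h 0 x)) has_integral \<Phi> (VR \<beta> t) 1 - \<Phi> (VR \<beta> t) t) {t..1}"
    unfolding \<Phi>_def using h t
    by (intro repeated_ibp[of _ _ S m "\<lambda>j. VR \<beta> t (m + j)" h])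
      (auto intro!: VR_continuous VR_deriv deriv_chain_continuous[OF h] simp: deriv_chain_def VR_deriv)
  from has_integral_mult_right[OF this, of \<alpha>]
  have R: "((\<lambda>s. V \<beta> t 0 s * h 0 s + \<alpha> * (V \<beta> t m s * h m s)) has_integral \<alpha> * (\<Phi> (VR \<beta> t) 1 - \<Phi> (VR \<beta> t) t)) {t..1}"
  \<comment> \<open>At \<open>t\<close> itself \<open>V\<close> follows the left branch, so this
    single point is discarded.\<close>
  proof (rule has_integral_spike_finite[of "{t}", rotated 2])
    fix x assume "x \<in> {t..1} - {t}"
    then have v: "V \<beta> t i x = VR \<beta> t i x" for i by (simp add: V_eq)
    have o: "(-1) ^ m * (\<alpha> * VR \<beta> t (m + m) x) = - VR \<beta> t 0 x"
      using ode[of "\<beta> * (x - t)"] by (simp add: VR_def mult_2)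
    have "\<alpha> * (VR \<beta> t (m + 0) x * h m x - (-1) ^ m * (VR \<beta> t (m + m) x * h 0 x))
        = \<alpha> * (VR \<beta> t m x * h m x) - ((-1) ^ m * (\<alpha> * VR \<beta> t (m + m) x)) * h 0 x"
      by (simp add: algebra_simps)
    then show "V \<beta> t 0 x * h 0 x + \<alpha> * (V \<beta> t m x * h m x) = \<alpha> * (VR \<beta> t (m + 0) x * h m x - (-1) ^ m * (VR \<beta> t (m + m) x * h 0 x))"
      unfolding v o by simp
  qed simp
  \<comment> \<open>Of the boundary terms at \<open>t\<close> only the one with the derivative of
    order \<open>2m - 1\<close> differs between the sides. Its jump has size
    \<open>\<beta> ^ (2m)\<close>, which \<alpha> normalises to one.\<close>
  have jump: "\<alpha> * (\<Phi> (VL \<beta> t) t - \<Phi> (VR \<beta> t) t) = h 0 t"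
  proof -
    obtain m' where m': "m = Suc m'" using m_pos by (cases m) auto
    have z: "VL \<beta> t (m + j) t = VR \<beta> t (m + j) t" if "j < m'" for j
      using kappa_odd[of "m + j"] that m' by (cases "even (m + j)") (auto simp: VL_def VR_def)
    have "\<Phi> (VL \<beta> t) t - \<Phi> (VR \<beta> t) t
        = (\<Sum>j<m. (-1) ^ j * ((VL \<beta> t (m + j) t - VR \<beta> t (m + j) t) * h (m - 1 - j) t))"
      unfolding \<Phi>_def sum_subtractf[symmetric] by (simp add: algebra_simps)
    also have "\<dots> = (\<Sum>j<m'. 0) + (-1) ^ m' * ((VL \<beta> t (m + m') t - VR \<beta> t (m + m') t) * h (m - 1 - m') t)"
      unfolding arg_cong[OF m', of lessThan] sum.lessThan_Suc by (simp add: z)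
    also have "\<dots> = (-1) ^ m' * ((VL \<beta> t (m + m') t - VR \<beta> t (m + m') t) * h 0 t)"
      by (simp add: m')
    also have "VL \<beta> t (m + m') t - VR \<beta> t (m + m') t = - (2 * \<beta> ^ (2 * m) * \<kappa> (2 * m - 1) 0)"
    proof -
      have i: "m + m' = 2 * m - 1" "Suc (2 * m - 1) = 2 * m" using m' by auto
      have o: "(-1::real) ^ (2 * m - 1) = -1" using m' by (simp add: minus_one_power_iff)
      show ?thesis unfolding VL_def VR_def i o by simp
    qed
    also have "(-1) ^ m' * (- (2 * \<beta> ^ (2 * m) * \<kappa> (2 * m - 1) 0) * h 0 t) = \<beta> ^ (2 * m) * h 0 t"
    proof -
      have "(-1::real) ^ m = - ((-1) ^ m')" by (simp add: m')
      then show ?thesis unfolding kappa_top by (cases "even m'") auto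
    qed
    finally show ?thesis using \<alpha> by (simp add: mult.assoc[symmetric])
  qed
  define e where "e = \<alpha> * (\<Phi> (VR \<beta> t) 1 - \<Phi> (VL \<beta> t) 0)"
  have "((\<lambda>s. V \<beta> t 0 s * h 0 s + \<alpha> * (V \<beta> t m s * h m s)) has_integral h 0 t + e) {0..1}"
  proof -
    have "\<alpha> * (\<Phi> (VL \<beta> t) t - \<Phi> (VL \<beta> t) 0) + \<alpha> * (\<Phi> (VR \<beta> t) 1 - \<Phi> (VR \<beta> t) t) = h 0 t + e"
      unfolding jump[symmetric] e_def by (simp add: algebra_simps)
    then show ?thesis using has_integral_combine[OF _ _ L R] t by simp
  qed
  moreover have "\<bar>e\<bar> \<le> 2 * real m * C * H * exp (- c * \<beta> * \<delta>)"
  proof -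
    let ?E = "exp (- c * \<beta> * \<delta>)"
    have H0: "H \<ge> 0" using order_trans[OF abs_ge_zero H(1)[of 0]] m_pos by simp
    have env: "env \<beta> t 0 \<le> ?E" "env \<beta> t 1 \<le> ?E"
      unfolding env_def using t \<delta> b0 c_pos by (simp_all add: mult_left_mono)
    have "\<bar>VL \<beta> t i 0\<bar> \<le> C * \<beta> ^ Suc i * ?E" for i
    proof -
      have "\<bar>VL \<beta> t i 0\<bar> \<le> C * \<beta> ^ Suc i * env \<beta> t 0"
        using V_bound[OF b0, of t i 0] t by (simp add: V_eq)
      also have "\<dots> \<le> C * \<beta> ^ Suc i * ?E" using C_nonneg b0 by (intro mult_left_mono env) auto
      finally show ?thesis .
    qed
    then have 1: "\<bar>\<Phi> (VL \<beta> t) 0\<bar> \<le> real m * (C * \<beta> ^ (2 * m) * ?E * H)"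
      unfolding \<Phi>_def using H \<beta> H0 by (intro boundary_sum_bound[where W = "\<lambda>i. VL \<beta> t i 0" and h = "\<lambda>i. h i 0"]) auto
    have "\<bar>VR \<beta> t i 1\<bar> \<le> C * \<beta> ^ Suc i * ?E" for i
    proof -
      have "\<bar>VR \<beta> t i 1\<bar> \<le> C * \<beta> ^ Suc i * env \<beta> t 1"
        using V_bound[OF b0, of t i 1] t by (simp add: V_eq)
      also have "\<dots> \<le> C * \<beta> ^ Suc i * ?E" using C_nonneg b0 by (intro mult_left_mono env) auto
      finally show ?thesis .
    qed
    then have 2: "\<bar>\<Phi> (VR \<beta> t) 1\<bar> \<le> real m * (C * \<beta> ^ (2 * m) * ?E * H)"
      unfolding \<Phi>_def using H \<beta> H0 by (intro boundary_sum_bound[where W = "\<lambda>i. VR \<beta> t i 1" and h = "\<lambda>i. h i 1"]) auto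
    have \<alpha>0: "\<alpha> > 0" using \<alpha> b0 by (metis zero_less_mult_pos2 zero_less_one zero_less_power)
    have "\<bar>e\<bar> \<le> \<alpha> * (2 * (real m * (C * \<beta> ^ (2 * m) * ?E * H)))"
      unfolding e_def abs_mult using 1 2 \<alpha>0 by (intro mult_mono) auto
    also have "\<dots> = (\<alpha> * \<beta> ^ (2 * m)) * (2 * real m * C * H * ?E)" by (simp add: mult_ac)
    finally show ?thesis using \<alpha> by simp
  qed
  ultimately show ?thesis by blast
qed

end

section \<open>Linear approximation of the estimator\<close>

lemma sum_atLeast1: "(\<Sum>i=1..n. f i) = (\<Sum>i<n. f (Suc i))"
  unfolding One_nat_def by (rule sum.atLeast1_atMost_eq)

lemma integral_cell_const: "integral (cell n i) (\<lambda>_. z::real) = z / real n"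
  by (simp add: cell_def diff_divide_distrib[symmetric] divide_right_mono)

lemma sqrt_times_square: "B \<ge> 0 \<Longrightarrow> sqrt (x * B\<^sup>2) = sqrt x * B"
  by (simp add: real_sqrt_mult)

lemma sum_div_cells:
  fixes \<phi> :: "nat \<Rightarrow> real"
  assumes "r > 0"
  shows "(\<Sum>i<K * r. \<phi> (i div r)) = real r * (\<Sum>k<K. \<phi> k)"
proof -
  have "(\<Sum>i<K * r. \<phi> (i div r)) = (\<Sum>k<K. \<Sum>i\<in>{k * r..<k * r + r}. \<phi> (i div r))"
    by (rule sum.nat_group[symmetric])
  also have "\<dots> = (\<Sum>k<K. \<Sum>i\<in>{k * r..<k * r + r}. \<phi> k)"
  proof (intro sum.cong refl)
    fix k i assume "i \<in> {k * r..<k * r + r}"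
    then have "i div r = k" using assms by (intro div_nat_eqI) (auto simp: mult.commute)
    then show "\<phi> (i div r) = \<phi> k" by simp
  qed
  finally show ?thesis by (simp add: sum_distrib_left)
qed

lemma grid_cell_subset:
  assumes "r > 0" "K > 0"
  shows "cell (K * r) i \<subseteq> cell K (i div r)"
proof
  fix x assume x: "x \<in> cell (K * r) i"
  have "real (r * (i div r)) \<le> real i" by (simp only: of_nat_le_iff) simp
  moreover have "real (Suc i) \<le> real (r * Suc (i div r))"
    using dividend_less_times_div[OF assms(1), of i] by (simp only: of_nat_le_iff) simp
  ultimately have "real (r * (i div r)) / real (K * r) \<le> real i / real (K * r)"
    "real (Suc i) / real (K * r) \<le> real (r * Suc (i div r)) / real (K * r)"
    by (intro divide_right_mono; simp)+
  moreover have "real (r * l) / real (K * r) = real l / real K" for l using assms by simp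
  ultimately show "x \<in> cell K (i div r)" using x unfolding cell_def by (metis (no_types, lifting) atLeastAtMost_iff order_trans)
qed

text \<open>The oscillation of order \<open>m - 1\<close> is at most the integral of the absolute
  value of the step function of order \<open>m\<close>.\<close>

lemma spline_osc:
  assumes K: "K > 0" and m: "m \<ge> 1" and x: "x \<in> {0..1}" and y: "y \<in> {0..1}"
  shows "\<bar>spline_deriv_chain K m b (m - 1) x - spline_deriv_chain K m b (m - 1) y\<bar>
       \<le> (\<Sum>k<K. \<bar>top_deriv K m b k\<bar>) / real K"
proof -
  let ?G = "spline_deriv_chain K m b"
  have "((\<lambda>x. \<bar>?G m x\<bar>) has_integral (\<Sum>k<K. \<bar>top_deriv K m b k\<bar> / real K)) {0..1}"
  proof (rule has_integral_cells[OF K])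
    fix k assume k: "k < K"
    have "((\<lambda>x. \<bar>top_deriv K m b k\<bar>) has_integral (real (Suc k) / real K - real k / real K) *\<^sub>R \<bar>top_deriv K m b k\<bar>) {real k / real K..real (Suc k) / real K}"
      using has_integral_const_real[of "\<bar>top_deriv K m b k\<bar>" "real k / real K" "real (Suc k) / real K"]
      by (simp add: divide_right_mono)
    then have "((\<lambda>x. \<bar>top_deriv K m b k\<bar>) has_integral \<bar>top_deriv K m b k\<bar> / real K) {real k / real K..real (Suc k) / real K}"
      by (simp add: diff_divide_distrib[symmetric])
    then show "((\<lambda>x. \<bar>?G m x\<bar>) has_integral \<bar>top_deriv K m b k\<bar> / real K) {real k / real K..real (Suc k) / real K}"
      by (rule has_integral_spike_finite[of "{real k / real K}", rotated 2])
        (use spline_deriv_chain_top[OF K k] in auto)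
  qed
  then have ai: "(\<lambda>x. \<bar>?G m x\<bar>) integrable_on {0..1}" "integral {0..1} (\<lambda>x. \<bar>?G m x\<bar>) = (\<Sum>k<K. \<bar>top_deriv K m b k\<bar>) / real K"
    by (auto simp: has_integral_iff sum_divide_distrib)
  have *: "\<bar>?G (m - 1) y - ?G (m - 1) x\<bar> \<le> (\<Sum>k<K. \<bar>top_deriv K m b k\<bar>) / real K"
    if "0 \<le> x" "x \<le> y" "y \<le> 1" for x y
  proof -
    have i: "(?G m has_integral ?G (m - 1) y - ?G (m - 1) x) {x..y}"
      using deriv_chain_has_integral[OF deriv_chain_spline[OF K, of m b], of "m - 1" x y] that m by simp
    have ax: "(\<lambda>x. \<bar>?G m x\<bar>) integrable_on {x..y}"
      using that by (intro integrable_subinterval_real[OF ai(1)]) auto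
    have "\<bar>integral {x..y} (?G m)\<bar> \<le> integral {x..y} (\<lambda>x. \<bar>?G m x\<bar>)"
      using integral_norm_bound_integral[OF has_integral_integrable[OF i] ax] by simp
    also have "\<dots> \<le> integral {0..1} (\<lambda>x. \<bar>?G m x\<bar>)"
      using that by (intro integral_subset_le ax ai) auto
    finally show ?thesis using ai(2) integral_unique[OF i] by simp
  qed
  show ?thesis using *[of x y] *[of y x] x y by (cases "x \<le> y") auto
qed

lemma sum_abs_le_L2:
  fixes a :: "nat \<Rightarrow> real"
  assumes "(\<Sum>k<K. (a k)\<^sup>2) / real K \<le> B\<^sup>2" "B \<ge> 0" "K > 0"
  shows "(\<Sum>k<K. \<bar>a k\<bar>) / real K \<le> B"
proof -
  have "(\<Sum>k<K. \<bar>a k\<bar>) = (\<Sum>k<K. \<bar>1\<bar> * \<bar>a k\<bar>)" by simp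
  also have "\<dots> \<le> L2_set (\<lambda>_. 1) {..<K} * L2_set a {..<K}" by (rule L2_set_mult_ineq)
  also have "\<dots> = sqrt (real K) * sqrt (\<Sum>k<K. (a k)\<^sup>2)" by (simp add: L2_set_def)
  also have "\<dots> \<le> sqrt (real K) * sqrt (real K * B\<^sup>2)"
    using assms by (intro mult_left_mono real_sqrt_le_mono) (auto simp: field_simps)
  also have "\<dots> = real K * B" using assms by (simp add: real_sqrt_mult)
  finally show ?thesis using assms by (simp add: field_simps)
qed

context green_kernel
begin

text \<open>The constant of \<open>env_sum\<close>: the grid means of the envelope and of its square
  are at most \<open>\<Lambda> / \<beta>\<close>.\<close>

definition \<Lambda> :: real where "\<Lambda> = 2 * exp c / c"

lemma Lambda_pos: "\<Lambda> > 0" using c_pos by (simp add: \<Lambda>_def)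

lemma env_sq_sum:
  assumes "\<beta> > 0" "\<beta> \<le> real n" "0 \<le> t" "t \<le> 1"
  shows "(\<Sum>i<n. (env \<beta> t (real (Suc i) / real n))\<^sup>2) / real n \<le> \<Lambda> / \<beta>"
proof -
  have "(\<Sum>i<n. (env \<beta> t (real (Suc i) / real n))\<^sup>2) / real n \<le> (\<Sum>i<n. env \<beta> t (real (Suc i) / real n)) / real n"
    using env_le_1[OF assms(1)] env_nonneg
    by (intro divide_right_mono sum_mono) (auto simp: power2_eq_square mult_left_le)
  also have "\<dots> \<le> \<Lambda> / \<beta>" using env_sum[OF assms] by (simp add: \<Lambda>_def)
  finally show ?thesis .
qed

text \<open>The Cauchy-Schwarz inequality against the envelope; for data known only in mean square
  this saves the factor \<open>1 / sqrt \<beta>\<close>.\<close>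

lemma env_cs:
  assumes "\<beta> > 0" "\<beta> \<le> real n" "0 \<le> t" "t \<le> 1" "A \<ge> 0" "(\<Sum>i<n. (a i)\<^sup>2) / real n \<le> A\<^sup>2"
  shows "(\<Sum>i<n. env \<beta> t (real (Suc i) / real n) * \<bar>a i\<bar>) / real n \<le> sqrt (\<Lambda> / \<beta>) * A"
proof -
  have n: "real n > 0" using assms by linarith
  let ?e = "\<lambda>i. env \<beta> t (real (Suc i) / real n)"
  have "(\<Sum>i<n. ?e i * \<bar>a i\<bar>) = (\<Sum>i<n. \<bar>?e i\<bar> * \<bar>a i\<bar>)" using env_nonneg by simp
  also have "\<dots> \<le> L2_set ?e {..<n} * L2_set a {..<n}" by (rule L2_set_mult_ineq)
  also have "\<dots> \<le> sqrt (real n * (\<Lambda> / \<beta>)) * sqrt (real n * A\<^sup>2)"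
    unfolding L2_set_def using env_sq_sum[OF assms(1-4)] assms(6) n assms(1) Lambda_pos
    by (intro mult_mono real_sqrt_le_mono) (auto simp: field_simps sum_nonneg)
  also have "\<dots> = (sqrt (real n) * sqrt (real n)) * (sqrt (\<Lambda> / \<beta>) * A)"
    unfolding sqrt_times_square[OF assms(5)] real_sqrt_mult[of "real n"] by (simp only: mult_ac)
  also have "\<dots> = real n * (sqrt (\<Lambda> / \<beta>) * A)" by simp
  finally show ?thesis using n by (simp add: field_simps)
qed

text \<open>On each cell the error splits into the oscillation of \<open>V\<close> times
  \<open>g\<close> and the size of \<open>V\<close> times the oscillation of \<open>g\<close>. Both
  \<open>g\<close> and the oscillation bounds \<open>b\<close> enter only in mean square, since in
  degree one the energy controls no more than that.\<close>

lemma quadrature_first_order: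
  assumes \<beta>: "\<beta> \<ge> 1" "\<beta> \<le> real n" and t: "0 \<le> t" "t \<le> 1"
    and g: "continuous_on {0..1} g"
    and b: "\<And>i x. i < n \<Longrightarrow> x \<in> cell n i \<Longrightarrow> \<bar>g x - g (real (Suc i) / real n)\<bar> \<le> b i"
    and A: "A \<ge> 0" "(\<Sum>i<n. (g (real (Suc i) / real n))\<^sup>2) / real n \<le> A\<^sup>2"
    and B: "B \<ge> 0" "(\<Sum>i<n. (b i)\<^sup>2) / real n \<le> (B / real n)\<^sup>2"
  shows "\<bar>integral {0..1} (\<lambda>s. V \<beta> t 0 s * g s) - (\<Sum>i<n. V \<beta> t 0 (real (Suc i) / real n) * g (real (Suc i) / real n)) / real n\<bar>
      \<le> C * exp c * sqrt \<Lambda> * sqrt \<beta> * (\<beta> * A + B) / real n"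
proof -
  have n: "real n > 0" "n > 0" using \<beta> by auto
  have b0: "\<beta> > 0" using \<beta> by simp
  let ?x = "\<lambda>i. real (Suc i) / real n"
  let ?e = "\<lambda>i. env \<beta> t (?x i)"
  have Vc: "continuous_on {0..1} (V \<beta> t 0)" using V_chain_m m_pos by (auto simp: deriv_chain_def)
  have int: "(\<lambda>s. V \<beta> t 0 s * g s) integrable_on {0..1}"
    using Vc g by (intro integrable_continuous_real continuous_intros)
  have bn: "b i \<ge> 0" if "i < n" for i
    using b[OF that, of "?x i"] by (simp add: cell_def divide_right_mono)
  let ?err = "\<lambda>i. C * exp c * \<beta> ^ 2 / real n * ?e i * \<bar>g (?x i)\<bar> + C * \<beta> * (exp c * ?e i) * b i"
  have cell: "\<bar>integral (cell n i) (\<lambda>s. V \<beta> t 0 s * g s) - V \<beta> t 0 (?x i) * g (?x i) / real n\<bar> \<le> ?err i / real n" if i: "i < n" for i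
  proof -
    have xi: "?x i \<in> cell n i" by (simp add: cell_def divide_right_mono)
    have len: "real (Suc i) / real n - real i / real n = 1 / real n" by (simp add: diff_divide_distrib[symmetric])
    have ic: "(\<lambda>s. V \<beta> t 0 s * g s) integrable_on cell n i"
      using cell_subset[OF i] unfolding cell_def by (intro integrable_subinterval_real[OF int]) (auto simp: cell_def)
    have icc: "(\<lambda>_. z) integrable_on cell n i" for z :: real
      unfolding cell_def by (rule integrable_const_ivl)
    have ik: "integral (cell n i) (\<lambda>s. V \<beta> t 0 (?x i) * g (?x i)) = V \<beta> t 0 (?x i) * g (?x i) / real n"
      by (rule integral_cell_const)
    have "\<bar>integral (cell n i) (\<lambda>s. V \<beta> t 0 s * g s - V \<beta> t 0 (?x i) * g (?x i))\<bar> \<le> ?err i * (real (Suc i) / real n - real i / real n)"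
    proof -
      have pt: "\<bar>V \<beta> t 0 s * g s - V \<beta> t 0 (?x i) * g (?x i)\<bar> \<le> ?err i" if s: "s \<in> cell n i" for s
      proof -
        have "V \<beta> t 0 s * g s - V \<beta> t 0 (?x i) * g (?x i) = (V \<beta> t 0 s - V \<beta> t 0 (?x i)) * g (?x i) + V \<beta> t 0 s * (g s - g (?x i))"
          by (simp add: algebra_simps)
        also have "\<bar>\<dots>\<bar> \<le> \<bar>V \<beta> t 0 s - V \<beta> t 0 (?x i)\<bar> * \<bar>g (?x i)\<bar> + \<bar>V \<beta> t 0 s\<bar> * \<bar>g s - g (?x i)\<bar>"
          unfolding abs_mult[symmetric] by (rule abs_triangle_ineq)
        also have "\<dots> \<le> ?err i"
        proof (intro add_mono mult_mono mult_right_mono b i s)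
          show "\<bar>V \<beta> t 0 s - V \<beta> t 0 (?x i)\<bar> \<le> C * exp c * \<beta>\<^sup>2 / real n * ?e i"
            using V_osc[of 0 \<beta> n i s "?x i" "?x i" t] m_pos b0 \<beta> i s xi by (simp add: power2_eq_square)
          have "\<bar>V \<beta> t 0 s\<bar> \<le> C * \<beta> * env \<beta> t s" using V_bound[OF b0, of t 0 s] by simp
          also have "\<dots> \<le> C * \<beta> * (exp c * ?e i)"
            using C_nonneg b0 \<beta> s xi by (intro mult_left_mono env_compare) auto
          finally show "\<bar>V \<beta> t 0 s\<bar> \<le> C * \<beta> * (exp c * ?e i)" .
        qed (use C_nonneg b0 env_nonneg in auto)
        finally show ?thesis .
      qed
      have "((\<lambda>s. V \<beta> t 0 s * g s - V \<beta> t 0 (?x i) * g (?x i)) has_integral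
          integral (cell n i) (\<lambda>s. V \<beta> t 0 s * g s - V \<beta> t 0 (?x i) * g (?x i))) {real i / real n..?x i}"
        unfolding cell_def[symmetric] by (intro integrable_integral integrable_diff ic icc)
      from has_integral_bound_real[OF _ finite.emptyI this, of "?err i"] pt
      show ?thesis using C_nonneg b0 env_nonneg bn[OF i] by (simp add: cell_def divide_right_mono)
    qed
    then show ?thesis
      unfolding len integral_diff[OF ic icc] ik by simp
  qed
  have eq: "integral {0..1} (\<lambda>s. V \<beta> t 0 s * g s) - (\<Sum>i<n. V \<beta> t 0 (?x i) * g (?x i)) / real n
      = (\<Sum>i<n. integral (cell n i) (\<lambda>s. V \<beta> t 0 s * g s) - V \<beta> t 0 (?x i) * g (?x i) / real n)"
    using integral_cells[OF n(2) int] by (simp add: cell_def sum_subtractf sum_divide_distrib)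
  have "\<bar>integral {0..1} (\<lambda>s. V \<beta> t 0 s * g s) - (\<Sum>i<n. V \<beta> t 0 (?x i) * g (?x i)) / real n\<bar> \<le> (\<Sum>i<n. ?err i / real n)"
    unfolding eq by (rule order_trans[OF sum_abs sum_mono]) (rule cell, simp)
  also have "(\<Sum>i<n. ?err i / real n) = C * exp c * \<beta> * (\<beta> / real n * ((\<Sum>i<n. ?e i * \<bar>g (?x i)\<bar>) / real n) + (\<Sum>i<n. ?e i * \<bar>b i\<bar>) / real n)"
  proof -
    let ?P = "C * exp c * \<beta> * (\<beta> / real n) / real n" and ?Q = "C * exp c * \<beta> / real n"
    have "(\<Sum>i<n. ?err i / real n) = (\<Sum>i<n. ?P * (?e i * \<bar>g (?x i)\<bar>) + ?Q * (?e i * \<bar>b i\<bar>))"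
    proof (rule sum.cong[OF refl])
      fix i assume "i \<in> {..<n}"
      then have "\<bar>b i\<bar> = b i" using bn by simp
      moreover have "(C * exp c * \<beta>\<^sup>2 / N * a * G + C * \<beta> * (exp c * a) * B) / N
          = C * exp c * \<beta> * (\<beta> / N) / N * (a * G) + C * exp c * \<beta> / N * (a * B)" for a G B N :: real
        by (simp add: power2_eq_square add_divide_distrib mult_ac)
      ultimately show "?err i / real n = ?P * (?e i * \<bar>g (?x i)\<bar>) + ?Q * (?e i * \<bar>b i\<bar>)" by (simp only:)
    qed
    also have "\<dots> = ?P * (\<Sum>i<n. ?e i * \<bar>g (?x i)\<bar>) + ?Q * (\<Sum>i<n. ?e i * \<bar>b i\<bar>)"
      by (simp only: sum.distrib sum_distrib_left)
    also have "\<dots> = C * exp c * \<beta> * (\<beta> / real n * ((\<Sum>i<n. ?e i * \<bar>g (?x i)\<bar>) / real n) + (\<Sum>i<n. ?e i * \<bar>b i\<bar>) / real n)"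
      by (simp only: distrib_left times_divide_eq_right times_divide_eq_left)
    finally show ?thesis .
  qed
  also have "\<dots> \<le> C * exp c * \<beta> * (\<beta> / real n * (sqrt (\<Lambda> / \<beta>) * A) + sqrt (\<Lambda> / \<beta>) * (B / real n))"
    using C_nonneg b0 n A B \<beta> t by (intro mult_left_mono add_mono env_cs) auto
  also have "\<dots> = C * exp c * sqrt \<Lambda> * sqrt \<beta> * (\<beta> * A + B) / real n"
  proof -
    have s: "\<beta> * sqrt (\<Lambda> / \<beta>) = sqrt \<Lambda> * sqrt \<beta>"
      using b0 by (simp add: real_sqrt_divide field_simps)
    have "C * exp c * \<beta> * (\<beta> / real n * (sqrt (\<Lambda> / \<beta>) * A) + sqrt (\<Lambda> / \<beta>) * (B / real n))
        = C * exp c * (\<beta> * sqrt (\<Lambda> / \<beta>)) * (\<beta> * A + B) / real n"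
      by (simp add: algebra_simps add_divide_distrib)
    then show ?thesis unfolding s by (simp only: mult.assoc)
  qed
  finally show ?thesis .
qed

text \<open>The two summands serve the two cases of \<open>V_projection\<close>:
  \<open>sqrt \<Lambda>\<close> for \<open>m = 1\<close>, \<Lambda> for larger
  \<open>m\<close>.\<close>

definition D1 :: real where "D1 = C * exp c * (sqrt \<Lambda> + \<Lambda>)"

lemma D1_nonneg: "D1 \<ge> 0" using C_nonneg Lambda_pos by (simp add: D1_def)

text \<open>The spline \<open>q\<close> is the projection of the kernel. For \<open>m = 1\<close>
  the first order error has the shape of the envelope and is summed in mean square; for
  \<open>m \<ge> 2\<close> at least one integration yields a supremum bound. The second order bound
  uses that \<open>V^(m)\<close> is continuous for \<open>m \<ge> 2\<close>, being of order below
  \<open>2m - 1\<close>.\<close>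

lemma V_projection:
  assumes \<beta>: "\<beta> \<ge> 1" "\<beta> \<le> real K" and t: "0 \<le> t" "t \<le> 1"
  obtains q where
    "\<And>k. k < K \<Longrightarrow> top_deriv K m q k = real K * (V \<beta> t (m - 1) (real (Suc k) / real K) - V \<beta> t (m - 1) (real k / real K))"
    "\<And>n. real K \<le> real n \<Longrightarrow> (\<Sum>i<n. (V \<beta> t 0 (real (Suc i) / real n) - spline K m q (real (Suc i) / real n))\<^sup>2) / real n
        \<le> (D1 * sqrt \<beta> * \<beta> ^ m / real K)\<^sup>2"
    "\<And>x. m \<ge> 2 \<Longrightarrow> x \<in> {0..1} \<Longrightarrow> \<bar>V \<beta> t 0 x - spline K m q x\<bar> \<le> C * exp c * \<beta> ^ (m + 2) / (real K)\<^sup>2"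
proof -
  have K: "K > 0" "real K > 0" using \<beta> by auto
  have b0: "\<beta> > 0" using \<beta> by simp
  let ?W = "V \<beta> t (m - 1)"
  obtain q where
    q1: "\<And>k. k < K \<Longrightarrow> top_deriv K m q k = real K * (?W (real (Suc k) / real K) - ?W (real k / real K))" and
    q2: "\<And>\<rho> k x. \<lbrakk>\<forall>k<K. \<forall>x\<in>cell K k. \<forall>y\<in>cell K k. \<bar>?W x - ?W y\<bar> \<le> \<rho> k; k < K; x \<in> cell K k\<rbrakk>
        \<Longrightarrow> \<bar>?W x - spline_deriv_chain K m q (m - 1) x\<bar> \<le> \<rho> k" and
    q3: "\<And>k. k \<le> K \<Longrightarrow> spline_deriv_chain K m q (m - 1) (real k / real K) = ?W (real k / real K)" and
    q4: "\<And>\<rho> x. \<lbrakk>\<forall>k<K. \<forall>x\<in>cell K k. \<bar>?W x - spline_deriv_chain K m q (m - 1) x\<bar> \<le> \<rho> k; m \<ge> 2; x \<in> {0..1}\<rbrakk>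
        \<Longrightarrow> \<bar>V \<beta> t 0 x - spline K m q x\<bar> \<le> (\<Sum>k<K. \<rho> k) / real K"
    using spline_projection[OF K(1) m_pos V_chain_m[of t \<beta>]] by blast
  define C' where "C' = C * exp c * \<beta> ^ (m + 1) / real K"
  have C': "C' \<ge> 0" using C_nonneg b0 by (simp add: C'_def)
  have osc: "\<bar>?W x - ?W y\<bar> \<le> C' * env \<beta> t z" if "k < K" "x \<in> cell K k" "y \<in> cell K k" "z \<in> cell K k" for k x y z
    using V_osc[of "m - 1" \<beta> K k x y z t] that b0 \<beta> m_pos
    by (simp add: C'_def Suc_diff_Suc numeral_2_eq_2)
  have knot: "real k / real K \<in> cell K k" "real (Suc k) / real K \<in> cell K k" for k by (auto simp: cell_def divide_right_mono)
  have pw: "\<bar>?W x - spline_deriv_chain K m q (m - 1) x\<bar> \<le> C' * env \<beta> t z" if k: "k < K" "x \<in> cell K k" "z \<in> cell K k" for k x z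
  proof -
    \<comment> \<open>A family of bounds must be given for all cells: it uses \<open>z\<close> on
      the cell in question and the left knot on the others.\<close>
    have "\<bar>?W x - spline_deriv_chain K m q (m - 1) x\<bar> \<le> (\<lambda>l. C' * env \<beta> t (if l = k then z else real l / real K)) k"
      by (rule q2) (use osc k knot in auto)
    then show ?thesis by simp
  qed
  show ?thesis
  proof (rule that[OF q1])
    fix n :: nat assume n: "real K \<le> real n"
    then have bn: "\<beta> \<le> real n" "real n > 0" using \<beta> K by linarith+
    let ?x = "\<lambda>i. real (Suc i) / real n"
    have x01: "?x i \<in> {0..1}" if "i < n" for i using that by auto
    let ?S = "(\<Sum>i<n. (V \<beta> t 0 (?x i) - spline K m q (?x i))\<^sup>2) / real n"
    have sb: "sqrt \<beta> \<ge> 1" using \<beta> by simp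
    show "?S \<le> (D1 * sqrt \<beta> * \<beta> ^ m / real K)\<^sup>2"
    proof (cases "m = 1")
      case True
      have "\<bar>V \<beta> t 0 (?x i) - spline K m q (?x i)\<bar> \<le> C' * env \<beta> t (?x i)" if i: "i < n" for i
      proof -
        obtain k where "k < K" "?x i \<in> cell K k" using ex_cell[OF K(1) x01[OF i]] by blast
        from pw[OF this this(2)] show ?thesis using True by (simp add: spline_deriv_chain_0)
      qed
      then have "?S \<le> (\<Sum>i<n. (C' * env \<beta> t (?x i))\<^sup>2) / real n"
        using C' env_nonneg by (intro divide_right_mono sum_mono) (auto simp: abs_le_square_iff[symmetric])
      also have "\<dots> = C'\<^sup>2 * ((\<Sum>i<n. (env \<beta> t (?x i))\<^sup>2) / real n)"
        by (simp add: power_mult_distrib sum_distrib_left)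
      also have "\<dots> \<le> C'\<^sup>2 * (\<Lambda> / \<beta>)" by (intro mult_left_mono env_sq_sum b0 bn t) auto
      also have "\<dots> = (C' * sqrt (\<Lambda> / \<beta>))\<^sup>2" using Lambda_pos b0 by (simp add: power_mult_distrib)
      also have "C' * sqrt (\<Lambda> / \<beta>) = C * exp c * sqrt \<Lambda> * sqrt \<beta> * \<beta> ^ m / real K"
      proof -
        have "\<beta> * sqrt (\<Lambda> / \<beta>) = sqrt \<Lambda> * sqrt \<beta>" using b0 by (simp add: real_sqrt_divide field_simps)
        moreover have "C' * sqrt (\<Lambda> / \<beta>) = C * exp c * \<beta> ^ m / real K * (\<beta> * sqrt (\<Lambda> / \<beta>))" by (simp add: C'_def)
        ultimately show ?thesis by simp
      qed
      also have "(\<dots>)\<^sup>2 \<le> (D1 * sqrt \<beta> * \<beta> ^ m / real K)\<^sup>2"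
        using C_nonneg Lambda_pos b0 K unfolding D1_def
        by (intro power_mono divide_right_mono mult_right_mono mult_left_mono) auto
      finally show ?thesis .
    next
      case False
      then have m2: "m \<ge> 2" using m_pos by auto
      have "\<bar>V \<beta> t 0 (?x i) - spline K m q (?x i)\<bar> \<le> D1 * sqrt \<beta> * \<beta> ^ m / real K" if i: "i < n" for i
      proof -
        have "\<bar>V \<beta> t 0 (?x i) - spline K m q (?x i)\<bar> \<le> (\<Sum>k<K. C' * env \<beta> t (real (Suc k) / real K)) / real K"
          by (rule q4) (use pw knot m2 x01[OF i] in auto)
        also have "\<dots> = C' * ((\<Sum>k<K. env \<beta> t (real (Suc k) / real K)) / real K)" by (simp add: sum_distrib_left)
        also have "\<dots> \<le> C' * (\<Lambda> / \<beta>)" using env_sum[OF b0 \<beta>(2) t] C' by (intro mult_left_mono) (auto simp: \<Lambda>_def)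
        also have "\<dots> = C * exp c * \<Lambda> * 1 * \<beta> ^ m / real K" using b0 by (simp add: C'_def)
        also have "\<dots> \<le> D1 * sqrt \<beta> * \<beta> ^ m / real K"
          unfolding D1_def using C_nonneg Lambda_pos b0 K sb
          by (intro divide_right_mono mult_right_mono mult_mono mult_left_mono) auto
        finally show ?thesis .
      qed
      then have "?S \<le> (\<Sum>i<n. (D1 * sqrt \<beta> * \<beta> ^ m / real K)\<^sup>2) / real n"
        using D1_nonneg b0 by (intro divide_right_mono sum_mono) (auto simp: abs_le_square_iff[symmetric])
      then show ?thesis using bn by simp
    qed
  next
    fix x :: real assume m2: "m \<ge> 2" and x: "x \<in> {0..1}"
    have ch: "deriv_chain (m + 1) {t} (V \<beta> t)" by (rule deriv_chain_mono[OF V_chain]) (use m2 in auto)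
    have s: "Suc (m - 1) = m" using m2 by simp
    let ?B = "C * exp c * \<beta> ^ (m + 2) / (real K)\<^sup>2"
    have B0: "?B \<ge> 0" using C_nonneg b0 by simp
    have "\<bar>?W y - spline_deriv_chain K m q (m - 1) y\<bar> \<le> ?B" if k: "k < K" "y \<in> cell K k" for k y
    proof (cases "y = real k / real K")
      case True
      then show ?thesis using q3[of k] k B0 by simp
    next
      case False
      let ?a = "real k / real K" and ?b = "real (Suc k) / real K"
      have y: "?a < y" "y \<le> ?b" "0 \<le> ?a" "?b \<le> 1" using False k cell_subset[OF k(1)] knot(2)[of k] by (auto simp: cell_def)
      have ab: "?a < ?b" using y by linarith
      obtain z1 where z1: "?a < z1" "z1 < y" "?W y - ?W ?a = (y - ?a) * V \<beta> t m z1"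
        using deriv_chain_mvt[OF ch, of "m - 1" ?a y] y unfolding s by auto
      obtain z2 where z2: "?a < z2" "z2 < ?b" "?W ?b - ?W ?a = (?b - ?a) * V \<beta> t m z2"
        using deriv_chain_mvt[OF ch, of "m - 1" ?a ?b] y ab unfolding s by auto
      have len: "?b - ?a = 1 / real K" by (simp add: diff_divide_distrib[symmetric])
      \<comment> \<open>Both slopes are mean values of \<open>V^(m)\<close> inside the same cell;
        their difference supplies the second factor \<open>1 / K\<close>.\<close>
      have "top_deriv K m q k = V \<beta> t m z2" using q1[OF k(1)] z2(3) K unfolding len by simp
      then have "?W y - spline_deriv_chain K m q (m - 1) y = (y - ?a) * (V \<beta> t m z1 - V \<beta> t m z2)"
        using spline_deriv_chain_linear[OF K(1) m_pos k, of q] q3[of k] k z1(3) by (simp add: algebra_simps)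
      then have "\<bar>?W y - spline_deriv_chain K m q (m - 1) y\<bar> = (y - ?a) * \<bar>V \<beta> t m z1 - V \<beta> t m z2\<bar>"
        using y by (simp add: abs_mult)
      also have "\<dots> \<le> (1 / real K) * (C * exp c * \<beta> ^ (m + 2) / real K * env \<beta> t z1)"
        using y len z1 z2 b0 \<beta> k m2 by (intro mult_mono V_osc) (auto simp: cell_def)
      also have "\<dots> \<le> (1 / real K) * (C * exp c * \<beta> ^ (m + 2) / real K * 1)"
        using C_nonneg b0 env_le_1[OF b0] by (intro mult_left_mono) auto
      finally show ?thesis by (simp add: power2_eq_square)
    qed
    then have "\<bar>V \<beta> t 0 x - spline K m q x\<bar> \<le> (\<Sum>k<K. ?B) / real K"
      by (intro q4 m2 x) auto
    then show "\<bar>V \<beta> t 0 x - spline K m q x\<bar> \<le> ?B" using K by simp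
  qed
qed

text \<open>\<open>representation\<close> is applied to the estimate itself; the normal equations
  tested with \<open>q\<close> replace its exact penalty integral by data. Quadrature and the
  passage from \<open>V\<close> to its spline give the first error term, the boundary the second.
  The energy inequality measures everything by the empirical norm \<open>Y\<close> of the data, so
  arbitrary data are allowed.\<close>

lemma estimator_close:
  assumes t: "0 < t" "t < 1" "\<delta> \<le> t" "\<delta> \<le> 1 - t"
  shows "\<exists>D n0. D \<ge> 0 \<and> (\<forall>n K \<beta> \<alpha> y b Y q. n0 \<le> n \<longrightarrow> n > 0 \<longrightarrow> K dvd n \<longrightarrow> 1 \<le> \<beta> \<longrightarrow> \<beta> \<le> real K \<longrightarrow> \<alpha> * \<beta> ^ (2 * m) = 1
      \<longrightarrow> normal_eq n K m \<alpha> y b \<longrightarrow> 0 \<le> Y \<longrightarrow> (\<Sum>i<n. (y (Suc i))\<^sup>2) / real n \<le> Y\<^sup>2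
      \<longrightarrow> (\<forall>k<K. top_deriv K m q k = real K * (V \<beta> t (m - 1) (real (Suc k) / real K) - V \<beta> t (m - 1) (real k / real K)))
      \<longrightarrow> (\<Sum>i<n. (V \<beta> t 0 (real (Suc i) / real n) - spline K m q (real (Suc i) / real n))\<^sup>2) / real n
        \<le> (D1 * sqrt \<beta> * \<beta> ^ m / real K)\<^sup>2
      \<longrightarrow> \<bar>spline K m b t - (\<Sum>i<n. y (Suc i) * spline K m q (real (Suc i) / real n)) / real n\<bar>
         \<le> D * (sqrt \<beta> * \<beta> ^ m / real K + \<beta> ^ m * exp (- c * \<beta> * \<delta>)) * Y)"
proof -
  obtain Ds n0 where Ds: "Ds \<ge> 1" and sob: "\<And>n F S A I i x. n0 \<le> n \<Longrightarrow> deriv_chain m S F \<Longrightarrow> A \<ge> 0 \<Longrightarrow> I \<ge> 0 \<Longrightarrow>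
     (\<Sum>i=1..n. (F 0 (real i / real n))\<^sup>2) \<le> real n * A\<^sup>2 \<Longrightarrow>
     (\<forall>x\<in>{0..1}. \<forall>y\<in>{0..1}. \<bar>F (m - 1) x - F (m - 1) y\<bar> \<le> I) \<Longrightarrow> i < m \<Longrightarrow> x \<in> {0..1} \<Longrightarrow> \<bar>F i x\<bar> \<le> Ds * (A + I)"
    using grid_sobolev[of m] by blast
  define E1 where "E1 = C * exp c * sqrt \<Lambda> * (1 + 2 * Ds)"
  define E2 where "E2 = 2 * real m * C * (2 * Ds)"
  define D where "D = E1 + D1 + E2"
  have E: "E1 \<ge> 0" "E2 \<ge> 0" using C_nonneg Lambda_pos Ds by (auto simp: E1_def E2_def)
  have D0: "D \<ge> 0" using E D1_nonneg by (simp add: D_def)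
  show ?thesis
  proof (intro exI[of _ D] exI[of _ n0] conjI D0 allI impI)
    fix n K :: nat and \<beta> \<alpha> Y :: real and y b q
    assume n: "n0 \<le> n" "n > 0" and dvd: "K dvd n" and \<beta>: "1 \<le> \<beta>" "\<beta> \<le> real K" and \<alpha>: "\<alpha> * \<beta> ^ (2 * m) = 1"
      and ne: "normal_eq n K m \<alpha> y b" and Y: "0 \<le> Y" "(\<Sum>i<n. (y (Suc i))\<^sup>2) / real n \<le> Y\<^sup>2"
      and q: "\<forall>k<K. top_deriv K m q k = real K * (V \<beta> t (m - 1) (real (Suc k) / real K) - V \<beta> t (m - 1) (real k / real K))"
      and Q: "(\<Sum>i<n. (V \<beta> t 0 (real (Suc i) / real n) - spline K m q (real (Suc i) / real n))\<^sup>2) / real n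
        \<le> (D1 * sqrt \<beta> * \<beta> ^ m / real K)\<^sup>2"
    have K: "K > 0" "real K > 0" using \<beta> by auto
    have b0: "\<beta> > 0" using \<beta> by simp
    have Kn: "real K \<le> real n" using dvd_imp_le[OF dvd n(2)] by simp
    have \<beta>n: "\<beta> \<le> real n" using Kn \<beta> by simp
    have rn: "real n > 0" using n by simp
    have \<alpha>0: "\<alpha> > 0" using \<alpha> b0 by (metis zero_less_mult_pos2 zero_less_one zero_less_power)
    have bm1: "\<beta> ^ m \<ge> 1" using \<beta> by simp
    have b_le: "\<beta> \<le> \<beta> ^ m" using \<beta> m_pos power_increasing[of 1 m \<beta>] by simp
    let ?x = "\<lambda>i. real (Suc i) / real n"
    let ?G = "spline_deriv_chain K m b"
    let ?\<gamma> = "top_deriv K m b"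
    have chain: "deriv_chain m ((\<lambda>j. real j / real K) ` {..K}) ?G" by (rule deriv_chain_spline[OF K(1)])
    have g1: "(\<Sum>i<n. (spline K m b (?x i))\<^sup>2) \<le> (\<Sum>i<n. (y (Suc i))\<^sup>2)"
      using normal_eq_energy(1)[OF ne \<alpha>0] unfolding sum_atLeast1 .
    also have "\<dots> \<le> real n * Y\<^sup>2" using Y(2) rn by (simp add: field_simps)
    finally have gA: "(\<Sum>i<n. (spline K m b (?x i))\<^sup>2) \<le> real n * Y\<^sup>2" .
    \<comment> \<open>The energy inequality bounds \<alpha> times the squared norm of the
      \<open>m\<close>-th derivative; \<open>\<alpha> * \<beta> ^ (2m) = 1\<close> turns this into a
      factor \<open>\<beta> ^ m\<close>.\<close>
    have \<gamma>: "(\<Sum>k<K. (?\<gamma> k)\<^sup>2) / real K \<le> (\<beta> ^ m * Y)\<^sup>2"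
    proof -
      have "real n * \<alpha> / real K * (\<Sum>k<K. (?\<gamma> k)\<^sup>2) \<le> real n * Y\<^sup>2"
        using normal_eq_energy(2)[OF ne \<alpha>0] Y(2) rn unfolding sum_atLeast1 by (simp add: field_simps)
      then have "real n * (\<alpha> * ((\<Sum>k<K. (?\<gamma> k)\<^sup>2) / real K)) \<le> real n * Y\<^sup>2" by (simp add: mult_ac)
      then have "\<alpha> * ((\<Sum>k<K. (?\<gamma> k)\<^sup>2) / real K) \<le> Y\<^sup>2" using rn mult_le_cancel_left_pos by blast
      then have "(\<alpha> * \<beta> ^ (2 * m)) * ((\<Sum>k<K. (?\<gamma> k)\<^sup>2) / real K) \<le> \<beta> ^ (2 * m) * Y\<^sup>2"
        using mult_left_mono[of "\<alpha> * ((\<Sum>k<K. (?\<gamma> k)\<^sup>2) / real K)" "Y\<^sup>2" "\<beta> ^ (2 * m)"] b0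
        by (simp add: mult_ac)
      then show ?thesis using \<alpha> by (simp add: power_mult_distrib power_mult mult.commute[of 2 m])
    qed
    have bY: "\<beta> ^ m * Y \<ge> 0" using b0 Y by simp
    have I: "(\<Sum>k<K. \<bar>?\<gamma> k\<bar>) / real K \<le> \<beta> ^ m * Y" by (rule sum_abs_le_L2[OF \<gamma> bY K(1)])
    \<comment> \<open>The bound of the discrete Sobolev inequality: \<open>Y\<close> for the values
      and \<open>\<beta> ^ m * Y\<close> for the oscillation of order \<open>m - 1\<close>, the
      former being absorbed by the latter.\<close>
    define H where "H = 2 * Ds * (\<beta> ^ m * Y)"
    have YH: "Y \<le> \<beta> ^ m * Y" using bm1 Y by (simp add: mult_le_cancel_right1)
    have sup: "\<bar>?G i x\<bar> \<le> H" if "i < m" "x \<in> {0..1}" for i x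
    proof -
      have "\<bar>?G i x\<bar> \<le> Ds * (Y + \<beta> ^ m * Y)"
      proof (rule sob[OF n(1) chain Y(1) bY _ _ that])
        show "\<forall>x\<in>{0..1}. \<forall>y\<in>{0..1}. \<bar>?G (m - 1) x - ?G (m - 1) y\<bar> \<le> \<beta> ^ m * Y"
          using spline_osc[OF K(1) m_pos] I by (meson order_trans)
      qed (use gA in \<open>simp add: sum_atLeast1[unfolded One_nat_def] spline_deriv_chain_0\<close>)
      also have "\<dots> \<le> Ds * (\<beta> ^ m * Y + \<beta> ^ m * Y)" using Ds YH by (intro mult_left_mono add_right_mono) auto
      finally show ?thesis by (simp add: H_def mult_ac)
    qed
    have H0: "H \<ge> 0" unfolding H_def using Ds bY by simp
    obtain e where e: "((\<lambda>s. V \<beta> t 0 s * ?G 0 s + \<alpha> * (V \<beta> t m s * ?G m s)) has_integral ?G 0 t + e) {0..1}"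
       "\<bar>e\<bar> \<le> 2 * real m * C * H * exp (- c * \<beta> * \<delta>)"
      using representation[OF chain t(1,2) \<beta>(1) \<alpha>, of H \<delta>] sup t by auto
    have pen: "((\<lambda>s. V \<beta> t m s * ?G m s) has_integral
        (\<Sum>k<K. (V \<beta> t (m - 1) (real (Suc k) / real K) - V \<beta> t (m - 1) (real k / real K)) * ?\<gamma> k)) {0..1}"
      by (rule has_integral_chain_times_top[OF K(1) m_pos V_chain_m])
    define P where "P = (\<Sum>k<K. (V \<beta> t (m - 1) (real (Suc k) / real K) - V \<beta> t (m - 1) (real k / real K)) * ?\<gamma> k)"
    have "(\<Sum>i<n. (y (Suc i) - spline K m b (?x i)) * spline K m q (?x i)) = real n * \<alpha> / real K * (\<Sum>k<K. ?\<gamma> k * top_deriv K m q k)"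
      using ne unfolding normal_eq_def sum_atLeast1 by blast
    also have "(\<Sum>k<K. ?\<gamma> k * top_deriv K m q k) = real K * P"
      unfolding P_def sum_distrib_left using q by (intro sum.cong) auto
    finally have P: "\<alpha> * P = (\<Sum>i<n. (y (Suc i) - spline K m b (?x i)) * spline K m q (?x i)) / real n"
      using rn K by simp
    have iVG: "((\<lambda>s. V \<beta> t 0 s * ?G 0 s) has_integral ?G 0 t + e - \<alpha> * P) {0..1}"
      using has_integral_diff[OF e(1) has_integral_mult_right[OF pen[folded P_def], of \<alpha>]] by simp
    \<comment> \<open>For \<open>m = 1\<close> the slope is known only through its mean square, so
      it is kept per knot cell; \<open>i div (n div K)\<close> is the knot cell containing grid cell
      \<open>i\<close>. For \<open>m \<ge> 2\<close> the first derivative is bounded by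
      \<open>H\<close>.\<close>
    define b' where "b' i = (if m = 1 then \<bar>?\<gamma> (i div (n div K))\<bar> / real n else H / real n)" for i
    have r: "n = K * (n div K)" "n div K > 0" using dvd n K by (auto simp: div_greater_zero_iff dvd_imp_le)
    have b'1: "\<bar>?G 0 x - ?G 0 (?x i)\<bar> \<le> b' i" if i: "i < n" and x: "x \<in> cell n i" for i x
    proof (cases "m = 1")
      case True
      let ?k = "i div (n div K)"
      have k: "?k < K" using i r by (metis less_mult_imp_div_less)
      have sub: "cell n i \<subseteq> cell K ?k" using grid_cell_subset[OF r(2) K(1), of i] r(1) by simp
      have xi: "?x i \<in> cell n i" by (simp add: cell_def divide_right_mono)
      have "?G 0 x - ?G 0 (?x i) = (x - ?x i) * ?\<gamma> ?k"
      proof -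
        have lin: "?G 0 z = ?G 0 (real ?k / real K) + (z - real ?k / real K) * ?\<gamma> ?k" if "z \<in> cell n i" for z
          using spline_deriv_chain_linear[OF K(1) m_pos k, of z b] that sub True by auto
        show ?thesis unfolding lin[OF x] lin[OF xi] by (simp add: left_diff_distrib)
      qed
      moreover have "\<bar>x - ?x i\<bar> \<le> 1 / real n"
      proof -
        have "\<bar>x - ?x i\<bar> \<le> real (Suc i) / real n - real i / real n" using x by (auto simp: cell_def)
        then show ?thesis by (simp add: diff_divide_distrib[symmetric])
      qed
      ultimately show ?thesis using True by (simp add: b'_def abs_mult) (metis abs_ge_zero mult_right_mono mult_1 times_divide_eq_left)
    next
      case False
      then have m2: "Suc 0 < m" using m_pos by auto
      have *: "\<bar>?G 0 x - ?G 0 z\<bar> \<le> H / real n" if xz0: "x \<in> cell n i" "z \<in> cell n i" "x < z" for x z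
      proof -
        have xz: "0 \<le> x" "z \<le> 1" using xz0 cell_subset[OF i] by auto
        obtain \<xi> where \<xi>: "x < \<xi>" "\<xi> < z" "?G 0 z - ?G 0 x = (z - x) * ?G (Suc 0) \<xi>"
          using deriv_chain_mvt[OF chain m2 xz(1) xz0(3) xz(2)] by blast
        have "z - x \<le> real (Suc i) / real n - real i / real n" using xz0 by (auto simp: cell_def)
        then have "z - x \<le> 1 / real n" by (simp add: diff_divide_distrib[symmetric])
        moreover have "\<bar>?G (Suc 0) \<xi>\<bar> \<le> H" using m2 \<xi> xz by (intro sup) auto
        ultimately have "\<bar>(z - x) * ?G (Suc 0) \<xi>\<bar> \<le> 1 / real n * H"
          unfolding abs_mult using xz0 by (intro mult_mono) auto
        then show ?thesis using \<xi>(3) by simp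
      qed
      have xi: "?x i \<in> cell n i" by (simp add: cell_def divide_right_mono)
      show ?thesis using *[OF x xi] False H0 x by (cases "x = ?x i") (auto simp: b'_def cell_def)
    qed
    have b'2: "(\<Sum>i<n. (b' i)\<^sup>2) / real n \<le> (H / real n)\<^sup>2"
    proof (cases "m = 1")
      case True
      have "(\<Sum>i<n. (b' i)\<^sup>2) = (\<Sum>i<n. (?\<gamma> (i div (n div K)))\<^sup>2) / (real n)\<^sup>2"
        using True by (simp add: b'_def power_divide sum_divide_distrib)
      also have "(\<Sum>i<n. (?\<gamma> (i div (n div K)))\<^sup>2) = real (n div K) * (\<Sum>k<K. (?\<gamma> k)\<^sup>2)"
        using sum_div_cells[OF r(2), of "\<lambda>k. (?\<gamma> k)\<^sup>2" K] r(1) by simp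
      also have "real (n div K) = real n / real K" using dvd by (simp add: real_of_nat_div)
      finally have "(\<Sum>i<n. (b' i)\<^sup>2) / real n = ((\<Sum>k<K. (?\<gamma> k)\<^sup>2) / real K) / (real n)\<^sup>2"
        using rn by (simp add: field_simps)
      also have "\<dots> \<le> (\<beta> ^ m * Y)\<^sup>2 / (real n)\<^sup>2" by (intro divide_right_mono \<gamma>) auto
      also have "\<dots> = (\<beta> ^ m * Y / real n)\<^sup>2" by (simp add: power_divide)
      also have "\<dots> \<le> (H / real n)\<^sup>2"
      proof -
        have "1 * (\<beta> ^ m * Y) \<le> H" unfolding H_def using Ds bY by (intro mult_right_mono) auto
        then show ?thesis using bY by (intro power_mono divide_right_mono) auto
      qed
      finally show ?thesis .
    next
      case False
      then show ?thesis using rn by (simp add: b'_def)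
    qed
    have quad: "\<bar>integral {0..1} (\<lambda>s. V \<beta> t 0 s * ?G 0 s) - (\<Sum>i<n. V \<beta> t 0 (?x i) * ?G 0 (?x i)) / real n\<bar>
       \<le> C * exp c * sqrt \<Lambda> * sqrt \<beta> * (\<beta> * Y + H) / real n"
    proof (rule quadrature_first_order[where b = b'])
      show "continuous_on {0..1} (?G 0)" using chain m_pos by (auto simp: deriv_chain_def)
      show "(\<Sum>i<n. (?G 0 (?x i))\<^sup>2) / real n \<le> Y\<^sup>2" using gA rn by (simp add: spline_deriv_chain_0 field_simps)
    qed (use \<beta> \<beta>n t Y H0 b'1 b'2 in auto)
    have R: "\<bar>(\<Sum>i<n. ?G 0 (?x i) * (V \<beta> t 0 (?x i) - spline K m q (?x i))) / real n\<bar> \<le> Y * (D1 * sqrt \<beta> * \<beta> ^ m / real K)"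
    proof -
      have "\<bar>\<Sum>i<n. ?G 0 (?x i) * (V \<beta> t 0 (?x i) - spline K m q (?x i))\<bar> \<le> (\<Sum>i<n. \<bar>?G 0 (?x i)\<bar> * \<bar>V \<beta> t 0 (?x i) - spline K m q (?x i)\<bar>)"
        unfolding abs_mult[symmetric] by (rule sum_abs)
      also have "\<dots> \<le> L2_set (\<lambda>i. ?G 0 (?x i)) {..<n} * L2_set (\<lambda>i. V \<beta> t 0 (?x i) - spline K m q (?x i)) {..<n}"
        by (rule L2_set_mult_ineq)
      also have "\<dots> \<le> sqrt (real n * Y\<^sup>2) * sqrt (real n * (D1 * sqrt \<beta> * \<beta> ^ m / real K)\<^sup>2)"
        unfolding L2_set_def using gA Q rn
        by (intro mult_mono real_sqrt_le_mono) (auto simp: spline_deriv_chain_0 pos_divide_le_eq mult.commute sum_nonneg)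
      also have "\<dots> = (sqrt (real n) * sqrt (real n)) * (Y * (D1 * sqrt \<beta> * \<beta> ^ m / real K))"
        using Y(1) D1_nonneg b0 K by (subst (1 2) sqrt_times_square) (auto simp only: mult_ac intro!: divide_nonneg_pos mult_nonneg_nonneg real_sqrt_ge_zero zero_le_power)
      also have "\<dots> = real n * (Y * (D1 * sqrt \<beta> * \<beta> ^ m / real K))" by simp
      finally show ?thesis using rn by (simp add: pos_divide_le_eq mult.commute)
    qed
    have eq: "spline K m b t - (\<Sum>i<n. y (Suc i) * spline K m q (?x i)) / real n
       = (integral {0..1} (\<lambda>s. V \<beta> t 0 s * ?G 0 s) - (\<Sum>i<n. V \<beta> t 0 (?x i) * ?G 0 (?x i)) / real n)
        + (\<Sum>i<n. ?G 0 (?x i) * (V \<beta> t 0 (?x i) - spline K m q (?x i))) / real n - e"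
      unfolding integral_unique[OF iVG] P
      by (simp add: spline_deriv_chain_0 algebra_simps sum_subtractf diff_divide_distrib)
    have q1: "C * exp c * sqrt \<Lambda> * sqrt \<beta> * (\<beta> * Y + H) / real n \<le> E1 * (sqrt \<beta> * \<beta> ^ m / real K * Y)"
    proof -
      have "\<beta> * Y + H \<le> (1 + 2 * Ds) * (\<beta> ^ m * Y)"
        unfolding H_def using b_le Y by (simp add: algebra_simps mult_left_mono)
      then have "C * exp c * sqrt \<Lambda> * sqrt \<beta> * (\<beta> * Y + H) / real n
          \<le> C * exp c * sqrt \<Lambda> * sqrt \<beta> * ((1 + 2 * Ds) * (\<beta> ^ m * Y)) / real K"
        using C_nonneg Lambda_pos b0 Kn K H0 Y Ds bY by (intro frac_le mult_left_mono mult_nonneg_nonneg) auto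
      then show ?thesis by (simp add: E1_def mult_ac)
    qed
    have q2: "2 * real m * C * H * exp (- c * \<beta> * \<delta>) = E2 * (\<beta> ^ m * exp (- c * \<beta> * \<delta>) * Y)"
      by (simp add: E2_def H_def mult_ac)
    have "\<bar>spline K m b t - (\<Sum>i<n. y (Suc i) * spline K m q (?x i)) / real n\<bar>
       \<le> E1 * (sqrt \<beta> * \<beta> ^ m / real K * Y) + D1 * (sqrt \<beta> * \<beta> ^ m / real K * Y) + E2 * (\<beta> ^ m * exp (- c * \<beta> * \<delta>) * Y)"
    proof -
      have "Y * (D1 * sqrt \<beta> * \<beta> ^ m / real K) = D1 * (sqrt \<beta> * \<beta> ^ m / real K * Y)" by simp
      then show ?thesis unfolding eq using quad R e(2) q1 q2 by linarith
    qed
    also have "\<dots> \<le> D * (sqrt \<beta> * \<beta> ^ m / real K * Y) + D * (\<beta> ^ m * exp (- c * \<beta> * \<delta>) * Y)"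
    proof -
      have "E2 * (\<beta> ^ m * exp (- c * \<beta> * \<delta>) * Y) \<le> D * (\<beta> ^ m * exp (- c * \<beta> * \<delta>) * Y)"
        using E D1_nonneg b0 Y by (intro mult_right_mono) (auto simp: D_def)
      moreover have "(E1 + D1) * (sqrt \<beta> * \<beta> ^ m / real K * Y) \<le> D * (sqrt \<beta> * \<beta> ^ m / real K * Y)"
        using E D1_nonneg b0 Y by (intro mult_right_mono) (auto simp: D_def)
      ultimately show ?thesis unfolding distrib_right by linarith
    qed
    also have "\<dots> = D * (sqrt \<beta> * \<beta> ^ m / real K + \<beta> ^ m * exp (- c * \<beta> * \<delta>)) * Y" by (simp add: algebra_simps)
    finally show "\<bar>spline K m b t - (\<Sum>i<n. y (Suc i) * spline K m q (?x i)) / real n\<bar>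
         \<le> D * (sqrt \<beta> * \<beta> ^ m / real K + \<beta> ^ m * exp (- c * \<beta> * \<delta>)) * Y" .
  qed
qed

end

section \<open>Bias for orders at least two\<close>

text \<open>The objective is convex, so stationarity implies minimality: the mixed terms of the
  expansion cancel by the normal equations and only squares remain.\<close>

lemma normal_eq_minimal:
  assumes "normal_eq n K m \<alpha> y b" "\<alpha> > 0"
  shows "(\<Sum>i<n. (y (Suc i) - spline K m b (real (Suc i) / real n))\<^sup>2) + real n * \<alpha> / real K * (\<Sum>k<K. (top_deriv K m b k)\<^sup>2)
    \<le> (\<Sum>i<n. (y (Suc i) - spline K m p (real (Suc i) / real n))\<^sup>2) + real n * \<alpha> / real K * (\<Sum>k<K. (top_deriv K m p k)\<^sup>2)"
proof -
  define w where "w = (\<lambda>k. p k + (-1) * b k)"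
  let ?A = "real n * \<alpha> / real K"
  define g where "g i = spline K m b (real (Suc i) / real n)" for i
  define h where "h i = spline K m w (real (Suc i) / real n)" for i
  define \<gamma> where "\<gamma> = top_deriv K m b"
  define \<eta> where "\<eta> = top_deriv K m w"
  have p: "spline K m p (real (Suc i) / real n) = g i + h i" for i
    unfolding w_def g_def h_def spline_add spline_scale by simp
  have tp: "top_deriv K m p k = \<gamma> k + \<eta> k" for k
    unfolding w_def \<gamma>_def \<eta>_def top_deriv_add top_deriv_scale by simp
  have ne: "(\<Sum>i<n. (y (Suc i) - g i) * h i) = ?A * (\<Sum>k<K. \<gamma> k * \<eta> k)"
    using assms(1) unfolding normal_eq_def sum_atLeast1 g_def h_def \<gamma>_def \<eta>_def by blast
  have 1: "(\<Sum>i<n. (y (Suc i) - (g i + h i))\<^sup>2) = (\<Sum>i<n. (y (Suc i) - g i)\<^sup>2) - 2 * (\<Sum>i<n. (y (Suc i) - g i) * h i) + (\<Sum>i<n. (h i)\<^sup>2)"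
    unfolding sum_distrib_left sum_subtractf[symmetric] sum.distrib[symmetric]
    by (rule sum.cong) (auto simp: power2_eq_square algebra_simps)
  have 2: "(\<Sum>k<K. (\<gamma> k + \<eta> k)\<^sup>2) = (\<Sum>k<K. (\<gamma> k)\<^sup>2) + 2 * (\<Sum>k<K. \<gamma> k * \<eta> k) + (\<Sum>k<K. (\<eta> k)\<^sup>2)"
    unfolding sum_distrib_left sum.distrib[symmetric]
    by (rule sum.cong) (auto simp: power2_eq_square algebra_simps)
  have "0 \<le> (\<Sum>i<n. (h i)\<^sup>2)" "0 \<le> ?A * (\<Sum>k<K. (\<eta> k)\<^sup>2)"
    using assms(2) by (simp_all add: sum_nonneg)
  then show ?thesis
    unfolding p tp g_def[symmetric] \<gamma>_def[symmetric] 1 2 ne distrib_left by (simp add: algebra_simps)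
qed

section \<open>Second order quadrature, approximate identity and the bias expansion\<close>

lemma power_exp_decay:
  assumes "k > (0::real)"
  shows "((\<lambda>x. x ^ p * exp (- k * x)) \<longlongrightarrow> 0) at_top"
proof -
  have "filterlim (\<lambda>x. k * x) at_top at_top"
    using assms by (intro filterlim_tendsto_pos_mult_at_top[OF tendsto_const] filterlim_ident)
  from filterlim_compose[OF tendsto_power_div_exp_0[of p] this]
  have "((\<lambda>x. (k * x) ^ p / exp (k * x)) \<longlongrightarrow> 0) at_top" .
  from tendsto_mult_right[OF this, of "1 / k ^ p"]
  have "((\<lambda>x. (k * x) ^ p / exp (k * x) * (1 / k ^ p)) \<longlongrightarrow> 0) at_top" by simp
  moreover have "(\<lambda>x. (k * x) ^ p / exp (k * x) * (1 / k ^ p)) = (\<lambda>x. x ^ p * exp (- k * x))"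
    using assms by (auto simp: fun_eq_iff power_mult_distrib exp_minus field_simps)
  ultimately show ?thesis by simp
qed

text \<open>The trapezoidal rule costs one oscillation of the first derivative per cell. Changing it
  to the right end point sum moves only the two end values, which are exponentially small when the
  integrand contains the kernel.\<close>

lemma trapezoid:
  fixes F :: "nat \<Rightarrow> real \<Rightarrow> real"
  assumes F: "deriv_chain 2 S F" and n: "n > 0"
    and \<omega>: "\<And>i x y. i < n \<Longrightarrow> x \<in> cell n i \<Longrightarrow> y \<in> cell n i \<Longrightarrow> \<bar>F 1 x - F 1 y\<bar> \<le> \<omega> i"
  shows "\<bar>integral {0..1} (F 0) - (\<Sum>i<n. F 0 (real (Suc i) / real n)) / real n\<bar>
     \<le> (\<Sum>i<n. \<omega> i) / (real n)\<^sup>2 + (\<bar>F 0 0\<bar> + \<bar>F 0 1\<bar>) / real n"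
proof -
  have rn: "real n > 0" using n by simp
  have c: "continuous_on {0..1} (F 0)" using F by (auto simp: deriv_chain_def)
  have int: "F 0 integrable_on {0..1}" using c by (rule integrable_continuous_real)
  let ?L = "\<lambda>i. F 0 (real i / real n)"
  have cellb: "\<bar>integral (cell n i) (F 0) - (?L i + ?L (Suc i)) / (2 * real n)\<bar> \<le> \<omega> i / (real n)\<^sup>2" if i: "i < n" for i
  proof -
    let ?a = "real i / real n" and ?b = "real (Suc i) / real n"
    have ab: "?a < ?b" "0 \<le> ?a" "?b \<le> 1" "?b - ?a = 1 / real n" using i rn by (auto simp: divide_strict_right_mono diff_divide_distrib[symmetric])
    \<comment> \<open>The slope of the chord, itself a value of \<open>F 1\<close> inside the cell;
      comparing chord and function thus costs one oscillation of \<open>F 1\<close>.\<close>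
    define s where "s = (F 0 ?b - F 0 ?a) * real n"
    have si: "?a \<in> cell n i" "?b \<in> cell n i" using ab by (auto simp: cell_def)
    have \<omega>0: "0 \<le> \<omega> i" using \<omega>[OF i si(1) si(1)] by simp
    obtain z2 where z2: "?a < z2" "z2 < ?b" "F 0 ?b - F 0 ?a = (?b - ?a) * F (Suc 0) z2"
      using deriv_chain_mvt[OF F, of 0 ?a ?b] ab by auto
    have s: "s = F 1 z2" unfolding s_def z2(3) ab(4) using rn by simp
    have lin: "((\<lambda>x. F 0 ?a + (x - ?a) * s) has_integral (?L i + ?L (Suc i)) / (2 * real n)) {?a..?b}"
    proof -
      have "((\<lambda>x. F 0 ?a + (x - ?a) * s) has_integral (F 0 ?a * ?b + (?b - ?a)\<^sup>2 / 2 * s) - (F 0 ?a * ?a + (?a - ?a)\<^sup>2 / 2 * s)) {?a..?b}"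
        using ab(1) by (intro fundamental_theorem_of_calculus)
          (auto intro!: derivative_eq_intros simp: has_real_derivative_iff_has_vector_derivative[symmetric])
      also have "(F 0 ?a * ?b + (?b - ?a)\<^sup>2 / 2 * s) - (F 0 ?a * ?a + (?a - ?a)\<^sup>2 / 2 * s) = F 0 ?a * (?b - ?a) + (?b - ?a)\<^sup>2 / 2 * s"
        by (simp only: right_diff_distrib) simp
      also have "\<dots> = (?L i + ?L (Suc i)) / (2 * real n)"
        unfolding ab(4) s_def using rn by (simp add: field_simps power2_eq_square del: of_nat_Suc)
      finally show ?thesis .
    qed
    have pt: "\<bar>F 0 x - (F 0 ?a + (x - ?a) * s)\<bar> \<le> \<omega> i / real n" if x: "x \<in> {?a..?b}" for x
    proof (cases "x = ?a")
      case True then show ?thesis using \<omega>0 rn by simp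
    next
      case False
      then have x': "?a < x" "x \<le> ?b" using x by auto
      obtain z1 where z1: "?a < z1" "z1 < x" "F 0 x - F 0 ?a = (x - ?a) * F (Suc 0) z1"
        using deriv_chain_mvt[OF F, of 0 ?a x] ab x' by auto
      have "F 0 x - (F 0 ?a + (x - ?a) * s) = (x - ?a) * (F 1 z1 - F 1 z2)"
        using z1(3) unfolding s by (simp add: algebra_simps)
      also have "\<bar>\<dots>\<bar> \<le> 1 / real n * \<omega> i"
        unfolding abs_mult using x' z1 z2 ab(4) i by (intro mult_mono \<omega>) (auto simp: cell_def)
      finally show ?thesis by simp
    qed
    have ic: "F 0 integrable_on {?a..?b}" using ab by (intro integrable_subinterval_real[OF int]) auto
    have "((\<lambda>x. F 0 x - (F 0 ?a + (x - ?a) * s)) has_integral integral {?a..?b} (F 0) - (?L i + ?L (Suc i)) / (2 * real n)) {?a..?b}"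
      by (intro has_integral_diff integrable_integral ic lin)
    from has_integral_bound_real[OF _ finite.emptyI this, of "\<omega> i / real n"] pt \<omega>0
    have "\<bar>integral {?a..?b} (F 0) - (?L i + ?L (Suc i)) / (2 * real n)\<bar> \<le> \<omega> i / real n * (?b - ?a)"
      using ab(1) rn by (simp del: of_nat_Suc)
    then show ?thesis unfolding ab(4) cell_def by (simp add: power2_eq_square)
  qed
  have tel: "(\<Sum>i<n. ?L i) = (\<Sum>i<n. ?L (Suc i)) + F 0 0 - F 0 1"
    using sum_lessThan_telescope[of ?L n] rn by (simp add: sum_subtractf del: of_nat_Suc)
  have "(\<Sum>i<n. (?L i + ?L (Suc i)) / (2 * real n)) = (\<Sum>i<n. ?L (Suc i)) / real n + (F 0 0 - F 0 1) / (2 * real n)"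
    unfolding sum_divide_distrib[symmetric] sum.distrib tel by (simp add: add_divide_distrib diff_divide_distrib del: of_nat_Suc)
  then have e: "integral {0..1} (F 0) - (\<Sum>i<n. ?L (Suc i)) / real n
     = (\<Sum>i<n. integral (cell n i) (F 0) - (?L i + ?L (Suc i)) / (2 * real n)) + (F 0 0 - F 0 1) / (2 * real n)"
    unfolding sum_subtractf cell_def integral_cells[OF n int] by simp
  have "\<bar>\<Sum>i<n. integral (cell n i) (F 0) - (?L i + ?L (Suc i)) / (2 * real n)\<bar> \<le> (\<Sum>i<n. \<omega> i / (real n)\<^sup>2)"
    by (rule order_trans[OF sum_abs sum_mono]) (rule cellb, simp)
  moreover have "\<bar>(F 0 0 - F 0 1) / (2 * real n)\<bar> \<le> (\<bar>F 0 0\<bar> + \<bar>F 0 1\<bar>) / real n"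
    using rn by (simp add: field_simps)
  ultimately show ?thesis unfolding e sum_divide_distrib[of \<omega>] by linarith
qed

context green_kernel
begin

text \<open>The mass tends to one by \<open>representation\<close> for a constant function. The
  deviation of \<phi> is majorised by \<open>\<epsilon> + L * \<bar>s - t\<bar>\<close> on the whole
  interval, which avoids splitting the domain.\<close>

lemma V_approx_identity:
  assumes \<phi>: "continuous_on {0..1} \<phi>" and t: "0 < t" "t < 1"
  shows "((\<lambda>\<beta>. integral {0..1} (\<lambda>s. V \<beta> t 0 s * \<phi> s)) \<longlongrightarrow> \<phi> t) at_top"
proof (rule tendstoI)
  fix e :: real assume e: "e > 0"
  define \<delta> where "\<delta> = min t (1 - t)"
  have \<delta>: "\<delta> > 0" "\<delta> \<le> t" "\<delta> \<le> 1 - t" using t by (auto simp: \<delta>_def)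
  obtain M where M: "\<And>s. s \<in> {0..1} \<Longrightarrow> \<bar>\<phi> s\<bar> \<le> M"
    using compact_imp_bounded[OF compact_continuous_image[OF \<phi>]] unfolding bounded_iff by fastforce
  have M0: "M \<ge> 0" using M[of 0] by (force intro: order_trans[OF abs_ge_zero])
  \<comment> \<open>Chosen such that the contribution \<open>2 * C * \<epsilon> / c\<close> is at
    most \<open>e / 4\<close>; the \<open>C + 1\<close> guards against \<open>C = 0\<close>.\<close>
  define \<epsilon> where "\<epsilon> = e * c / (8 * (C + 1))"
  have \<epsilon>: "\<epsilon> > 0" using e c_pos C_nonneg by (simp add: \<epsilon>_def)
  obtain \<eta> where \<eta>: "\<eta> > 0" "\<And>s. s \<in> {0..1} \<Longrightarrow> \<bar>s - t\<bar> < \<eta> \<Longrightarrow> \<bar>\<phi> s - \<phi> t\<bar> < \<epsilon>"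
    using \<phi> t \<epsilon> unfolding continuous_on_iff dist_real_def by (metis atLeastAtMost_iff less_eq_real_def)
  define L where "L = 2 * M / \<eta>"
  have L0: "L \<ge> 0" using M0 \<eta> by (simp add: L_def)
  have mod: "\<bar>\<phi> s - \<phi> t\<bar> \<le> \<epsilon> + L * \<bar>s - t\<bar>" if s: "s \<in> {0..1}" for s
  proof (cases "\<bar>s - t\<bar> < \<eta>")
    case True
    then have "\<bar>\<phi> s - \<phi> t\<bar> < \<epsilon>" using \<eta> s by blast
    moreover have "0 \<le> L * \<bar>s - t\<bar>" using L0 by simp
    ultimately show ?thesis by linarith
  next
    case False
    then have "2 * M / \<eta> * \<eta> \<le> L * \<bar>s - t\<bar>" unfolding L_def[symmetric] using L0 by (intro mult_left_mono) auto
    then have "2 * M \<le> L * \<bar>s - t\<bar>" using \<eta> by simp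
    moreover have "\<bar>\<phi> s - \<phi> t\<bar> \<le> 2 * M" using M[OF s] M[of t] t by force
    ultimately show ?thesis using \<epsilon> by linarith
  qed
  have bound: "\<bar>integral {0..1} (\<lambda>s. V \<beta> t 0 s * \<phi> s) - \<phi> t\<bar>
      \<le> 2 * real m * C * \<bar>\<phi> t\<bar> * exp (- c * \<beta> * \<delta>) + (e / 4 + L * C * 8 / (c\<^sup>2 * \<beta>))" if \<beta>: "\<beta> \<ge> 1" for \<beta>
  proof -
    have b0: "\<beta> > 0" using \<beta> by simp
    define h where "h i = (if i = 0 then (\<lambda>_::real. \<phi> t) else (\<lambda>_. 0))" for i :: nat
    have h: "deriv_chain m {} h" by (auto simp: deriv_chain_def h_def)
    have hm: "h m = (\<lambda>_. 0)" "h 0 = (\<lambda>_. \<phi> t)" using m_pos by (auto simp: h_def)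
    have "1 / \<beta> ^ (2 * m) * \<beta> ^ (2 * m) = 1" using b0 by simp
    moreover have "\<bar>h i x\<bar> \<le> \<bar>\<phi> t\<bar>" for i x by (simp add: h_def)
    ultimately obtain r where r: "((\<lambda>s. V \<beta> t 0 s * \<phi> t) has_integral \<phi> t + r) {0..1}"
      "\<bar>r\<bar> \<le> 2 * real m * C * \<bar>\<phi> t\<bar> * exp (- c * \<beta> * \<delta>)"
      using representation[OF h t \<beta> _ _ _ \<delta>(2,3), of "1 / \<beta> ^ (2 * m)" "\<bar>\<phi> t\<bar>"] unfolding hm by auto
    have Vc: "continuous_on {0..1} (V \<beta> t 0)" using V_chain_m m_pos by (auto simp: deriv_chain_def)
    have int: "(\<lambda>s. V \<beta> t 0 s * \<phi> s) integrable_on {0..1}"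
      using Vc \<phi> by (intro integrable_continuous_real continuous_intros)
    have i1: "((\<lambda>s. V \<beta> t 0 s * \<phi> s - V \<beta> t 0 s * \<phi> t) has_integral integral {0..1} (\<lambda>s. V \<beta> t 0 s * \<phi> s) - (\<phi> t + r)) {0..1}"
      by (intro has_integral_diff integrable_integral int r)
    \<comment> \<open>The factor \<open>\<bar>s - t\<bar>\<close> is paid for by half of the
      exponential decay, whence the envelope with parameter \<open>\<beta> / 2\<close>.\<close>
    let ?G = "\<lambda>s. C * \<beta> * (\<epsilon> * env \<beta> t s + L * (2 / (c * \<beta>)) * env (\<beta> / 2) t s)"
    have i2: "(?G has_integral C * \<beta> * (\<epsilon> * integral {0..1} (env \<beta> t) + L * (2 / (c * \<beta>)) * integral {0..1} (env (\<beta> / 2) t))) {0..1}"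
      by (intro has_integral_mult_right has_integral_add integrable_integral env_integrable)
    have pt: "norm (V \<beta> t 0 s * \<phi> s - V \<beta> t 0 s * \<phi> t) \<le> ?G s" if s: "s \<in> {0..1}" for s
    proof -
      let ?u = "\<bar>s - t\<bar>"
      have "c * \<beta> * ?u / 2 \<le> exp (c * \<beta> * ?u / 2)" using exp_ge_add_one_self[of "c * \<beta> * ?u / 2"] by linarith
      then have "?u \<le> 2 / (c * \<beta>) * exp (c * \<beta> * ?u / 2)" using c_pos b0 by (simp add: field_simps)
      then have "?u * env \<beta> t s \<le> 2 / (c * \<beta>) * exp (c * \<beta> * ?u / 2) * env \<beta> t s"
        using env_nonneg by (intro mult_right_mono)
      also have "\<dots> = 2 / (c * \<beta>) * env (\<beta> / 2) t s"
        by (simp add: env_def exp_add[symmetric] mult.assoc)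
      finally have u: "?u * env \<beta> t s \<le> 2 / (c * \<beta>) * env (\<beta> / 2) t s" .
      have "norm (V \<beta> t 0 s * \<phi> s - V \<beta> t 0 s * \<phi> t) = \<bar>V \<beta> t 0 s\<bar> * \<bar>\<phi> s - \<phi> t\<bar>"
        by (simp add: abs_mult[symmetric] right_diff_distrib)
      also have "\<dots> \<le> (C * \<beta> * env \<beta> t s) * (\<epsilon> + L * ?u)"
        using V_bound[OF b0, of t 0 s] mod[OF s] C_nonneg b0 env_nonneg by (intro mult_mono) auto
      also have "\<dots> = C * \<beta> * (\<epsilon> * env \<beta> t s + L * (?u * env \<beta> t s))" by (simp add: algebra_simps)
      also have "\<dots> \<le> C * \<beta> * (\<epsilon> * env \<beta> t s + L * (2 / (c * \<beta>) * env (\<beta> / 2) t s))"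
        using u C_nonneg b0 L0 by (intro mult_left_mono add_left_mono) auto
      finally show ?thesis by (simp add: mult.assoc)
    qed
    have "\<bar>integral {0..1} (\<lambda>s. V \<beta> t 0 s * \<phi> s) - (\<phi> t + r)\<bar>
        \<le> C * \<beta> * (\<epsilon> * integral {0..1} (env \<beta> t) + L * (2 / (c * \<beta>)) * integral {0..1} (env (\<beta> / 2) t))"
      using integral_norm_bound_integral[OF has_integral_integrable[OF i1] has_integral_integrable[OF i2] pt]
      unfolding integral_unique[OF i1] integral_unique[OF i2] by simp
    also have "\<dots> \<le> C * \<beta> * (\<epsilon> * (2 / (c * \<beta>)) + L * (2 / (c * \<beta>)) * (2 / (c * (\<beta> / 2))))"
      using C_nonneg b0 \<epsilon> L0 c_pos t by (intro mult_left_mono add_mono env_integral) auto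
    also have "\<dots> = 2 * C * \<epsilon> / c + L * C * 8 / (c\<^sup>2 * \<beta>)"
      using b0 c_pos by (simp add: field_simps power2_eq_square)
    also have "2 * C * \<epsilon> / c \<le> e / 4"
    proof -
      have "2 * C * \<epsilon> / c = e / 4 * (C / (C + 1))" using c_pos C_nonneg by (simp add: \<epsilon>_def divide_simps)
      also have "\<dots> \<le> e / 4 * 1" using e C_nonneg by (intro mult_left_mono) auto
      finally show ?thesis by simp
    qed
    finally have "\<bar>integral {0..1} (\<lambda>s. V \<beta> t 0 s * \<phi> s) - (\<phi> t + r)\<bar> \<le> e / 4 + L * C * 8 / (c\<^sup>2 * \<beta>)" by simp
    then show ?thesis using r(2) by linarith
  qed
  have "((\<lambda>\<beta>. 2 * real m * C * \<bar>\<phi> t\<bar> * exp (- (c * \<delta>) * \<beta>) + (e / 4 + L * C * 8 / (c\<^sup>2 * \<beta>))) \<longlongrightarrow> 2 * real m * C * \<bar>\<phi> t\<bar> * 0 + (e / 4 + 0)) at_top"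
  proof -
    have k: "c * \<delta> > 0" "c\<^sup>2 > 0" using c_pos \<delta> by auto
    have "((\<lambda>\<beta>. exp (- (c * \<delta>) * \<beta>)) \<longlongrightarrow> 0) at_top" using power_exp_decay[OF k(1), of 0] by simp
    moreover have "((\<lambda>\<beta>. L * C * 8 / (c\<^sup>2 * \<beta>)) \<longlongrightarrow> 0) at_top" using k by real_asymp
    ultimately show ?thesis by (intro tendsto_intros)
  qed
  then have "eventually (\<lambda>\<beta>. 2 * real m * C * \<bar>\<phi> t\<bar> * exp (- (c * \<delta>) * \<beta>) + (e / 4 + L * C * 8 / (c\<^sup>2 * \<beta>)) < e) at_top"
    by (rule order_tendstoD(2)) (use e in auto)
  then show "eventually (\<lambda>\<beta>. dist (integral {0..1} (\<lambda>s. V \<beta> t 0 s * \<phi> s)) (\<phi> t) < e) at_top"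
    using eventually_ge_at_top[of 1]
  proof eventually_elim
    case (elim \<beta>)
    then show ?case using bound[of \<beta>] by (simp add: dist_real_def mult_ac)
  qed
qed

text \<open>The derivatives of the kernel move onto \<open>f\<close>. The orders of \<open>V\<close>
  in the boundary terms are below \<open>m\<close> and therefore continuous at \<open>t\<close>, so
  no jump term appears there.\<close>

lemma V_ibp:
  assumes f: "deriv_chain (2 * m) S f" and F: "\<And>i x. i < 2 * m \<Longrightarrow> x \<in> {0..1} \<Longrightarrow> \<bar>f i x\<bar> \<le> B"
    and f2m: "continuous_on {0..1} (f (2 * m))"
    and t: "0 < t" "t < 1" and \<beta>: "\<beta> \<ge> 1" and \<delta>: "\<delta> \<le> t" "\<delta> \<le> 1 - t"
  shows "\<bar>integral {0..1} (\<lambda>s. V \<beta> t m s * f m s) - (-1) ^ m * integral {0..1} (\<lambda>s. V \<beta> t 0 s * f (2 * m) s)\<bar>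
     \<le> 2 * real m * C * \<beta> ^ m * B * exp (- c * \<beta> * \<delta>)"
    and "(\<lambda>s. V \<beta> t m s * f m s) integrable_on {0..1}"
proof -
  have b0: "\<beta> > 0" using \<beta> by simp
  define \<Psi> where "\<Psi> s = (\<Sum>j<m. (-1) ^ j * (f (m + j) s * V \<beta> t (m - 1 - j) s))" for s
  have fin: "finite (S \<union> {t})" using f by (simp add: deriv_chain_def)
  have i: "((\<lambda>x. f (m + 0) x * V \<beta> t m x - (-1) ^ m * (f (m + m) x * V \<beta> t 0 x)) has_integral \<Psi> 1 - \<Psi> 0) {0..1}"
    unfolding \<Psi>_def
    by (rule repeated_ibp[of 0 1 "S \<union> {t}" m "\<lambda>j. f (m + j)" "V \<beta> t"])
      (use f fin V_chain_m[of t \<beta>] in \<open>auto simp: deriv_chain_def intro: V_deriv\<close>)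
  have Vc: "continuous_on {0..1} (V \<beta> t 0)" using V_chain_m m_pos by (auto simp: deriv_chain_def)
  have i2: "(\<lambda>s. V \<beta> t 0 s * f (2 * m) s) integrable_on {0..1}"
    using Vc f2m by (intro integrable_continuous_real continuous_intros)
  have "((\<lambda>x. V \<beta> t m x * f m x) has_integral \<Psi> 1 - \<Psi> 0 + (-1) ^ m * integral {0..1} (\<lambda>s. V \<beta> t 0 s * f (2 * m) s)) {0..1}"
    using has_integral_add[OF i has_integral_mult_right[OF integrable_integral[OF i2], of "(-1) ^ m"]]
    by (simp add: mult_2[of m] mult.commute[of "V \<beta> t _ _"])
  note I = this
  show "(\<lambda>s. V \<beta> t m s * f m s) integrable_on {0..1}" using I by (rule has_integral_integrable)
  have end_bound: "\<bar>\<Psi> s\<bar> \<le> real m * (C * \<beta> ^ m * B * exp (- c * \<beta> * \<delta>))" if s: "s = 0 \<or> s = 1" for s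
  proof -
    have s01: "s \<in> {0..1}" using s by auto
    have env: "env \<beta> t s \<le> exp (- c * \<beta> * \<delta>)"
      unfolding env_def using s t \<delta> b0 c_pos by (auto simp: mult_left_mono)
    have "\<bar>\<Psi> s\<bar> \<le> (\<Sum>j<m. C * \<beta> ^ m * B * exp (- c * \<beta> * \<delta>))"
      unfolding \<Psi>_def
    proof (rule order_trans[OF sum_abs], rule sum_mono)
      fix j assume "j \<in> {..<m}"
      then have j: "j < m" by simp
      have "\<bar>V \<beta> t (m - 1 - j) s\<bar> \<le> C * \<beta> ^ Suc (m - 1 - j) * env \<beta> t s" by (rule V_bound[OF b0])
      also have "\<dots> \<le> C * \<beta> ^ m * exp (- c * \<beta> * \<delta>)"
        using C_nonneg \<beta> j env env_nonneg by (intro mult_mono mult_left_mono power_increasing) auto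
      finally have v: "\<bar>V \<beta> t (m - 1 - j) s\<bar> \<le> C * \<beta> ^ m * exp (- c * \<beta> * \<delta>)" .
      have "\<bar>f (m + j) s\<bar> * \<bar>V \<beta> t (m - 1 - j) s\<bar> \<le> B * (C * \<beta> ^ m * exp (- c * \<beta> * \<delta>))"
        using F[of "m + j" s] j s01 v by (intro mult_mono) auto
      then show "\<bar>(-1) ^ j * (f (m + j) s * V \<beta> t (m - 1 - j) s)\<bar> \<le> C * \<beta> ^ m * B * exp (- c * \<beta> * \<delta>)"
        by (simp add: abs_mult power_abs mult_ac)
    qed
    then show ?thesis by simp
  qed
  show "\<bar>integral {0..1} (\<lambda>s. V \<beta> t m s * f m s) - (-1) ^ m * integral {0..1} (\<lambda>s. V \<beta> t 0 s * f (2 * m) s)\<bar>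
     \<le> 2 * real m * C * \<beta> ^ m * B * exp (- c * \<beta> * \<delta>)"
    unfolding integral_unique[OF I] using end_bound[of 0] end_bound[of 1] by simp
qed

text \<open>For noise-free data the error \<open>d\<close> of the fit replaces the fit itself.
  Comparing the fit with the projection of \<open>f\<close> shows that \<open>d\<close> has mean
  square of order \<alpha> and that the derivatives of \<open>d\<close> are bounded independently of
  \<beta>. The first gains a factor \<open>\<beta> ^ m\<close> when \<open>V\<close> is replaced by
  its spline, the second allows the trapezoidal rule for \<open>V * d\<close>.\<close>

lemma bias_expansion:
  assumes m2: "m \<ge> 2" and t: "0 < t" "t < 1" "\<delta> \<le> t" "\<delta> \<le> 1 - t"
    and f: "deriv_chain (2 * m) S f" and B: "\<And>i x. i \<le> 2 * m \<Longrightarrow> x \<in> {0..1} \<Longrightarrow> \<bar>f i x\<bar> \<le> B"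
    and f2m: "continuous_on {0..1} (f (2 * m))"
  shows "\<exists>D n0. D \<ge> 0 \<and> (\<forall>n K \<beta> \<alpha> b. n0 \<le> n \<longrightarrow> n > 0 \<longrightarrow> K dvd n \<longrightarrow> 1 \<le> \<beta> \<longrightarrow> \<beta> ^ m \<le> real K \<longrightarrow> \<alpha> * \<beta> ^ (2 * m) = 1
      \<longrightarrow> normal_eq n K m \<alpha> (\<lambda>i. f 0 (real i / real n)) b
      \<longrightarrow> \<bar>spline K m b t - f 0 t + (-1) ^ m * \<alpha> * integral {0..1} (\<lambda>s. V \<beta> t 0 s * f (2 * m) s)\<bar>
         \<le> D * (\<beta>\<^sup>2 / (real K)\<^sup>2 + \<beta> ^ m * exp (- c * \<beta> * \<delta>)))"
proof -
  obtain Ds n0 where Ds: "Ds \<ge> 1" and sob: "\<And>n F S A I i x. n0 \<le> n \<Longrightarrow> deriv_chain m S F \<Longrightarrow> A \<ge> 0 \<Longrightarrow> I \<ge> 0 \<Longrightarrow>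
     (\<Sum>i=1..n. (F 0 (real i / real n))\<^sup>2) \<le> real n * A\<^sup>2 \<Longrightarrow>
     (\<forall>x\<in>{0..1}. \<forall>y\<in>{0..1}. \<bar>F (m - 1) x - F (m - 1) y\<bar> \<le> I) \<Longrightarrow> i < m \<Longrightarrow> x \<in> {0..1} \<Longrightarrow> \<bar>F i x\<bar> \<le> Ds * (A + I)"
    using grid_sobolev[of m] by blast
  have B0: "B \<ge> 0" using B[of 0 0] by (force intro: order_trans[OF abs_ge_zero])
  \<comment> \<open>The Sobolev bound for \<open>d\<close>: \<open>2 * B\<close> from the mean
    square, and \<open>3 * B\<close> for the oscillation of order \<open>m - 1\<close>, of which
    \<open>B\<close> comes from \<open>f\<close> and \<open>2 * B\<close> from the spline.\<close>
  define H where "H = Ds * (2 * B + 3 * B)"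
  have H0: "H \<ge> 0" using Ds B0 by (simp add: H_def)
  have BH: "3 * B \<le> H"
  proof -
    have "1 * (3 * B) \<le> Ds * (5 * B)" using Ds B0 by (intro mult_mono) auto
    then show ?thesis by (simp add: H_def)
  qed
  define E where "E = C * exp c"
  have E0: "E \<ge> 0" using C_nonneg by (simp add: E_def)
  define D where "D = 2 * B * E + (3 * E * H * \<Lambda> + E * H) + (2 * C * H + 2 * real m * C * H + 2 * real m * C * B)"
  have Dparts: "0 \<le> 2 * B * E + (3 * E * H * \<Lambda> + E * H)" "0 \<le> 2 * C * H + 2 * real m * C * H + 2 * real m * C * B"
    using B0 E0 H0 Lambda_pos C_nonneg by auto
  have D0: "D \<ge> 0" using Dparts by (simp add: D_def)
  have fm: "deriv_chain m S f" by (rule deriv_chain_mono[OF f]) simp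
  have flip: "\<bar>f i x - f i y\<bar> \<le> B * \<bar>x - y\<bar>" if i: "i < 2 * m - 1" and xy: "x \<in> {0..1}" "y \<in> {0..1}" for i x y
  proof -
    have *: "\<bar>f i y - f i x\<bar> \<le> B * (y - x)" if xy: "0 \<le> x" "x < y" "y \<le> 1" for x y
    proof -
      obtain z where z: "x < z" "z < y" "f i y - f i x = (y - x) * f (Suc i) z"
        using deriv_chain_mvt[OF f, of i x y] less_diff_conv[of i "2 * m" 1] i xy by auto
      have "\<bar>(y - x) * f (Suc i) z\<bar> \<le> (y - x) * B"
        unfolding abs_mult using B[of "Suc i" z] i xy z by (intro mult_mono) auto
      then show ?thesis using z(3) by (simp add: mult.commute)
    qed
    show ?thesis using *[of x y] *[of y x] xy by (cases x y rule: linorder_cases) (auto simp: abs_minus_commute)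
  qed
  show ?thesis
  proof (intro exI[of _ D] exI[of _ n0] conjI D0 allI impI)
    fix n K :: nat and \<beta> \<alpha> :: real and b
    assume n: "n0 \<le> n" "n > 0" and dvd: "K dvd n" and \<beta>: "1 \<le> \<beta>" "\<beta> ^ m \<le> real K" and \<alpha>: "\<alpha> * \<beta> ^ (2 * m) = 1"
      and ne: "normal_eq n K m \<alpha> (\<lambda>i. f 0 (real i / real n)) b"
    have b0: "\<beta> > 0" using \<beta> by simp
    have b_le: "\<beta> \<le> \<beta> ^ m" using \<beta> m_pos power_increasing[of 1 m \<beta>] by simp
    have \<beta>K: "\<beta> \<le> real K" using b_le \<beta> by linarith
    have K: "K > 0" "real K > 0" using \<beta>K b0 by auto
    have Kn: "real K \<le> real n" using dvd_imp_le[OF dvd n(2)] by simp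
    have \<beta>n: "\<beta> \<le> real n" using Kn \<beta>K by simp
    have rn: "real n > 0" using n by simp
    have \<alpha>0: "\<alpha> > 0" using \<alpha> b0 by (metis zero_less_mult_pos2 zero_less_one zero_less_power)
    have \<alpha>e: "\<alpha> = (1 / \<beta> ^ m)\<^sup>2" using \<alpha> b0 by (simp add: field_simps power_mult[symmetric] mult.commute)
    have bm1: "\<beta> ^ m \<ge> 1" using \<beta> by simp
    have \<alpha>1: "\<alpha> \<le> 1" unfolding \<alpha>e using bm1 by (simp add: power_le_one)
    let ?x = "\<lambda>i. real (Suc i) / real n"
    let ?G = "spline_deriv_chain K m b"
    let ?\<gamma> = "top_deriv K m b"
    have x01: "?x i \<in> {0..1}" if "i < n" for i using that by auto
    have chain: "deriv_chain m ((\<lambda>j. real j / real K) ` {..K}) ?G" by (rule deriv_chain_spline[OF K(1)])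
    have celllen: "\<bar>x - y\<bar> \<le> 1 / real l" if "x \<in> cell l k" "y \<in> cell l k" for x y l k
    proof -
      have "\<bar>x - y\<bar> \<le> real (Suc k) / real l - real k / real l" using that by (auto simp: cell_def)
      then show ?thesis by (simp add: diff_divide_distrib[symmetric])
    qed
    obtain p where p1: "\<And>k. k < K \<Longrightarrow> top_deriv K m p k = real K * (f (m - 1) (real (Suc k) / real K) - f (m - 1) (real k / real K))"
      and p2: "\<And>\<rho> k x. \<lbrakk>\<forall>k<K. \<forall>x\<in>cell K k. \<forall>y\<in>cell K k. \<bar>f (m - 1) x - f (m - 1) y\<bar> \<le> \<rho> k; k < K; x \<in> cell K k\<rbrakk>
        \<Longrightarrow> \<bar>f (m - 1) x - spline_deriv_chain K m p (m - 1) x\<bar> \<le> \<rho> k"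
      and p3: "\<And>k. k \<le> K \<Longrightarrow> spline_deriv_chain K m p (m - 1) (real k / real K) = f (m - 1) (real k / real K)"
      and p4: "\<And>\<rho> x. \<lbrakk>\<forall>k<K. \<forall>x\<in>cell K k. \<bar>f (m - 1) x - spline_deriv_chain K m p (m - 1) x\<bar> \<le> \<rho> k; m \<ge> 2; x \<in> {0..1}\<rbrakk>
        \<Longrightarrow> \<bar>f 0 x - spline K m p x\<bar> \<le> (\<Sum>k<K. \<rho> k) / real K"
      using spline_projection[OF K(1) m_pos fm] by blast
    have fosc: "\<bar>f (m - 1) x - f (m - 1) y\<bar> \<le> B / real K" if k: "k < K" and xy: "x \<in> cell K k" "y \<in> cell K k" for k x y
    proof -
      have "\<bar>f (m - 1) x - f (m - 1) y\<bar> \<le> B * \<bar>x - y\<bar>" using cell_subset[OF k] xy m2 by (intro flip) auto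
      also have "\<dots> \<le> B * (1 / real K)" using B0 celllen[OF xy] by (intro mult_left_mono)
      finally show ?thesis by simp
    qed
    have fp: "\<bar>f 0 x - spline K m p x\<bar> \<le> B / real K" if "x \<in> {0..1}" for x
    proof -
      have "\<bar>f 0 x - spline K m p x\<bar> \<le> (\<Sum>k<K. B / real K) / real K"
        by (rule p4[OF _ m2 that]) (use p2[of "\<lambda>_. B / real K"] fosc in auto)
      then show ?thesis using K by simp
    qed
    have tp: "\<bar>top_deriv K m p k\<bar> \<le> B" if k: "k < K" for k
    proof -
      have "real k / real K \<in> cell K k" "real (Suc k) / real K \<in> cell K k" by (auto simp: cell_def divide_right_mono)
      then show ?thesis using fosc[OF k, of "real (Suc k) / real K" "real k / real K"] K
        unfolding p1[OF k] abs_mult by (simp add: field_simps del: of_nat_Suc)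
    qed
    define d where "d i x = f i x - ?G i x" for i x
    have d0: "d 0 (?x i) = f 0 (?x i) - spline K m b (?x i)" for i by (simp add: d_def spline_deriv_chain_0)
    \<comment> \<open>The comparison spline \<open>p\<close> has fitting error at most
      \<open>B / K\<close>, at most \<open>B / \<beta> ^ m\<close> because
      \<open>\<beta> ^ m \<le> K\<close>, and top derivative at most \<open>B\<close>; fit and
      penalty contribute \<open>n * \<alpha> * B^2\<close> each.\<close>
    have en: "(\<Sum>i<n. (d 0 (?x i))\<^sup>2) + real n * \<alpha> / real K * (\<Sum>k<K. (?\<gamma> k)\<^sup>2) \<le> 2 * real n * \<alpha> * B\<^sup>2"
    proof -
      have "(\<Sum>i<n. (f 0 (?x i) - spline K m p (?x i))\<^sup>2) \<le> (\<Sum>i<n. (B / real K)\<^sup>2)"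
        using fp[OF x01] B0 K by (intro sum_mono) (auto simp: abs_le_square_iff[symmetric])
      also have "\<dots> \<le> real n * (\<alpha> * B\<^sup>2)"
      proof -
        have "B / real K \<le> B / \<beta> ^ m" using \<beta> B0 b0 K by (intro divide_left_mono mult_pos_pos) auto
        then have "(B / real K)\<^sup>2 \<le> (B / \<beta> ^ m)\<^sup>2" using B0 K by (intro power_mono) auto
        also have "\<dots> = \<alpha> * B\<^sup>2" by (simp add: \<alpha>e power_divide)
        finally show ?thesis using rn by simp
      qed
      finally have 1: "(\<Sum>i<n. (f 0 (?x i) - spline K m p (?x i))\<^sup>2) \<le> real n * (\<alpha> * B\<^sup>2)" .
      have "(\<Sum>k<K. (top_deriv K m p k)\<^sup>2) \<le> (\<Sum>k<K. B\<^sup>2)"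
        using tp B0 by (intro sum_mono) (auto simp: abs_le_square_iff[symmetric])
      then have "real n * \<alpha> / real K * (\<Sum>k<K. (top_deriv K m p k)\<^sup>2) \<le> real n * \<alpha> / real K * (\<Sum>k<K. B\<^sup>2)"
        using \<alpha>0 by (intro mult_left_mono) auto
      then have 2: "real n * \<alpha> / real K * (\<Sum>k<K. (top_deriv K m p k)\<^sup>2) \<le> real n * \<alpha> * B\<^sup>2"
        using K by simp
      from normal_eq_minimal[OF ne \<alpha>0, of p] 1 2 show ?thesis unfolding d0 by (simp add: mult.assoc)
    qed
    have dn: "(\<Sum>i<n. (d 0 (?x i))\<^sup>2) \<le> real n * (2 * B / \<beta> ^ m)\<^sup>2"
    proof -
      have "0 \<le> real n * \<alpha> / real K * (\<Sum>k<K. (?\<gamma> k)\<^sup>2)" using \<alpha>0 by (simp add: sum_nonneg)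
      then have "(\<Sum>i<n. (d 0 (?x i))\<^sup>2) \<le> 2 * (real n * \<alpha> * B\<^sup>2)" using en by simp
      also have "\<dots> \<le> 4 * (real n * \<alpha> * B\<^sup>2)" using \<alpha>0 by simp
      also have "\<dots> = real n * (2 * B / \<beta> ^ m)\<^sup>2" by (simp add: \<alpha>e power_divide power_mult_distrib)
      finally show ?thesis .
    qed
    have dn1: "(\<Sum>i<n. (d 0 (?x i))\<^sup>2) \<le> real n * (2 * B)\<^sup>2"
    proof -
      have "2 * B / \<beta> ^ m \<le> 2 * B" using bm1 B0 by (simp add: divide_le_eq mult_le_cancel_left1)
      then have "(2 * B / \<beta> ^ m)\<^sup>2 \<le> (2 * B)\<^sup>2" using B0 bm1 by (intro power_mono) auto
      then have "real n * (2 * B / \<beta> ^ m)\<^sup>2 \<le> real n * (2 * B)\<^sup>2" using rn by (intro mult_left_mono) auto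
      then show ?thesis using dn by linarith
    qed
    have \<gamma>: "(\<Sum>k<K. \<bar>?\<gamma> k\<bar>) / real K \<le> 2 * B"
    proof (rule sum_abs_le_L2[OF _ _ K(1)])
      have "0 \<le> (\<Sum>i<n. (d 0 (?x i))\<^sup>2)" by (intro sum_nonneg) auto
      then have "real n * \<alpha> / real K * (\<Sum>k<K. (?\<gamma> k)\<^sup>2) \<le> 2 * real n * \<alpha> * B\<^sup>2" using en by linarith
      then have "(real n * \<alpha>) * ((\<Sum>k<K. (?\<gamma> k)\<^sup>2) / real K) \<le> (real n * \<alpha>) * (2 * B\<^sup>2)" by (simp add: mult_ac)
      then have "(\<Sum>k<K. (?\<gamma> k)\<^sup>2) / real K \<le> 2 * B\<^sup>2"
        using mult_le_cancel_left_pos[of "real n * \<alpha>"] rn \<alpha>0 by (meson mult_pos_pos)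
      then show "(\<Sum>k<K. (?\<gamma> k)\<^sup>2) / real K \<le> (2 * B)\<^sup>2" by (simp add: power_mult_distrib) (use zero_le_power2[of B] in linarith)
    qed (use B0 in auto)
    have dc: "deriv_chain m (S \<union> (\<lambda>j. real j / real K) ` {..K}) d"
      unfolding d_def[abs_def] by (rule deriv_chain_diff[OF fm chain])
    have sup: "\<bar>d i x\<bar> \<le> H" if "i < m" "x \<in> {0..1}" for i x
      unfolding H_def
    proof (rule sob[OF n(1) dc _ _ _ _ that])
      show "\<forall>x\<in>{0..1}. \<forall>y\<in>{0..1}. \<bar>d (m - 1) x - d (m - 1) y\<bar> \<le> 3 * B"
      proof (intro ballI)
        fix x y :: real assume xy: "x \<in> {0..1}" "y \<in> {0..1}"
        have "\<bar>f (m - 1) x - f (m - 1) y\<bar> \<le> B * \<bar>x - y\<bar>" using m2 xy by (intro flip) auto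
        also have "\<dots> \<le> B * 1" using B0 xy by (intro mult_left_mono) auto
        finally have "\<bar>f (m - 1) x - f (m - 1) y\<bar> \<le> B" by simp
        moreover have "\<bar>?G (m - 1) x - ?G (m - 1) y\<bar> \<le> 2 * B" using spline_osc[OF K(1) m_pos xy, of b] \<gamma> by linarith
        ultimately show "\<bar>d (m - 1) x - d (m - 1) y\<bar> \<le> 3 * B" unfolding d_def by linarith
      qed
      show "(\<Sum>i = 1..n. (d 0 (real i / real n))\<^sup>2) \<le> real n * (2 * B)\<^sup>2" unfolding sum_atLeast1 by (rule dn1)
    qed (use B0 in auto)
    obtain e where e: "((\<lambda>s. V \<beta> t 0 s * d 0 s + \<alpha> * (V \<beta> t m s * d m s)) has_integral d 0 t + e) {0..1}"
       "\<bar>e\<bar> \<le> 2 * real m * C * H * exp (- c * \<beta> * \<delta>)"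
      using representation[OF dc t(1,2) \<beta>(1) \<alpha> _ _ t(3,4), of H] sup by auto
    have F: "\<bar>f i x\<bar> \<le> B" if "i < 2 * m" "x \<in> {0..1}" for i x using B that by simp
    note ibp = V_ibp[OF f F f2m t(1,2) \<beta>(1) t(3,4)]
    define J where "J = integral {0..1} (\<lambda>s. V \<beta> t m s * f m s)"
    obtain q where
      q1: "\<And>k. k < K \<Longrightarrow> top_deriv K m q k = real K * (V \<beta> t (m - 1) (real (Suc k) / real K) - V \<beta> t (m - 1) (real k / real K))" and
      q2: "\<And>n. real K \<le> real n \<Longrightarrow> (\<Sum>i<n. (V \<beta> t 0 (real (Suc i) / real n) - spline K m q (real (Suc i) / real n))\<^sup>2) / real n
        \<le> (D1 * sqrt \<beta> * \<beta> ^ m / real K)\<^sup>2" and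
      q3: "\<And>x. m \<ge> 2 \<Longrightarrow> x \<in> {0..1} \<Longrightarrow> \<bar>V \<beta> t 0 x - spline K m q x\<bar> \<le> C * exp c * \<beta> ^ (m + 2) / (real K)\<^sup>2"
      using V_projection[OF \<beta>(1) \<beta>K less_imp_le[OF t(1)] less_imp_le[OF t(2)]] by blast
    define P where "P = (\<Sum>k<K. (V \<beta> t (m - 1) (real (Suc k) / real K) - V \<beta> t (m - 1) (real k / real K)) * ?\<gamma> k)"
    have pen: "((\<lambda>s. V \<beta> t m s * ?G m s) has_integral P) {0..1}"
      unfolding P_def by (rule has_integral_chain_times_top[OF K(1) m_pos V_chain_m])
    have "(\<Sum>i<n. d 0 (?x i) * spline K m q (?x i)) = real n * \<alpha> / real K * (\<Sum>k<K. ?\<gamma> k * top_deriv K m q k)"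
      using ne unfolding normal_eq_def sum_atLeast1 d0 by blast
    also have "(\<Sum>k<K. ?\<gamma> k * top_deriv K m q k) = real K * P"
      unfolding P_def sum_distrib_left using q1 by (intro sum.cong) auto
    finally have P: "\<alpha> * P = (\<Sum>i<n. d 0 (?x i) * spline K m q (?x i)) / real n"
      using rn K by simp
    have "((\<lambda>s. V \<beta> t m s * f m s - V \<beta> t m s * ?G m s) has_integral J - P) {0..1}"
      unfolding J_def by (intro has_integral_diff integrable_integral ibp(2) pen)
    from has_integral_diff[OF e(1) has_integral_mult_right[OF this, of \<alpha>]]
    have iVd: "((\<lambda>s. V \<beta> t 0 s * d 0 s) has_integral d 0 t + e - \<alpha> * (J - P)) {0..1}"
      by (simp add: d_def right_diff_distrib)
    \<comment> \<open>The mean of \<open>\<bar>d\<bar>\<close> is of order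
      \<open>\<beta> ^ (- m)\<close>, and it meets the second order projection error of order
      \<open>\<beta> ^ (m + 2) / K^2\<close>.\<close>
    have R: "\<bar>(\<Sum>i<n. d 0 (?x i) * (V \<beta> t 0 (?x i) - spline K m q (?x i))) / real n\<bar> \<le> 2 * B * E * (\<beta>\<^sup>2 / (real K)\<^sup>2)"
    proof -
      let ?M = "C * exp c * \<beta> ^ (m + 2) / (real K)\<^sup>2"
      have M0: "?M \<ge> 0" using C_nonneg b0 by simp
      have "\<bar>\<Sum>i<n. d 0 (?x i) * (V \<beta> t 0 (?x i) - spline K m q (?x i))\<bar> \<le> (\<Sum>i<n. \<bar>d 0 (?x i)\<bar> * ?M)"
      proof (rule order_trans[OF sum_abs sum_mono])
        fix i assume "i \<in> {..<n}"
        then show "\<bar>d 0 (?x i) * (V \<beta> t 0 (?x i) - spline K m q (?x i))\<bar> \<le> \<bar>d 0 (?x i)\<bar> * ?M"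
          unfolding abs_mult using q3[OF m2 x01] by (intro mult_left_mono) auto
      qed
      also have "\<dots> = (\<Sum>i<n. \<bar>d 0 (?x i)\<bar>) * ?M" by (simp only: sum_distrib_right)
      also have "\<dots> \<le> (real n * (2 * B / \<beta> ^ m)) * ?M"
      proof (rule mult_right_mono[OF _ M0])
        have "(\<Sum>i<n. \<bar>d 0 (?x i)\<bar>) / real n \<le> 2 * B / \<beta> ^ m"
          by (rule sum_abs_le_L2) (use dn rn n B0 bm1 in \<open>auto simp: pos_divide_le_eq mult.commute\<close>)
        then show "(\<Sum>i<n. \<bar>d 0 (?x i)\<bar>) \<le> real n * (2 * B / \<beta> ^ m)" using rn by (simp only: pos_divide_le_eq mult.commute)
      qed
      also have "\<dots> = real n * (2 * B * E * (\<beta>\<^sup>2 / (real K)\<^sup>2))" using b0 by (simp add: E_def power_add power2_eq_square)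
      finally show ?thesis using rn by (simp add: pos_divide_le_eq mult.commute)
    qed
    have trap: "\<bar>integral {0..1} (\<lambda>s. V \<beta> t 0 s * d 0 s) - (\<Sum>i<n. V \<beta> t 0 (?x i) * d 0 (?x i)) / real n\<bar>
        \<le> (3 * E * H * \<Lambda> + E * H) * (\<beta>\<^sup>2 / (real K)\<^sup>2) + 2 * C * H * (\<beta> ^ m * exp (- c * \<beta> * \<delta>))"
    proof -
      let ?e = "\<lambda>i. env \<beta> t (?x i)"
      define r where "r = n div K"
      have r: "n = K * r" "r > 0" using dvd n K by (auto simp: r_def div_greater_zero_iff dvd_imp_le)
      define FF where "FF i s = (if i = 0 then V \<beta> t 0 s * d 0 s else if i = 1 then V \<beta> t 1 s * d 0 s + V \<beta> t 0 s * d 1 s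
          else (V \<beta> t 2 s * d 0 s + V \<beta> t 1 s * d 1 s) + (V \<beta> t 1 s * d 1 s + V \<beta> t 0 s * d 2 s))" for i :: nat and s
      have FF: "FF 0 = (\<lambda>s. V \<beta> t 0 s * d 0 s)" "FF (Suc 0) = (\<lambda>s. V \<beta> t 1 s * d 0 s + V \<beta> t 0 s * d 1 s)"
        "FF (Suc (Suc 0)) = (\<lambda>s. (V \<beta> t 2 s * d 0 s + V \<beta> t 1 s * d 1 s) + (V \<beta> t 1 s * d 1 s + V \<beta> t 0 s * d 2 s))"
        by (auto simp: FF_def fun_eq_iff)
      let ?S = "S \<union> (\<lambda>j. real j / real K) ` {..K} \<union> {t}"
      have Vc: "continuous_on {0..1} (V \<beta> t i)" if "i < 2" for i
        using V_chain[of t \<beta>] that m2 by (auto simp: deriv_chain_def)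
      have dcc: "continuous_on {0..1} (d i)" if "i < 2" for i
        using dc that m2 by (auto simp: deriv_chain_def)
      have dd: "(d i has_real_derivative d (Suc i) x) (at x)" if "i < 2" "x \<in> {0<..<1} - ?S" for i x
        using dc that m2 by (auto simp: deriv_chain_def)
      have dF: "deriv_chain 2 ?S FF"
        unfolding deriv_chain_def
      proof (intro conjI allI impI ballI)
        show "finite ?S" using dc by (simp add: deriv_chain_def)
        fix i :: nat assume "i < 2"
        then consider "i = 0" | "i = Suc 0" by linarith
        note cs = this
        show "continuous_on {0..1} (FF i)"
          using cs by cases (simp_all add: FF Vc dcc continuous_intros)
        fix x assume x: "x \<in> {0<..<1} - ?S"
        then have xt: "x \<noteq> t" by auto
        have D: "((\<lambda>s. V \<beta> t i s * d j s) has_real_derivative V \<beta> t (Suc i) x * d j x + V \<beta> t i x * d (Suc j) x) (at x)" if "j < 2" for i j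
          using DERIV_mult'[OF V_deriv[OF xt] dd[OF that x], of \<beta> i] by (simp add: algebra_simps)
        show "(FF i has_real_derivative FF (Suc i) x) (at x)"
          using cs
        proof cases
          case 1
          then show ?thesis using D[of 0 0] by (simp add: FF)
        next
          case 2
          have "((\<lambda>s. V \<beta> t 1 s * d 0 s + V \<beta> t 0 s * d 1 s) has_real_derivative
            (V \<beta> t (Suc 1) x * d 0 x + V \<beta> t 1 x * d (Suc 0) x) + (V \<beta> t (Suc 0) x * d 1 x + V \<beta> t 0 x * d (Suc 1) x)) (at x)"
            by (intro DERIV_add D) auto
          then show ?thesis unfolding 2 FF by (simp add: numeral_2_eq_2)
        qed
      qed
      have dosc: "\<bar>d i x - d i y\<bar> \<le> H / real n" if i: "Suc i < m" and l: "l < n" and xy: "x \<in> cell n l" "y \<in> cell n l" for i l x y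
      proof -
        have *: "\<bar>d i y - d i x\<bar> \<le> H / real n" if xy: "x \<in> cell n l" "y \<in> cell n l" "x < y" for x y
        proof -
          have xy': "0 \<le> x" "y \<le> 1" using xy cell_subset[OF l] by auto
          obtain z where z: "x < z" "z < y" "d i y - d i x = (y - x) * d (Suc i) z"
            using deriv_chain_mvt[OF dc i xy'(1) xy(3) xy'(2)] by blast
          have "\<bar>(y - x) * d (Suc i) z\<bar> \<le> 1 / real n * H"
            unfolding abs_mult using sup[of "Suc i" z] i z xy' celllen[OF xy(2,1)] by (intro mult_mono) auto
          then show ?thesis using z(3) by simp
        qed
        show ?thesis using *[OF xy] *[OF xy(2,1)] H0 rn by (cases x y rule: linorder_cases) (auto simp: abs_minus_commute)
      qed
      \<comment> \<open>For \<open>m = 2\<close> the first derivative of the spline is only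
        piecewise linear and its slopes are bounded only on average, so they are kept per knot cell.
        From \<open>m = 3\<close> on the second derivative is bounded by \<open>H\<close>.\<close>
      define w where "w i = (if m = 2 then (B + \<bar>?\<gamma> (i div r)\<bar>) / real n else H / real n)" for i
      have w0: "w i \<ge> 0" for i using B0 H0 by (simp add: w_def)
      have d1osc: "\<bar>d 1 x - d 1 y\<bar> \<le> w l" if l: "l < n" and xy: "x \<in> cell n l" "y \<in> cell n l" for l x y
      proof (cases "m = 2")
        case True
        let ?k = "l div r"
        have k: "?k < K" using l r by (metis less_mult_imp_div_less)
        have sub: "cell n l \<subseteq> cell K ?k" using grid_cell_subset[OF r(2) K(1), of l] r(1) by simp
        have lin: "?G 1 z = ?G 1 (real ?k / real K) + (z - real ?k / real K) * ?\<gamma> ?k" if "z \<in> cell n l" for z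
          using spline_deriv_chain_linear[OF K(1) m_pos k, of z b] that sub True by auto
        have "?G 1 x - ?G 1 y = (x - y) * ?\<gamma> ?k"
          unfolding lin[OF xy(1)] lin[OF xy(2)] by (simp add: left_diff_distrib)
        then have "\<bar>?G 1 x - ?G 1 y\<bar> \<le> 1 / real n * \<bar>?\<gamma> ?k\<bar>"
          using celllen[OF xy] by (simp only: abs_mult) (intro mult_right_mono, auto)
        moreover have "\<bar>f 1 x - f 1 y\<bar> \<le> B * \<bar>x - y\<bar>" using xy cell_subset[OF l] m2 by (intro flip) auto
        moreover have "B * \<bar>x - y\<bar> \<le> B * (1 / real n)" using celllen[OF xy] B0 by (intro mult_left_mono)
        ultimately have "\<bar>d 1 x - d 1 y\<bar> \<le> B * (1 / real n) + 1 / real n * \<bar>?\<gamma> ?k\<bar>" unfolding d_def by linarith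
        then show ?thesis using True by (simp add: w_def add_divide_distrib)
      next
        case False
        then show ?thesis using dosc[of 1, OF _ l xy] m2 by (simp add: w_def)
      qed
      have wsum: "(\<Sum>i<n. w i) \<le> H"
      proof (cases "m = 2")
        case True
        have "(\<Sum>i<n. w i) = (real n * B + (\<Sum>i<n. \<bar>?\<gamma> (i div r)\<bar>)) / real n"
          using True by (simp add: w_def sum_divide_distrib[symmetric] sum.distrib)
        also have "(\<Sum>i<n. \<bar>?\<gamma> (i div r)\<bar>) = real r * (\<Sum>k<K. \<bar>?\<gamma> k\<bar>)"
          using sum_div_cells[OF r(2), of "\<lambda>k. \<bar>?\<gamma> k\<bar>" K] r(1) by simp
        also have "(real n * B + real r * (\<Sum>k<K. \<bar>?\<gamma> k\<bar>)) / real n = B + (\<Sum>k<K. \<bar>?\<gamma> k\<bar>) / real K"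
          using r K by (simp add: add_divide_distrib)
        finally show ?thesis using \<gamma> BH by linarith
      next
        case False
        then show ?thesis using rn by (simp add: w_def)
      qed
      \<comment> \<open>The oscillation of \<open>V' d + V d'\<close> on a cell, split into four
        products. Only the last one involves \<open>w\<close>, and there the envelope may be bounded
        by one because the sum of \<open>w\<close> is at most \<open>H\<close>.\<close>
      define \<omega> where "\<omega> i = E * H * (\<beta> ^ 3 + 2 * \<beta>\<^sup>2) / real n * ?e i + E * \<beta> * ?e i * w i" for i
      have Fosc: "\<bar>FF 1 x - FF 1 y\<bar> \<le> \<omega> l" if l: "l < n" and xy: "x \<in> cell n l" "y \<in> cell n l" for l x y
      proof -
        have x1: "?x l \<in> cell n l" by (simp add: cell_def divide_right_mono)
        have xy01: "x \<in> {0..1}" "y \<in> {0..1}" using xy cell_subset[OF l] by auto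
        have V1: "\<bar>V \<beta> t 1 x - V \<beta> t 1 y\<bar> \<le> E * \<beta> ^ 3 / real n * ?e l"
          using V_osc[of 1 \<beta> n l x y "?x l" t] m2 b0 \<beta>n l xy x1 by (simp add: E_def numeral_3_eq_3)
        have V0: "\<bar>V \<beta> t 0 x - V \<beta> t 0 y\<bar> \<le> E * \<beta>\<^sup>2 / real n * ?e l"
          using V_osc[of 0 \<beta> n l x y "?x l" t] m2 b0 \<beta>n l xy x1 by (simp add: E_def power2_eq_square)
        have Vb: "\<bar>V \<beta> t i y\<bar> \<le> E * \<beta> ^ Suc i * ?e l" for i
        proof -
          have "\<bar>V \<beta> t i y\<bar> \<le> C * \<beta> ^ Suc i * env \<beta> t y" by (rule V_bound[OF b0])
          also have "\<dots> \<le> C * \<beta> ^ Suc i * (exp c * ?e l)"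
            using C_nonneg b0 xy x1 by (intro mult_left_mono env_compare[OF b0 \<beta>n]) auto
          finally show ?thesis by (simp add: E_def mult_ac)
        qed
        have "FF 1 x - FF 1 y = (V \<beta> t 1 x - V \<beta> t 1 y) * d 0 x + V \<beta> t 1 y * (d 0 x - d 0 y)
            + (V \<beta> t 0 x - V \<beta> t 0 y) * d 1 x + V \<beta> t 0 y * (d 1 x - d 1 y)"
          by (simp add: FF algebra_simps)
        moreover have "\<bar>(V \<beta> t 1 x - V \<beta> t 1 y) * d 0 x\<bar> \<le> E * \<beta> ^ 3 / real n * ?e l * H"
          unfolding abs_mult using V1 sup[of 0 x] m2 xy01 E0 b0 env_nonneg by (intro mult_mono) auto
        moreover have "\<bar>V \<beta> t 1 y * (d 0 x - d 0 y)\<bar> \<le> E * \<beta>\<^sup>2 * ?e l * (H / real n)"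
          unfolding abs_mult using Vb[of 1] dosc[of 0, OF _ l xy] m2 E0 b0 env_nonneg
          by (intro mult_mono) (auto simp: power2_eq_square)
        moreover have "\<bar>(V \<beta> t 0 x - V \<beta> t 0 y) * d 1 x\<bar> \<le> E * \<beta>\<^sup>2 / real n * ?e l * H"
          unfolding abs_mult using V0 sup[of 1 x] m2 xy01 E0 b0 env_nonneg by (intro mult_mono) auto
        moreover have "\<bar>V \<beta> t 0 y * (d 1 x - d 1 y)\<bar> \<le> E * \<beta> * ?e l * w l"
          unfolding abs_mult using Vb[of 0] d1osc[OF l xy] E0 b0 env_nonneg w0 by (intro mult_mono) auto
        ultimately have "\<bar>FF 1 x - FF 1 y\<bar> \<le> E * \<beta> ^ 3 / real n * ?e l * H + E * \<beta>\<^sup>2 * ?e l * (H / real n)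
            + E * \<beta>\<^sup>2 / real n * ?e l * H + E * \<beta> * ?e l * w l" by linarith
        also have "\<dots> = \<omega> l"
        proof -
          have "E * \<beta> ^ 3 / N * a * H + E * \<beta>\<^sup>2 * a * (H / N) + E * \<beta>\<^sup>2 / N * a * H + E * \<beta> * a * u
             = E * H * (\<beta> ^ 3 + 2 * \<beta>\<^sup>2) / N * a + E * \<beta> * a * u" for N a u :: real
            by (simp add: algebra_simps add_divide_distrib)
          then show ?thesis unfolding \<omega>_def by blast
        qed
        finally show ?thesis .
      qed
      have "(\<Sum>i<n. \<omega> i) \<le> (3 * E * H * \<Lambda> + E * H) * \<beta>\<^sup>2"
      proof -
        have "(\<Sum>i<n. E * H * (\<beta> ^ 3 + 2 * \<beta>\<^sup>2) / real n * ?e i) = E * H * (\<beta> ^ 3 + 2 * \<beta>\<^sup>2) * ((\<Sum>i<n. ?e i) / real n)"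
          by (simp add: sum_distrib_left sum_divide_distrib)
        also have "\<dots> \<le> E * H * (\<beta> ^ 3 + 2 * \<beta>\<^sup>2) * (\<Lambda> / \<beta>)"
          using env_sum[OF b0 \<beta>n, of t] t E0 H0 b0 by (intro mult_left_mono) (auto simp: \<Lambda>_def)
        also have "\<dots> = E * H * \<Lambda> * (\<beta>\<^sup>2 + 2 * \<beta>)"
          using b0 by (simp add: field_simps power2_eq_square power3_eq_cube)
        also have "\<dots> \<le> E * H * \<Lambda> * (3 * \<beta>\<^sup>2)"
          using \<beta> E0 H0 Lambda_pos by (intro mult_left_mono) (auto simp: power2_eq_square)
        finally have 1: "(\<Sum>i<n. E * H * (\<beta> ^ 3 + 2 * \<beta>\<^sup>2) / real n * ?e i) \<le> 3 * E * H * \<Lambda> * \<beta>\<^sup>2" by simp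
        have "(\<Sum>i<n. E * \<beta> * ?e i * w i) \<le> (\<Sum>i<n. E * \<beta> * 1 * w i)"
          using env_le_1[OF b0] E0 b0 w0 by (intro sum_mono mult_right_mono mult_left_mono) auto
        also have "\<dots> = E * \<beta> * (\<Sum>i<n. w i)" by (simp add: sum_distrib_left)
        also have "\<dots> \<le> E * \<beta>\<^sup>2 * H"
          using wsum E0 b0 \<beta> H0 by (intro mult_mono) (auto simp: power2_eq_square intro: sum_nonneg w0)
        finally have 2: "(\<Sum>i<n. E * \<beta> * ?e i * w i) \<le> E * H * \<beta>\<^sup>2" by (simp add: mult_ac)
        show ?thesis unfolding \<omega>_def sum.distrib distrib_right using 1 2 by linarith
      qed
      then have "(\<Sum>i<n. \<omega> i) / (real n)\<^sup>2 \<le> (3 * E * H * \<Lambda> + E * H) * \<beta>\<^sup>2 / (real K)\<^sup>2"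
        using Kn K E0 H0 Lambda_pos by (intro frac_le) (auto intro: power_mono)
      moreover have "(\<bar>FF 0 0\<bar> + \<bar>FF 0 1\<bar>) / real n \<le> 2 * C * H * (\<beta> ^ m * exp (- c * \<beta> * \<delta>))"
      proof -
        have ep: "\<bar>FF 0 s\<bar> \<le> C * H * (\<beta> ^ m * exp (- c * \<beta> * \<delta>))" if s: "s = 0 \<or> s = 1" for s
        proof -
          have "env \<beta> t s \<le> exp (- c * \<beta> * \<delta>)"
            unfolding env_def using s t b0 c_pos by (auto simp: mult_left_mono)
          then have "C * \<beta> * env \<beta> t s \<le> C * \<beta> ^ m * exp (- c * \<beta> * \<delta>)"
            using C_nonneg b0 b_le env_nonneg by (intro mult_mono mult_left_mono) auto
          then have "\<bar>V \<beta> t 0 s\<bar> \<le> C * \<beta> ^ m * exp (- c * \<beta> * \<delta>)"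
            using V_bound[OF b0, of t 0 s] by simp
          then have "\<bar>V \<beta> t 0 s\<bar> * \<bar>d 0 s\<bar> \<le> (C * \<beta> ^ m * exp (- c * \<beta> * \<delta>)) * H"
            using sup[of 0 s] s m2 C_nonneg b0 by (intro mult_mono) auto
          then show ?thesis by (simp add: FF abs_mult mult_ac)
        qed
        have "(\<bar>FF 0 0\<bar> + \<bar>FF 0 1\<bar>) / real n \<le> (\<bar>FF 0 0\<bar> + \<bar>FF 0 1\<bar>) / 1"
          using n by (intro divide_left_mono) auto
        then show ?thesis using ep[of 0] ep[of 1] by simp
      qed
      ultimately show ?thesis using trapezoid[OF dF n(2), of \<omega>] Fosc unfolding FF by force
    qed
    have eq: "spline K m b t - f 0 t = - (\<alpha> * J) - (integral {0..1} (\<lambda>s. V \<beta> t 0 s * d 0 s) - (\<Sum>i<n. V \<beta> t 0 (?x i) * d 0 (?x i)) / real n)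
       - (\<Sum>i<n. d 0 (?x i) * (V \<beta> t 0 (?x i) - spline K m q (?x i))) / real n + e"
    proof -
      have "spline K m b t - f 0 t = - d 0 t" by (simp add: d_def spline_deriv_chain_0)
      also have "d 0 t = integral {0..1} (\<lambda>s. V \<beta> t 0 s * d 0 s) - e + \<alpha> * J - \<alpha> * P"
        unfolding integral_unique[OF iVd] by (simp add: algebra_simps)
      also have "\<alpha> * P = (\<Sum>i<n. V \<beta> t 0 (?x i) * d 0 (?x i)) / real n - (\<Sum>i<n. d 0 (?x i) * (V \<beta> t 0 (?x i) - spline K m q (?x i))) / real n"
        unfolding P diff_divide_distrib[symmetric] sum_subtractf[symmetric] by (simp add: algebra_simps)
      finally show ?thesis by (simp add: algebra_simps)
    qed
    have J: "\<bar>\<alpha> * J - (-1) ^ m * \<alpha> * integral {0..1} (\<lambda>s. V \<beta> t 0 s * f (2 * m) s)\<bar> \<le> 2 * real m * C * B * (\<beta> ^ m * exp (- c * \<beta> * \<delta>))"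
    proof -
      have "\<bar>\<alpha> * J - (-1) ^ m * \<alpha> * integral {0..1} (\<lambda>s. V \<beta> t 0 s * f (2 * m) s)\<bar>
          = \<alpha> * \<bar>J - (-1) ^ m * integral {0..1} (\<lambda>s. V \<beta> t 0 s * f (2 * m) s)\<bar>"
      proof -
        have "\<alpha> * J - s * \<alpha> * X = \<alpha> * (J - s * X)" for s X by (simp add: algebra_simps)
        then show ?thesis using \<alpha>0 by (simp add: abs_mult)
      qed
      also have "\<dots> \<le> 1 * (2 * real m * C * \<beta> ^ m * B * exp (- c * \<beta> * \<delta>))"
        using \<alpha>0 \<alpha>1 ibp(1) unfolding J_def by (intro mult_mono) auto
      finally show ?thesis by (simp add: mult_ac)
    qed
    have e': "\<bar>e\<bar> \<le> 2 * real m * C * H * (\<beta> ^ m * exp (- c * \<beta> * \<delta>))"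
    proof -
      have "2 * real m * C * H * (1 * exp (- c * \<beta> * \<delta>)) \<le> 2 * real m * C * H * (\<beta> ^ m * exp (- c * \<beta> * \<delta>))"
        using C_nonneg H0 bm1 by (intro mult_left_mono mult_right_mono) auto
      then show ?thesis using e(2) by simp
    qed
    have "\<bar>spline K m b t - f 0 t + (-1) ^ m * \<alpha> * integral {0..1} (\<lambda>s. V \<beta> t 0 s * f (2 * m) s)\<bar>
       \<le> (2 * B * E + (3 * E * H * \<Lambda> + E * H)) * (\<beta>\<^sup>2 / (real K)\<^sup>2)
         + (2 * C * H + 2 * real m * C * H + 2 * real m * C * B) * (\<beta> ^ m * exp (- c * \<beta> * \<delta>))"
      unfolding distrib_right using eq R trap J e' unfolding distrib_right by linarith
    also have "\<dots> \<le> D * (\<beta>\<^sup>2 / (real K)\<^sup>2) + D * (\<beta> ^ m * exp (- c * \<beta> * \<delta>))"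
      using Dparts b0 by (intro add_mono mult_right_mono) (auto simp: D_def)
    finally show "\<bar>spline K m b t - f 0 t + (-1) ^ m * \<alpha> * integral {0..1} (\<lambda>s. V \<beta> t 0 s * f (2 * m) s)\<bar>
         \<le> D * (\<beta>\<^sup>2 / (real K)\<^sup>2 + \<beta> ^ m * exp (- c * \<beta> * \<delta>))" by (simp only: distrib_left)
  qed
qed

end

section \<open>Variance\<close>

lemma normal_eq_add:
  "normal_eq n K m \<alpha> y b \<Longrightarrow> normal_eq n K m \<alpha> y' b' \<Longrightarrow> normal_eq n K m \<alpha> (\<lambda>i. y i + y' i) (\<lambda>k. b k + b' k)"
proof -
  assume 1: "normal_eq n K m \<alpha> y b" and 2: "normal_eq n K m \<alpha> y' b'"
  show ?thesis unfolding normal_eq_def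
  proof
    fix p
    let ?x = "\<lambda>i. real i / real n"
    have "(\<Sum>i=1..n. (y i + y' i - spline K m (\<lambda>k. b k + b' k) (?x i)) * spline K m p (?x i))
      = (\<Sum>i=1..n. (y i - spline K m b (?x i)) * spline K m p (?x i)) + (\<Sum>i=1..n. (y' i - spline K m b' (?x i)) * spline K m p (?x i))"
      unfolding spline_add sum.distrib[symmetric] by (rule sum.cong) (auto simp: algebra_simps)
    also have "\<dots> = real n * \<alpha> / real K * (\<Sum>k<K. top_deriv K m b k * top_deriv K m p k)
       + real n * \<alpha> / real K * (\<Sum>k<K. top_deriv K m b' k * top_deriv K m p k)"
      using 1 2 unfolding normal_eq_def by simp
    also have "\<dots> = real n * \<alpha> / real K * (\<Sum>k<K. top_deriv K m (\<lambda>k. b k + b' k) k * top_deriv K m p k)"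
      unfolding top_deriv_add distrib_right sum.distrib distrib_left ..
    finally show "(\<Sum>i=1..n. (y i + y' i - spline K m (\<lambda>k. b k + b' k) (?x i)) * spline K m p (?x i))
      = real n * \<alpha> / real K * (\<Sum>k<K. top_deriv K m (\<lambda>k. b k + b' k) k * top_deriv K m p k)" .
  qed
qed

lemma normal_eq_scale:
  "normal_eq n K m \<alpha> y b \<Longrightarrow> normal_eq n K m \<alpha> (\<lambda>i. a * y i) (\<lambda>k. a * b k)"
proof -
  assume 1: "normal_eq n K m \<alpha> y b"
  show ?thesis unfolding normal_eq_def
  proof
    fix p
    let ?x = "\<lambda>i. real i / real n"
    have "(\<Sum>i=1..n. (a * y i - spline K m (\<lambda>k. a * b k) (?x i)) * spline K m p (?x i))
      = a * (\<Sum>i=1..n. (y i - spline K m b (?x i)) * spline K m p (?x i))"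
      unfolding spline_scale sum_distrib_left by (rule sum.cong) (auto simp: algebra_simps)
    also have "\<dots> = a * (real n * \<alpha> / real K * (\<Sum>k<K. top_deriv K m b k * top_deriv K m p k))"
      using 1 unfolding normal_eq_def by simp
    also have "\<dots> = real n * \<alpha> / real K * (\<Sum>k<K. top_deriv K m (\<lambda>k. a * b k) k * top_deriv K m p k)"
      unfolding top_deriv_scale by (simp add: sum_distrib_left mult_ac)
    finally show "(\<Sum>i=1..n. (a * y i - spline K m (\<lambda>k. a * b k) (?x i)) * spline K m p (?x i))
      = real n * \<alpha> / real K * (\<Sum>k<K. top_deriv K m (\<lambda>k. a * b k) k * top_deriv K m p k)" .
  qed
qed

lemma normal_eq_cong:
  "normal_eq n K m \<alpha> y b \<Longrightarrow> (\<And>i. i \<in> {1..n} \<Longrightarrow> y i = y' i) \<Longrightarrow> normal_eq n K m \<alpha> y' b"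
  unfolding normal_eq_def by simp

lemma normal_eq_sum:
  assumes "finite L" "\<And>l. l \<in> L \<Longrightarrow> normal_eq n K m \<alpha> (y l) (b l)"
  shows "normal_eq n K m \<alpha> (\<lambda>i. \<Sum>l\<in>L. y l i) (\<lambda>k. \<Sum>l\<in>L. b l k)"
  using assms
proof (induction rule: finite_induct)
  case empty
  have "\<exists>b. normal_eq n K m \<alpha> (\<lambda>_. 0 * 0) (\<lambda>_. 0 * b)"
  proof -
    have "spline K m (\<lambda>k. 0 * 0) x = 0" for x by (subst spline_scale) simp
    moreover have "top_deriv K m (\<lambda>k. 0 * 0) x = 0" for x by (subst top_deriv_scale) simp
    ultimately show ?thesis by (simp add: normal_eq_def)
  qed
  then show ?case by simp
next
  case (insert l L)
  then show ?case using normal_eq_add[of n K m \<alpha> "y l" "b l"] by simp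
qed

lemma spline_sum: "finite L \<Longrightarrow> spline K m (\<lambda>k. \<Sum>l\<in>L. b l k) x = (\<Sum>l\<in>L. spline K m (b l) x)"
proof (induction rule: finite_induct)
  case empty
  then show ?case by (simp add: spline_def)
qed (simp add: spline_add)

context green_kernel
begin

section \<open>Limit of the squared norm of the kernel\<close>

definition \<Psi> :: "real \<Rightarrow> real" where "\<Psi> x = integral {0..x} (\<lambda>u. (\<kappa> 0 u)\<^sup>2)"

lemma kappa_continuous: "continuous_on T (\<kappa> i)"
  by (meson DERIV_isCont kappa_deriv continuous_at_imp_continuous_on)

lemma kappa_sq_integrable: "(\<lambda>u. (\<kappa> 0 u)\<^sup>2) integrable_on {a..b}"
  by (intro integrable_continuous_real continuous_intros kappa_continuous)

lemma Psi_mono: "0 \<le> x \<Longrightarrow> x \<le> y \<Longrightarrow> \<Psi> x \<le> \<Psi> y"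
  unfolding \<Psi>_def by (intro integral_subset_le kappa_sq_integrable) auto

lemma Psi_bounded: "x \<ge> 0 \<Longrightarrow> \<Psi> x \<le> C\<^sup>2 / (2 * c)"
proof -
  assume x: "x \<ge> 0"
  have I: "((\<lambda>u. C\<^sup>2 * exp (- (2 * c) * u)) has_integral (- (C\<^sup>2 * exp (- (2 * c) * x) / (2 * c))) - (- (C\<^sup>2 * exp (- (2 * c) * 0) / (2 * c)))) {0..x}"
    using x c_pos by (intro fundamental_theorem_of_calculus)
      (auto intro!: derivative_eq_intros simp: has_real_derivative_iff_has_vector_derivative[symmetric])
  have "\<Psi> x \<le> integral {0..x} (\<lambda>u. C\<^sup>2 * exp (- (2 * c) * u))"
    unfolding \<Psi>_def
  proof (rule integral_le[OF kappa_sq_integrable has_integral_integrable[OF I]])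
    fix u assume u: "u \<in> {0..x}"
    have "(\<kappa> 0 u)\<^sup>2 \<le> (C * exp (- c * u))\<^sup>2"
      using power_mono[OF kappa_bound[of u 0], of 2] u by simp
    also have "\<dots> = C\<^sup>2 * exp (- (2 * c) * u)"
      by (simp add: power_mult_distrib exp_double[symmetric] mult.assoc)
    finally show "(\<kappa> 0 u)\<^sup>2 \<le> C\<^sup>2 * exp (- (2 * c) * u)" .
  qed
  also have "\<dots> = C\<^sup>2 / (2 * c) - C\<^sup>2 * exp (- (2 * c) * x) / (2 * c)" using integral_unique[OF I] by simp
  also have "\<dots> \<le> C\<^sup>2 / (2 * c)" using c_pos by simp
  finally show ?thesis .
qed

text \<open>If the profile vanished on the positive half line, so would all its derivatives, and by
  continuity \<open>\<kappa> (2m - 1)\<close> would vanish at 0, against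
  \<open>kappa_top\<close>.\<close>

lemma Psi_pos: "\<exists>x\<ge>0. \<Psi> x > 0"
proof (rule ccontr)
  assume "\<not> ?thesis"
  then have le: "\<Psi> x \<le> 0" if "x \<ge> 0" for x using that by force
  have z: "\<kappa> 0 u = 0" if u: "u > 0" for u
  proof -
    have nn: "integral {0..u} (\<lambda>u. (\<kappa> 0 u)\<^sup>2) \<ge> 0" by (intro integral_nonneg kappa_sq_integrable) auto
    then have "integral {0..u} (\<lambda>u. (\<kappa> 0 u)\<^sup>2) = 0" using le[of u] u unfolding \<Psi>_def by simp
    then have "\<forall>v\<in>{0..u}. (\<kappa> 0 v)\<^sup>2 = 0"
      using u by (subst (asm) integral_eq_0_iff) (auto intro!: continuous_intros kappa_continuous)
    then have "(\<kappa> 0 u)\<^sup>2 = 0" using u by auto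
    then show ?thesis by simp
  qed
  have all: "\<kappa> i u = 0" if "u > 0" for i u
    using that
  proof (induction i arbitrary: u)
    case 0
    then show ?case by (rule z)
  next
    case (Suc i)
    have "(\<kappa> i has_real_derivative 0) (at u)"
      by (rule has_field_derivative_transform_within_open[OF DERIV_const open_greaterThan[of 0]]) (use Suc in auto)
    then show ?case using kappa_deriv DERIV_unique by blast
  qed
  have "isCont (\<kappa> (2 * m - 1)) 0" by (rule DERIV_isCont[OF kappa_deriv])
  then have "(\<kappa> (2 * m - 1) \<longlongrightarrow> \<kappa> (2 * m - 1) 0) (at_right 0)"
    by (auto simp: isCont_def intro: tendsto_mono[rotated] at_le)
  moreover have "(\<kappa> (2 * m - 1) \<longlongrightarrow> 0) (at_right 0)"
    by (rule tendsto_eventually) (use eventually_at_right_less[of 0] all in \<open>auto elim!: eventually_mono\<close>)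
  ultimately have "\<kappa> (2 * m - 1) 0 = 0" using tendsto_unique trivial_limit_at_right_real by blast
  then show False using kappa_top by simp
qed

lemma Psi_limit: "\<exists>L>0. (\<Psi> \<longlongrightarrow> L) at_top"
proof -
  define L where "L = Sup (\<Psi> ` {0..})"
  have bdd: "bdd_above (\<Psi> ` {0..})" using Psi_bounded by (auto intro!: bdd_aboveI2)
  obtain x0 where x0: "x0 \<ge> 0" "\<Psi> x0 > 0" using Psi_pos by blast
  have up: "\<Psi> x \<le> L" if "x \<ge> 0" for x unfolding L_def using that bdd by (intro cSup_upper) auto
  have "L > 0" using up[of x0] x0 by linarith
  moreover have "(\<Psi> \<longlongrightarrow> L) at_top"
  proof (rule order_tendstoI)
    fix a assume "a < L"
    then obtain x where x: "x \<ge> 0" "a < \<Psi> x" unfolding L_def using less_cSup_iff[OF _ bdd, of a] by auto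
    show "eventually (\<lambda>x. a < \<Psi> x) at_top"
      using eventually_ge_at_top[of x] by eventually_elim (use x Psi_mono in force)
  next
    fix a assume "L < a"
    then show "eventually (\<lambda>x. \<Psi> x < a) at_top"
      using eventually_ge_at_top[of 0] by (intro eventually_mono[OF eventually_ge_at_top[of 0]]) (use up in force)
  qed
  ultimately show ?thesis by blast
qed

lemma V_sq_integral:
  assumes \<beta>: "\<beta> > 0" and t: "0 \<le> t" "t \<le> 1"
  shows "1 / \<beta> * integral {0..1} (\<lambda>s. (V \<beta> t 0 s)\<^sup>2) = \<Psi> (\<beta> * t) + \<Psi> (\<beta> * (1 - t))"
proof -
  \<comment> \<open>Starting the antiderivative at -1 makes it two-sidedly differentiable at 0, the
    value of the argument at \<open>s = t\<close>.\<close>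
  define A where "A x = integral {-1..x} (\<lambda>u. (\<kappa> 0 u)\<^sup>2)" for x
  have dA: "(A has_real_derivative (\<kappa> 0 x)\<^sup>2) (at x)" if "x > -1" for x
  proof -
    have "(A has_real_derivative (\<kappa> 0 x)\<^sup>2) (at x within {-1..x+1})"
      unfolding A_def[abs_def] using that
      by (intro integral_has_real_derivative continuous_intros kappa_continuous) auto
    then show ?thesis using that by (simp add: at_within_Icc_at)
  qed
  have AP: "A x - A 0 = \<Psi> x" if "x \<ge> 0" for x
    unfolding A_def \<Psi>_def using Henstock_Kurzweil_Integration.integral_combine[of "-1" 0 x, OF _ that kappa_sq_integrable] by simp
  have "((\<lambda>s. \<beta> * (\<kappa> 0 (\<beta> * (t - s)))\<^sup>2) has_integral (- A (\<beta> * (t - t))) - (- A (\<beta> * (t - 0)))) {0..t}"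
  proof (rule fundamental_theorem_of_calculus[OF t(1)])
    fix x assume x: "x \<in> {0..t}"
    have "\<beta> * (t - x) \<ge> 0" using \<beta> x by simp
    then have "\<beta> * (t - x) > -1" by linarith
    from dA[OF this]
    have "((\<lambda>s. A (\<beta> * (t - s))) has_real_derivative (\<kappa> 0 (\<beta> * (t - x)))\<^sup>2 * - \<beta>) (at x)"
      by (rule DERIV_chain2[where f = A and g = "\<lambda>s. \<beta> * (t - s)"]) (auto intro!: derivative_eq_intros)
    from DERIV_minus[OF this]
    show "((\<lambda>s. - A (\<beta> * (t - s))) has_vector_derivative \<beta> * (\<kappa> 0 (\<beta> * (t - x)))\<^sup>2) (at x within {0..t})"
      by (simp add: has_real_derivative_iff_has_vector_derivative[symmetric] has_field_derivative_at_within mult.commute)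
  qed
  then have "((\<lambda>s. \<beta> * (\<kappa> 0 (\<beta> * (t - s)))\<^sup>2) has_integral \<Psi> (\<beta> * t)) {0..t}"
    using AP[of "\<beta> * t"] \<beta> t by (simp add: algebra_simps)
  from has_integral_mult_right[OF this, of \<beta>]
  have L: "((\<lambda>s. (V \<beta> t 0 s)\<^sup>2) has_integral \<beta> * \<Psi> (\<beta> * t)) {0..t}"
    by (rule has_integral_eq[rotated]) (auto simp: V_def power2_eq_square)
  have "((\<lambda>s. \<beta> * (\<kappa> 0 (\<beta> * (s - t)))\<^sup>2) has_integral (A (\<beta> * (1 - t))) - (A (\<beta> * (t - t)))) {t..1}"
  proof (rule fundamental_theorem_of_calculus[OF t(2)])
    fix x assume x: "x \<in> {t..1}"
    have "\<beta> * (x - t) \<ge> 0" using \<beta> x by simp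
    then have "\<beta> * (x - t) > -1" by linarith
    from dA[OF this]
    have "((\<lambda>s. A (\<beta> * (s - t))) has_real_derivative (\<kappa> 0 (\<beta> * (x - t)))\<^sup>2 * \<beta>) (at x)"
      by (rule DERIV_chain2[where f = A and g = "\<lambda>s. \<beta> * (s - t)"]) (auto intro!: derivative_eq_intros)
    then show "((\<lambda>s. A (\<beta> * (s - t))) has_vector_derivative \<beta> * (\<kappa> 0 (\<beta> * (x - t)))\<^sup>2) (at x within {t..1})"
      by (simp add: has_real_derivative_iff_has_vector_derivative[symmetric] has_field_derivative_at_within mult.commute)
  qed
  then have "((\<lambda>s. \<beta> * (\<kappa> 0 (\<beta> * (s - t)))\<^sup>2) has_integral \<Psi> (\<beta> * (1 - t))) {t..1}"
    using AP[of "\<beta> * (1 - t)"] \<beta> t by simp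
  from has_integral_mult_right[OF this, of \<beta>]
  have R: "((\<lambda>s. (V \<beta> t 0 s)\<^sup>2) has_integral \<beta> * \<Psi> (\<beta> * (1 - t))) {t..1}"
    by (rule has_integral_eq[rotated]) (auto simp: V_def power2_eq_square)
  from integral_unique[OF has_integral_combine[OF t L R]] \<beta> show ?thesis by (simp add: distrib_left)
qed

lemma V_sq_limit:
  assumes t: "0 < t" "t < 1"
  shows "\<exists>L>0. ((\<lambda>\<beta>. 1 / \<beta> * integral {0..1} (\<lambda>s. (V \<beta> t 0 s)\<^sup>2)) \<longlongrightarrow> L) at_top"
proof -
  obtain L where L: "L > 0" "(\<Psi> \<longlongrightarrow> L) at_top" using Psi_limit by blast
  have f: "filterlim (\<lambda>\<beta>. \<beta> * a) at_top at_top" if "a > 0" for a :: real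
    using that by (subst mult.commute) (intro filterlim_tendsto_pos_mult_at_top[OF tendsto_const] filterlim_ident)
  have "((\<lambda>\<beta>. \<Psi> (\<beta> * t) + \<Psi> (\<beta> * (1 - t))) \<longlongrightarrow> L + L) at_top"
    using t by (intro tendsto_add filterlim_compose[OF L(2)] f) auto
  then have "((\<lambda>\<beta>. 1 / \<beta> * integral {0..1} (\<lambda>s. (V \<beta> t 0 s)\<^sup>2)) \<longlongrightarrow> L + L) at_top"
  proof (rule Lim_transform_eventually)
    show "eventually (\<lambda>\<beta>. \<Psi> (\<beta> * t) + \<Psi> (\<beta> * (1 - t)) = 1 / \<beta> * integral {0..1} (\<lambda>s. (V \<beta> t 0 s)\<^sup>2)) at_top"
      using eventually_gt_at_top[of 0] by eventually_elim (use V_sq_integral t in auto)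
  qed
  then show ?thesis using L(1) by (intro exI[of _ "L + L"]) auto
qed

text \<open>The case \<open>g = V\<close> of the first order rule. The envelope supplies mean
  squares of order \<beta> for \<open>V\<close> and of order \<open>\<beta>^3 / n^2\<close> for its
  oscillation on grid cells.\<close>

lemma V_sq_quadrature:
  "\<exists>D. \<forall>n \<beta> t. 1 \<le> \<beta> \<longrightarrow> \<beta> \<le> real n \<longrightarrow> 0 \<le> t \<longrightarrow> t \<le> 1 \<longrightarrow>
     \<bar>integral {0..1} (\<lambda>s. (V \<beta> t 0 s)\<^sup>2) - (\<Sum>i<n. (V \<beta> t 0 (real (Suc i) / real n))\<^sup>2) / real n\<bar> \<le> D * \<beta>\<^sup>2 / real n"
proof (intro exI allI impI)
  fix n :: nat and \<beta> t :: real
  assume \<beta>: "1 \<le> \<beta>" "\<beta> \<le> real n" and t: "0 \<le> t" "t \<le> 1"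
  let ?x = "\<lambda>i. real (Suc i) / real n"
  let ?e = "\<lambda>i. env \<beta> t (?x i)"
  have b0: "\<beta> > 0" using \<beta> by simp
  have rn: "real n > 0" using \<beta> by simp
  have s: "\<beta> * sqrt (\<Lambda> / \<beta>) = sqrt \<Lambda> * sqrt \<beta>" using b0 by (simp add: real_sqrt_divide field_simps)
  define A where "A = C * (sqrt \<Lambda> * sqrt \<beta>)"
  define B where "B = C * exp c * (\<beta> * (sqrt \<Lambda> * sqrt \<beta>))"
  have nn: "A \<ge> 0" "B \<ge> 0" using C_nonneg Lambda_pos b0 by (auto simp: A_def B_def)
  have scaled: "(\<Sum>i<n. (k * ?e i)\<^sup>2) / real n \<le> (k * sqrt (\<Lambda> / \<beta>))\<^sup>2" for k
  proof -
    have "(\<Sum>i<n. (k * ?e i)\<^sup>2) / real n = k\<^sup>2 * ((\<Sum>i<n. (?e i)\<^sup>2) / real n)"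
      by (simp add: power_mult_distrib sum_distrib_left)
    also have "\<dots> \<le> k\<^sup>2 * (\<Lambda> / \<beta>)" by (intro mult_left_mono env_sq_sum b0 \<beta> t) auto
    also have "\<dots> = (k * sqrt (\<Lambda> / \<beta>))\<^sup>2" using Lambda_pos b0 by (simp add: power_mult_distrib)
    finally show ?thesis .
  qed
  have "\<bar>integral {0..1} (\<lambda>s. V \<beta> t 0 s * V \<beta> t 0 s) - (\<Sum>i<n. V \<beta> t 0 (?x i) * V \<beta> t 0 (?x i)) / real n\<bar>
      \<le> C * exp c * sqrt \<Lambda> * sqrt \<beta> * (\<beta> * A + B) / real n"
  proof (rule quadrature_first_order[OF \<beta> t _ _ nn(1) _ nn(2)])
    show "continuous_on {0..1} (V \<beta> t 0)" using V_chain_m m_pos by (auto simp: deriv_chain_def)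
    show "\<bar>V \<beta> t 0 x - V \<beta> t 0 (?x i)\<bar> \<le> C * exp c * \<beta>\<^sup>2 / real n * ?e i" if "i < n" "x \<in> cell n i" for i x
      using V_osc[of 0 \<beta> n i x "?x i" "?x i" t] m_pos b0 \<beta> that
      by (simp add: cell_def divide_right_mono power2_eq_square)
    have "(\<Sum>i<n. (V \<beta> t 0 (?x i))\<^sup>2) \<le> (\<Sum>i<n. (C * \<beta> * ?e i)\<^sup>2)"
      using V_bound[OF b0, of t 0] C_nonneg b0 env_nonneg by (intro sum_mono) (auto simp: abs_le_square_iff[symmetric])
    then have "(\<Sum>i<n. (V \<beta> t 0 (?x i))\<^sup>2) / real n \<le> (C * \<beta> * sqrt (\<Lambda> / \<beta>))\<^sup>2"
      using scaled[of "C * \<beta>"] rn by (meson divide_right_mono less_imp_le order_trans)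
    then show "(\<Sum>i<n. (V \<beta> t 0 (?x i))\<^sup>2) / real n \<le> A\<^sup>2" by (simp only: mult.assoc s A_def)
    have "C * exp c * \<beta>\<^sup>2 / real n * sqrt (\<Lambda> / \<beta>) = B / real n"
      unfolding B_def s[symmetric] by (simp add: power2_eq_square)
    then show "(\<Sum>i<n. (C * exp c * \<beta>\<^sup>2 / real n * ?e i)\<^sup>2) / real n \<le> (B / real n)\<^sup>2"
      using scaled[of "C * exp c * \<beta>\<^sup>2 / real n"] by (simp only:)
  qed
  also have "C * exp c * sqrt \<Lambda> * sqrt \<beta> * (\<beta> * A + B) / real n = (C * exp c * \<Lambda> * (C + C * exp c)) * \<beta>\<^sup>2 / real n"
  proof -
    have "sqrt \<Lambda> * sqrt \<beta> * (\<beta> * A + B) = (sqrt \<Lambda> * sqrt \<Lambda>) * (sqrt \<beta> * sqrt \<beta>) * \<beta> * (C + C * exp c)"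
      by (simp only: A_def B_def algebra_simps)
    also have "\<dots> = \<Lambda> * \<beta> * \<beta> * (C + C * exp c)" using Lambda_pos b0 by simp
    finally have "sqrt \<Lambda> * sqrt \<beta> * (\<beta> * A + B) = \<Lambda> * \<beta> * \<beta> * (C + C * exp c)" .
    then have "C * exp c * sqrt \<Lambda> * sqrt \<beta> * (\<beta> * A + B) = C * exp c * (\<Lambda> * \<beta> * \<beta> * (C + C * exp c))"
      by (simp only: mult.assoc)
    then show ?thesis by (simp add: power2_eq_square mult_ac)
  qed
  finally show "\<bar>integral {0..1} (\<lambda>s. (V \<beta> t 0 s)\<^sup>2) - (\<Sum>i<n. (V \<beta> t 0 (?x i))\<^sup>2) / real n\<bar> \<le> (C * exp c * \<Lambda> * (C + C * exp c)) * \<beta>\<^sup>2 / real n"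
    unfolding power2_eq_square by blast
qed

text \<open>The weights are the fits to unit data, and linearity is derived without uniqueness of
  the coefficients. Their distance to \<open>Q / n\<close> follows by duality: the estimate of
  \<open>estimator_close\<close> holds for all data, in particular for that distance itself.\<close>

lemma weights:
  assumes t: "0 < t" "t < 1" "\<delta> \<le> t" "\<delta> \<le> 1 - t"
  shows "\<exists>D n0. D \<ge> 0 \<and> (\<forall>n K \<beta> \<alpha>. n0 \<le> n \<longrightarrow> n > 0 \<longrightarrow> K dvd n \<longrightarrow> 1 \<le> \<beta> \<longrightarrow> \<beta> \<le> real K \<longrightarrow> \<alpha> * \<beta> ^ (2 * m) = 1
      \<longrightarrow> (\<exists>w. (\<forall>y b. normal_eq n K m \<alpha> y b \<longrightarrow> spline K m b t = (\<Sum>i<n. w i * y (Suc i))) \<and>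
         \<bar>sqrt (real n * (\<Sum>i<n. (w i)\<^sup>2)) - sqrt ((\<Sum>i<n. (V \<beta> t 0 (real (Suc i) / real n))\<^sup>2) / real n)\<bar>
         \<le> D * (sqrt \<beta> * \<beta> ^ m / real K + \<beta> ^ m * exp (- c * \<beta> * \<delta>))))"
proof -
  obtain D n0 where D: "D \<ge> 0" and close: "\<And>n K \<beta> \<alpha> y b Y q. n0 \<le> n \<Longrightarrow> n > 0 \<Longrightarrow> K dvd n \<Longrightarrow> 1 \<le> \<beta> \<Longrightarrow> \<beta> \<le> real K \<Longrightarrow> \<alpha> * \<beta> ^ (2 * m) = 1
      \<Longrightarrow> normal_eq n K m \<alpha> y b \<Longrightarrow> 0 \<le> Y \<Longrightarrow> (\<Sum>i<n. (y (Suc i))\<^sup>2) / real n \<le> Y\<^sup>2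
      \<Longrightarrow> \<forall>k<K. top_deriv K m q k = real K * (V \<beta> t (m - 1) (real (Suc k) / real K) - V \<beta> t (m - 1) (real k / real K))
      \<Longrightarrow> (\<Sum>i<n. (V \<beta> t 0 (real (Suc i) / real n) - spline K m q (real (Suc i) / real n))\<^sup>2) / real n
        \<le> (D1 * sqrt \<beta> * \<beta> ^ m / real K)\<^sup>2
      \<Longrightarrow> \<bar>spline K m b t - (\<Sum>i<n. y (Suc i) * spline K m q (real (Suc i) / real n)) / real n\<bar>
         \<le> D * (sqrt \<beta> * \<beta> ^ m / real K + \<beta> ^ m * exp (- c * \<beta> * \<delta>)) * Y"
    using estimator_close[OF t] by blast
  show ?thesis
  proof (intro exI[of _ "D + D1"] exI[of _ n0] conjI allI impI)
    show "0 \<le> D + D1" using D D1_nonneg by simp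
    fix n K :: nat and \<beta> \<alpha> :: real
    assume n: "n0 \<le> n" "n > 0" and dvd: "K dvd n" and \<beta>: "1 \<le> \<beta>" "\<beta> \<le> real K" and \<alpha>: "\<alpha> * \<beta> ^ (2 * m) = 1"
    have b0: "\<beta> > 0" using \<beta> by simp
    have rn: "real n > 0" using n by simp
    have Kn: "real K \<le> real n" using dvd_imp_le[OF dvd n(2)] by simp
    have \<alpha>0: "\<alpha> > 0" using \<alpha> b0 by (metis zero_less_mult_pos2 zero_less_one zero_less_power)
    obtain q where
      q1: "\<And>k. k < K \<Longrightarrow> top_deriv K m q k = real K * (V \<beta> t (m - 1) (real (Suc k) / real K) - V \<beta> t (m - 1) (real k / real K))" and
      q2: "\<And>n. real K \<le> real n \<Longrightarrow> (\<Sum>i<n. (V \<beta> t 0 (real (Suc i) / real n) - spline K m q (real (Suc i) / real n))\<^sup>2) / real n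
        \<le> (D1 * sqrt \<beta> * \<beta> ^ m / real K)\<^sup>2" and
      q3: "\<And>x. m \<ge> 2 \<Longrightarrow> x \<in> {0..1} \<Longrightarrow> \<bar>V \<beta> t 0 x - spline K m q x\<bar> \<le> C * exp c * \<beta> ^ (m + 2) / (real K)\<^sup>2"
      using V_projection[OF \<beta> less_imp_le[OF t(1)] less_imp_le[OF t(2)]] by blast
    let ?\<Delta> = "sqrt \<beta> * \<beta> ^ m / real K + \<beta> ^ m * exp (- c * \<beta> * \<delta>)"
    let ?x = "\<lambda>i. real (Suc i) / real n"
    define Q where "Q i = spline K m q (?x i)" for i
    have cl: "\<bar>spline K m b t - (\<Sum>i<n. y (Suc i) * Q i) / real n\<bar> \<le> D * ?\<Delta> * Y"
      if "normal_eq n K m \<alpha> y b" "0 \<le> Y" "(\<Sum>i<n. (y (Suc i))\<^sup>2) / real n \<le> Y\<^sup>2" for y b Y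
      unfolding Q_def by (rule close[OF n dvd \<beta> \<alpha> that]) (use q1 q2[OF Kn] in auto)
    obtain B where B: "\<And>l. normal_eq n K m \<alpha> (\<lambda>i. if i = Suc l then 1 else 0) (B l)"
    proof -
      have "\<forall>l. \<exists>b. normal_eq n K m \<alpha> (\<lambda>i. if i = Suc l then 1 else 0) b"
        using normal_eq_solvable[OF \<alpha>0] by blast
      from choice[OF this] that show thesis by blast
    qed
    define w where "w l = spline K m (B l) t" for l
    have lin: "spline K m b t = (\<Sum>i<n. w i * y (Suc i))" if b: "normal_eq n K m \<alpha> y b" for y b
    proof -
      let ?b = "\<lambda>k. b k + (-1) * (\<Sum>l<n. y (Suc l) * B l k)"
      have "normal_eq n K m \<alpha> (\<lambda>i. y i + (-1) * (\<Sum>l<n. y (Suc l) * (if i = Suc l then 1 else 0))) ?b"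
        by (intro normal_eq_add b normal_eq_scale normal_eq_sum B) auto
      then have "normal_eq n K m \<alpha> (\<lambda>_. 0) ?b"
      proof (rule normal_eq_cong)
        fix i assume "i \<in> {1..n}"
        then obtain l where l: "i = Suc l" "l < n" by (cases i) auto
        then show "y i + (-1) * (\<Sum>l<n. y (Suc l) * (if i = Suc l then 1 else 0)) = 0"
          by (simp add: if_distrib cong: if_cong)
      qed
      \<comment> \<open>Zero data admit \<open>Y = 0\<close>, so every solution of the normal
        equations with zero data vanishes at \<open>t\<close>.\<close>
      from cl[OF this, of 0] have "spline K m ?b t = 0" by simp
      then show ?thesis
        unfolding spline_add spline_scale spline_sum[OF finite_lessThan] by (simp add: w_def mult.commute)
    qed
    have dev: "sqrt (real n * (\<Sum>i<n. (w i)\<^sup>2)) \<le> sqrt ((\<Sum>i<n. (V \<beta> t 0 (?x i))\<^sup>2) / real n) + (D + D1) * ?\<Delta> \<and>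
        sqrt ((\<Sum>i<n. (V \<beta> t 0 (?x i))\<^sup>2) / real n) \<le> sqrt (real n * (\<Sum>i<n. (w i)\<^sup>2)) + (D + D1) * ?\<Delta>"
    proof -
      \<comment> \<open>With \<open>z\<close> as data the error functional returns the sum of
        squares of \<open>z\<close>, so the bound \<open>D * \<Delta> * Y\<close> with
        \<open>Y = sqrt (Z / n)\<close> can be divided by \<open>sqrt Z\<close>.\<close>
      define z where "z i = w i - Q i / real n" for i
      define Z where "Z = (\<Sum>i<n. (z i)\<^sup>2)"
      have Z0: "Z \<ge> 0" unfolding Z_def by (intro sum_nonneg) auto
      have \<Delta>0: "?\<Delta> \<ge> 0" using b0 by simp
      obtain b where b: "normal_eq n K m \<alpha> (\<lambda>i. z (i - 1)) b" using normal_eq_solvable[OF \<alpha>0] by blast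
      have "spline K m b t - (\<Sum>i<n. z i * Q i) / real n = Z"
        unfolding lin[OF b] Z_def sum_divide_distrib sum_subtractf[symmetric]
        by (rule sum.cong) (auto simp: z_def power2_eq_square algebra_simps diff_divide_distrib)
      moreover have "(\<Sum>i<n. (z (Suc i - 1))\<^sup>2) / real n \<le> (sqrt (Z / real n))\<^sup>2" using Z0 by (simp add: Z_def)
      ultimately have "Z \<le> D * ?\<Delta> * sqrt (Z / real n)" using cl[OF b, of "sqrt (Z / real n)"] Z0 by simp
      then have zb: "sqrt (real n * Z) \<le> D * ?\<Delta>"
      proof (cases "Z = 0")
        case False
        then have Zp: "sqrt Z > 0" using Z0 by simp
        assume "Z \<le> D * ?\<Delta> * sqrt (Z / real n)"
        then have "sqrt Z * sqrt Z \<le> (D * ?\<Delta> / sqrt (real n)) * sqrt Z" using Z0 by (simp add: real_sqrt_divide)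
        then have "sqrt Z \<le> D * ?\<Delta> / sqrt (real n)" using Zp by (rule mult_right_le_imp_le)
        then show ?thesis using rn by (simp add: real_sqrt_mult field_simps)
      qed (use D \<Delta>0 in auto)
      have L1: "L2_set (\<lambda>i. sqrt (real n) * z i) {..<n} \<le> D * ?\<Delta>"
        using zb rn by (simp add: L2_set_def power_mult_distrib sum_distrib_left[symmetric] Z_def)
      have L2: "L2_set (\<lambda>i. (V \<beta> t 0 (?x i) - Q i) / sqrt (real n)) {..<n} \<le> D1 * ?\<Delta>"
      proof -
        have "(\<Sum>i<n. (V \<beta> t 0 (?x i) - Q i)\<^sup>2) / real n \<le> (D1 * sqrt \<beta> * \<beta> ^ m / real K)\<^sup>2"
          using q2[OF Kn] by (simp add: Q_def)
        then have "sqrt ((\<Sum>i<n. (V \<beta> t 0 (?x i) - Q i)\<^sup>2) / real n) \<le> \<bar>D1 * sqrt \<beta> * \<beta> ^ m / real K\<bar>"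
          using real_sqrt_le_mono by fastforce
        also have "\<dots> = D1 * (sqrt \<beta> * \<beta> ^ m / real K)" using D1_nonneg b0 by simp
        also have "\<dots> \<le> D1 * ?\<Delta>" using D1_nonneg b0 by (intro mult_left_mono) auto
        finally show ?thesis using rn by (simp add: L2_set_def power_divide sum_divide_distrib)
      qed
      define W where "W i = sqrt (real n) * w i" for i
      define U where "U i = V \<beta> t 0 (?x i) / sqrt (real n)" for i
      have sn: "sqrt (real n) * sqrt (real n) = real n" "sqrt (real n) > 0" using rn by auto
      have W: "W i = U i + (sqrt (real n) * z i + - ((V \<beta> t 0 (?x i) - Q i) / sqrt (real n)))" for i
        unfolding W_def U_def z_def using sn by (simp add: field_simps)
      have neg: "L2_set (\<lambda>i. - g i) A = L2_set g A" for g :: "nat \<Rightarrow> real" and A by (simp add: L2_set_def)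
      have R: "L2_set (\<lambda>i. sqrt (real n) * z i + - ((V \<beta> t 0 (?x i) - Q i) / sqrt (real n))) {..<n} \<le> (D + D1) * ?\<Delta>"
        using L2_set_triangle_ineq[of "\<lambda>i. sqrt (real n) * z i" "\<lambda>i. - ((V \<beta> t 0 (?x i) - Q i) / sqrt (real n))" "{..<n}"] L1 L2
        unfolding neg distrib_right by linarith
      have LW: "L2_set W {..<n} = sqrt (real n * (\<Sum>i<n. (w i)\<^sup>2))"
        using rn by (simp add: L2_set_def W_def power_mult_distrib sum_distrib_left)
      have LU: "L2_set U {..<n} = sqrt ((\<Sum>i<n. (V \<beta> t 0 (?x i))\<^sup>2) / real n)"
        using rn by (simp add: L2_set_def U_def power_divide sum_divide_distrib)
      define r where "r i = sqrt (real n) * z i + - ((V \<beta> t 0 (?x i) - Q i) / sqrt (real n))" for i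
      have "L2_set W {..<n} \<le> L2_set U {..<n} + L2_set r {..<n}"
        unfolding W[abs_def, folded r_def] by (rule L2_set_triangle_ineq)
      moreover have "L2_set U {..<n} \<le> L2_set W {..<n} + L2_set r {..<n}"
        using L2_set_triangle_ineq[of W "\<lambda>i. - r i" "{..<n}"] unfolding neg by (simp add: W[folded r_def])
      ultimately show ?thesis using R[folded r_def] unfolding LW LU by linarith
    qed
    show "\<exists>w. (\<forall>y b. normal_eq n K m \<alpha> y b \<longrightarrow> spline K m b t = (\<Sum>i<n. w i * y (Suc i))) \<and>
         \<bar>sqrt (real n * (\<Sum>i<n. (w i)\<^sup>2)) - sqrt ((\<Sum>i<n. (V \<beta> t 0 (real (Suc i) / real n))\<^sup>2) / real n)\<bar>
         \<le> (D + D1) * (sqrt \<beta> * \<beta> ^ m / real K + \<beta> ^ m * exp (- c * \<beta> * \<delta>))"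
      using lin dev by (intro exI[of _ w]) (auto simp: abs_le_iff)
  qed
qed

end

section \<open>Bias for order one\<close>

text \<open>For \<open>m = 1\<close> the estimator is piecewise linear with nodal values \<open>b (Suc j)\<close> at the knots \<open>j / K\<close>, and
  its bilinear form has nonpositive off-diagonal entries. This gives a discrete maximum principle.\<close>

definition lin :: "(nat \<Rightarrow> real) \<Rightarrow> nat \<Rightarrow> real \<Rightarrow> real" where
  "lin p k s = (1 - s) * p k + s * p (Suc k)"

text \<open>The position of a grid point inside its knot cell. The last one equals 1, so a knot is
  itself a grid point.\<close>

definition sl :: "nat \<Rightarrow> nat \<Rightarrow> real" where
  "sl r l = real (Suc l) / real r"

text \<open>Mass matrix on the grid plus \<alpha> times the stiffness matrix, in nodal
  values.\<close>

definition p1_form :: "nat \<Rightarrow> nat \<Rightarrow> real \<Rightarrow> (nat \<Rightarrow> real) \<Rightarrow> (nat \<Rightarrow> real) \<Rightarrow> real" where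
  "p1_form K r \<alpha> p e = (\<Sum>k<K. \<Sum>l<r. lin p k (sl r l) * lin e k (sl r l)) / real (K * r)
     + \<alpha> * real K * (\<Sum>k<K. (p (Suc k) - p k) * (e (Suc k) - e k))"

lemma sl_bounds: "l < r \<Longrightarrow> 0 \<le> sl r l \<and> sl r l \<le> 1"
  by (auto simp: sl_def)

lemma lin_diff: "lin (\<lambda>j. p j - q j) k s = lin p k s - lin q k s"
  by (simp add: lin_def algebra_simps)

lemma p1_form_diff: "p1_form K r \<alpha> (\<lambda>j. p j - q j) e = p1_form K r \<alpha> p e - p1_form K r \<alpha> q e"
proof -
  have eq: "(\<Sum>k<K. (p (Suc k) - q (Suc k) - (p k - q k)) * (e (Suc k) - e k))
      = (\<Sum>k<K. (p (Suc k) - p k) * (e (Suc k) - e k)) - (\<Sum>k<K. (q (Suc k) - q k) * (e (Suc k) - e k))"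
    unfolding sum_subtractf[symmetric] by (rule sum.cong) (auto simp: algebra_simps)
  show ?thesis
    unfolding p1_form_def eq lin_diff left_diff_distrib[of "lin _ _ _"] sum_subtractf
      right_diff_distrib[of "\<alpha> * real K"] diff_divide_distrib by simp
qed

text \<open>For \<open>p\<close> and \<open>e\<close> with disjoint supports only the off-diagonal
  entries act. Those of the mass matrix are at most \<open>1 / (4 * K)\<close>, since
  \<open>(1 - s) * s \<le> 1/4\<close>; those of the stiffness part are
  \<open>- \<alpha> * K\<close>, and the assumption on \<alpha> lets the latter win.\<close>

lemma p1_form_nonpos:
  assumes K: "K > 0" "r > 0" and \<alpha>: "1 / 4 \<le> \<alpha> * (real K)\<^sup>2"
    and p: "\<And>j. p j \<ge> 0" and e: "\<And>j. e j \<ge> 0" and pe: "\<And>j. p j * e j = 0"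
  shows "p1_form K r \<alpha> p e \<le> 0"
proof -
  have rK: "real K > 0" "real r > 0" using K by auto
  define X where "X k = p k * e (Suc k) + p (Suc k) * e k" for k
  have X: "X k \<ge> 0" for k using p e by (simp add: X_def)
  have "(\<Sum>k<K. \<Sum>l<r. lin p k (sl r l) * lin e k (sl r l)) \<le> (\<Sum>k<K. \<Sum>l<r. X k / 4)"
  proof (intro sum_mono)
    fix k l assume "l \<in> {..<r}"
    define s where "s = sl r l"
    have "(1 - s) * s \<le> 1 / 4" using zero_le_power2[of "s - 1 / 2"] by (simp add: power2_eq_square algebra_simps)
    then have "(1 - s) * s * X k \<le> 1 / 4 * X k" using X by (intro mult_right_mono)
    moreover have "lin p k s * lin e k s = (1 - s) * s * X k + (1 - s)\<^sup>2 * (p k * e k) + s\<^sup>2 * (p (Suc k) * e (Suc k))"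
      by (simp add: lin_def X_def power2_eq_square algebra_simps)
    ultimately show "lin p k (sl r l) * lin e k (sl r l) \<le> X k / 4" unfolding s_def using pe by simp
  qed
  then have "(\<Sum>k<K. \<Sum>l<r. lin p k (sl r l) * lin e k (sl r l)) / real (K * r) \<le> (real r * (\<Sum>k<K. X k) / 4) / real (K * r)"
    by (intro divide_right_mono) (auto simp: sum_distrib_left sum_divide_distrib)
  also have "\<dots> = (\<Sum>k<K. X k) / (4 * real K)" using rK by simp
  finally have 1: "(\<Sum>k<K. \<Sum>l<r. lin p k (sl r l) * lin e k (sl r l)) / real (K * r) \<le> (\<Sum>k<K. X k) / (4 * real K)" .
  have 2: "(\<Sum>k<K. (p (Suc k) - p k) * (e (Suc k) - e k)) = - (\<Sum>k<K. X k)"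
    unfolding sum_negf[symmetric]
  proof (rule sum.cong)
    fix k
    have "(p (Suc k) - p k) * (e (Suc k) - e k) = p (Suc k) * e (Suc k) + p k * e k - X k" by (simp add: X_def algebra_simps)
    then show "(p (Suc k) - p k) * (e (Suc k) - e k) = - X k" using pe by simp
  qed simp
  have "1 / (4 * real K) \<le> \<alpha> * real K" using \<alpha> rK by (simp add: field_simps power2_eq_square)
  then have "1 / (4 * real K) * (\<Sum>k<K. X k) \<le> \<alpha> * real K * (\<Sum>k<K. X k)"
    using X by (intro mult_right_mono sum_nonneg)
  then show ?thesis unfolding p1_form_def 2 using 1 by simp
qed

text \<open>The stiffness part forces equal nodal values, and the last grid point of the first cell
  is a knot, where the mass part forces the value 0.\<close>

lemma p1_form_zero:
  assumes K: "K > 0" "r > 0" and \<alpha>: "\<alpha> > 0" and z: "p1_form K r \<alpha> e e \<le> 0" and j: "j \<le> K"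
  shows "e j = 0"
proof -
  have rK: "real K > 0" "real r > 0" using K by auto
  have nn: "0 \<le> (\<Sum>k<K. \<Sum>l<r. lin e k (sl r l) * lin e k (sl r l)) / real (K * r)"
    "0 \<le> \<alpha> * real K * (\<Sum>k<K. (e (Suc k) - e k) * (e (Suc k) - e k))"
    using \<alpha> rK by (auto intro!: divide_nonneg_nonneg mult_nonneg_nonneg[of "\<alpha> * real K"] sum_nonneg)
  then have "(\<Sum>k<K. \<Sum>l<r. lin e k (sl r l) * lin e k (sl r l)) / real (K * r) = 0"
     "\<alpha> * real K * (\<Sum>k<K. (e (Suc k) - e k) * (e (Suc k) - e k)) = 0"
    using z unfolding p1_form_def by linarith+
  then have z1: "(\<Sum>k<K. \<Sum>l<r. lin e k (sl r l) * lin e k (sl r l)) = 0" and z2: "(\<Sum>k<K. (e (Suc k) - e k) * (e (Suc k) - e k)) = 0"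
    using rK \<alpha> K by auto
  have step: "e (Suc k) = e k" if "k < K" for k
  proof -
    have "\<forall>k\<in>{..<K}. (e (Suc k) - e k) * (e (Suc k) - e k) = 0"
      using z2 by (subst (asm) sum_nonneg_eq_0_iff) auto
    then show ?thesis using that by auto
  qed
  have "\<forall>k\<in>{..<K}. (\<Sum>l<r. lin e k (sl r l) * lin e k (sl r l)) = 0"
    using z1 by (subst (asm) sum_nonneg_eq_0_iff) (auto intro: sum_nonneg)
  then have "(\<Sum>l<r. lin e 0 (sl r l) * lin e 0 (sl r l)) = 0" using K by auto
  then have "\<forall>l\<in>{..<r}. lin e 0 (sl r l) * lin e 0 (sl r l) = 0"
    by (subst (asm) sum_nonneg_eq_0_iff) auto
  then have "lin e 0 (sl r (r - 1)) = 0" using K by auto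
  then have "e (Suc 0) = 0" using K by (simp add: lin_def sl_def)
  then have e0: "e 0 = 0" using step[of 0] K by simp
  show ?thesis using j
  proof (induction j)
    case (Suc j)
    then show ?case using step[of j] by simp
  qed (rule e0)
qed

text \<open>The form is tested with the negative part \<open>e\<close> of \<open>w\<close>: the
  positive part contributes nothing positive, so the form vanishes on \<open>e\<close>.\<close>

lemma p1_max_principle:
  assumes K: "K > 0" "r > 0" and \<alpha>: "\<alpha> > 0" "1 / 4 \<le> \<alpha> * (real K)\<^sup>2"
    and w: "\<And>e. (\<And>j. e j \<ge> 0) \<Longrightarrow> p1_form K r \<alpha> w e \<ge> 0" and j: "j \<le> K"
  shows "w j \<ge> 0"
proof -
  define p where "p j = max (w j) 0" for j
  define e where "e j = max (- w j) 0" for j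
  have we: "w = (\<lambda>j. p j - e j)" by (auto simp: p_def e_def fun_eq_iff max_def)
  have "0 \<le> p1_form K r \<alpha> w e" by (rule w) (simp add: e_def)
  also have "\<dots> = p1_form K r \<alpha> p e - p1_form K r \<alpha> e e" by (subst we) (rule p1_form_diff)
  also have "p1_form K r \<alpha> p e \<le> 0" by (rule p1_form_nonpos[OF K \<alpha>(2)]) (auto simp: p_def e_def max_def)
  finally have "p1_form K r \<alpha> e e \<le> 0" by simp
  from p1_form_zero[OF K \<alpha>(1) this j] show ?thesis by (auto simp: e_def max_def split: if_splits)
qed

text \<open>Grid quadrature of the piecewise linear interpolant, that is \<open>u\<close> weighted
  by the row sums of the mass matrix.\<close>

definition lumped :: "nat \<Rightarrow> nat \<Rightarrow> (nat \<Rightarrow> real) \<Rightarrow> real" where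
  "lumped K r u = (\<Sum>k<K. \<Sum>l<r. lin u k (sl r l)) / real (K * r)"

text \<open>At an inner node the shares of the two adjacent cells add up to \<open>1 / K\<close>
  because \<open>1 - s\<close> and \<open>s\<close> do; the end nodes receive one share
  only.\<close>

lemma lumped_eq:
  assumes K: "K > 0" "r > 0"
  obtains a b where "0 \<le> a" "a \<le> 1 / real K" "0 \<le> b" "b \<le> 1 / real K"
    "\<And>u. lumped K r u = (\<Sum>k<K - 1. u (Suc k)) / real K + a * u 0 + b * u K"
proof -
  define a where "a = (\<Sum>l<r. 1 - sl r l)"
  define b where "b = (\<Sum>l<r. sl r l)"
  have ab: "a \<ge> 0" "b \<ge> 0" "a + b = real r"
    using sl_bounds by (auto simp: a_def b_def sum.distrib[symmetric] intro!: sum_nonneg)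
  have "lumped K r u = (\<Sum>k<K - 1. u (Suc k)) / real K + a / real (K * r) * u 0 + b / real (K * r) * u K" for u
  proof -
    have "(\<Sum>k<K. \<Sum>l<r. lin u k (sl r l)) = (\<Sum>k<K. a * u k + b * u (Suc k))"
      by (rule sum.cong) (auto simp: lin_def a_def b_def sum.distrib sum_distrib_right)
    also have "\<dots> = a * (\<Sum>k<K. u k) + b * (\<Sum>k<K. u (Suc k))" by (simp add: sum.distrib sum_distrib_left)
    also have "(\<Sum>k<K. u k) = u 0 + (\<Sum>k<K - 1. u (Suc k))"
      using K by (cases K) (simp, simp only: sum.lessThan_Suc_shift diff_Suc_1)
    also have "(\<Sum>k<K. u (Suc k)) = (\<Sum>k<K - 1. u (Suc k)) + u K"
      using K by (cases K) simp_all
    also have "a * (u 0 + (\<Sum>k<K - 1. u (Suc k))) + b * ((\<Sum>k<K - 1. u (Suc k)) + u K)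
        = real r * (\<Sum>k<K - 1. u (Suc k)) + a * u 0 + b * u K"
      unfolding ab(3)[symmetric] by (simp add: algebra_simps)
    finally show ?thesis unfolding lumped_def using K by (simp add: add_divide_distrib)
  qed
  moreover have "a / real (K * r) \<le> 1 / real K" "b / real (K * r) \<le> 1 / real K"
    using ab K by (simp_all add: field_simps)
  ultimately show ?thesis using that[of "a / real (K * r)" "b / real (K * r)"] ab by auto
qed

section \<open>Nodal form of the order one estimator and difference quotients\<close>

lemma stiffness_by_parts:
  fixes h e :: "nat \<Rightarrow> real"
  assumes "K > 0"
  shows "(\<Sum>k<K. (h (Suc k) - h k) * (e (Suc k) - e k))
     = (h K - h (K - 1)) * e K - (h 1 - h 0) * e 0 - (\<Sum>k<K - 1. (h (Suc (Suc k)) - 2 * h (Suc k) + h k) * e (Suc k))"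
  using assms
proof (induction K rule: nat_induct_non_zero)
  case 1
  then show ?case by (simp add: algebra_simps)
next
  case (Suc K)
  then obtain K' where K': "K = Suc K'" by (cases K) auto
  show ?case using Suc.IH unfolding K' by (simp add: algebra_simps)
qed

lemma spline1_knot:
  assumes "K > 0" "k \<le> K"
  shows "spline K 1 b (real k / real K) = b (Suc k)"
proof -
  have "bspline K 1 (int l) (real k / real K) = (if l = Suc k then 1 else 0)" if "l \<in> {1..K+1}" for l
  proof -
    have "real K * (real k / real K) = real k" using assms by simp
    then show ?thesis unfolding bspline_1[OF assms(1)] by (cases l "Suc k" rule: linorder_cases) auto
  qed
  then have "spline K 1 b (real k / real K) = (\<Sum>l=1..K+1. if l = Suc k then b l else 0)"
    unfolding spline_def by (intro sum.cong) auto
  then show ?thesis using assms by simp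
qed

lemma top_deriv_1: "top_deriv K 1 b k = real K * (b (Suc (Suc k)) - b (Suc k))"
  by (simp add: top_deriv_def forward_diff_def)

lemma spline1_cell:
  assumes "K > 0" "k < K" "x \<in> cell K k"
  shows "spline K 1 b x = lin (\<lambda>j. b (Suc j)) k (x * real K - real k)"
proof -
  have "spline K 1 b x = b (Suc k) + (x - real k / real K) * (real K * (b (Suc (Suc k)) - b (Suc k)))"
    using spline_deriv_chain_linear[OF assms(1) _ assms(2,3), of 1 b] spline1_knot[OF assms(1), of k b] assms(2)
    by (simp add: spline_deriv_chain_0 top_deriv_1[unfolded One_nat_def])
  also have "\<dots> = lin (\<lambda>j. b (Suc j)) k (x * real K - real k)"
    using assms(1) by (simp add: lin_def field_simps)
  finally show ?thesis .
qed

lemma grid_index: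
  assumes "K > 0" "r > 0" "l < r"
  shows "real (Suc (k * r + l)) / real (K * r) = (real k + sl r l) / real K"
    and "real (Suc (k * r + l)) / real (K * r) \<in> cell K k"
proof -
  show e: "real (Suc (k * r + l)) / real (K * r) = (real k + sl r l) / real K"
    using assms by (simp add: sl_def field_simps)
  show "real (Suc (k * r + l)) / real (K * r) \<in> cell K k"
    unfolding e cell_def using sl_bounds[OF assms(3)] assms by (auto simp: divide_right_mono)
qed

lemma spline1_grid:
  assumes "K > 0" "r > 0" "k < K" "l < r"
  shows "spline K 1 b (real (Suc (k * r + l)) / real (K * r)) = lin (\<lambda>j. b (Suc j)) k (sl r l)"
  using spline1_cell[OF assms(1,3) grid_index(2)[OF assms(1,2,4)], of b] assms
  unfolding grid_index(1)[OF assms(1,2,4)] by simp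

lemma grid_sum:
  fixes F :: "nat \<Rightarrow> real"
  shows "(\<Sum>i<K * r. F i) = (\<Sum>k<K. \<Sum>l<r. F (k * r + l))"
proof -
  have "(\<Sum>i<K * r. F i) = (\<Sum>k<K. \<Sum>i\<in>{k * r..<k * r + r}. F i)" by (rule sum.nat_group[symmetric])
  also have "\<dots> = (\<Sum>k<K. \<Sum>l<r. F (k * r + l))"
  proof (rule sum.cong[OF refl])
    fix k
    show "(\<Sum>i\<in>{k * r..<k * r + r}. F i) = (\<Sum>l<r. F (k * r + l))"
      by (rule sum.reindex_bij_witness[of _ "\<lambda>l. k * r + l" "\<lambda>i. i - k * r"]) auto
  qed
  finally show ?thesis .
qed

lemma normal_eq_p1:
  assumes "K > 0" "r > 0" "normal_eq (K * r) K 1 \<alpha> (\<lambda>i. f (real i / real (K * r))) b"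
  shows "p1_form K r \<alpha> (\<lambda>j. b (Suc j)) e
     = (\<Sum>k<K. \<Sum>l<r. f ((real k + sl r l) / real K) * lin e k (sl r l)) / real (K * r)"
proof -
  let ?n = "K * r"
  \<comment> \<open>Node \<open>j\<close> carries coefficient \<open>Suc j\<close>, so the test
    vector is shifted by one.\<close>
  define b' where "b' j = e (j - 1)" for j
  have b': "(\<lambda>j. b' (Suc j)) = e" by (simp add: b'_def fun_eq_iff)
  have rn: "real ?n > 0" "real K > 0" using assms by auto
  have "(\<Sum>i<?n. (f (real (Suc i) / real ?n) - spline K 1 b (real (Suc i) / real ?n)) * spline K 1 b' (real (Suc i) / real ?n))
      = real ?n * \<alpha> / real K * (\<Sum>k<K. top_deriv K 1 b k * top_deriv K 1 b' k)"
    using assms(3) unfolding normal_eq_def sum_atLeast1 by blast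
  also have "(\<Sum>k<K. top_deriv K 1 b k * top_deriv K 1 b' k) = (real K)\<^sup>2 * (\<Sum>k<K. (b (Suc (Suc k)) - b (Suc k)) * (e (Suc k) - e k))"
    unfolding top_deriv_1 sum_distrib_left by (rule sum.cong) (auto simp: b'_def power2_eq_square)
  also have "(\<Sum>i<?n. (f (real (Suc i) / real ?n) - spline K 1 b (real (Suc i) / real ?n)) * spline K 1 b' (real (Suc i) / real ?n))
      = (\<Sum>k<K. \<Sum>l<r. (f ((real k + sl r l) / real K) - lin (\<lambda>j. b (Suc j)) k (sl r l)) * lin e k (sl r l))"
    unfolding grid_sum
  proof (intro sum.cong refl)
    fix k l assume "k \<in> {..<K}" "l \<in> {..<r}"
    then have kl: "k < K" "l < r" by auto
    show "(f (real (Suc (k * r + l)) / real ?n) - spline K 1 b (real (Suc (k * r + l)) / real ?n)) * spline K 1 b' (real (Suc (k * r + l)) / real ?n)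
       = (f ((real k + sl r l) / real K) - lin (\<lambda>j. b (Suc j)) k (sl r l)) * lin e k (sl r l)"
      unfolding spline1_grid[OF assms(1,2) kl] b' unfolding grid_index(1)[OF assms(1,2) kl(2)] ..
  qed
  also have "\<dots> = (\<Sum>k<K. \<Sum>l<r. f ((real k + sl r l) / real K) * lin e k (sl r l)) - (\<Sum>k<K. \<Sum>l<r. lin (\<lambda>j. b (Suc j)) k (sl r l) * lin e k (sl r l))"
    by (simp add: left_diff_distrib sum_subtractf)
  finally have eq: "(\<Sum>k<K. \<Sum>l<r. f ((real k + sl r l) / real K) * lin e k (sl r l)) - (\<Sum>k<K. \<Sum>l<r. lin (\<lambda>j. b (Suc j)) k (sl r l) * lin e k (sl r l))
     = real ?n * \<alpha> / real K * ((real K)\<^sup>2 * (\<Sum>k<K. (b (Suc (Suc k)) - b (Suc k)) * (e (Suc k) - e k)))" by simp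
  have "S2 / N + \<alpha> * L * S3 = S1 / N" if "S1 - S2 = N * \<alpha> / L * (L\<^sup>2 * S3)" "N > 0" "L > 0" for S1 S2 S3 N L :: real
  proof -
    have "S1 = S2 + N * (\<alpha> * L * S3)" using that by (simp add: field_simps power2_eq_square)
    then have "S1 / N = S2 / N + (N * (\<alpha> * L * S3)) / N" by (simp only: add_divide_distrib)
    then show ?thesis using that(2) by simp
  qed
  from this[OF eq rn] show ?thesis unfolding p1_form_def .
qed

lemma deriv_chain_increment:
  assumes F: "deriv_chain m S F" "i < m" and xy: "0 \<le> x" "x \<le> y" "y \<le> 1" and \<epsilon>: "\<epsilon> \<ge> 0"
    and u: "\<And>z. z \<in> {x..y} \<Longrightarrow> \<bar>F (Suc i) z - a\<bar> \<le> \<epsilon>"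
  shows "\<bar>F i y - F i x - a * (y - x)\<bar> \<le> \<epsilon> * (y - x)"
proof -
  have "((\<lambda>z. F (Suc i) z - a) has_integral (F i y - F i x) - (y - x) * a) {x..y}"
    using has_integral_diff[OF deriv_chain_has_integral[OF F xy] has_integral_const_real[of a x y]] xy by simp
  from has_integral_bound_real[OF \<epsilon> finite.emptyI this] u xy show ?thesis by (simp add: mult.commute)
qed

lemma lin_interpolation_error:
  assumes F: "deriv_chain 2 S F" and B: "\<And>x. x \<in> {0..1} \<Longrightarrow> \<bar>F 2 x\<bar> \<le> B"
    and k: "k < K" and s: "0 \<le> s" "s \<le> 1"
  shows "\<bar>lin (\<lambda>j. F 0 (real j / real K)) k s - F 0 ((real k + s) / real K)\<bar> \<le> B / (real K)\<^sup>2"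
proof (cases "s = 0")
  case True
  have "B \<ge> 0" using order_trans[OF abs_ge_zero B[of 0]] by simp
  then show ?thesis using True by (simp add: lin_def)
next
  case False
  have B0: "B \<ge> 0" using order_trans[OF abs_ge_zero B[of 0]] by simp
  have K: "real K > 0" using k by simp
  let ?a = "real k / real K" and ?b = "real (Suc k) / real K" and ?x = "(real k + s) / real K"
  have o: "0 \<le> ?a" "?a < ?b" "?b \<le> 1" "?a < ?x" "?x \<le> ?b"
    using k False s K by (auto simp: divide_strict_right_mono divide_right_mono)
  obtain z1 where z1: "?a < z1" "z1 < ?x" "F 0 ?x - F 0 ?a = (?x - ?a) * F (Suc 0) z1"
    using deriv_chain_mvt[OF F, of 0 ?a ?x] o by auto
  obtain z2 where z2: "?a < z2" "z2 < ?b" "F 0 ?b - F 0 ?a = (?b - ?a) * F (Suc 0) z2"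
    using deriv_chain_mvt[OF F, of 0 ?a ?b] o by auto
  have len: "?b - ?a = 1 / real K" "?x - ?a = s / real K" by (simp_all add: diff_divide_distrib[symmetric])
  have "lin (\<lambda>j. F 0 (real j / real K)) k s - F 0 ?x = s * (F 0 ?b - F 0 ?a) - (F 0 ?x - F 0 ?a)"
    by (simp add: lin_def algebra_simps)
  also have "\<dots> = s / real K * (F 1 z2 - F 1 z1)" unfolding z1(3) z2(3) len by (simp add: algebra_simps)
  finally have e: "\<bar>lin (\<lambda>j. F 0 (real j / real K)) k s - F 0 ?x\<bar> = s / real K * \<bar>F 1 z2 - F 1 z1\<bar>"
    using s K by (simp add: abs_mult)
  have lip: "\<bar>F 1 y - F 1 x\<bar> \<le> B * (1 / real K)" if "?a \<le> x" "x \<le> y" "y \<le> ?b" for x y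
  proof -
    have "\<bar>F 1 y - F 1 x - 0 * (y - x)\<bar> \<le> B * (y - x)"
      using that order_trans[OF o(1) that(1)] order_trans[OF that(3) o(3)] B B0
      by (intro deriv_chain_increment[OF F]) (auto simp: numeral_2_eq_2)
    also have "\<dots> \<le> B * (1 / real K)" using that len B0 by (intro mult_left_mono) auto
    finally show ?thesis by simp
  qed
  have "\<bar>F 1 z2 - F 1 z1\<bar> \<le> B * (1 / real K)"
    using lip[of z1 z2] lip[of z2 z1] z1 z2 o by (cases "z1 \<le> z2") (auto simp: abs_minus_commute)
  then have "s / real K * \<bar>F 1 z2 - F 1 z1\<bar> \<le> 1 / real K * (B * (1 / real K))"
    using s K by (intro mult_mono divide_right_mono) auto
  then show ?thesis unfolding e by (simp add: power2_eq_square)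
qed

text \<open>The mean value theorem for the first difference turns the second difference into
  \<open>h\<close> times an increment of \<open>F 1\<close>, leaving a single integration of
  \<open>F 2\<close>. No continuity of \<open>F 2\<close> is involved.\<close>

lemma second_difference:
  assumes F: "deriv_chain 2 S F" and k: "Suc k < K" and \<epsilon>: "\<epsilon> \<ge> 0"
    and u: "\<And>x. x \<in> {real k / real K..real (Suc (Suc k)) / real K} \<Longrightarrow> x \<in> {0..1} \<Longrightarrow> \<bar>F 2 x - a\<bar> \<le> \<epsilon>"
  shows "\<bar>(real K)\<^sup>2 * (F 0 (real (Suc (Suc k)) / real K) - 2 * F 0 (real (Suc k) / real K) + F 0 (real k / real K)) - a\<bar> \<le> \<epsilon>"
proof -
  have K: "real K > 0" using k by simp
  define h where "h = 1 / real K"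
  have h: "h > 0" using K by (simp add: h_def)
  define x where "x = real k / real K"
  have xs: "real (Suc k) / real K = x + h" "real (Suc (Suc k)) / real K = x + h + h"
    using K by (simp_all add: x_def h_def field_simps)
  have x0: "0 \<le> x" by (simp add: x_def)
  have "real (Suc (Suc k)) \<le> real K" using k by (simp only: of_nat_le_iff)
  then have x1: "x + h + h \<le> 1" using K unfolding xs(2)[symmetric] by simp
  define \<phi> where "\<phi> y = F 0 (y + h) - F 0 y" for y
  have "continuous_on {x..x+h} \<phi>"
    unfolding \<phi>_def using x0 x1 h
    by (intro continuous_intros continuous_on_compose2[OF deriv_chain_continuous[OF F, of 0 "{0..1}"]]) auto
  moreover have "(\<phi> has_derivative (*) (F 1 (y + h) - F 1 y)) (at y)" if "x < y" "y < x + h" for y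
  proof -
    have "(F 0 has_real_derivative F 1 y) (at y)" "(F 0 has_real_derivative F 1 (y + h)) (at (y + h))"
      using that x0 x1 h deriv_chain_has_derivative[OF F, of 0] by auto
    then have "(\<phi> has_real_derivative F 1 (y + h) - F 1 y) (at y)"
      unfolding \<phi>_def by (intro DERIV_diff) (auto simp: DERIV_shift)
    then show ?thesis by (simp add: has_field_derivative_def)
  qed
  ultimately obtain y where y: "x < y" "y < x + h" "\<phi> (x + h) - \<phi> x = (F 1 (y + h) - F 1 y) * (x + h - x)"
    using mvt[of x "x + h" \<phi> "\<lambda>y. (*) (F 1 (y + h) - F 1 y)"] h by auto
  have "\<bar>F 1 (y + h) - F 1 y - a * (y + h - y)\<bar> \<le> \<epsilon> * (y + h - y)"
  proof (rule deriv_chain_increment[OF F _ _ _ _ \<epsilon>])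
    fix z assume z: "z \<in> {y..y + h}"
    have "\<bar>F 2 z - a\<bar> \<le> \<epsilon>"
      by (rule u) (use z y x0 x1 h in \<open>auto simp: x_def[symmetric] xs simp del: of_nat_Suc\<close>)
    then show "\<bar>F (Suc 1) z - a\<bar> \<le> \<epsilon>" by (simp add: numeral_2_eq_2)
  qed (use y x0 x1 h in auto)
  then have d: "\<bar>F 1 (y + h) - F 1 y - a * h\<bar> \<le> \<epsilon> * h" by simp
  have "F 0 (x + h + h) - 2 * F 0 (x + h) + F 0 x = (F 1 (y + h) - F 1 y) * h"
    using y(3) by (simp add: \<phi>_def)
  moreover have "(real K)\<^sup>2 * (w * h) - a = real K * (w - a * h)" for w
    using K by (simp add: h_def power2_eq_square field_simps)
  ultimately have "(real K)\<^sup>2 * (F 0 (x + h + h) - 2 * F 0 (x + h) + F 0 x) - a = real K * (F 1 (y + h) - F 1 y - a * h)"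
    by (simp only:)
  also have "\<bar>\<dots>\<bar> \<le> real K * (\<epsilon> * h)" unfolding abs_mult using d K by (intro mult_mono) auto
  also have "\<dots> = \<epsilon>" using K by (simp add: h_def)
  finally show ?thesis unfolding xs x_def[symmetric] .
qed

section \<open>Exponential barrier and the error at the knots\<close>

lemma p1_form_affine:
  "p1_form K r \<alpha> (\<lambda>j. a + b * h j) e = a * lumped K r e + b * p1_form K r \<alpha> h e"
proof -
  have l: "lin (\<lambda>j. a + b * h j) k s * x = a * x + b * (lin h k s * x)" for k s x
    by (simp add: lin_def algebra_simps)
  have d: "(a + b * h (Suc k) - (a + b * h k)) * x = b * ((h (Suc k) - h k) * x)" for k x
    by (simp add: algebra_simps)
  show ?thesis
    unfolding p1_form_def lumped_def l d sum.distrib sum_distrib_left[symmetric]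
    by (simp add: add_divide_distrib algebra_simps)
qed

text \<open>The rate \<open>\<beta> / 2\<close> is half the critical one:
  \<open>exp (- \<beta> s)\<close> solves \<open>h = \<alpha> h''\<close>, while at half the rate
  \<open>\<alpha> h'' = h / 4\<close>. This slack pays for the discretisation in the interior, and
  the slopes at the two ends leave a boundary term of order
  \<open>\<alpha> * \<beta>\<close>.\<close>

lemma p1_barrier:
  assumes K: "K \<ge> 2" "r > 0" and \<beta>: "1 \<le> \<beta>" "\<beta> \<le> real K" "exp (- \<beta> / 4) \<le> 1 / 4" and \<alpha>: "\<alpha> * \<beta>\<^sup>2 = 1"
    and e: "\<And>j. e j \<ge> 0"
  defines "\<rho> \<equiv> exp (- \<beta> / (2 * real K))"
  shows "\<alpha> * \<beta> / 8 * (e 0 + e K) \<le> p1_form K r \<alpha> (\<lambda>j. \<rho> ^ j + \<rho> ^ (K - j)) e"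
proof -
  have rK: "real K > 0" "K > 0" using K by auto
  have b0: "\<beta> > 0" using \<beta> by simp
  have \<alpha>0: "\<alpha> > 0" using \<alpha> b0 by (metis zero_less_mult_pos2 zero_less_one zero_less_power)
  define x where "x = \<beta> / (2 * real K)"
  have x: "0 < x" "x \<le> 1 / 2" using b0 \<beta> rK by (auto simp: x_def field_simps)
  have \<rho>x: "\<rho> = exp (- x)" by (simp add: \<rho>_def x_def)
  have \<rho>: "0 < \<rho>" "\<rho> < 1" using x by (auto simp: \<rho>x)
  have r1: "1 - x \<le> \<rho>" unfolding \<rho>x using exp_ge_add_one_self[of "- x"] by simp
  have r2: "x / 2 \<le> 1 - \<rho>"
  proof -
    have "1 + x \<le> exp x" by (rule exp_ge_add_one_self)
    then have "\<rho> * (1 + x) \<le> \<rho> * exp x" using \<rho> by (intro mult_left_mono) auto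
    then have "\<rho> * (1 + x) \<le> 1" by (simp add: \<rho>x exp_minus)
    also have "1 \<le> (1 - x / 2) * (1 + x)"
    proof -
      have "x * x \<le> x * 1" using x by (intro mult_left_mono) auto
      then show ?thesis by (simp add: algebra_simps)
    qed
    finally show ?thesis using x by (simp add: mult_le_cancel_right)
  qed
  define h where "h j = \<rho> ^ j + \<rho> ^ (K - j)" for j
  have h0: "h j \<ge> 0" for j using \<rho> by (simp add: h_def)
  have hs: "\<rho> * h k \<le> h (Suc k)" "\<rho> * h (Suc k) \<le> h k" "\<rho> * h k \<le> h k" "\<rho> * h (Suc k) \<le> h (Suc k)" if k: "k < K" for k
  proof -
    have Kk: "K - k = Suc (K - Suc k)" using k by simp
    have le: "\<rho> * (\<rho> * p) \<le> p" "\<rho> * p \<le> p" if "p \<ge> 0" for p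
    proof -
      show 1: "\<rho> * p \<le> p" using \<rho> that by (simp add: mult_left_le_one_le)
      have "\<rho> * (\<rho> * p) \<le> \<rho> * p" using \<rho> that 1 by (intro mult_left_mono) auto
      then show "\<rho> * (\<rho> * p) \<le> p" using 1 by linarith
    qed
    have p: "\<rho> ^ k \<ge> 0" "\<rho> ^ (K - Suc k) \<ge> 0" using \<rho> by auto
    show "\<rho> * h k \<le> h (Suc k)" "\<rho> * h (Suc k) \<le> h k"
      unfolding h_def Kk power_Suc distrib_left using le[OF p(1)] le[OF p(2)] by auto
    show "\<rho> * h k \<le> h k" "\<rho> * h (Suc k) \<le> h (Suc k)" using le h0 by auto
  qed
  \<comment> \<open>Neighbouring values of \<open>h\<close> differ by a factor of at most
    \<open>1 / \<rho>\<close>, so moving the evaluation of \<open>h\<close> from a grid point to a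
    node costs no more than a factor \<rho>.\<close>
  have mass: "\<rho> * lumped K r (\<lambda>j. h j * e j) \<le> (\<Sum>k<K. \<Sum>l<r. lin h k (sl r l) * lin e k (sl r l)) / real (K * r)"
    unfolding lumped_def times_divide_eq_right sum_distrib_left
  proof (intro divide_right_mono sum_mono)
    fix k l assume kl: "k \<in> {..<K}" "l \<in> {..<r}"
    then have s: "0 \<le> sl r l" "sl r l \<le> 1" using sl_bounds by auto
    have a: "\<rho> * h k \<le> lin h k (sl r l)" "\<rho> * h (Suc k) \<le> lin h k (sl r l)"
    proof -
      have conv: "p \<le> lin h k (sl r l)" if "p \<le> h k" "p \<le> h (Suc k)" for p
      proof -
        have "p = (1 - sl r l) * p + sl r l * p" by (simp add: algebra_simps)
        also have "\<dots> \<le> lin h k (sl r l)" unfolding lin_def using that s by (intro add_mono mult_left_mono) auto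
        finally show ?thesis .
      qed
      show "\<rho> * h k \<le> lin h k (sl r l)" "\<rho> * h (Suc k) \<le> lin h k (sl r l)"
        using hs kl by (auto intro!: conv)
    qed
    have "\<rho> * lin (\<lambda>j. h j * e j) k (sl r l) = (1 - sl r l) * e k * (\<rho> * h k) + sl r l * e (Suc k) * (\<rho> * h (Suc k))"
      by (simp add: lin_def algebra_simps)
    also have "\<dots> \<le> (1 - sl r l) * e k * lin h k (sl r l) + sl r l * e (Suc k) * lin h k (sl r l)"
      using a s e by (intro add_mono mult_left_mono mult_nonneg_nonneg) auto
    also have "\<dots> = lin h k (sl r l) * lin e k (sl r l)" by (simp add: lin_def algebra_simps)
    finally show "\<rho> * lin (\<lambda>j. h j * e j) k (sl r l) \<le> lin h k (sl r l) * lin e k (sl r l)" .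
  qed simp
  obtain a b where ab: "0 \<le> a" "0 \<le> b" and lump: "\<And>u. lumped K r u = (\<Sum>k<K - 1. u (Suc k)) / real K + a * u 0 + b * u K"
    using lumped_eq[OF rK(2) K(2)] by metis
  define I where "I = (\<Sum>k<K - 1. h (Suc k) * e (Suc k))"
  have I0: "I \<ge> 0" unfolding I_def using h0 e by (intro sum_nonneg) auto
  have m1: "\<rho> * (I / real K) \<le> (\<Sum>k<K. \<Sum>l<r. lin h k (sl r l) * lin e k (sl r l)) / real (K * r)"
  proof -
    have "I / real K \<le> lumped K r (\<lambda>j. h j * e j)" unfolding lump I_def using ab h0 e by simp
    then have "\<rho> * (I / real K) \<le> \<rho> * lumped K r (\<lambda>j. h j * e j)" using \<rho> by (intro mult_left_mono) auto
    then show ?thesis using mass by linarith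
  qed
  \<comment> \<open>Both geometric sequences are eigenvectors of the second difference with the same
    eigenvalue.\<close>
  have D2: "h (Suc (Suc k)) - 2 * h (Suc k) + h k = h (Suc k) * ((1 - \<rho>)\<^sup>2 / \<rho>)" if "k < K - 1" for k
  proof -
    define q where "q = K - Suc (Suc k)"
    have Kk: "K - Suc (Suc k) = q" "K - Suc k = Suc q" "K - k = Suc (Suc q)" using that by (auto simp: q_def)
    show ?thesis unfolding h_def Kk using \<rho> by (simp add: field_simps power2_eq_square)
  qed
  have bd: "h K - h (K - 1) = (1 - \<rho>) * (1 - \<rho> ^ (K - 1))" "h 1 - h 0 = - ((1 - \<rho>) * (1 - \<rho> ^ (K - 1)))"
  proof -
    obtain K' where K': "K = Suc K'" using rK by (cases K) auto
    show "h K - h (K - 1) = (1 - \<rho>) * (1 - \<rho> ^ (K - 1))" "h 1 - h 0 = - ((1 - \<rho>) * (1 - \<rho> ^ (K - 1)))"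
      unfolding h_def K' by (simp_all add: algebra_simps)
  qed
  \<comment> \<open>The slope of \<open>h\<close> at the ends. The assumption
    \<open>exp (- \<beta> / 4) \<le> 1 / 4\<close> keeps the exponential from the far end from
    cancelling it.\<close>
  define Z where "Z = (1 - \<rho>) * (1 - \<rho> ^ (K - 1))"
  have Z: "\<beta> / (8 * real K) \<le> Z"
  proof -
    have "\<rho> ^ (K - 1) = exp (- (real (K - 1) * x))" unfolding \<rho>x by (simp add: exp_of_nat_mult[symmetric])
    also have "\<dots> \<le> exp (- \<beta> / 4)"
    proof -
      have "real K / 2 \<le> real (K - 1)" using K by (simp add: of_nat_diff)
      then have "real K / 2 * x \<le> real (K - 1) * x" using x by (intro mult_right_mono) auto
      moreover have "real K / 2 * x = \<beta> / 4" using rK by (simp add: x_def)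
      ultimately have "\<beta> / 4 \<le> real (K - 1) * x" by linarith
      then show ?thesis by simp
    qed
    finally have "1 / 2 \<le> 1 - \<rho> ^ (K - 1)" using \<beta>(3) by linarith
    then have "x / 2 * (1 / 2) \<le> Z" unfolding Z_def using r2 x \<rho> by (intro mult_mono) auto
    then show ?thesis by (simp add: x_def)
  qed
  have st: "(\<Sum>k<K. (h (Suc k) - h k) * (e (Suc k) - e k)) = Z * (e 0 + e K) - (1 - \<rho>)\<^sup>2 / \<rho> * I"
  proof -
    have "(\<Sum>k<K - 1. (h (Suc (Suc k)) - 2 * h (Suc k) + h k) * e (Suc k)) = (1 - \<rho>)\<^sup>2 / \<rho> * I"
      unfolding I_def sum_distrib_left by (rule sum.cong) (use D2 in \<open>auto simp: mult_ac\<close>)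
    then show ?thesis unfolding stiffness_by_parts[OF rK(2)] bd Z_def[symmetric] by (simp add: algebra_simps)
  qed
  \<comment> \<open>The negative interior part of the stiffness term is absorbed by the lumped mass;
    this rests on \<open>\<rho> \<ge> 1/2\<close>, that is on
    \<open>\<beta> \<le> K\<close>.\<close>
  have key: "\<alpha> * real K * ((1 - \<rho>)\<^sup>2 / \<rho>) \<le> \<rho> / real K"
  proof -
    have "real K * (1 - \<rho>) \<le> \<beta> * \<rho>"
    proof -
      have "real K * (1 - \<rho>) \<le> real K * x" using r1 rK by (intro mult_left_mono) auto
      also have "\<dots> = \<beta> * (1 / 2)" using rK by (simp add: x_def)
      also have "\<dots> \<le> \<beta> * \<rho>" using r1 x b0 by (intro mult_left_mono) auto
      finally show ?thesis .
    qed
    then have "(real K * (1 - \<rho>))\<^sup>2 \<le> (\<beta> * \<rho>)\<^sup>2" using rK \<rho> by (intro power_mono) auto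
    then have "\<alpha> * (real K * (1 - \<rho>))\<^sup>2 \<le> \<alpha> * (\<beta> * \<rho>)\<^sup>2" using \<alpha>0 by (intro mult_left_mono) auto
    also have "\<dots> = \<rho>\<^sup>2" using \<alpha> by (simp add: power_mult_distrib mult.assoc[symmetric])
    finally have "\<alpha> * (real K)\<^sup>2 * (1 - \<rho>)\<^sup>2 \<le> \<rho>\<^sup>2" by (simp add: power_mult_distrib mult.assoc)
    then show ?thesis using rK \<rho> by (simp add: field_simps power2_eq_square)
  qed
  have "\<alpha> * real K * ((1 - \<rho>)\<^sup>2 / \<rho>) * I \<le> \<rho> / real K * I" using key I0 by (intro mult_right_mono)
  moreover have "\<alpha> * real K * (\<beta> / (8 * real K) * (e 0 + e K)) \<le> \<alpha> * real K * (Z * (e 0 + e K))"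
    using Z e \<alpha>0 rK by (intro mult_left_mono mult_right_mono add_nonneg_nonneg) auto
  moreover have "\<alpha> * real K * (\<beta> / (8 * real K) * (e 0 + e K)) = \<alpha> * \<beta> / 8 * (e 0 + e K)" using rK by simp
  moreover have "p1_form K r \<alpha> h e = (\<Sum>k<K. \<Sum>l<r. lin h k (sl r l) * lin e k (sl r l)) / real (K * r)
      + (\<alpha> * real K * (Z * (e 0 + e K)) - \<alpha> * real K * ((1 - \<rho>)\<^sup>2 / \<rho>) * I)"
    unfolding p1_form_def st right_diff_distrib[of "\<alpha> * real K"] by (simp only: mult.assoc)
  moreover have "\<rho> * (I / real K) = \<rho> / real K * I" by simp
  ultimately have "\<alpha> * \<beta> / 8 * (e 0 + e K) \<le> p1_form K r \<alpha> h e"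
    using m1 by linarith
  then show ?thesis unfolding h_def[abs_def] .
qed

text \<open>Formally \<open>(1 - \<alpha> D^2) b = f\<close> gives
  \<open>b = f + \<alpha> f''\<close> to first order. The correction uses \<psi> instead of
  \<open>f''\<close>, because the consistency error contains two derivatives of the correction. The
  residual of \<open>f + \<alpha> \<psi>\<close> is dominated by the form applied to a constant plus
  a multiple of the barrier.\<close>

lemma p1_nodal_error:
  assumes K: "K \<ge> 2" "r > 0" and \<beta>: "1 \<le> \<beta>" "\<beta> \<le> real K" "exp (- \<beta> / 4) \<le> 1 / 4" and \<alpha>: "\<alpha> * \<beta>\<^sup>2 = 1"
    and f: "deriv_chain 2 S f" "\<And>i x. i \<le> 2 \<Longrightarrow> x \<in> {0..1} \<Longrightarrow> \<bar>f i x\<bar> \<le> B"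
    and \<psi>: "deriv_chain 2 T \<psi>" "\<And>i x. i \<le> 2 \<Longrightarrow> x \<in> {0..1} \<Longrightarrow> \<bar>\<psi> i x\<bar> \<le> P"
    and \<epsilon>: "\<And>x. x \<in> {0..1} \<Longrightarrow> \<bar>f 2 x - \<psi> 0 x\<bar> \<le> \<epsilon>"
    and ne: "normal_eq (K * r) K 1 \<alpha> (\<lambda>i. f 0 (real i / real (K * r))) b" and j: "j \<le> K"
  defines "\<rho> \<equiv> exp (- \<beta> / (2 * real K))"
  shows "\<bar>b (Suc j) - (f 0 (real j / real K) + \<alpha> * \<psi> 0 (real j / real K))\<bar>
     \<le> (B / (real K)\<^sup>2 + \<alpha> * (\<epsilon> + 2 * P / real K + \<alpha> * P)) + 8 * (B + 2 * P) / \<beta> * (\<rho> ^ j + \<rho> ^ (K - j))"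
proof -
  have rK: "real K > 0" "K > 0" using K by auto
  have b0: "\<beta> > 0" using \<beta> by simp
  have \<alpha>0: "\<alpha> > 0" using \<alpha> b0 by (metis zero_less_mult_pos2 zero_less_one zero_less_power)
  have \<alpha>1: "\<alpha> \<le> 1"
  proof -
    have "\<alpha> * 1 \<le> \<alpha> * \<beta>\<^sup>2" using \<alpha>0 \<beta> by (intro mult_left_mono) auto
    then show ?thesis using \<alpha> by simp
  qed
  have \<alpha>K: "1 / 4 \<le> \<alpha> * (real K)\<^sup>2"
  proof -
    have "\<alpha> * \<beta>\<^sup>2 \<le> \<alpha> * (real K)\<^sup>2" using \<alpha>0 \<beta> by (intro mult_left_mono power_mono) auto
    then show ?thesis using \<alpha> by simp
  qed
  have B0: "B \<ge> 0" using order_trans[OF abs_ge_zero f(2)[of 0 0]] by simp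
  have P0: "P \<ge> 0" using order_trans[OF abs_ge_zero \<psi>(2)[of 0 0]] by simp
  have e0: "\<epsilon> \<ge> 0" using order_trans[OF abs_ge_zero \<epsilon>[of 0]] by simp
  let ?f = "\<lambda>j. f 0 (real j / real K)" and ?g = "\<lambda>j. \<psi> 0 (real j / real K)"
  define v where "v j = ?f j + \<alpha> * ?g j" for j
  define z where "z j = b (Suc j) - v j" for j
  \<comment> \<open>\<open>B / K^2\<close> is the interpolation error of \<open>f\<close>,
    \<epsilon> the distance from \<open>f''\<close> to \<psi>. One \<open>P / K\<close> stems from
    lumping the mass, the other from moving \<psi> to the middle node, and
    \<open>\<alpha> * P\<close> from the second difference of \<psi>.\<close>
  define \<eta> where "\<eta> = B / (real K)\<^sup>2 + \<alpha> * (\<epsilon> + 2 * P / real K + \<alpha> * P)"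
  define h where "h j = \<rho> ^ j + \<rho> ^ (K - j)" for j
  have in01: "real j / real K \<in> {0..1}" if "j \<le> K" for j using that rK by auto
  have step: "\<bar>F 0 (real (Suc k) / real K) - F 0 (real k / real K)\<bar> \<le> M / real K"
    if F: "deriv_chain 2 U F" "\<And>x. x \<in> {0..1} \<Longrightarrow> \<bar>F 1 x\<bar> \<le> M" and k: "k < K" for F U M k
  proof -
    have M0: "M \<ge> 0" using order_trans[OF abs_ge_zero F(2)[of 0]] by simp
    have l: "real (Suc k) / real K - real k / real K = 1 / real K" by (simp add: diff_divide_distrib[symmetric])
    have "\<bar>F 0 (real (Suc k) / real K) - F 0 (real k / real K) - 0 * (real (Suc k) / real K - real k / real K)\<bar>
        \<le> M * (real (Suc k) / real K - real k / real K)"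
    proof (rule deriv_chain_increment[OF F(1) _ _ _ _ M0])
      fix x assume x: "x \<in> {real k / real K..real (Suc k) / real K}"
      have "x \<in> {0..1}" using x in01[OF less_imp_le[OF k]] in01[OF Suc_leI[OF k]] unfolding atLeastAtMost_iff by linarith
      then show "\<bar>F (Suc 0) x - 0\<bar> \<le> M" using F(2) by simp
    qed (use k in01[of "Suc k"] in \<open>auto simp: divide_right_mono simp del: of_nat_Suc\<close>)
    then show ?thesis unfolding l by simp
  qed
  \<comment> \<open>Consistency: the interior residual is measured by the lumped mass of
    \<open>e\<close>, the boundary residual by the end values of \<open>e\<close>. The factor
    \<open>B + 2 * P\<close> consists of the end slopes of \<open>f + \<alpha> \<psi>\<close> and
    the end masses of \<psi>.\<close>
  have main: "\<bar>p1_form K r \<alpha> z e\<bar> \<le> \<eta> * lumped K r e + \<alpha> * (B + 2 * P) * (e 0 + e K)" if e: "\<And>j. e j \<ge> 0" for e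
  proof -
    let ?n = "real (K * r)"
    obtain a b' where ab: "0 \<le> a" "a \<le> 1 / real K" "0 \<le> b'" "b' \<le> 1 / real K"
      and lump: "\<And>u. lumped K r u = (\<Sum>k<K - 1. u (Suc k)) / real K + a * u 0 + b' * u K"
      using lumped_eq[OF rK(2) K(2)] by metis
    define I where "I = (\<Sum>k<K - 1. e (Suc k)) / real K"
    have I0: "I \<ge> 0" unfolding I_def using e by (intro divide_nonneg_nonneg sum_nonneg) auto
    have IL: "I \<le> lumped K r e" unfolding lump I_def using ab e by simp
    have L0: "lumped K r e \<ge> 0" using I0 IL by linarith
    have le0: "lin e k (sl r l) \<ge> 0" if "l < r" for k l using sl_bounds[OF that] e by (simp add: lin_def)
    define T1 where "T1 = (\<Sum>k<K. \<Sum>l<r. (f 0 ((real k + sl r l) / real K) - lin ?f k (sl r l)) * lin e k (sl r l)) / ?n"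
    define T2 where "T2 = (\<Sum>k<K. \<Sum>l<r. lin ?g k (sl r l) * lin e k (sl r l)) / ?n"
    define T3 where "T3 = (\<Sum>k<K. (v (Suc k) - v k) * (e (Suc k) - e k))"
    have lumpsum: "\<bar>(\<Sum>k<K. \<Sum>l<r. X k l) / ?n\<bar> \<le> M * lumped K r e"
      if X: "\<And>k l. k < K \<Longrightarrow> l < r \<Longrightarrow> \<bar>X k l\<bar> \<le> M * lin e k (sl r l)" for X M
    proof -
      have "\<bar>\<Sum>k<K. \<Sum>l<r. X k l\<bar> \<le> (\<Sum>k<K. \<Sum>l<r. M * lin e k (sl r l))"
        by (rule order_trans[OF sum_abs sum_mono], rule order_trans[OF sum_abs sum_mono]) (use X in auto)
      then have "\<bar>\<Sum>k<K. \<Sum>l<r. X k l\<bar> / ?n \<le> (\<Sum>k<K. \<Sum>l<r. M * lin e k (sl r l)) / ?n"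
        by (intro divide_right_mono) auto
      then show ?thesis by (simp add: lumped_def sum_distrib_left)
    qed
    have t1: "\<bar>T1\<bar> \<le> B / (real K)\<^sup>2 * lumped K r e"
      unfolding T1_def
    proof (rule lumpsum)
      fix k l assume kl: "k < K" "l < r"
      have "\<bar>lin ?f k (sl r l) - f 0 ((real k + sl r l) / real K)\<bar> \<le> B / (real K)\<^sup>2"
        by (rule lin_interpolation_error[OF f(1)]) (use f(2) kl sl_bounds in auto)
      then show "\<bar>(f 0 ((real k + sl r l) / real K) - lin ?f k (sl r l)) * lin e k (sl r l)\<bar> \<le> B / (real K)\<^sup>2 * lin e k (sl r l)"
        unfolding abs_mult using le0[OF kl(2)] by (intro mult_mono) (auto simp: abs_minus_commute)
    qed
    have t2: "\<bar>T2 - lumped K r (\<lambda>j. ?g j * e j)\<bar> \<le> P / real K * lumped K r e"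
    proof -
      have "T2 - lumped K r (\<lambda>j. ?g j * e j) = (\<Sum>k<K. \<Sum>l<r. lin ?g k (sl r l) * lin e k (sl r l) - lin (\<lambda>j. ?g j * e j) k (sl r l)) / ?n"
        unfolding T2_def lumped_def by (simp add: sum_subtractf diff_divide_distrib)
      also have "\<bar>\<dots>\<bar> \<le> P / real K * lumped K r e"
      proof (rule lumpsum)
        fix k l assume kl: "k < K" "l < r"
        let ?s = "sl r l"
        define d where "d = ?g (Suc k) - ?g k"
        have d: "\<bar>d\<bar> \<le> P / real K" unfolding d_def by (rule step[OF \<psi>(1)]) (use \<psi>(2) kl in auto)
        have s: "0 \<le> ?s" "?s \<le> 1" using sl_bounds[OF kl(2)] by auto
        have "lin ?g k ?s * lin e k ?s - lin (\<lambda>j. ?g j * e j) k ?s = (1 - ?s) * e k * (?s * d) + ?s * e (Suc k) * (- ((1 - ?s) * d))"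
          by (simp add: lin_def d_def algebra_simps)
        also have "\<bar>\<dots>\<bar> \<le> (1 - ?s) * e k * (P / real K) + ?s * e (Suc k) * (P / real K)"
        proof (rule order_trans[OF abs_triangle_ineq], rule add_mono)
          have 1: "?s * \<bar>d\<bar> \<le> 1 * (P / real K)" using s d by (intro mult_mono) auto
          show "\<bar>(1 - ?s) * e k * (?s * d)\<bar> \<le> (1 - ?s) * e k * (P / real K)"
            using mult_left_mono[OF 1, of "(1 - ?s) * e k"] s e by (simp add: abs_mult)
          have 2: "(1 - ?s) * \<bar>d\<bar> \<le> 1 * (P / real K)" using s d by (intro mult_mono) auto
          show "\<bar>?s * e (Suc k) * (- ((1 - ?s) * d))\<bar> \<le> ?s * e (Suc k) * (P / real K)"
            using mult_left_mono[OF 2, of "?s * e (Suc k)"] s e by (simp add: abs_mult)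
        qed
        also have "\<dots> = P / real K * lin e k ?s" by (simp add: lin_def algebra_simps add_divide_distrib diff_divide_distrib)
        finally show "\<bar>lin ?g k ?s * lin e k ?s - lin (\<lambda>j. ?g j * e j) k ?s\<bar> \<le> P / real K * lin e k ?s" .
      qed
      finally show ?thesis .
    qed
    \<comment> \<open>The leading term: it occurs in the mass of \<open>\<alpha> \<psi>\<close> and
      in the second difference of \<open>f\<close> with opposite signs and cancels.\<close>
    define G where "G = (\<Sum>k<K - 1. ?g (Suc k) * e (Suc k)) / real K"
    have t2': "\<bar>lumped K r (\<lambda>j. ?g j * e j) - G\<bar> \<le> P * (e 0 + e K)"
    proof -
      have "lumped K r (\<lambda>j. ?g j * e j) - G = a * (?g 0 * e 0) + b' * (?g K * e K)" unfolding lump G_def by simp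
      moreover have "\<bar>a * (?g 0 * e 0)\<bar> \<le> 1 * (P * e 0)"
        unfolding abs_mult using ab e \<psi>(2)[OF _ in01[of 0]] K P0
        by (intro mult_mono) (auto intro: order_trans[of a "1 / real K" 1])
      moreover have "\<bar>b' * (?g K * e K)\<bar> \<le> 1 * (P * e K)"
        unfolding abs_mult using ab e \<psi>(2)[OF _ in01[of K]] K P0
        by (intro mult_mono) (auto intro: order_trans[of b' "1 / real K" 1])
      ultimately show ?thesis by (simp add: distrib_left)
    qed
    define W where "W k = (real K)\<^sup>2 * (v (Suc (Suc k)) - 2 * v (Suc k) + v k) - ?g (Suc k)" for k
    have W: "\<bar>W k\<bar> \<le> \<epsilon> + P / real K + \<alpha> * P" if k: "k < K - 1" for k
    proof -
      have k': "Suc k < K" using k by simp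
      have 1: "\<bar>(real K)\<^sup>2 * (?f (Suc (Suc k)) - 2 * ?f (Suc k) + ?f k) - ?g (Suc k)\<bar> \<le> \<epsilon> + P / real K"
      proof (rule second_difference[OF f(1) k'])
        show "0 \<le> \<epsilon> + P / real K" using e0 P0 by simp
        fix x assume x: "x \<in> {real k / real K..real (Suc (Suc k)) / real K}" "x \<in> {0..1}"
        have m: "real (Suc k) / real K = real k / real K + 1 / real K" "real (Suc (Suc k)) / real K = real (Suc k) / real K + 1 / real K"
          by (simp_all add: add_divide_distrib)
        let ?y = "real (Suc k) / real K"
        have y01: "?y \<in> {0..1}" using in01[of "Suc k"] k' by simp
        have inc: "\<bar>\<psi> 0 q - \<psi> 0 p\<bar> \<le> P * (1 / real K)" if "p \<le> q" "q \<le> p + 1 / real K" "p \<in> {0..1}" "q \<in> {0..1}" for p q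
        proof -
          have "\<bar>\<psi> 0 q - \<psi> 0 p - 0 * (q - p)\<bar> \<le> P * (q - p)"
            using that \<psi>(2)[of 1] P0 by (intro deriv_chain_increment[OF \<psi>(1)]) auto
          also have "\<dots> \<le> P * (1 / real K)" using that P0 by (intro mult_left_mono) auto
          finally show ?thesis by simp
        qed
        have "\<bar>\<psi> 0 x - \<psi> 0 ?y\<bar> \<le> P * (1 / real K)"
        proof (cases "x \<le> ?y")
          case True
          have "?y \<le> x + 1 / real K" using x(1) unfolding m(1) atLeastAtMost_iff by linarith
          from inc[OF True this x(2) y01] show ?thesis by (simp only: abs_minus_commute)
        next
          case False
          then have le: "?y \<le> x" by simp
          have "x \<le> ?y + 1 / real K" using x(1) unfolding m(2) atLeastAtMost_iff by blast
          from inc[OF le this y01 x(2)] show ?thesis .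
        qed
        then show "\<bar>f 2 x - ?g (Suc k)\<bar> \<le> \<epsilon> + P / real K" using \<epsilon>[OF x(2)] by (simp del: of_nat_Suc)
      qed
      have 2: "\<bar>(real K)\<^sup>2 * (?g (Suc (Suc k)) - 2 * ?g (Suc k) + ?g k) - 0\<bar> \<le> P"
        by (rule second_difference[OF \<psi>(1) k' P0]) (use \<psi>(2) in auto)
      have "W k = ((real K)\<^sup>2 * (?f (Suc (Suc k)) - 2 * ?f (Suc k) + ?f k) - ?g (Suc k))
          + \<alpha> * ((real K)\<^sup>2 * (?g (Suc (Suc k)) - 2 * ?g (Suc k) + ?g k) - 0)"
        by (simp add: W_def v_def algebra_simps)
      moreover have "\<bar>\<alpha> * ((real K)\<^sup>2 * (?g (Suc (Suc k)) - 2 * ?g (Suc k) + ?g k) - 0)\<bar> \<le> \<alpha> * P"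
        unfolding abs_mult using 2 \<alpha>0 by (intro mult_mono) auto
      ultimately show ?thesis using 1 by linarith
    qed
    define J where "J = (\<Sum>k<K - 1. W k * e (Suc k)) / real K"
    have J: "\<bar>J\<bar> \<le> (\<epsilon> + P / real K + \<alpha> * P) * I"
    proof -
      have "\<bar>\<Sum>k<K - 1. W k * e (Suc k)\<bar> \<le> (\<Sum>k<K - 1. (\<epsilon> + P / real K + \<alpha> * P) * e (Suc k))"
        by (rule order_trans[OF sum_abs sum_mono]) (use W e in \<open>auto simp: abs_mult intro!: mult_right_mono\<close>)
      then have "\<bar>\<Sum>k<K - 1. W k * e (Suc k)\<bar> / real K \<le> (\<Sum>k<K - 1. (\<epsilon> + P / real K + \<alpha> * P) * e (Suc k)) / real K"
        by (intro divide_right_mono) auto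
      then show ?thesis by (simp add: J_def I_def sum_distrib_left)
    qed
    have vb: "real K * \<bar>v (Suc k) - v k\<bar> \<le> B + P" if k: "k < K" for k
    proof -
      have "\<bar>?f (Suc k) - ?f k\<bar> \<le> B / real K" by (rule step[OF f(1)]) (use f(2) k in auto)
      moreover have "\<bar>?g (Suc k) - ?g k\<bar> \<le> P / real K" by (rule step[OF \<psi>(1)]) (use \<psi>(2) k in auto)
      then have "\<alpha> * \<bar>?g (Suc k) - ?g k\<bar> \<le> 1 * (P / real K)" using \<alpha>0 \<alpha>1 by (intro mult_mono) auto
      then have "\<bar>\<alpha> * (?g (Suc k) - ?g k)\<bar> \<le> P / real K" using \<alpha>0 by (simp add: abs_mult)
      moreover have "v (Suc k) - v k = (?f (Suc k) - ?f k) + \<alpha> * (?g (Suc k) - ?g k)" by (simp add: v_def algebra_simps)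
      ultimately have "\<bar>v (Suc k) - v k\<bar> \<le> (B + P) / real K" unfolding add_divide_distrib by linarith
      then show ?thesis using rK by (simp add: pos_le_divide_eq mult.commute)
    qed
    define Q1 where "Q1 = real K * ((v K - v (K - 1)) * e K)"
    define Q0 where "Q0 = real K * ((v 1 - v 0) * e 0)"
    have q1: "\<bar>Q1\<bar> \<le> (B + P) * e K"
    proof -
      have "real K * \<bar>v K - v (K - 1)\<bar> \<le> B + P" using vb[of "K - 1"] rK by simp
      then have "(real K * \<bar>v K - v (K - 1)\<bar>) * e K \<le> (B + P) * e K" using e by (intro mult_right_mono)
      then show ?thesis using e by (simp add: Q1_def abs_mult mult.assoc)
    qed
    have q0: "\<bar>Q0\<bar> \<le> (B + P) * e 0"
    proof -
      have "(real K * \<bar>v 1 - v 0\<bar>) * e 0 \<le> (B + P) * e 0" using e vb[of 0] rK by (intro mult_right_mono) auto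
      then show ?thesis using e by (simp add: Q0_def abs_mult mult.assoc)
    qed
    have t3: "real K * T3 = Q1 - Q0 - (J + G)"
    proof -
      have "(\<Sum>k<K - 1. (v (Suc (Suc k)) - 2 * v (Suc k) + v k) * e (Suc k)) = (\<Sum>k<K - 1. (W k * e (Suc k) + ?g (Suc k) * e (Suc k)) / (real K)\<^sup>2)"
        using rK by (intro sum.cong refl) (simp add: W_def field_simps del: of_nat_Suc)
      also have "\<dots> = ((\<Sum>k<K - 1. W k * e (Suc k)) + (\<Sum>k<K - 1. ?g (Suc k) * e (Suc k))) / (real K)\<^sup>2"
        by (simp only: sum_divide_distrib[symmetric] sum.distrib)
      finally have fin: "(\<Sum>k<K - 1. (v (Suc (Suc k)) - 2 * v (Suc k) + v k) * e (Suc k)) = ((\<Sum>k<K - 1. W k * e (Suc k)) + (\<Sum>k<K - 1. ?g (Suc k) * e (Suc k))) / (real K)\<^sup>2" .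
      have "real K * (\<Sum>k<K - 1. (v (Suc (Suc k)) - 2 * v (Suc k) + v k) * e (Suc k)) = J + G"
      proof -
        have "real K * ((p + q) / (real K)\<^sup>2) = p / real K + q / real K" for p q :: real
          using rK by (simp add: field_simps power2_eq_square)
        then show ?thesis unfolding fin by (simp only: J_def G_def)
      qed
      then show ?thesis unfolding T3_def stiffness_by_parts[OF rK(2)] Q1_def Q0_def by (simp add: right_diff_distrib)
    qed
    have "p1_form K r \<alpha> z e = T1 - \<alpha> * T2 - \<alpha> * (real K * T3)"
    proof -
      have l: "lin v k s = lin ?f k s + \<alpha> * lin ?g k s" for k s by (simp add: lin_def v_def algebra_simps)
      have "p1_form K r \<alpha> z e = p1_form K r \<alpha> (\<lambda>j. b (Suc j)) e - p1_form K r \<alpha> v e"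
        unfolding z_def by (rule p1_form_diff)
      also have "p1_form K r \<alpha> v e = (\<Sum>k<K. \<Sum>l<r. lin ?f k (sl r l) * lin e k (sl r l)) / ?n + \<alpha> * T2 + \<alpha> * (real K * T3)"
        unfolding p1_form_def T2_def T3_def l distrib_right sum.distrib
        by (simp add: add_divide_distrib sum_distrib_left mult.assoc)
      also have "p1_form K r \<alpha> (\<lambda>j. b (Suc j)) e = (\<Sum>k<K. \<Sum>l<r. f 0 ((real k + sl r l) / real K) * lin e k (sl r l)) / ?n"
        by (rule normal_eq_p1[OF rK(2) K(2) ne])
      finally show ?thesis unfolding T1_def left_diff_distrib sum_subtractf diff_divide_distrib by simp
    qed
    also have "\<dots> = T1 + \<alpha> * (- (T2 - lumped K r (\<lambda>j. ?g j * e j)) - (lumped K r (\<lambda>j. ?g j * e j) - G) + J - Q1 + Q0)"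
      unfolding t3 by (simp add: algebra_simps)
    also have "\<bar>\<dots>\<bar> \<le> B / (real K)\<^sup>2 * lumped K r e + \<alpha> * (P / real K * lumped K r e + P * (e 0 + e K) + (\<epsilon> + P / real K + \<alpha> * P) * I + (B + P) * e K + (B + P) * e 0)"
    proof (rule order_trans[OF abs_triangle_ineq], rule add_mono[OF t1])
      show "\<bar>\<alpha> * (- (T2 - lumped K r (\<lambda>j. ?g j * e j)) - (lumped K r (\<lambda>j. ?g j * e j) - G) + J - Q1 + Q0)\<bar>
        \<le> \<alpha> * (P / real K * lumped K r e + P * (e 0 + e K) + (\<epsilon> + P / real K + \<alpha> * P) * I + (B + P) * e K + (B + P) * e 0)"
        unfolding abs_mult using \<alpha>0 t2 t2' J q1 q0 by (intro mult_mono) auto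
    qed
    also have "\<dots> \<le> B / (real K)\<^sup>2 * lumped K r e + \<alpha> * (P / real K * lumped K r e + P * (e 0 + e K) + (\<epsilon> + P / real K + \<alpha> * P) * lumped K r e + (B + P) * e K + (B + P) * e 0)"
      using IL \<alpha>0 e0 P0 by (intro add_mono mult_left_mono order_refl) auto
    also have "\<dots> = \<eta> * lumped K r e + \<alpha> * (B + 2 * P) * (e 0 + e K)"
      by (simp add: \<eta>_def algebra_simps)
    finally show ?thesis .
  qed
  have barrier: "\<eta> * lumped K r e + \<alpha> * (B + 2 * P) * (e 0 + e K) \<le> p1_form K r \<alpha> (\<lambda>j. \<eta> + 8 * (B + 2 * P) / \<beta> * h j) e"
    if e: "\<And>j. e j \<ge> 0" for e
  proof -
    have "8 * (B + 2 * P) / \<beta> * (\<alpha> * \<beta> / 8 * (e 0 + e K)) \<le> 8 * (B + 2 * P) / \<beta> * p1_form K r \<alpha> h e"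
      unfolding h_def[abs_def] \<rho>_def using B0 P0 b0 by (intro mult_left_mono p1_barrier K \<beta> \<alpha> e) auto
    moreover have "8 * (B + 2 * P) / \<beta> * (\<alpha> * \<beta> / 8 * (e 0 + e K)) = \<alpha> * (B + 2 * P) * (e 0 + e K)" using b0 by (simp add: field_simps)
    ultimately show ?thesis unfolding p1_form_affine by linarith
  qed
  let ?\<phi> = "\<lambda>j. \<eta> + 8 * (B + 2 * P) / \<beta> * h j"
  \<comment> \<open>The maximum principle is used for the majorant minus the error and for the
    majorant plus the error.\<close>
  have "(\<lambda>j. ?\<phi> j - z j) j \<ge> 0"
  proof (rule p1_max_principle[OF rK(2) K(2) \<alpha>0 \<alpha>K _ j])
    fix e :: "nat \<Rightarrow> real" assume e: "\<And>j. e j \<ge> 0"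
    show "0 \<le> p1_form K r \<alpha> (\<lambda>j. ?\<phi> j - z j) e"
      unfolding p1_form_diff using main[of e, OF e] barrier[of e, OF e] by linarith
  qed
  moreover have "(\<lambda>j. ?\<phi> j - (v j - b (Suc j))) j \<ge> 0"
  proof (rule p1_max_principle[OF rK(2) K(2) \<alpha>0 \<alpha>K _ j])
    fix e :: "nat \<Rightarrow> real" assume e: "\<And>j. e j \<ge> 0"
    have "p1_form K r \<alpha> (\<lambda>j. v j - b (Suc j)) e = - p1_form K r \<alpha> z e"
      unfolding z_def p1_form_diff by simp
    then show "0 \<le> p1_form K r \<alpha> (\<lambda>j. ?\<phi> j - (v j - b (Suc j))) e"
      using main[of e, OF e] barrier[of e, OF e] p1_form_diff[of K r \<alpha> ?\<phi> "\<lambda>j. v j - b (Suc j)" e] by linarith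
  qed
  ultimately show ?thesis
    unfolding \<eta>_def[symmetric] h_def[symmetric] v_def[symmetric] z_def by (simp add: abs_le_iff)
qed

text \<open>The value at \<open>t\<close> is a convex combination of the two neighbouring nodal
  values, up to interpolation errors of \<open>f\<close> and \<psi>. A cell is shorter than
  \<open>\<delta> / 2\<close>, so both nodes keep distance \<open>\<delta> / 2\<close> from the
  ends, where the barrier has decayed to \<open>exp (- \<delta> * \<beta> / 4)\<close>.\<close>

lemma p1_bias_at:
  assumes K: "K \<ge> 2" "r > 0" and \<beta>: "1 \<le> \<beta>" "\<beta> \<le> real K" "exp (- \<beta> / 4) \<le> 1 / 4" and \<alpha>: "\<alpha> * \<beta>\<^sup>2 = 1"
    and f: "deriv_chain 2 S f" "\<And>i x. i \<le> 2 \<Longrightarrow> x \<in> {0..1} \<Longrightarrow> \<bar>f i x\<bar> \<le> B"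
    and \<psi>: "deriv_chain 2 T \<psi>" "\<And>i x. i \<le> 2 \<Longrightarrow> x \<in> {0..1} \<Longrightarrow> \<bar>\<psi> i x\<bar> \<le> P"
    and \<epsilon>: "\<And>x. x \<in> {0..1} \<Longrightarrow> \<bar>f 2 x - \<psi> 0 x\<bar> \<le> \<epsilon>"
    and ne: "normal_eq (K * r) K 1 \<alpha> (\<lambda>i. f 0 (real i / real (K * r))) b"
    and t: "t \<in> {0..1}" "\<delta> \<le> t" "\<delta> \<le> 1 - t" "1 / real K \<le> \<delta> / 2"
  shows "\<bar>spline K 1 b t - f 0 t - \<alpha> * \<psi> 0 t\<bar>
     \<le> 2 * B / (real K)\<^sup>2 + \<alpha> * (\<epsilon> + 2 * P / real K + \<alpha> * P + P / (real K)\<^sup>2) + 16 * (B + 2 * P) / \<beta> * exp (- (\<delta> / 4) * \<beta>)"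
proof -
  have rK: "real K > 0" "K > 0" using K by auto
  have b0: "\<beta> > 0" using \<beta> by simp
  have \<alpha>0: "\<alpha> > 0" using \<alpha> b0 by (metis zero_less_mult_pos2 zero_less_one zero_less_power)
  have B0: "B \<ge> 0" using order_trans[OF abs_ge_zero f(2)[of 0 0]] by simp
  have P0: "P \<ge> 0" using order_trans[OF abs_ge_zero \<psi>(2)[of 0 0]] by simp
  obtain k where k: "k < K" "t \<in> cell K k" using ex_cell[OF rK(2) t(1)] by blast
  define s where "s = t * real K - real k"
  have "real k \<le> t * real K" "t * real K \<le> real k + 1" using k rK by (auto simp: cell_def field_simps)
  then have s: "0 \<le> s" "s \<le> 1" by (auto simp: s_def)
  have ts: "(real k + s) / real K = t" using rK by (simp add: s_def)
  let ?f = "\<lambda>j. f 0 (real j / real K)" and ?g = "\<lambda>j. \<psi> 0 (real j / real K)"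
  define \<rho> where "\<rho> = exp (- \<beta> / (2 * real K))"
  define \<eta> where "\<eta> = B / (real K)\<^sup>2 + \<alpha> * (\<epsilon> + 2 * P / real K + \<alpha> * P)"
  define X where "X = \<eta> + 16 * (B + 2 * P) / \<beta> * exp (- (\<delta> / 4) * \<beta>)"
  have pw: "\<rho> ^ i \<le> exp (- (\<delta> / 4) * \<beta>)" if "\<delta> / 2 * real K \<le> real i" for i
  proof -
    have "\<rho> ^ i = exp (- (real i * \<beta> / (2 * real K)))" unfolding \<rho>_def exp_of_nat_mult[symmetric] by simp
    moreover have "\<delta> / 4 * \<beta> \<le> real i * \<beta> / (2 * real K)"
    proof -
      have "\<delta> / 2 * real K * \<beta> \<le> real i * \<beta>" using that b0 by (intro mult_right_mono) auto
      then show ?thesis using rK by (simp add: field_simps)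
    qed
    ultimately show ?thesis by simp
  qed
  have Kd: "1 \<le> \<delta> / 2 * real K" using t(4) rK by (simp add: field_simps)
  have tK: "\<delta> * real K \<le> t * real K" "\<delta> * real K \<le> real K - t * real K"
    using mult_right_mono[OF t(2), of "real K"] mult_right_mono[OF t(3), of "real K"] rK by (simp_all add: algebra_simps)
  have nodal: "\<bar>b (Suc j) - (?f j + \<alpha> * ?g j)\<bar> \<le> X" if j: "j = k \<or> j = Suc k" for j
  proof -
    have jK: "j \<le> K" using j k by auto
    have rj: "real (K - j) = real K - real j" using jK by (simp add: of_nat_diff)
    have "\<rho> ^ j \<le> exp (- (\<delta> / 4) * \<beta>)"
    proof (rule pw)
      have "real j \<ge> real k" using j by auto
      then show "\<delta> / 2 * real K \<le> real j" using s(2) Kd tK(1) unfolding s_def by linarith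
    qed
    moreover have "\<rho> ^ (K - j) \<le> exp (- (\<delta> / 4) * \<beta>)"
    proof (rule pw)
      have "real j \<le> real k + 1" using j by auto
      then show "\<delta> / 2 * real K \<le> real (K - j)" unfolding rj using s(1) Kd tK(2) unfolding s_def by linarith
    qed
    ultimately have "8 * (B + 2 * P) / \<beta> * (\<rho> ^ j + \<rho> ^ (K - j)) \<le> 8 * (B + 2 * P) / \<beta> * (exp (- (\<delta> / 4) * \<beta>) + exp (- (\<delta> / 4) * \<beta>))"
      using B0 P0 b0 by (intro mult_left_mono add_mono) auto
    moreover have "8 * (B + 2 * P) / \<beta> * (exp (- (\<delta> / 4) * \<beta>) + exp (- (\<delta> / 4) * \<beta>)) = 16 * (B + 2 * P) / \<beta> * exp (- (\<delta> / 4) * \<beta>)"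
      by (simp add: field_simps)
    moreover have "\<bar>b (Suc j) - (?f j + \<alpha> * ?g j)\<bar> \<le> \<eta> + 8 * (B + 2 * P) / \<beta> * (\<rho> ^ j + \<rho> ^ (K - j))"
      unfolding \<eta>_def \<rho>_def
      by (rule p1_nodal_error[OF K \<beta> \<alpha> f(1) _ \<psi>(1) _ _ ne jK]) (use f(2) \<psi>(2) \<epsilon> in auto)
    ultimately show ?thesis unfolding X_def by linarith
  qed
  have "spline K 1 b t - f 0 t - \<alpha> * \<psi> 0 t = (1 - s) * (b (Suc k) - (?f k + \<alpha> * ?g k)) + s * (b (Suc (Suc k)) - (?f (Suc k) + \<alpha> * ?g (Suc k)))
      + (lin ?f k s - f 0 t) + \<alpha> * (lin ?g k s - \<psi> 0 t)"
    unfolding spline1_cell[OF rK(2) k] s_def[symmetric] by (simp add: lin_def algebra_simps)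
  moreover have "\<bar>(1 - s) * (b (Suc k) - (?f k + \<alpha> * ?g k))\<bar> \<le> (1 - s) * X"
    unfolding abs_mult using s nodal[of k] by (intro mult_mono) auto
  moreover have "\<bar>s * (b (Suc (Suc k)) - (?f (Suc k) + \<alpha> * ?g (Suc k)))\<bar> \<le> s * X"
    unfolding abs_mult using s nodal[of "Suc k"] by (intro mult_mono) auto
  moreover have "\<bar>lin ?f k s - f 0 t\<bar> \<le> B / (real K)\<^sup>2"
    using lin_interpolation_error[OF f(1) f(2)[of 2] k(1) s] ts by simp
  moreover have "\<bar>\<alpha> * (lin ?g k s - \<psi> 0 t)\<bar> \<le> \<alpha> * (P / (real K)\<^sup>2)"
    unfolding abs_mult using lin_interpolation_error[OF \<psi>(1) \<psi>(2)[of 2] k(1) s] ts \<alpha>0 by (intro mult_mono) auto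
  ultimately have "\<bar>spline K 1 b t - f 0 t - \<alpha> * \<psi> 0 t\<bar> \<le> (1 - s) * X + s * X + B / (real K)\<^sup>2 + \<alpha> * (P / (real K)\<^sup>2)" by linarith
  also have "(1 - s) * X + s * X = X" by (simp add: algebra_simps)
  finally show ?thesis unfolding X_def \<eta>_def by (simp add: algebra_simps)
qed

section \<open>Limits\<close>

text \<open>The common form of both parts of the theorem: the growth conditions on the knots enter
  through \<open>ratio_top\<close>, the smallness of \<alpha> through
  \<open>\<beta>_top\<close>.\<close>

locale penalized_regime =
  fixes m :: nat and N K :: "nat \<Rightarrow> nat" and \<alpha> \<beta> :: "nat \<Rightarrow> real"
  assumes m1: "m \<ge> 1" and N_pos: "\<And>j. N j > 0" and K_dvd: "\<And>j. K j dvd N j"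
    and N_top: "filterlim N at_top sequentially"
    and \<beta>_top: "filterlim \<beta> at_top sequentially"
    and \<alpha>_eq: "\<And>j. \<alpha> j * \<beta> j ^ (2 * m) = 1"
    and ratio_top: "(\<lambda>j. \<beta> j ^ (2 * m - 1) / real (K j)) \<longlonglongrightarrow> 0"
begin

lemma K_pos: "K j > 0"
  using N_pos[of j] K_dvd[of j] by (auto intro: Nat.gr0I)

lemma \<beta>_ge: "eventually (\<lambda>j. x \<le> \<beta> j) sequentially"
  using \<beta>_top by (simp add: filterlim_at_top)

lemma N_ge: "eventually (\<lambda>j. n \<le> N j) sequentially"
  using N_top by (simp add: filterlim_at_top)

lemma ratio: "p \<le> 2 * m - 1 \<Longrightarrow> (\<lambda>j. \<beta> j ^ p / real (K j)) \<longlonglongrightarrow> 0"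
proof (rule tendsto_sandwich[OF _ _ tendsto_const ratio_top])
  assume p: "p \<le> 2 * m - 1"
  show "eventually (\<lambda>j. 0 \<le> \<beta> j ^ p / real (K j)) sequentially"
    using \<beta>_ge[of 0] by eventually_elim simp
  show "eventually (\<lambda>j. \<beta> j ^ p / real (K j) \<le> \<beta> j ^ (2 * m - 1) / real (K j)) sequentially"
    using \<beta>_ge[of 1] by eventually_elim (use p in \<open>auto intro!: divide_right_mono power_increasing\<close>)
qed

lemma power_le_K: "p \<le> 2 * m - 1 \<Longrightarrow> eventually (\<lambda>j. \<beta> j ^ p \<le> real (K j)) sequentially"
proof -
  assume "p \<le> 2 * m - 1"
  then have "eventually (\<lambda>j. \<beta> j ^ p / real (K j) < 1) sequentially"
    by (intro order_tendstoD(2)[OF ratio]) auto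
  then show ?thesis by eventually_elim (use K_pos in \<open>auto simp: divide_less_eq\<close>)
qed

lemma inverse_K: "(\<lambda>j. 1 / real (K j)) \<longlonglongrightarrow> 0"
  using ratio[of 0] by simp

lemma K_le_N: "real (K j) \<le> real (N j)"
  using dvd_imp_le[OF K_dvd N_pos] by simp

lemma \<alpha>_pos: "eventually (\<lambda>j. \<alpha> j > 0) sequentially"
  using \<beta>_ge[of 1]
proof eventually_elim
  case (elim j)
  then have "\<beta> j ^ (2 * m) > 0" by simp
  then show ?case using \<alpha>_eq[of j] by (metis zero_less_mult_pos2 zero_less_one)
qed

lemma inverse_\<alpha>: "1 / \<alpha> j = \<beta> j ^ (2 * m)"
  using \<alpha>_eq[of j] by (auto simp: divide_eq_eq mult.commute)

lemma \<beta>_exp: "k > 0 \<Longrightarrow> (\<lambda>j. \<beta> j ^ p * exp (- k * \<beta> j)) \<longlonglongrightarrow> 0"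
  using filterlim_compose[OF power_exp_decay \<beta>_top] .

lemma \<alpha>_0: "\<alpha> \<longlonglongrightarrow> 0"
proof -
  have "filterlim (\<lambda>j. \<beta> j ^ (2 * m)) at_top sequentially"
    using m1 by (intro filterlim_pow_at_top \<beta>_top) auto
  then have "(\<lambda>j. inverse (\<beta> j ^ (2 * m))) \<longlonglongrightarrow> 0" by (rule tendsto_inverse_0_at_top)
  moreover have "inverse (\<beta> j ^ (2 * m)) = \<alpha> j" for j
    unfolding inverse_\<alpha>[symmetric] by simp
  ultimately show ?thesis by simp
qed

text \<open>The second derivative of \<open>f\<close> is merely continuous, so \<psi> is a
  polynomial within \<epsilon> of it. The bound \<open>P\<close> for the derivatives of this
  polynomial depends on \<epsilon>, but it multiplies null sequences only.\<close>

lemma bias_limit_1: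
  assumes m: "m = 1" and t: "0 < t" "t < 1"
    and f: "deriv_chain 2 S f" "\<And>i x. i \<le> 2 \<Longrightarrow> x \<in> {0..1} \<Longrightarrow> \<bar>f i x\<bar> \<le> B" "continuous_on {0..1} (f 2)"
    and ne: "eventually (\<lambda>j. normal_eq (N j) (K j) 1 (\<alpha> j) (\<lambda>i. f 0 (real i / real (N j))) (b j)) sequentially"
  shows "(\<lambda>j. (spline (K j) 1 (b j) t - f 0 t) / \<alpha> j) \<longlonglongrightarrow> f 2 t"
proof (rule tendstoI)
  fix e :: real assume e: "e > 0"
  define \<epsilon> where "\<epsilon> = e / 4"
  have \<epsilon>0: "\<epsilon> > 0" using e by (simp add: \<epsilon>_def)
  obtain p where p: "polynomial_function p" "\<forall>x\<in>{0..1}. norm (f 2 x - p x) < \<epsilon>"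
    using Stone_Weierstrass_polynomial_function[OF _ f(3) \<epsilon>0] by auto
  obtain p' where p': "real_polynomial_function p'" "\<And>x. (p has_real_derivative p' x) (at x)"
    using has_real_derivative_polynomial_function[of p] p(1) by (auto simp: real_polynomial_function_eq)
  obtain p'' where p'': "real_polynomial_function p''" "\<And>x. (p' has_real_derivative p'' x) (at x)"
    using has_real_derivative_polynomial_function[OF p'(1)] by auto
  define \<psi> where "\<psi> i = (if i = 0 then p else if i = 1 then p' else p'')" for i :: nat
  have cont: "continuous_on {0..1} (\<psi> i)" for i
  proof -
    have "continuous_on {0..1} p''"
      using p''(1) by (simp add: continuous_on_polymonial_function real_polynomial_function_eq)
    moreover have "continuous_on {0..1} p" "continuous_on {0..1} p'"
      using p'(2) p''(2) by (meson DERIV_isCont continuous_at_imp_continuous_on)+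
    ultimately show ?thesis by (simp add: \<psi>_def)
  qed
  have \<psi>: "deriv_chain 2 {} \<psi>"
    unfolding deriv_chain_def
  proof (intro conjI allI impI ballI)
    fix i :: nat and x :: real assume "i < 2"
    then have "i = 0 \<or> i = 1" by auto
    then show "(\<psi> i has_real_derivative \<psi> (Suc i) x) (at x)" using p'(2) p''(2) by (auto simp: \<psi>_def)
  qed (use cont in auto)
  obtain P where P: "\<And>i x. i \<le> 2 \<Longrightarrow> x \<in> {0..1} \<Longrightarrow> \<bar>\<psi> i x\<bar> \<le> P"
  proof -
    have "\<exists>M. \<forall>x\<in>{0..1}. \<bar>\<psi> i x\<bar> \<le> M" for i
      using compact_imp_bounded[OF compact_continuous_image[OF cont compact_Icc]] unfolding bounded_iff by fastforce
    then obtain M where M: "\<And>i x. x \<in> {0..1} \<Longrightarrow> \<bar>\<psi> i x\<bar> \<le> M i" by metis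
    show ?thesis
      by (rule that[of "Max (M ` {..2})"]) (use M in \<open>auto intro!: order_trans[OF M Max_ge]\<close>)
  qed
  define \<delta> where "\<delta> = min t (1 - t)"
  have \<delta>: "\<delta> > 0" "\<delta> \<le> t" "\<delta> \<le> 1 - t" using t by (auto simp: \<delta>_def)
  \<comment> \<open>The bound of \<open>p1_bias_at\<close> divided by
    \<open>\<alpha> = \<beta> ^ (- 2)\<close>; its limit is \<epsilon>.\<close>
  define Q where "Q j = 2 * B * (\<beta> j ^ 1 / real (K j))\<^sup>2 + (\<epsilon> + 2 * P * (1 / real (K j)) + \<alpha> j * P + P * (1 / real (K j))\<^sup>2)
      + 16 * (B + 2 * P) * (\<beta> j ^ 1 * exp (- (\<delta> / 4) * \<beta> j))" for j
  have "Q \<longlonglongrightarrow> 2 * B * 0\<^sup>2 + (\<epsilon> + 2 * P * 0 + 0 * P + P * 0\<^sup>2) + 16 * (B + 2 * P) * 0"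
    unfolding Q_def using m \<delta>(1) by (intro tendsto_intros ratio inverse_K \<alpha>_0 \<beta>_exp) auto
  then have "eventually (\<lambda>j. Q j < 2 * \<epsilon>) sequentially" using \<epsilon>0 by (intro order_tendstoD(2)) auto
  moreover have "eventually (\<lambda>j. exp (- (1 / 4) * \<beta> j) < 1 / 4) sequentially"
    using \<beta>_exp[of "1 / 4" 0] by (intro order_tendstoD(2)[where y = 0]) auto
  moreover have "eventually (\<lambda>j. 1 / real (K j) < \<delta> / 2) sequentially"
    using \<delta> by (intro order_tendstoD(2)[OF inverse_K]) auto
  moreover have "eventually (\<lambda>j. \<beta> j ^ 1 \<le> real (K j)) sequentially" using m by (intro power_le_K) auto
  ultimately show "eventually (\<lambda>j. dist ((spline (K j) 1 (b j) t - f 0 t) / \<alpha> j) (f 2 t) < e) sequentially"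
    using ne \<beta>_ge[of 2] \<alpha>_pos
  proof eventually_elim
    case (elim j)
    define r where "r = N j div K j"
    have r: "N j = K j * r" "r > 0" using K_dvd[of j] N_pos[of j] K_pos[of j] by (auto simp: r_def div_greater_zero_iff dvd_imp_le)
    have b0: "\<beta> j > 0" using elim by simp
    have K2: "K j \<ge> 2" using elim by simp
    have \<alpha>: "\<alpha> j * (\<beta> j)\<^sup>2 = 1" using \<alpha>_eq[of j] m by simp
    have ea: "exp (- \<beta> j / 4) \<le> 1 / 4" using elim by simp
    have "\<bar>spline (K j) 1 (b j) t - f 0 t - \<alpha> j * \<psi> 0 t\<bar>
       \<le> 2 * B / (real (K j))\<^sup>2 + \<alpha> j * (\<epsilon> + 2 * P / real (K j) + \<alpha> j * P + P / (real (K j))\<^sup>2) + 16 * (B + 2 * P) / \<beta> j * exp (- (\<delta> / 4) * \<beta> j)"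
      by (rule p1_bias_at[OF K2 r(2) _ _ ea \<alpha> f(1) _ \<psi>])
        (use elim f(2) P p(2) r t \<delta> in \<open>auto simp: \<psi>_def less_imp_le\<close>)
    also have "\<dots> = \<alpha> j * Q j"
    proof -
      have i: "1 = \<alpha> j * (\<beta> j)\<^sup>2" using \<alpha> by simp
      have "2 * B / (real (K j))\<^sup>2 = \<alpha> j * (2 * B * (\<beta> j ^ 1 / real (K j))\<^sup>2)"
        using \<alpha> by (simp add: power_divide mult.left_commute[of "\<alpha> j"])
      moreover have "16 * (B + 2 * P) / \<beta> j * exp (- (\<delta> / 4) * \<beta> j) = \<alpha> j * (16 * (B + 2 * P) * (\<beta> j ^ 1 * exp (- (\<delta> / 4) * \<beta> j)))"
      proof -
        have "1 / \<beta> j = \<alpha> j * \<beta> j" using \<alpha> b0 by (simp add: field_simps power2_eq_square)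
        then have "16 * (B + 2 * P) * (1 / \<beta> j) * exp (- (\<delta> / 4) * \<beta> j) = 16 * (B + 2 * P) * (\<alpha> j * \<beta> j) * exp (- (\<delta> / 4) * \<beta> j)" by (simp only:)
        then show ?thesis by (simp add: mult_ac)
      qed
      ultimately show ?thesis unfolding Q_def by (simp add: distrib_left power_divide)
    qed
    finally have 1: "\<bar>spline (K j) 1 (b j) t - f 0 t - \<alpha> j * \<psi> 0 t\<bar> \<le> \<alpha> j * Q j" .
    have "(spline (K j) 1 (b j) t - f 0 t) / \<alpha> j - \<psi> 0 t = (spline (K j) 1 (b j) t - f 0 t - \<alpha> j * \<psi> 0 t) / \<alpha> j"
      using elim by (simp add: field_simps)
    then have "\<bar>(spline (K j) 1 (b j) t - f 0 t) / \<alpha> j - \<psi> 0 t\<bar> \<le> Q j"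
      using 1 elim by (simp add: abs_divide pos_divide_le_eq mult.commute)
    moreover have "\<bar>f 2 t - \<psi> 0 t\<bar> < \<epsilon>" using p(2) t by (simp add: \<psi>_def)
    ultimately show ?case using elim e unfolding dist_real_def \<epsilon>_def by linarith
  qed
qed

end

locale kernel_regime = green_kernel m \<kappa> C c + penalized_regime m N K \<alpha> \<beta>
  for m \<kappa> C c N K \<alpha> \<beta>
begin

lemma bias_limit_ge_2:
  assumes m2: "m \<ge> 2" and t: "0 < t" "t < 1"
    and f: "deriv_chain (2 * m) S f" and B: "\<And>i x. i \<le> 2 * m \<Longrightarrow> x \<in> {0..1} \<Longrightarrow> \<bar>f i x\<bar> \<le> B"
    and f2m: "continuous_on {0..1} (f (2 * m))"
    and ne: "eventually (\<lambda>j. normal_eq (N j) (K j) m (\<alpha> j) (\<lambda>i. f 0 (real i / real (N j))) (b j)) sequentially"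
  shows "(\<lambda>j. (spline (K j) m (b j) t - f 0 t) / \<alpha> j) \<longlonglongrightarrow> (-1) ^ (m - 1) * f (2 * m) t"
proof -
  define \<delta> where "\<delta> = min t (1 - t)"
  have \<delta>: "\<delta> > 0" "\<delta> \<le> t" "\<delta> \<le> 1 - t" using t by (auto simp: \<delta>_def)
  obtain D n0 where D: "D \<ge> 0" and exp: "\<And>n K \<beta> \<alpha> b. n0 \<le> n \<Longrightarrow> n > 0 \<Longrightarrow> K dvd n \<Longrightarrow> 1 \<le> \<beta> \<Longrightarrow> \<beta> ^ m \<le> real K \<Longrightarrow> \<alpha> * \<beta> ^ (2 * m) = 1
      \<Longrightarrow> normal_eq n K m \<alpha> (\<lambda>i. f 0 (real i / real n)) b
      \<Longrightarrow> \<bar>spline K m b t - f 0 t + (-1) ^ m * \<alpha> * integral {0..1} (\<lambda>s. V \<beta> t 0 s * f (2 * m) s)\<bar>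
         \<le> D * (\<beta>\<^sup>2 / (real K)\<^sup>2 + \<beta> ^ m * exp (- c * \<beta> * \<delta>))"
    using bias_expansion[OF m2 t \<delta>(2,3) f B f2m] by blast
  let ?I = "\<lambda>j. integral {0..1} (\<lambda>s. V (\<beta> j) t 0 s * f (2 * m) s)"
  let ?X = "\<lambda>j. (spline (K j) m (b j) t - f 0 t) / \<alpha> j"
  \<comment> \<open>The remainder of \<open>bias_expansion\<close> divided by
    \<open>\<alpha> = \<beta> ^ (- 2m)\<close>. Here \<open>m + 1 \<le> 2m - 1\<close> is used,
    which is where \<open>m \<ge> 2\<close> enters.\<close>
  define Q where "Q j = D * ((\<beta> j ^ (m + 1) / real (K j))\<^sup>2 + \<beta> j ^ (3 * m) * exp (- (c * \<delta>) * \<beta> j))" for j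
  have "Q \<longlonglongrightarrow> D * (0\<^sup>2 + 0)"
    unfolding Q_def using m2 \<delta>(1) c_pos by (intro tendsto_intros ratio \<beta>_exp) auto
  then have Q0: "Q \<longlonglongrightarrow> 0" by simp
  have "(\<lambda>j. ?X j + (-1) ^ m * ?I j) \<longlonglongrightarrow> 0"
  proof (rule Lim_null_comparison[OF _ Q0])
    have pk: "m \<le> 2 * m - 1" using m1 by auto
    show "eventually (\<lambda>j. norm (?X j + (-1) ^ m * ?I j) \<le> Q j) sequentially"
      using ne \<beta>_ge[of 1] \<alpha>_pos N_ge[of n0] power_le_K[OF pk]
    proof eventually_elim
      case (elim j)
      from exp[OF elim(4) N_pos K_dvd elim(2,5) \<alpha>_eq elim(1)]
      have "\<bar>spline (K j) m (b j) t - f 0 t + (-1) ^ m * \<alpha> j * ?I j\<bar> \<le> D * ((\<beta> j)\<^sup>2 / (real (K j))\<^sup>2 + \<beta> j ^ m * exp (- c * \<beta> j * \<delta>))" .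
      then have "\<bar>spline (K j) m (b j) t - f 0 t + (-1) ^ m * \<alpha> j * ?I j\<bar> * (1 / \<alpha> j)
          \<le> D * ((\<beta> j)\<^sup>2 / (real (K j))\<^sup>2 + \<beta> j ^ m * exp (- c * \<beta> j * \<delta>)) * (1 / \<alpha> j)"
        using elim by (intro mult_right_mono) auto
      also have "\<dots> = Q j"
      proof -
        have "(x\<^sup>2 / k\<^sup>2 + x ^ m * E) * x ^ (2 * m) = (x ^ (m + 1) / k)\<^sup>2 + x ^ (3 * m) * E" for x k E :: real
        proof -
          have "x\<^sup>2 * x ^ (2 * m) = (x ^ (m + 1))\<^sup>2" by (simp add: power_add power_mult power2_eq_square power_mult_distrib mult_ac)
          moreover have "x ^ m * x ^ (2 * m) = x ^ (3 * m)" by (simp add: power_add[symmetric])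
          ultimately show ?thesis by (simp add: distrib_right power_divide)
        qed
        from this[of "\<beta> j" "real (K j)" "exp (- c * \<beta> j * \<delta>)"] show ?thesis
          unfolding inverse_\<alpha> Q_def by (simp add: mult.assoc mult.left_commute[of c] mult.commute[of \<delta>])
      qed
      also have "\<bar>spline (K j) m (b j) t - f 0 t + (-1) ^ m * \<alpha> j * ?I j\<bar> * (1 / \<alpha> j) = norm (?X j + (-1) ^ m * ?I j)"
      proof -
        have "?X j + (-1) ^ m * ?I j = (spline (K j) m (b j) t - f 0 t + (-1) ^ m * \<alpha> j * ?I j) / \<alpha> j"
          using elim by (simp add: field_simps)
        then show ?thesis using elim by (simp add: abs_divide)
      qed
      finally show ?case .
    qed
  qed
  moreover have "?I \<longlonglongrightarrow> f (2 * m) t"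
    by (rule filterlim_compose[OF V_approx_identity[OF f2m t] \<beta>_top])
  ultimately have "(\<lambda>j. (?X j + (-1) ^ m * ?I j) - (-1) ^ m * ?I j) \<longlonglongrightarrow> 0 - (-1) ^ m * f (2 * m) t"
    by (intro tendsto_intros)
  moreover have "0 - (-1) ^ m * f (2 * m) t = (-1) ^ (m - 1) * f (2 * m) t"
    using m2 by (cases m) auto
  ultimately show ?thesis by simp
qed

text \<open>Norms rather than squared norms are compared, so that the error of
  \<open>weights\<close> stays additive; after division by \<open>sqrt \<beta>\<close> it is of
  order \<open>\<beta> ^ m / K\<close> up to an exponentially small term. Squaring is left to the
  end.\<close>

lemma variance_limit:
  assumes t: "0 < t" "t < 1" and L: "((\<lambda>\<beta>. 1 / \<beta> * integral {0..1} (\<lambda>s. (V \<beta> t 0 s)\<^sup>2)) \<longlongrightarrow> L) at_top"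
  shows "\<exists>w. eventually (\<lambda>j. \<forall>y b. normal_eq (N j) (K j) m (\<alpha> j) y b \<longrightarrow> spline (K j) m b t = (\<Sum>i<N j. w j i * y (Suc i))) sequentially
     \<and> (\<lambda>j. real (N j) / \<beta> j * (\<Sum>i<N j. (w j i)\<^sup>2)) \<longlonglongrightarrow> L"
proof -
  define \<delta> where "\<delta> = min t (1 - t)"
  have \<delta>: "\<delta> > 0" "\<delta> \<le> t" "\<delta> \<le> 1 - t" using t by (auto simp: \<delta>_def)
  let ?U = "\<lambda>n \<beta>. (\<Sum>i<n. (V \<beta> t 0 (real (Suc i) / real n))\<^sup>2) / real n"
  obtain D n0 where D: "D \<ge> 0" and wt: "\<And>n K \<beta> \<alpha>. n0 \<le> n \<Longrightarrow> n > 0 \<Longrightarrow> K dvd n \<Longrightarrow> 1 \<le> \<beta> \<Longrightarrow> \<beta> \<le> real K \<Longrightarrow> \<alpha> * \<beta> ^ (2 * m) = 1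
      \<Longrightarrow> \<exists>w. (\<forall>y b. normal_eq n K m \<alpha> y b \<longrightarrow> spline K m b t = (\<Sum>i<n. w i * y (Suc i))) \<and>
         \<bar>sqrt (real n * (\<Sum>i<n. (w i)\<^sup>2)) - sqrt (?U n \<beta>)\<bar> \<le> D * (sqrt \<beta> * \<beta> ^ m / real K + \<beta> ^ m * exp (- c * \<beta> * \<delta>))"
    using weights[OF t \<delta>(2,3)] by blast
  define good where "good j w \<longleftrightarrow> (\<forall>y b. normal_eq (N j) (K j) m (\<alpha> j) y b \<longrightarrow> spline (K j) m b t = (\<Sum>i<N j. w i * y (Suc i))) \<and>
         \<bar>sqrt (real (N j) * (\<Sum>i<N j. (w i)\<^sup>2)) - sqrt (?U (N j) (\<beta> j))\<bar> \<le> D * (sqrt (\<beta> j) * \<beta> j ^ m / real (K j) + \<beta> j ^ m * exp (- c * \<beta> j * \<delta>))" for j w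
  define w where "w j = (SOME w. good j w)" for j
  have pk: "1 \<le> 2 * m - 1" using m1 by auto
  have ev: "eventually (\<lambda>j. good j (w j)) sequentially"
    using \<beta>_ge[of 1] N_ge[of n0] power_le_K[OF pk]
  proof eventually_elim
    case (elim j)
    have bK: "\<beta> j \<le> real (K j)" using elim by simp
    have "\<exists>w. good j w" unfolding good_def by (rule wt[OF elim(2) N_pos K_dvd elim(1) bK \<alpha>_eq])
    then show ?case unfolding w_def by (rule someI_ex)
  qed
  let ?W = "\<lambda>j. real (N j) / \<beta> j * (\<Sum>i<N j. (w j i)\<^sup>2)"
  obtain D' where D': "\<forall>n \<beta> t. 1 \<le> \<beta> \<longrightarrow> \<beta> \<le> real n \<longrightarrow> 0 \<le> t \<longrightarrow> t \<le> 1 \<longrightarrow>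
     \<bar>integral {0..1} (\<lambda>s. (V \<beta> t 0 s)\<^sup>2) - (\<Sum>i<n. (V \<beta> t 0 (real (Suc i) / real n))\<^sup>2) / real n\<bar> \<le> D' * \<beta>\<^sup>2 / real n"
    using V_sq_quadrature ..
  let ?J = "\<lambda>j. 1 / \<beta> j * integral {0..1} (\<lambda>s. (V (\<beta> j) t 0 s)\<^sup>2)"
  have J: "?J \<longlonglongrightarrow> L" by (rule filterlim_compose[OF L \<beta>_top])
  have "(\<lambda>j. ?J j - ?U (N j) (\<beta> j) / \<beta> j) \<longlonglongrightarrow> 0"
  proof (rule Lim_null_comparison)
    have "(\<lambda>j. \<bar>D'\<bar> * (\<beta> j ^ 1 / real (K j))) \<longlonglongrightarrow> \<bar>D'\<bar> * 0" using m1 by (intro tendsto_intros ratio) auto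
    then show "(\<lambda>j. \<bar>D'\<bar> * (\<beta> j ^ 1 / real (K j))) \<longlonglongrightarrow> 0" by simp
    show "eventually (\<lambda>j. norm (?J j - ?U (N j) (\<beta> j) / \<beta> j) \<le> \<bar>D'\<bar> * (\<beta> j ^ 1 / real (K j))) sequentially"
      using \<beta>_ge[of 1] power_le_K[OF pk]
    proof eventually_elim
      case (elim j)
      have bN: "\<beta> j \<le> real (N j)" using elim K_le_N[of j] by simp
      have b0: "\<beta> j > 0" using elim by simp
      have rK: "real (K j) > 0" using K_pos[of j] by simp
      have "?J j - ?U (N j) (\<beta> j) / \<beta> j = (integral {0..1} (\<lambda>s. (V (\<beta> j) t 0 s)\<^sup>2) - ?U (N j) (\<beta> j)) / \<beta> j"
        by (simp add: diff_divide_distrib)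
      then have "norm (?J j - ?U (N j) (\<beta> j) / \<beta> j) = \<bar>integral {0..1} (\<lambda>s. (V (\<beta> j) t 0 s)\<^sup>2) - ?U (N j) (\<beta> j)\<bar> / \<beta> j"
        using b0 by (simp add: abs_divide)
      also have "\<dots> \<le> (\<bar>D'\<bar> * (\<beta> j)\<^sup>2 / real (N j)) / \<beta> j"
      proof (rule divide_right_mono)
        have "D' * (\<beta> j)\<^sup>2 / real (N j) \<le> \<bar>D'\<bar> * (\<beta> j)\<^sup>2 / real (N j)" by (intro divide_right_mono mult_right_mono) auto
        then show "\<bar>integral {0..1} (\<lambda>s. (V (\<beta> j) t 0 s)\<^sup>2) - ?U (N j) (\<beta> j)\<bar> \<le> \<bar>D'\<bar> * (\<beta> j)\<^sup>2 / real (N j)"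
          using D'[rule_format, OF elim(1) bN, of t] t by linarith
      qed (use b0 in simp)
      also have "\<dots> = \<bar>D'\<bar> * (\<beta> j / real (N j))" using b0 by (simp add: power2_eq_square)
      also have "\<dots> \<le> \<bar>D'\<bar> * (\<beta> j / real (K j))" using b0 K_le_N[of j] rK by (intro mult_left_mono divide_left_mono mult_pos_pos) auto
      finally show ?case by simp
    qed
  qed
  from tendsto_diff[OF J this] have U: "(\<lambda>j. ?U (N j) (\<beta> j) / \<beta> j) \<longlonglongrightarrow> L" by simp
  have "(\<lambda>j. sqrt (?W j) - sqrt (?U (N j) (\<beta> j) / \<beta> j)) \<longlonglongrightarrow> 0"
  proof (rule Lim_null_comparison)
    have "(\<lambda>j. D * (\<beta> j ^ m / real (K j) + \<beta> j ^ m * exp (- (c * \<delta>) * \<beta> j))) \<longlonglongrightarrow> D * (0 + 0)"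
      using m1 \<delta>(1) c_pos by (intro tendsto_intros ratio \<beta>_exp) auto
    then show "(\<lambda>j. D * (\<beta> j ^ m / real (K j) + \<beta> j ^ m * exp (- (c * \<delta>) * \<beta> j))) \<longlonglongrightarrow> 0" by simp
    show "eventually (\<lambda>j. norm (sqrt (?W j) - sqrt (?U (N j) (\<beta> j) / \<beta> j)) \<le> D * (\<beta> j ^ m / real (K j) + \<beta> j ^ m * exp (- (c * \<delta>) * \<beta> j))) sequentially"
      using ev \<beta>_ge[of 1]
    proof eventually_elim
      case (elim j)
      have b0: "\<beta> j > 0" using elim by simp
      have sb: "sqrt (\<beta> j) \<ge> 1" using elim by simp
      let ?E = "\<beta> j ^ m * exp (- c * \<beta> j * \<delta>)"
      have "sqrt (?W j) - sqrt (?U (N j) (\<beta> j) / \<beta> j) = (sqrt (real (N j) * (\<Sum>i<N j. (w j i)\<^sup>2)) - sqrt (?U (N j) (\<beta> j))) / sqrt (\<beta> j)"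
        unfolding times_divide_eq_left real_sqrt_divide diff_divide_distrib ..
      then have "norm (sqrt (?W j) - sqrt (?U (N j) (\<beta> j) / \<beta> j)) = \<bar>sqrt (real (N j) * (\<Sum>i<N j. (w j i)\<^sup>2)) - sqrt (?U (N j) (\<beta> j))\<bar> / sqrt (\<beta> j)"
        using b0 by (simp add: abs_divide)
      also have "\<dots> \<le> D * (sqrt (\<beta> j) * \<beta> j ^ m / real (K j) + ?E) / sqrt (\<beta> j)"
        using elim(1) b0 unfolding good_def by (intro divide_right_mono) auto
      also have "\<dots> = D * (\<beta> j ^ m / real (K j) + ?E / sqrt (\<beta> j))"
        unfolding times_divide_eq_right[symmetric] using b0 by (simp add: add_divide_distrib)
      also have "\<dots> \<le> D * (\<beta> j ^ m / real (K j) + ?E)"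
      proof -
        have "?E / sqrt (\<beta> j) \<le> ?E / 1" using sb b0 by (intro divide_left_mono) auto
        then show ?thesis using D by (intro mult_left_mono add_left_mono) auto
      qed
      finally show ?case by (simp add: mult_ac)
    qed
  qed
  from tendsto_add[OF this tendsto_real_sqrt[OF U]] have "(\<lambda>j. sqrt (?W j)) \<longlonglongrightarrow> sqrt L" by simp
  from tendsto_power[OF this, of 2] have W: "(\<lambda>j. (sqrt (?W j))\<^sup>2) \<longlonglongrightarrow> (sqrt L)\<^sup>2" .
  have L0: "L \<ge> 0"
  proof (rule tendsto_lowerbound[OF L])
    show "eventually (\<lambda>\<beta>. 0 \<le> 1 / \<beta> * integral {0..1} (\<lambda>s. (V \<beta> t 0 s)\<^sup>2)) at_top"
      using eventually_gt_at_top[of 0]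
    proof eventually_elim
      case (elim \<beta>)
      have "(\<lambda>s. (V \<beta> t 0 s)\<^sup>2) integrable_on {0..1}"
        using V_chain_m[of t \<beta>] m_pos by (intro integrable_continuous_real continuous_intros) (auto simp: deriv_chain_def)
      then show ?case using elim by (intro mult_nonneg_nonneg integral_nonneg) auto
    qed
  qed simp
  have "?W \<longlonglongrightarrow> L"
  proof (rule Lim_transform_eventually)
    show "(\<lambda>j. (sqrt (?W j))\<^sup>2) \<longlonglongrightarrow> L" using W L0 by simp
    show "eventually (\<lambda>j. (sqrt (?W j))\<^sup>2 = ?W j) sequentially"
      using \<beta>_ge[of 1] by eventually_elim (simp add: sum_nonneg)
  qed
  moreover have "eventually (\<lambda>j. \<forall>y b. normal_eq (N j) (K j) m (\<alpha> j) y b \<longrightarrow> spline (K j) m b t = (\<Sum>i<N j. w j i * y (Suc i))) sequentially"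
    using ev by eventually_elim (simp add: good_def)
  ultimately show ?thesis by blast
qed

end

section \<open>Normal laws and weak convergence of the estimator\<close>

lemma normal_law_cdf:
  assumes "v > 0"
  shows "cdf (normal_law \<mu> v) x = cdf std_normal_distribution ((x - \<mu>) / sqrt v)"
proof -
  interpret S: prob_space std_normal_distribution
    by (rule prob_space_normal_density) simp
  have "distributed std_normal_distribution lborel (\<lambda>x. x) std_normal_density"
    by (auto simp: distributed_def distr_id2 measurable_ident_sets[OF sets_density])
  from S.normal_density_affine[OF this, of "sqrt v" \<mu>] assms
  have "distributed std_normal_distribution lborel (\<lambda>x. \<mu> + sqrt v * x) (normal_density \<mu> (sqrt v))" by simp
  then have "normal_law \<mu> v = distr std_normal_distribution lborel (\<lambda>x. \<mu> + sqrt v * x)"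
    unfolding normal_law_def by (simp add: distributed_distr_eq_density)
  then have "cdf (normal_law \<mu> v) x = measure std_normal_distribution ((\<lambda>x. \<mu> + sqrt v * x) -` {..x} \<inter> space std_normal_distribution)"
    unfolding cdf_def by (simp add: measure_distr)
  also have "(\<lambda>x. \<mu> + sqrt v * x) -` {..x} \<inter> space std_normal_distribution = {..(x - \<mu>) / sqrt v}"
    using assms by (auto simp: field_simps)
  finally show ?thesis by (simp add: cdf_def)
qed

lemma std_normal_cdf_continuous: "isCont (cdf std_normal_distribution) x"
proof -
  interpret S: real_distribution std_normal_distribution by (rule real_dist_normal_dist)
  have "emeasure std_normal_distribution {x} = 0"
    by (subst emeasure_density) (auto intro!: nn_integral_null_set)
  then show ?thesis by (simp add: S.isCont_cdf measure_def)
qed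

text \<open>All laws are eventually exactly normal, so convergence of the parameters passes through
  the continuous standard normal distribution function.\<close>

lemma normal_law_weak_conv:
  assumes "\<mu> \<longlonglongrightarrow> \<mu>0" "v \<longlonglongrightarrow> v0" "v0 > 0" "eventually (\<lambda>j. D j = normal_law (\<mu> j) (v j)) sequentially"
  shows "weak_conv_m D (normal_law \<mu>0 v0)"
  unfolding weak_conv_m_def weak_conv_def
proof (intro allI impI)
  fix x
  have "(\<lambda>j. (x - \<mu> j) / sqrt (v j)) \<longlonglongrightarrow> (x - \<mu>0) / sqrt v0"
    using assms(1-3) by (intro tendsto_intros) auto
  from isCont_tendsto_compose[OF std_normal_cdf_continuous this]
  have "(\<lambda>j. cdf std_normal_distribution ((x - \<mu> j) / sqrt (v j))) \<longlonglongrightarrow> cdf (normal_law \<mu>0 v0) x"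
    using normal_law_cdf[OF assms(3)] by simp
  moreover have "eventually (\<lambda>j. v j > 0) sequentially" by (rule order_tendstoD(1)[OF assms(2,3)])
  with assms(4) have "eventually (\<lambda>j. cdf std_normal_distribution ((x - \<mu> j) / sqrt (v j)) = cdf (D j) x) sequentially"
    by eventually_elim (simp add: normal_law_cdf)
  ultimately show "(\<lambda>j. cdf (D j) x) \<longlonglongrightarrow> cdf (normal_law \<mu>0 v0) x" by (rule Lim_transform_eventually)
qed

lemma (in prob_space) distr_weighted_normal_sum:
  assumes \<sigma>: "\<sigma> > 0" and s: "s > 0" and w: "(\<Sum>i<n. (w i)\<^sup>2) > 0"
    and eps: "\<And>i. i \<in> {1..n} \<Longrightarrow> distributed M lborel (eps i) (normal_density 0 \<sigma>)"
    and ind: "indep_vars (\<lambda>_. borel) eps {1..n}"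
    and X: "\<And>\<omega>. \<omega> \<in> space M \<Longrightarrow> X \<omega> = s * (a + (\<Sum>i<n. w i * eps (Suc i) \<omega>))"
  shows "distr M borel X = normal_law (s * a) (s\<^sup>2 * \<sigma>\<^sup>2 * (\<Sum>i<n. (w i)\<^sup>2))"
proof -
  \<comment> \<open>Vanishing weights are removed first: a degenerate normal variable has no density
    and cannot enter the sum rule.\<close>
  define I where "I = {i \<in> {1..n}. w (i - 1) \<noteq> 0}"
  have I: "finite I" "I \<subseteq> {1..n}" by (auto simp: I_def)
  have sumI: "(\<Sum>i<n. g i) = (\<Sum>i\<in>I. g (i - 1))" if "\<And>i. w i = 0 \<Longrightarrow> g i = 0" for g :: "nat \<Rightarrow> real"
  proof -
    have "(\<Sum>i<n. g i) = (\<Sum>i=1..n. g (i - 1))" unfolding sum_atLeast1 by simp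
    also have "\<dots> = (\<Sum>i\<in>I. g (i - 1))"
      by (rule sum.mono_neutral_right) (use that in \<open>auto simp: I_def\<close>)
    finally show ?thesis .
  qed
  have w2: "(\<Sum>i<n. (w i)\<^sup>2) = (\<Sum>i\<in>I. (w (i - 1))\<^sup>2)" by (rule sumI) simp
  then have ne: "I \<noteq> {}" using w by auto
  have "indep_vars (\<lambda>_. borel) (\<lambda>i. (\<lambda>x. w (i - 1) * x) \<circ> eps i) I"
    by (rule indep_vars_compose[OF indep_vars_subset[OF ind I(2)]]) auto
  then have indI: "indep_vars (\<lambda>_. borel) (\<lambda>i x. w (i - 1) * eps i x) I" by (simp add: comp_def)
  have nI: "distributed M lborel (\<lambda>x. w (i - 1) * eps i x) (normal_density 0 (\<bar>w (i - 1)\<bar> * \<sigma>))" if "i \<in> I" for i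
    using normal_density_affine[OF eps[of i] \<sigma>, of "w (i - 1)" 0] that I by (auto simp: I_def)
  have "distributed M lborel (\<lambda>x. \<Sum>i\<in>I. w (i - 1) * eps i x) (normal_density (\<Sum>i\<in>I. 0) (sqrt (\<Sum>i\<in>I. (\<bar>w (i - 1)\<bar> * \<sigma>)\<^sup>2)))"
    by (rule sum_indep_normal[OF I(1) ne indI _ nI]) (use \<sigma> in \<open>auto simp: I_def\<close>)
  moreover have "(\<Sum>i\<in>I. (\<bar>w (i - 1)\<bar> * \<sigma>)\<^sup>2) = \<sigma>\<^sup>2 * (\<Sum>i<n. (w i)\<^sup>2)"
    unfolding w2 by (simp add: power_mult_distrib sum_distrib_left mult.commute)
  ultimately have d: "distributed M lborel (\<lambda>x. \<Sum>i\<in>I. w (i - 1) * eps i x) (normal_density 0 (sqrt (\<sigma>\<^sup>2 * (\<Sum>i<n. (w i)\<^sup>2))))"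
    by simp
  have pos: "0 < sqrt (\<sigma>\<^sup>2 * (\<Sum>i<n. (w i)\<^sup>2))" using \<sigma> w by simp
  from normal_density_affine[OF d pos, of s "s * a"] s
  have "distributed M lborel (\<lambda>x. s * a + s * (\<Sum>i\<in>I. w (i - 1) * eps i x)) (normal_density (s * a) (s * sqrt (\<sigma>\<^sup>2 * (\<Sum>i<n. (w i)\<^sup>2))))" by simp
  moreover have "s * sqrt (\<sigma>\<^sup>2 * (\<Sum>i<n. (w i)\<^sup>2)) = sqrt (s\<^sup>2 * \<sigma>\<^sup>2 * (\<Sum>i<n. (w i)\<^sup>2))"
    using s by (simp add: real_sqrt_mult mult.assoc)
  ultimately have "distr M lborel (\<lambda>x. s * a + s * (\<Sum>i\<in>I. w (i - 1) * eps i x)) = normal_law (s * a) (s\<^sup>2 * \<sigma>\<^sup>2 * (\<Sum>i<n. (w i)\<^sup>2))"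
    unfolding normal_law_def by (simp add: distributed_distr_eq_density)
  moreover have "distr M borel X = distr M lborel (\<lambda>x. s * a + s * (\<Sum>i\<in>I. w (i - 1) * eps i x))"
  proof (rule distr_cong)
    fix \<omega> assume "\<omega> \<in> space M"
    have "(\<Sum>i<n. w i * eps (Suc i) \<omega>) = (\<Sum>i\<in>I. w (i - 1) * eps (Suc (i - 1)) \<omega>)" by (rule sumI) simp
    also have "\<dots> = (\<Sum>i\<in>I. w (i - 1) * eps i \<omega>)" by (rule sum.cong) (auto simp: I_def)
    finally show "X \<omega> = s * a + s * (\<Sum>i\<in>I. w (i - 1) * eps i \<omega>)"
      using X[OF \<open>\<omega> \<in> space M\<close>] by (simp add: distrib_left)
  qed auto
  ultimately show ?thesis by simp
qed

lemma iter_deriv_on_chain: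
  assumes "cont_diff_on k f {0..1}"
  shows "deriv_chain k {} (\<lambda>i. iter_deriv_on {0..1} i f)"
    and "\<exists>B. \<forall>i\<le>k. \<forall>x\<in>{0..1}. \<bar>iter_deriv_on {0..1} i f x\<bar> \<le> B"
    and "continuous_on {0..1} (iter_deriv_on {0..1} k f)"
proof -
  let ?F = "\<lambda>i. iter_deriv_on {0..1} i f"
  have d: "(?F i has_vector_derivative ?F (Suc i) x) (at x within {0..1})" if "i < k" "x \<in> {0..1}" for i x
    using assms that by (simp add: cont_diff_on_def vector_derivative_works[symmetric])
  have c: "continuous_on {0..1} (?F i)" if "i < k" for i
    using d[OF that] by (meson continuous_on_eq_continuous_within has_vector_derivative_continuous)
  show ck: "continuous_on {0..1} (?F k)" using assms by (simp add: cont_diff_on_def)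
  show "deriv_chain k {} ?F"
    unfolding deriv_chain_def
  proof (intro conjI allI impI ballI)
    fix i and x :: real assume i: "i < k" and x: "x \<in> {0<..<1} - {}"
    then have "(?F i has_vector_derivative ?F (Suc i) x) (at x within {0..1})" by (intro d) auto
    then show "(?F i has_real_derivative ?F (Suc i) x) (at x)"
      using x by (simp add: has_real_derivative_iff_has_vector_derivative at_within_Icc_at del: iter_deriv_on.simps)
  qed (use c in auto)
  have ci: "continuous_on {0..1} (?F i)" if "i \<le> k" for i using c ck that by (cases "i = k") auto
  have "\<exists>M. \<forall>x\<in>{0..1}. \<bar>?F i x\<bar> \<le> M" if "i \<le> k" for i
    using compact_imp_bounded[OF compact_continuous_image[OF ci[OF that] compact_Icc]] unfolding bounded_iff by fastforce
  then obtain M where M: "\<And>i x. i \<le> k \<Longrightarrow> x \<in> {0..1} \<Longrightarrow> \<bar>?F i x\<bar> \<le> M i" by metis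
  show "\<exists>B. \<forall>i\<le>k. \<forall>x\<in>{0..1}. \<bar>?F i x\<bar> \<le> B"
    by (intro exI[of _ "Max (M ` {..k})"] allI impI ballI) (rule order_trans[OF M Max_ge], auto)
qed

text \<open>Since the estimate is linear in the data, it splits into the fit to noise-free data and
  a weighted sum of the noise. The scale \<open>s\<close> stays general; only its products with the
  bias order and with the standard deviation matter.\<close>

lemma (in kernel_regime) estimator_weak_conv:
  fixes P :: "'a measure"
  assumes prob: "prob_space P" and \<sigma>: "\<sigma> > 0" and t: "0 < t" "t < 1"
    and f: "cont_diff_on (2 * m) f {0..1}"
    and eps: "\<And>j i. i \<in> {1..N j} \<Longrightarrow> distributed P lborel (eps j i) (normal_density 0 \<sigma>)"
    and ind: "\<And>j. prob_space.indep_vars P (\<lambda>_. borel) (eps j) {1..N j}"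
    and ne: "\<And>j \<omega>. \<omega> \<in> space P \<Longrightarrow>
      normal_eq (N j) (K j) m (\<alpha> j) (\<lambda>i. f (real i / real (N j)) + eps j i \<omega>) (bhat j \<omega>)"
    and s: "\<And>j. s j > 0" and A: "(\<lambda>j. s j * \<alpha> j) \<longlonglongrightarrow> A"
    and q: "(\<lambda>j. (s j)\<^sup>2 * \<beta> j / real (N j)) \<longlonglongrightarrow> q" "q > 0"
    and L: "((\<lambda>\<beta>. 1 / \<beta> * integral {0..1} (\<lambda>s. (V \<beta> t 0 s)\<^sup>2)) \<longlongrightarrow> L) at_top" "L > 0"
  shows "weak_conv_m (\<lambda>j. distr P borel (\<lambda>\<omega>. s j * (spline (K j) m (bhat j \<omega>) t - f t)))
           (normal_law (A * ((-1) ^ (m - 1) * iter_deriv_on {0..1} (2 * m) f t)) (\<sigma>\<^sup>2 * (q * L)))"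
proof -
  interpret prob_space P by (rule prob)
  let ?F = "\<lambda>i. iter_deriv_on {0..1} i f"
  note chain = iter_deriv_on_chain[OF f]
  obtain B where B: "\<And>i x. i \<le> 2 * m \<Longrightarrow> x \<in> {0..1} \<Longrightarrow> \<bar>?F i x\<bar> \<le> B" using chain(2) by blast
  obtain w where w: "eventually (\<lambda>j. \<forall>y b. normal_eq (N j) (K j) m (\<alpha> j) y b \<longrightarrow>
        spline (K j) m b t = (\<Sum>i<N j. w j i * y (Suc i))) sequentially"
      "(\<lambda>j. real (N j) / \<beta> j * (\<Sum>i<N j. (w j i)\<^sup>2)) \<longlonglongrightarrow> L"
    using variance_limit[OF t L(1)] by blast
  \<comment> \<open>The fit to noise-free data, whose error at \<open>t\<close> is the exact mean of
    the estimation error.\<close>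
  define b where "b j = (SOME b. normal_eq (N j) (K j) m (\<alpha> j) (\<lambda>i. f (real i / real (N j))) b)" for j
  have b: "eventually (\<lambda>j. normal_eq (N j) (K j) m (\<alpha> j) (\<lambda>i. f (real i / real (N j))) (b j)) sequentially"
    using \<alpha>_pos
  proof eventually_elim
    case (elim j)
    show ?case unfolding b_def by (rule someI_ex[OF normal_eq_solvable[OF elim]])
  qed
  define bias where "bias j = spline (K j) m (b j) t - f t" for j
  have bias: "(\<lambda>j. bias j / \<alpha> j) \<longlonglongrightarrow> (-1) ^ (m - 1) * ?F (2 * m) t"
  proof (cases "m = 1")
    case True
    have two: "2 * m = 2" using True by simp
    have "(\<lambda>j. (spline (K j) 1 (b j) t - ?F 0 t) / \<alpha> j) \<longlonglongrightarrow> ?F 2 t"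
      by (rule bias_limit_1[OF True t chain(1)[unfolded two] B[unfolded two] chain(3)[unfolded two]])
        (use b[unfolded True] in simp_all)
    then show ?thesis unfolding bias_def two unfolding True by simp
  next
    case False
    then have "m \<ge> 2" using m1 by simp
    then have "(\<lambda>j. (spline (K j) m (b j) t - ?F 0 t) / \<alpha> j) \<longlonglongrightarrow> (-1) ^ (m - 1) * ?F (2 * m) t"
      by (rule bias_limit_ge_2[OF _ t chain(1) B chain(3)]) (use b in simp_all)
    then show ?thesis by (simp add: bias_def)
  qed
  show ?thesis
  proof (rule normal_law_weak_conv)
    have "(\<lambda>j. (s j * \<alpha> j) * (bias j / \<alpha> j)) \<longlonglongrightarrow> A * ((-1) ^ (m - 1) * ?F (2 * m) t)"
      by (intro tendsto_mult A bias)
    then show "(\<lambda>j. s j * bias j) \<longlonglongrightarrow> A * ((-1) ^ (m - 1) * ?F (2 * m) t)"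
      by (rule Lim_transform_eventually) (use \<alpha>_pos in \<open>eventually_elim, simp\<close>)
    have "(\<lambda>j. \<sigma>\<^sup>2 * (((s j)\<^sup>2 * \<beta> j / real (N j)) * (real (N j) / \<beta> j * (\<Sum>i<N j. (w j i)\<^sup>2)))) \<longlonglongrightarrow> \<sigma>\<^sup>2 * (q * L)"
      by (intro tendsto_mult q w tendsto_const)
    then show "(\<lambda>j. (s j)\<^sup>2 * \<sigma>\<^sup>2 * (\<Sum>i<N j. (w j i)\<^sup>2)) \<longlonglongrightarrow> \<sigma>\<^sup>2 * (q * L)"
      by (rule Lim_transform_eventually) (use \<beta>_ge[of 1] in \<open>eventually_elim, use N_pos in simp\<close>)
    show "\<sigma>\<^sup>2 * (q * L) > 0" using \<sigma> q(2) L(2) by simp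
    have "eventually (\<lambda>j. real (N j) / \<beta> j * (\<Sum>i<N j. (w j i)\<^sup>2) > 0) sequentially"
      by (rule order_tendstoD(1)[OF w(2) L(2)])
    with \<beta>_ge[of 1] w(1) b show "eventually (\<lambda>j. distr P borel (\<lambda>\<omega>. s j * (spline (K j) m (bhat j \<omega>) t - f t))
        = normal_law (s j * bias j) ((s j)\<^sup>2 * \<sigma>\<^sup>2 * (\<Sum>i<N j. (w j i)\<^sup>2))) sequentially"
    proof eventually_elim
      case (elim j)
      have "(\<Sum>i<N j. (w j i)\<^sup>2) > 0" using elim N_pos[of j] by (simp add: zero_less_mult_iff zero_less_divide_iff)
      then show ?case
      proof (rule distr_weighted_normal_sum[OF \<sigma> s _ eps ind])
        fix \<omega> assume \<omega>: "\<omega> \<in> space P"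
        have "spline (K j) m (bhat j \<omega>) t = (\<Sum>i<N j. w j i * (f (real (Suc i) / real (N j)) + eps j (Suc i) \<omega>))"
          using elim(2) ne[OF \<omega>] by blast
        also have "\<dots> = (\<Sum>i<N j. w j i * f (real (Suc i) / real (N j))) + (\<Sum>i<N j. w j i * eps j (Suc i) \<omega>)"
          by (simp add: distrib_left sum.distrib)
        also have "(\<Sum>i<N j. w j i * f (real (Suc i) / real (N j))) = spline (K j) m (b j) t"
          using elim(2,3) by simp
        finally show "s j * (spline (K j) m (bhat j \<omega>) t - f t) = s j * (bias j + (\<Sum>i<N j. w j i * eps j (Suc i) \<omega>))"
          by (simp add: bias_def)
      qed
    qed
  qed
qed

section \<open>Exponent arithmetic and the two regimes\<close>

lemma powr_minus_root_power:
  fixes a :: real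
  assumes "a > 0" "m \<ge> 1"
  shows "a * (a powr (- 1 / (2 * real m))) ^ (2 * m) = 1"
    and "(a powr (- 1 / (2 * real m))) ^ (2 * m - 1) = a powr (- (2 * real m - 1) / (2 * real m))"
proof -
  have "(a powr (- 1 / (2 * real m))) ^ (2 * m) = a powr (- 1)" using assms by (simp add: powr_power)
  then show "a * (a powr (- 1 / (2 * real m))) ^ (2 * m) = 1" using assms by (simp add: powr_minus)
  have "real (2 * m - 1) = 2 * real m - 1" using assms by (simp add: of_nat_diff)
  then have "- 1 / (2 * real m) * real (2 * m - 1) = - (2 * real m - 1) / (2 * real m)"
    by (simp only: times_divide_eq_left mult_minus1)
  then show "(a powr (- 1 / (2 * real m))) ^ (2 * m - 1) = a powr (- (2 * real m - 1) / (2 * real m))"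
    using assms by (subst powr_power) auto
qed

lemma powr_minus_root_at_top:
  fixes \<alpha> :: "nat \<Rightarrow> real"
  assumes pos: "\<And>j. \<alpha> j > 0" and m: "m \<ge> 1" and 0: "\<alpha> \<longlonglongrightarrow> 0"
  shows "filterlim (\<lambda>j. \<alpha> j powr (- 1 / (2 * real m))) at_top sequentially"
  unfolding filterlim_at_top
proof
  fix Z :: real
  define z where "z = max Z 1"
  have z: "z \<ge> 1" "Z \<le> z" by (auto simp: z_def)
  have "eventually (\<lambda>j. \<alpha> j < 1 / z ^ (2 * m)) sequentially"
    using z by (intro order_tendstoD(2)[OF 0]) auto
  then show "eventually (\<lambda>j. Z \<le> \<alpha> j powr (- 1 / (2 * real m))) sequentially"
  proof eventually_elim
    case (elim j)
    have "\<alpha> j * z ^ (2 * m) < \<alpha> j * (\<alpha> j powr (- 1 / (2 * real m))) ^ (2 * m)"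
      unfolding powr_minus_root_power(1)[OF pos m] using elim z by (simp add: pos_less_divide_eq)
    then have "z ^ (2 * m) < (\<alpha> j powr (- 1 / (2 * real m))) ^ (2 * m)" using pos[of j] by simp
    then have "z < \<alpha> j powr (- 1 / (2 * real m))" by (rule power_less_imp_less_base) simp
    then show ?case using z by simp
  qed
qed

text \<open>Both sides equal \<open>n powr (1/2) * a powr (1 + 1 / (4 m))\<close>. The scaled bias
  is thus a positive power of the quantity that tends to zero in the undersmoothing regime.\<close>

lemma undersmoothing_scale:
  fixes a n :: real
  assumes "a > 0" "n > 0" "m \<ge> 1"
  shows "sqrt (n / a powr (- 1 / (2 * real m))) * a
       = (a * n powr (2 * real m / (4 * real m + 1))) powr ((4 * real m + 1) / (4 * real m))"
proof -
  have m: "real m > 0" using assms by simp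
  have "sqrt (n / a powr (- 1 / (2 * real m))) = (n * a powr (1 / (2 * real m))) powr (1 / 2)"
  proof -
    have "a powr (- 1 / (2 * real m)) = inverse (a powr (1 / (2 * real m)))" unfolding powr_minus[symmetric] by simp
    then have "n / a powr (- 1 / (2 * real m)) = n * a powr (1 / (2 * real m))"
      by (simp only: divide_inverse[of n] inverse_inverse_eq)
    then show ?thesis using assms by (simp add: powr_half_sqrt)
  qed
  also have "\<dots> = n powr (1 / 2) * a powr (1 / (4 * real m))"
    using assms by (simp add: powr_mult powr_powr)
  finally have "sqrt (n / a powr (- 1 / (2 * real m))) * a = n powr (1 / 2) * (a powr (1 / (4 * real m)) * a powr 1)"
    using assms by simp
  also have "\<dots> = n powr (1 / 2) * a powr ((4 * real m + 1) / (4 * real m))"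
  proof -
    have "1 / (4 * real m) + 1 = (4 * real m + 1) / (4 * real m)" using m by (simp add: add_divide_distrib)
    then show ?thesis unfolding powr_add[symmetric] by simp
  qed
  also have "n powr (1 / 2) = n powr (2 * real m / (4 * real m + 1) * ((4 * real m + 1) / (4 * real m)))"
  proof -
    have k: "k > 0 \<Longrightarrow> 2 * real m / k * (k / (4 * real m)) = 1 / 2" for k using m by simp
    have "2 * real m / (4 * real m + 1) * ((4 * real m + 1) / (4 * real m)) = 1 / 2"
      by (rule k) (use m in simp)
    then show ?thesis by (simp only:)
  qed
  finally show ?thesis unfolding powr_mult powr_powr by (simp add: mult.commute)
qed

theorem corollary4p1:
  fixes m :: nat and f :: "real \<Rightarrow> real" and \<sigma> :: real
    and M :: "'a measure"
    and N :: "nat \<Rightarrow> nat"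
    and K :: "nat \<Rightarrow> nat"
    and lam :: "nat \<Rightarrow> real"
    and eps :: "nat \<Rightarrow> nat \<Rightarrow> 'a \<Rightarrow> real"
    and bhat :: "nat \<Rightarrow> 'a \<Rightarrow> nat \<Rightarrow> real"
    and \<alpha> \<beta> :: "nat \<Rightarrow> real"
    and ck dk :: "nat \<Rightarrow> real"
  assumes m: "m \<ge> 1"
    and f_smooth: "cont_diff_on (2 * m) f {0..1}"
    and f_bounded: "bounded (iter_deriv_on {0..1} (2 * m) f ` {0..1})"
    and N: "strict_mono N" "\<And>j. N j > 0"
    and K: "\<And>j. K j > 0" "\<And>j. K j dvd N j"
    and lam: "\<And>j. lam j > 0"
    and prob: "prob_space M"
    and sigma: "\<sigma> > 0"
    and eps_normal: "\<And>j i. i \<in> {1..N j} \<Longrightarrow> distributed M lborel (eps j i) (normal_density 0 \<sigma>)"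
    and eps_indep: "\<And>j. prob_space.indep_vars M (\<lambda>_. borel) (eps j) {1..N j}"
    and bhat: "\<And>j \<omega>. \<omega> \<in> space M \<Longrightarrow>
      is_pspline_coeff (N j) (K j) m m (lam j)
        (\<lambda>i. f (real i / real (N j)) + eps j i \<omega>) (bhat j \<omega>)"
    and alpha: "\<And>j. \<alpha> j = lam j / (real (N j) * real (K j) ^ (2 * m - 1))"
    and beta: "\<And>j. \<beta> j = \<alpha> j powr (- 1 / (2 * real m))"
    and coeffs: "kernel_system m ck dk"
  shows
    "(filterlim K at_top sequentially \<and>
      (\<lambda>j. \<alpha> j * real (N j) powr (2 * real m / (4 * real m + 1))) \<longlonglongrightarrow> 0 \<and>
      (\<lambda>j. \<alpha> j powr (- (2 * real m - 1) / (2 * real m)) * ln (real (K j)) / real (K j))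
        \<longlonglongrightarrow> 0
      \<longrightarrow>
      (\<forall>t\<in>{0<..<1}.
         (\<lambda>j. kernel_variance m ck dk (\<beta> j) t) \<longlonglongrightarrow> sigma_K2 m ck dk \<beta> t \<and>
         weak_conv_m
           (\<lambda>j. distr M borel
              (\<lambda>\<omega>. sqrt (real (N j) / \<beta> j) * (spline (K j) m (bhat j \<omega>) t - f t)))
           (normal_law 0 (\<sigma>\<^sup>2 * sigma_K2 m ck dk \<beta> t))))
     \<and>
     (\<forall>c \<gamma>. c > 0 \<and>
        (\<forall>j. \<alpha> j = c ^ (2 * m) * real (N j) powr (- (2 * real m) / (4 * real m + 1))) \<and>
        (\<lambda>j. real (K j)) \<sim>[sequentially] (\<lambda>j. real (N j) powr \<gamma>) \<and>
        \<gamma> > (2 * real m - 1) / (4 * real m + 1)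
      \<longrightarrow>
      (\<forall>t\<in>{0<..<1}.
         (\<lambda>j. kernel_variance m ck dk (\<beta> j) t) \<longlonglongrightarrow> sigma_K2 m ck dk \<beta> t \<and>
         weak_conv_m
           (\<lambda>j. distr M borel
              (\<lambda>\<omega>. real (N j) powr (2 * real m / (4 * real m + 1)) *
                   (spline (K j) m (bhat j \<omega>) t - f t)))
           (normal_law ((-1) ^ (m - 1) * c ^ (2 * m) * iter_deriv_on {0..1} (2 * m) f t)
                       (\<sigma>\<^sup>2 * sigma_K2 m ck dk \<beta> t / c))))"
proof -
  have N_top: "filterlim N at_top sequentially" by (rule filterlim_subseq[OF N(1)])
  have rN_top: "filterlim (\<lambda>j. real (N j)) at_top sequentially"
    by (rule filterlim_compose[OF filterlim_real_sequentially N_top])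
  have \<alpha>0: "\<alpha> j > 0" for j using lam[of j] N(2)[of j] K(1)[of j] by (simp add: alpha)
  have \<beta>0: "\<beta> j > 0" for j using \<alpha>0[of j] by (simp add: beta)
  have N1: "real (N j) \<ge> 1" for j using N(2)[of j] by simp
  have rK: "real (K j) > 0" for j using K(1)[of j] by simp
  obtain C c' where "green_kernel m (kernel_deriv m ck dk) C c'"
    using green_kernel_kernel_deriv[OF m coeffs] by blast
  then interpret G: green_kernel m "kernel_deriv m ck dk" C c' .
  have kernel_V: "kernel m ck dk b t s = G.V b t 0 s" for b t s
    by (simp add: kernel_eq_kernel_deriv G.V_def abs_if)
  \<comment> \<open>Both parts are instances: the first with \<open>s = sqrt (N / \<beta>)\<close>,
    \<open>A = 0\<close>, \<open>q = 1\<close>, the second with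
    \<open>s = N powr (2m / (4m + 1))\<close>, \<open>A = c ^ (2m)\<close>,
    \<open>q = 1 / c\<close>.\<close>
  have core: "(\<lambda>j. kernel_variance m ck dk (\<beta> j) t) \<longlonglongrightarrow> sigma_K2 m ck dk \<beta> t \<and>
      weak_conv_m (\<lambda>j. distr M borel (\<lambda>\<omega>. s j * (spline (K j) m (bhat j \<omega>) t - f t)))
        (normal_law (A * ((-1) ^ (m - 1) * iter_deriv_on {0..1} (2 * m) f t)) (\<sigma>\<^sup>2 * (q * sigma_K2 m ck dk \<beta> t)))"
    if \<alpha>_0: "\<alpha> \<longlonglongrightarrow> 0" and ratio: "(\<lambda>j. \<beta> j ^ (2 * m - 1) / real (K j)) \<longlonglongrightarrow> 0"
      and s: "\<And>j. s j > 0" and A: "(\<lambda>j. s j * \<alpha> j) \<longlonglongrightarrow> A"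
      and q: "\<And>j. (s j)\<^sup>2 * \<beta> j / real (N j) = q" and t: "0 < t" "t < 1" for s A q t
  proof -
    have \<beta>_top: "filterlim \<beta> at_top sequentially"
      using powr_minus_root_at_top[OF \<alpha>0 m \<alpha>_0] by (simp only: beta[symmetric])
    interpret kernel_regime m "kernel_deriv m ck dk" C c' N K \<alpha> \<beta>
    proof
      show "\<alpha> j * \<beta> j ^ (2 * m) = 1" for j unfolding beta by (rule powr_minus_root_power(1)[OF \<alpha>0 m])
    qed (fact m N(2) K(2) N_top \<beta>_top ratio)+
    obtain L where L: "L > 0" "((\<lambda>\<beta>. 1 / \<beta> * integral {0..1} (\<lambda>s. (G.V \<beta> t 0 s)\<^sup>2)) \<longlongrightarrow> L) at_top"
      using G.V_sq_limit[OF t] by blast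
    have lim: "(\<lambda>j. kernel_variance m ck dk (\<beta> j) t) \<longlonglongrightarrow> L"
      unfolding kernel_variance_def kernel_V by (rule filterlim_compose[OF L(2) \<beta>_top])
    then have sig: "sigma_K2 m ck dk \<beta> t = L" unfolding sigma_K2_def by (rule limI)
    have "q > 0" using q[of 0] s[of 0] \<beta>0[of 0] N1[of 0] by (metis divide_pos_pos less_le_trans mult_pos_pos zero_less_one zero_less_power)
    then have "weak_conv_m (\<lambda>j. distr M borel (\<lambda>\<omega>. s j * (spline (K j) m (bhat j \<omega>) t - f t)))
        (normal_law (A * ((-1) ^ (m - 1) * iter_deriv_on {0..1} (2 * m) f t)) (\<sigma>\<^sup>2 * (q * L)))"
      by (intro estimator_weak_conv[OF prob sigma t f_smooth eps_normal eps_indep _ s A _ _ L(2,1)]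
            pspline_coeff_normal_eq[OF K(1) N(2) lam m bhat alpha])
        (simp_all add: q)
    then show ?thesis using lim unfolding sig by blast
  qed
  let ?p = "2 * real m / (4 * real m + 1)"
  show ?thesis
  proof (intro conjI impI allI)
    assume hyp: "filterlim K at_top sequentially \<and> (\<lambda>j. \<alpha> j * real (N j) powr ?p) \<longlonglongrightarrow> 0 \<and>
      (\<lambda>j. \<alpha> j powr (- (2 * real m - 1) / (2 * real m)) * ln (real (K j)) / real (K j)) \<longlonglongrightarrow> 0"
    have small: "(\<lambda>j. \<alpha> j * real (N j) powr ?p) \<longlonglongrightarrow> 0" using hyp by blast
    have \<alpha>_0: "\<alpha> \<longlonglongrightarrow> 0"
    proof (rule tendsto_sandwich[OF _ _ tendsto_const small])
      show "eventually (\<lambda>j. \<alpha> j \<le> \<alpha> j * real (N j) powr ?p) sequentially"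
      proof (intro always_eventually allI)
        fix j
        have "real (N j) powr ?p \<ge> 1" by (intro ge_one_powr_ge_zero N1) simp
        then show "\<alpha> j \<le> \<alpha> j * real (N j) powr ?p" using \<alpha>0[of j] by simp
      qed
    qed (use \<alpha>0 in \<open>simp add: less_imp_le\<close>)
    have ratio: "(\<lambda>j. \<beta> j ^ (2 * m - 1) / real (K j)) \<longlonglongrightarrow> 0"
    proof (rule tendsto_sandwich[OF _ _ tendsto_const])
      show "(\<lambda>j. \<alpha> j powr (- (2 * real m - 1) / (2 * real m)) * ln (real (K j)) / real (K j)) \<longlonglongrightarrow> 0"
        using hyp by blast
      show "eventually (\<lambda>j. 0 \<le> \<beta> j ^ (2 * m - 1) / real (K j)) sequentially"
        using \<beta>0 by (simp add: less_imp_le)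
      \<comment> \<open>Since \<open>exp 1 \<le> 3\<close>, the logarithm is at least one from here
        on and the assumed null sequence dominates the ratio.\<close>
      have "eventually (\<lambda>j. 3 \<le> K j) sequentially" using hyp by (simp add: filterlim_at_top)
      then show "eventually (\<lambda>j. \<beta> j ^ (2 * m - 1) / real (K j)
          \<le> \<alpha> j powr (- (2 * real m - 1) / (2 * real m)) * ln (real (K j)) / real (K j)) sequentially"
      proof eventually_elim
        case (elim j)
        have "exp 1 \<le> real (K j)" using exp_le elim by linarith
        then have "1 \<le> ln (real (K j))" using rK[of j] by (simp add: ln_ge_iff)
        then have "\<beta> j ^ (2 * m - 1) * 1 \<le> \<beta> j ^ (2 * m - 1) * ln (real (K j))"
          using \<beta>0[of j] by (intro mult_left_mono) simp_all
        then show ?case unfolding beta powr_minus_root_power(2)[OF \<alpha>0 m] mult_1_right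
          by (rule divide_right_mono) simp
      qed
    qed
    have s: "sqrt (real (N j) / \<beta> j) > 0" for j using \<beta>0[of j] N(2)[of j] by simp
    have q: "(sqrt (real (N j) / \<beta> j))\<^sup>2 * \<beta> j / real (N j) = 1" for j
      using \<beta>0[of j] N(2)[of j] by simp
    have A: "(\<lambda>j. sqrt (real (N j) / \<beta> j) * \<alpha> j) \<longlonglongrightarrow> 0"
    proof -
      let ?r = "(4 * real m + 1) / (4 * real m)"
      have "(\<lambda>j. (\<alpha> j * real (N j) powr ?p) powr ?r) \<longlonglongrightarrow> 0 powr ?r"
        using m \<alpha>0 by (intro tendsto_powr2 small tendsto_const) (auto simp: less_imp_le)
      moreover have "sqrt (real (N j) / \<beta> j) * \<alpha> j = (\<alpha> j * real (N j) powr ?p) powr ?r" for j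
        unfolding beta by (rule undersmoothing_scale) (use \<alpha>0 N(2) m in simp_all)
      ultimately show ?thesis by simp
    qed
    show "\<forall>t\<in>{0<..<1}.
         (\<lambda>j. kernel_variance m ck dk (\<beta> j) t) \<longlonglongrightarrow> sigma_K2 m ck dk \<beta> t \<and>
         weak_conv_m (\<lambda>j. distr M borel
              (\<lambda>\<omega>. sqrt (real (N j) / \<beta> j) * (spline (K j) m (bhat j \<omega>) t - f t)))
           (normal_law 0 (\<sigma>\<^sup>2 * sigma_K2 m ck dk \<beta> t))"
      using core[OF \<alpha>_0 ratio s A q] by simp
  next
    fix c \<gamma> :: real
    assume hyp: "c > 0 \<and> (\<forall>j. \<alpha> j = c ^ (2 * m) * real (N j) powr (- (2 * real m) / (4 * real m + 1))) \<and>
        (\<lambda>j. real (K j)) \<sim>[sequentially] (\<lambda>j. real (N j) powr \<gamma>) \<and>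
        \<gamma> > (2 * real m - 1) / (4 * real m + 1)"
    have c: "c > 0" and \<gamma>: "(2 * real m - 1) / (4 * real m + 1) - \<gamma> < 0" using hyp by auto
    have ae: "\<alpha> j = c ^ (2 * m) * real (N j) powr (- ?p)" for j using hyp by simp
    have be: "\<beta> j = 1 / c * real (N j) powr (1 / (4 * real m + 1))" for j
    proof -
      have e1: "real (2 * m) * (- 1 / (2 * real m)) = - 1" using m by simp
      have e2: "- ?p * (- 1 / (2 * real m)) = 1 / (4 * real m + 1)"
      proof -
        have "- (2 * real m / k) * (- 1 / (2 * real m)) = 1 / k" for k using m by simp
        then show ?thesis .
      qed
      have "c ^ (2 * m) = c powr real (2 * m)" by (rule powr_realpow[OF c, symmetric])
      then have "\<beta> j = c powr (real (2 * m) * (- 1 / (2 * real m))) * real (N j) powr (- ?p * (- 1 / (2 * real m)))"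
        unfolding beta ae by (simp only: powr_mult powr_powr)
      then show ?thesis unfolding e1 e2 using c by (simp add: powr_minus_divide)
    qed
    have \<alpha>_0: "\<alpha> \<longlonglongrightarrow> 0"
    proof -
      have "(\<lambda>j. c ^ (2 * m) * real (N j) powr (- ?p)) \<longlonglongrightarrow> c ^ (2 * m) * 0"
        using m by (intro tendsto_mult tendsto_const tendsto_neg_powr rN_top) simp
      then show ?thesis by (simp only: ae[symmetric] mult_zero_right)
    qed
    have ratio: "(\<lambda>j. \<beta> j ^ (2 * m - 1) / real (K j)) \<longlonglongrightarrow> 0"
    proof -
      let ?e = "(2 * real m - 1) / (4 * real m + 1)"
      have "(\<lambda>j. real (N j) powr \<gamma>) \<sim>[sequentially] (\<lambda>j. real (K j))"
        using hyp asymp_equiv_sym by blast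
      then have K1: "(\<lambda>j. real (N j) powr \<gamma> / real (K j)) \<longlonglongrightarrow> 1"
        using rK[THEN less_imp_neq] unfolding asymp_equiv_def by (auto simp: eq_commute[of 0] simp del: of_nat_eq_0_iff)
      have "(\<lambda>j. (1 / c) ^ (2 * m - 1) * real (N j) powr (?e - \<gamma>) * (real (N j) powr \<gamma> / real (K j))) \<longlonglongrightarrow> (1 / c) ^ (2 * m - 1) * 0 * 1"
        by (intro tendsto_mult tendsto_const tendsto_neg_powr rN_top \<gamma> K1)
      moreover have "\<beta> j ^ (2 * m - 1) / real (K j) = (1 / c) ^ (2 * m - 1) * real (N j) powr (?e - \<gamma>) * (real (N j) powr \<gamma> / real (K j))" for j
      proof -
        have "real (2 * m - 1) = 2 * real m - 1" using m by (simp add: of_nat_diff)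
        then have "(real (N j) powr (1 / (4 * real m + 1))) ^ (2 * m - 1) = real (N j) powr ?e"
          using N(2)[of j] by (simp add: powr_power)
        also have "\<dots> = real (N j) powr (?e - \<gamma>) * real (N j) powr \<gamma>" by (simp add: powr_add[symmetric])
        finally show ?thesis unfolding be power_mult_distrib by simp
      qed
      ultimately show ?thesis by (simp only: mult_zero_left mult_zero_right)
    qed
    have s: "real (N j) powr ?p > 0" for j using N(2)[of j] by simp
    have sa: "real (N j) powr ?p * \<alpha> j = c ^ (2 * m)" for j
    proof -
      have "real (N j) powr ?p * real (N j) powr (- ?p) = 1" using N(2)[of j] by (simp add: powr_add[symmetric])
      then show ?thesis unfolding ae mult.left_commute[of _ "c ^ (2 * m)"] by (simp only: mult_1_right)
    qed
    then have A: "(\<lambda>j. real (N j) powr ?p * \<alpha> j) \<longlonglongrightarrow> c ^ (2 * m)" by simp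
    \<comment> \<open>The exponents \<open>4m / (4m + 1)\<close> and \<open>1 / (4m + 1)\<close> add
      up to one, so the powers of \<open>N\<close> cancel and the factor \<open>1 / c\<close> of
      \<beta> remains as the variance factor.\<close>
    have q: "(real (N j) powr ?p)\<^sup>2 * \<beta> j / real (N j) = 1 / c" for j
    proof -
      have "k > 0 \<Longrightarrow> 2 * real m / k + 2 * real m / k + 1 / k = (4 * real m + 1) / k" for k by (simp add: field_simps)
      from this[of "4 * real m + 1"] have e: "?p + ?p + 1 / (4 * real m + 1) = 1" by simp
      have "(real (N j) powr ?p)\<^sup>2 * real (N j) powr (1 / (4 * real m + 1)) = real (N j) powr (?p + ?p + 1 / (4 * real m + 1))"
        by (simp only: powr_add power2_eq_square)
      also have "\<dots> = real (N j)" unfolding e by simp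
      finally show ?thesis unfolding be mult.left_commute[of _ "1 / c"] using N(2)[of j] by simp
    qed
    show "\<forall>t\<in>{0<..<1}.
         (\<lambda>j. kernel_variance m ck dk (\<beta> j) t) \<longlonglongrightarrow> sigma_K2 m ck dk \<beta> t \<and>
         weak_conv_m (\<lambda>j. distr M borel
              (\<lambda>\<omega>. real (N j) powr ?p * (spline (K j) m (bhat j \<omega>) t - f t)))
           (normal_law ((-1) ^ (m - 1) * c ^ (2 * m) * iter_deriv_on {0..1} (2 * m) f t)
                       (\<sigma>\<^sup>2 * sigma_K2 m ck dk \<beta> t / c))"
    proof
      fix t :: real assume t: "t \<in> {0<..<1}"
      have "1 / c * x = x / c" for x by simp
      moreover have "c ^ (2 * m) * ((-1) ^ (m - 1) * x) = (-1) ^ (m - 1) * c ^ (2 * m) * x" for x :: real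
        by (simp only: mult.assoc mult.left_commute)
      ultimately show "(\<lambda>j. kernel_variance m ck dk (\<beta> j) t) \<longlonglongrightarrow> sigma_K2 m ck dk \<beta> t \<and>
         weak_conv_m (\<lambda>j. distr M borel
              (\<lambda>\<omega>. real (N j) powr ?p * (spline (K j) m (bhat j \<omega>) t - f t)))
           (normal_law ((-1) ^ (m - 1) * c ^ (2 * m) * iter_deriv_on {0..1} (2 * m) f t)
                       (\<sigma>\<^sup>2 * sigma_K2 m ck dk \<beta> t / c))"
        using core[OF \<alpha>_0 ratio s A q, of t] t by (simp only: greaterThanLessThan_iff times_divide_eq_right)
    qed
  qed
qed

end
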